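(* Let $(M^{2n+1},T^{1,0})$ be a CR manifold. Let $\mathscr R^\bullet=\bigoplus_k\mathscr R^k$ be its Rumin complex. Set $m_1:=d$; $m_2(\omega\otimes\tau):=\pi(\omega\wedge\tau)$; $m_3(\omega\otimes\tau\otimes\eta):=\pi\bigl(\Gamma(\omega\wedge\tau)\wedge\eta-(-1)^{|\omega|}\omega\wedge\Gamma(\tau\wedge\eta)\bigr)$; and $m_j:=0$ for all $j\ge4$. Then $(\mathscr R^\bullet,m)$ is a balanced $A_\infty$-algebra (i.e. it is a sheaf of balanced $A_\infty$-algebras: the sections over each open set form a balanced $A_\infty$-algebra).
   Context: CR manifolds. A CR manifold $(M^{2n+1},T^{1,0})$ is a connected real $(2n+1)$-manifold with a complex rank $n$ distribution $T^{1,0}\subset TM\otimes\mathbb C$ such that, with $T^{0,1}:=\overline{T^{1,0}}$, one has $T^{1,0}\cap T^{0,1}=\{0\}$, $[T^{1,0},T^{1,0}]\subset T^{1,0}$, and, for every real one-form $\theta$ on an open set $U$ with $\ker\theta=H|_U$, where $H:=\operatorname{Re}(T^{1,0}\oplus T^{0,1})$, the Levi form $L(Z,W):=-i\,d\theta(Z,\overline W)$ is a nondegenerate hermitian form on $T^{1,0}|_U$. Such a $\theta$ is called a local contact form. Rumin complex. Let $\mathscr A^k$ be the sheaf of smooth real $k$-forms. For $k\le n$ put $\mathscr R^k:=\{\omega\in\mathscr A^k:\theta\wedge\omega\wedge d\theta^{n+1-k}=0,\ \theta\wedge d\omega\wedge d\theta^{n-k}=0\}$; for $k\ge n+1$ put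 $\mathscr R^k:=\{\omega\in\mathscr A^k:\theta\wedge\omega=0,\ \theta\wedge d\omega=0\}$, where $\theta$ is any local contact form (the definition does not depend on the choice). The exterior derivative maps $\mathscr R^k$ to $\mathscr R^{k+1}$. Put $\mathscr R^k=0$ for $k\notin\{0,\dots,2n+1\}$. For $\omega\in\mathscr R^k$ write $|\omega|=k$. The operators $\Gamma$ and $\pi$. For $\omega\in\mathscr A^k$ with $k\le n$ there is a unique form $\theta\wedge\xi$, $\xi\in\mathscr A^{k-2}$, with $\theta\wedge\omega\wedge d\theta^{n+1-k}=\theta\wedge\xi\wedge d\theta^{n+2-k}$, and $\Gamma\omega:=\theta\wedge\xi$. For $k\ge n+1$ there is a unique form $\theta\wedge\xi$, $\xi\in\mathscr A^{2n-k}$, with $\theta\wedge\omega=\theta\wedge\xi\wedge d\theta^{k-n}$, and $\Gamma\omega:=\theta\wedge\xi\wedge d\theta^{k-n-1}$. (Forms of negative degree are zero.) $\Gamma\colon\mathscr A^k\to\mathscr A^{k-1}$ is independent of the local contact form. Set $\pi\omega:=\omega-d\Gamma\omega-\Gamma d\omega$; this is a projection $\pi\colon\mathscr A^k\to\mathscr R^k$. $A_\infty$-algebras. An $A_\infty$-algebra is a $\mathbb Z$-graded vector space $A$ with linear maps $m_k\colon A^{\otimes k}\to A$, $k\in\mathbb N=\{1,2,\dots\}$, homogeneous of degree $2-k$, such that for each $k\in\mathbb N$, $\sum_{r+s+t=k}(-1)^{r+st}m_{r+t+1}(1^{\otimes r}\otimes m_s\otimes1^{\otimes t})=0$ (sum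 over $r,t\ge0$, $s\ge1$), with the Koszul convention $(f\otimes g)(x\otimes y)=(-1)^{|g||x|}f(x)\otimes g(y)$. It is balanced if $m_{p+q}\circ\mu_{p,q}=0$ for all $p,q\in\mathbb N$, where $\mu_{p,q}(x_1\otimes\dots\otimes x_{p+q}):=\sum_{\sigma\in Sh_{p,q}}\operatorname{sgn}(\sigma)\,\epsilon(\sigma;x_1,\dots,x_{p+q})\,x_{\sigma^{-1}(1)}\otimes\dots\otimes x_{\sigma^{-1}(p+q)}$; here $Sh_{p,q}$ is the set of permutations $\sigma\in S_{p+q}$ with $\sigma(1)<\dots<\sigma(p)$ and $\sigma(p+1)<\dots<\sigma(p+q)$, and $\epsilon$ is the Koszul sign, i.e. $x_1\cdots x_{p+q}=\epsilon(\sigma;x_1,\dots,x_{p+q})\,x_{\sigma^{-1}(1)}\cdots x_{\sigma^{-1}(p+q)}$ in the free graded commutative algebra (so $xy=(-1)^{|x||y|}yx$). For example $\mu_{1,1}(x\otimes y)=x\otimes y-(-1)^{|x||y|}y\otimes x$. *)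

theory Defs
  imports
    "HOL-Analysis.Analysis"
    "HOL-Combinatorics.Permutations"
    "HOL-Library.Function_Algebras"
begin

instantiation "fun" :: (type, real_vector) real_vector
begin

definition scaleR_fun :: "real \<Rightarrow> ('a \<Rightarrow> 'b) \<Rightarrow> 'a \<Rightarrow> 'b" where
  "scaleR_fun r f = (\<lambda>x. r *\<^sub>R f x)"

instance
  by standard (simp_all add: scaleR_fun_def fun_eq_iff scaleR_add_right scaleR_add_left)

end


section \<open>Balanced A-infinity algebras\<close>

text \<open>Permutations are 0-indexed: they act on the set of indices below \<open>p + q\<close>.\<close>

definition Sh :: "nat \<Rightarrow> nat \<Rightarrow> (nat \<Rightarrow> nat) set" where
  "Sh p q = {\<sigma>. \<sigma> permutes {..<p + q} \<and>
                strict_mono_on {..<p} \<sigma> \<and> strict_mono_on {p..<p + q} \<sigma>}"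

text \<open>A graded vector space is a family \<open>A\<close> of subspaces \<open>A k\<close> (\<open>k\<close> an integer) of an ambient
  real vector space; the graded vector space meant is the external direct sum of the family.
  A homogeneous element is a pair of its degree and a vector of that degree.  Since only
  homogeneous elements carry signs, and since a linear map on a tensor power of a direct sum is
  the same as a family of multilinear maps on the summands, the operations are given on lists of
  homogeneous elements: \<open>m [x\<^sub>1, \<dots>, x\<^sub>k]\<close> is the \<open>k\<close>-ary operation applied to
  the tensor product of the \<open>x\<^sub>i\<close>.\<close>

definition homogeneous :: "(int \<Rightarrow> 'v set) \<Rightarrow> (int \<times> 'v) set" where
  "homogeneous A = {(k, x). x \<in> A k}"

definition total_degree :: "(int \<times> 'v) list \<Rightarrow> int" where
  "total_degree xs = sum_list (map fst xs)"

text \<open>The value of an operation with its degree recorded: the \<open>k\<close>-ary one has degree \<open>2 - k\<close>.\<close>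

definition hom_value :: "((int \<times> 'v) list \<Rightarrow> 'v) \<Rightarrow> (int \<times> 'v) list \<Rightarrow> int \<times> 'v" where
  "hom_value m xs = (total_degree xs + 2 - int (length xs), m xs)"

definition multilinear_on :: "(int \<Rightarrow> 'v::real_vector set) \<Rightarrow> ((int \<times> 'v) list \<Rightarrow> 'v) \<Rightarrow> bool" where
  "multilinear_on A m \<longleftrightarrow>
     (\<forall>us ws k x y a b.
        set us \<subseteq> homogeneous A \<longrightarrow> set ws \<subseteq> homogeneous A \<longrightarrow> x \<in> A k \<longrightarrow> y \<in> A k \<longrightarrow>
        m (us @ (k, a *\<^sub>R x + b *\<^sub>R y) # ws) =
          a *\<^sub>R m (us @ (k, x) # ws) + b *\<^sub>R m (us @ (k, y) # ws))"

definition A_infinity_algebra ::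
  "(int \<Rightarrow> 'v::real_vector set) \<Rightarrow> ((int \<times> 'v) list \<Rightarrow> 'v) \<Rightarrow> bool" where
  "A_infinity_algebra A m \<longleftrightarrow>
     (\<forall>k. subspace (A k)) \<and>
     multilinear_on A m \<and>
     (\<forall>xs. xs \<noteq> [] \<longrightarrow> set xs \<subseteq> homogeneous A \<longrightarrow> hom_value m xs \<in> homogeneous A) \<and>
     (\<forall>xs. xs \<noteq> [] \<longrightarrow> set xs \<subseteq> homogeneous A \<longrightarrow>
        (\<Sum>(r, s, t) \<in> {(r, s, t). r + s + t = length xs \<and> s \<ge> 1}.
           ((-1) ^ (r + s * t) * (-1) powi ((2 - int s) * total_degree (take r xs))) *\<^sub>R
           m (take r xs @ hom_value m (take s (drop r xs)) # drop (r + s) xs)) = 0)"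

text \<open>The Koszul sign: moving \<open>x\<^sub>i\<close> past \<open>x\<^sub>j\<close> costs
  \<open>(-1) ^ (\<bar>x\<^sub>i\<bar> * \<bar>x\<^sub>j\<bar>)\<close>, and reordering \<open>x\<close> into
  \<open>x \<circ> inv \<sigma>\<close> moves past each other exactly the pairs inverted by \<open>\<sigma>\<close>.\<close>

definition koszul_sign :: "(nat \<Rightarrow> nat) \<Rightarrow> (int \<times> 'v) list \<Rightarrow> real" where
  "koszul_sign \<sigma> xs =
     (\<Prod>(i, j) \<in> {(i, j). i < j \<and> j < length xs \<and> \<sigma> i > \<sigma> j}.
        (-1) powi (fst (xs ! i) * fst (xs ! j)))"

definition balanced :: "(int \<Rightarrow> 'v::real_vector set) \<Rightarrow> ((int \<times> 'v) list \<Rightarrow> 'v) \<Rightarrow> bool" where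
  "balanced A m \<longleftrightarrow>
     (\<forall>p q xs. p \<ge> 1 \<longrightarrow> q \<ge> 1 \<longrightarrow> length xs = p + q \<longrightarrow> set xs \<subseteq> homogeneous A \<longrightarrow>
        (\<Sum>\<sigma> \<in> Sh p q. (of_int (sign \<sigma>) * koszul_sign \<sigma> xs) *\<^sub>R
           m (map (\<lambda>j. xs ! inv \<sigma> j) [0..<p + q])) = 0)"

definition balanced_A_infinity_algebra ::
  "(int \<Rightarrow> 'v::real_vector set) \<Rightarrow> ((int \<times> 'v) list \<Rightarrow> 'v) \<Rightarrow> bool" where
  "balanced_A_infinity_algebra A m \<longleftrightarrow> A_infinity_algebra A m \<and> balanced A m"

text \<open>\<open>F V k\<close> are the sections of degree \<open>k\<close> over \<open>V\<close>, and \<open>res V\<close> is restriction to \<open>V\<close>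
  from any larger open set.\<close>

definition sheaf_of_vector_spaces ::
  "('a::topological_space set \<Rightarrow> 'v::real_vector set) \<Rightarrow> ('a set \<Rightarrow> 'v \<Rightarrow> 'v) \<Rightarrow> bool" where
  "sheaf_of_vector_spaces F res \<longleftrightarrow>
     (\<forall>V. open V \<longrightarrow> subspace (F V) \<and> (\<forall>x \<in> F V. res V x = x)) \<and>
     (\<forall>V W. open V \<longrightarrow> open W \<longrightarrow> W \<subseteq> V \<longrightarrow>
        res W ` F V \<subseteq> F W \<and>
        (\<forall>x \<in> F V. \<forall>y \<in> F V. \<forall>a b. res W (a *\<^sub>R x + b *\<^sub>R y) = a *\<^sub>R res W x + b *\<^sub>R res W y) \<and>
        (\<forall>O'. open O' \<longrightarrow> O' \<subseteq> W \<longrightarrow> (\<forall>x \<in> F V. res O' (res W x) = res O' x))) \<and>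
     (\<forall>\<V> s. (\<forall>V \<in> \<V>. open V \<and> s V \<in> F V) \<longrightarrow>
        (\<forall>V \<in> \<V>. \<forall>W \<in> \<V>. res (V \<inter> W) (s V) = res (V \<inter> W) (s W)) \<longrightarrow>
        (\<exists>!x. x \<in> F (\<Union>\<V>) \<and> (\<forall>V \<in> \<V>. res V x = s V)))"

definition sheaf_of_balanced_A_infinity_algebras ::
  "('a::topological_space set \<Rightarrow> int \<Rightarrow> 'v::real_vector set) \<Rightarrow> ('a set \<Rightarrow> 'v \<Rightarrow> 'v) \<Rightarrow>
   ('a set \<Rightarrow> (int \<times> 'v) list \<Rightarrow> 'v) \<Rightarrow> bool" where
  "sheaf_of_balanced_A_infinity_algebras F res m \<longleftrightarrow>
     (\<forall>V. open V \<longrightarrow> balanced_A_infinity_algebra (F V) (m V)) \<and>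
     (\<forall>k. sheaf_of_vector_spaces (\<lambda>V. F V k) res) \<and>
     (\<forall>V W xs. open V \<longrightarrow> open W \<longrightarrow> W \<subseteq> V \<longrightarrow> xs \<noteq> [] \<longrightarrow> set xs \<subseteq> homogeneous (F V) \<longrightarrow>
        res W (m V xs) = m W (map (\<lambda>(k, x). (k, res W x)) xs))"


section \<open>Exterior calculus on a Euclidean space\<close>

primrec C_diff_on :: "nat \<Rightarrow> 'e::real_normed_vector set \<Rightarrow> ('e \<Rightarrow> 'b::real_normed_vector) \<Rightarrow> bool" where
  "C_diff_on 0 S f \<longleftrightarrow> continuous_on S f"
| "C_diff_on (Suc k) S f \<longleftrightarrow> (\<forall>x \<in> S. f differentiable (at x)) \<and>
     (\<forall>v. C_diff_on k S (\<lambda>x. frechet_derivative f (at x) v))"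

text \<open>Only used on open sets \<open>S\<close> of a Euclidean space.\<close>

definition smooth_on :: "'e::real_normed_vector set \<Rightarrow> ('e \<Rightarrow> 'b::real_normed_vector) \<Rightarrow> bool" where
  "smooth_on S f \<longleftrightarrow> (\<forall>k. C_diff_on k S f)"

text \<open>A \<open>k\<close>-form on a vector space takes a list of \<open>k\<close> vectors and, so that forms of all degrees
  live in one type, is extended by 0 to lists of other lengths.\<close>

definition alternating :: "nat \<Rightarrow> ('e::real_vector list \<Rightarrow> real) \<Rightarrow> bool" where
  "alternating k \<alpha> \<longleftrightarrow>
     (\<forall>vs. length vs \<noteq> k \<longrightarrow> \<alpha> vs = 0) \<and>
     (\<forall>us ws. length us + 1 + length ws = k \<longrightarrow> linear (\<lambda>v. \<alpha> (us @ v # ws))) \<and>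
     (\<forall>vs. \<not> distinct vs \<longrightarrow> \<alpha> vs = 0)"

text \<open>No factorials: the wedge of two 1-forms takes \<open>v, w\<close> to
  \<open>\<alpha> v * \<beta> w - \<alpha> w * \<beta> v\<close>.\<close>

definition wedge_alt ::
  "('e list \<Rightarrow> real) \<Rightarrow> ('e list \<Rightarrow> real) \<Rightarrow> 'e list \<Rightarrow> real" where
  "wedge_alt \<alpha> \<beta> vs =
     (\<Sum>p \<le> length vs. \<Sum>\<sigma> \<in> Sh p (length vs - p).
        of_int (sign \<sigma>) * \<alpha> (map (\<lambda>i. vs ! \<sigma> i) [0..<p])
                        * \<beta> (map (\<lambda>i. vs ! \<sigma> i) [p..<length vs]))"

definition ext_deriv ::
  "('e::real_normed_vector \<Rightarrow> 'e list \<Rightarrow> real) \<Rightarrow> 'e \<Rightarrow> 'e list \<Rightarrow> real" where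
  "ext_deriv \<omega> x vs =
     (\<Sum>i < length vs. (-1) ^ i *
        frechet_derivative (\<lambda>y. \<omega> y (take i vs @ drop (Suc i) vs)) (at x) (vs ! i))"


section \<open>Manifolds and differential forms\<close>

text \<open>A chart is a pair of its domain and the coordinate map.\<close>

type_synonym ('a, 'e) chart = "'a set \<times> ('a \<Rightarrow> 'e)"

definition coords :: "('a, 'e) chart \<Rightarrow> 'a set \<Rightarrow> 'e set" where
  "coords c V = snd c ` (fst c \<inter> V)"

definition transition :: "('a, 'e) chart \<Rightarrow> ('a, 'e) chart \<Rightarrow> 'e \<Rightarrow> 'e" where
  "transition c c' = snd c' \<circ> inv_into (fst c) (snd c)"

definition transition_deriv ::
  "('a, 'e::euclidean_space) chart \<Rightarrow> ('a, 'e) chart \<Rightarrow> 'e \<Rightarrow> 'e \<Rightarrow> 'e" where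
  "transition_deriv c c' x = frechet_derivative (transition c c') (at x)"

definition smooth_atlas ::
  "('a::topological_space, 'e::euclidean_space) chart set \<Rightarrow> bool" where
  "smooth_atlas \<A> \<longleftrightarrow>
     (\<Union>c \<in> \<A>. fst c) = UNIV \<and>
     (\<forall>(U, \<phi>) \<in> \<A>. open U \<and> open (\<phi> ` U) \<and> homeomorphism U (\<phi> ` U) \<phi> (inv_into U \<phi>)) \<and>
     (\<forall>c \<in> \<A>. \<forall>c' \<in> \<A>. smooth_on (coords c (fst c')) (transition c c'))"

text \<open>A differential form on an open set \<open>V\<close> of the manifold is given by its local expressions
  \<open>\<omega> c\<close> on \<open>coords c V\<close>, for \<open>c\<close> in the atlas, which are required to be pulled back to one another
  by the transition maps; \<open>\<omega> c x\<close> is extended by 0 to all other \<open>c\<close> and \<open>x\<close>.\<close>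

type_synonym ('a, 'e) form = "('a, 'e) chart \<Rightarrow> 'e \<Rightarrow> 'e list \<Rightarrow> real"

definition forms ::
  "('a, 'e::euclidean_space) chart set \<Rightarrow> 'a set \<Rightarrow> int \<Rightarrow> ('a, 'e) form set" where
  "forms \<A> V k = (if k < 0 then {0} else
     {\<omega>. (\<forall>c x. c \<notin> \<A> \<or> x \<notin> coords c V \<longrightarrow> \<omega> c x = 0) \<and>
          (\<forall>c \<in> \<A>. \<forall>x \<in> coords c V. alternating (nat k) (\<omega> c x)) \<and>
          (\<forall>c \<in> \<A>. \<forall>vs. smooth_on (coords c V) (\<lambda>x. \<omega> c x vs)) \<and>
          (\<forall>c \<in> \<A>. \<forall>c' \<in> \<A>. \<forall>x \<in> coords c (V \<inter> fst c'). \<forall>vs.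
             \<omega> c x vs = \<omega> c' (transition c c' x) (map (transition_deriv c c' x) vs))})"

definition restrict_form :: "'a set \<Rightarrow> ('a, 'e) form \<Rightarrow> ('a, 'e) form" where
  "restrict_form V \<omega> = (\<lambda>c x. if x \<in> coords c V then \<omega> c x else 0)"

definition one_form :: "('a, 'e) chart set \<Rightarrow> 'a set \<Rightarrow> ('a, 'e) form" where
  "one_form \<A> V = (\<lambda>c x vs. if c \<in> \<A> \<and> x \<in> coords c V \<and> vs = [] then 1 else 0)"

definition wedge :: "('a, 'e) form \<Rightarrow> ('a, 'e) form \<Rightarrow> ('a, 'e) form"
    (infixl "\<and>\<^sub>d" 70) where
  "\<omega> \<and>\<^sub>d \<tau> = (\<lambda>c x. wedge_alt (\<omega> c x) (\<tau> c x))"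

definition d_form :: "'a set \<Rightarrow> ('a, 'e::euclidean_space) form \<Rightarrow> ('a, 'e) form" where
  "d_form V \<omega> = restrict_form V (\<lambda>c. ext_deriv (\<omega> c))"

primrec wedge_power ::
  "('a, 'e) chart set \<Rightarrow> 'a set \<Rightarrow> ('a, 'e) form \<Rightarrow> nat \<Rightarrow> ('a, 'e) form" where
  "wedge_power \<A> V \<omega> 0 = one_form \<A> V"
| "wedge_power \<A> V \<omega> (Suc j) = \<omega> \<and>\<^sub>d wedge_power \<A> V \<omega> j"


section \<open>CR manifolds\<close>

text \<open>The complexification of \<open>'e\<close> is \<open>'e \<times> 'e\<close>, with \<open>(v, w)\<close> standing for \<open>v + \<i> w\<close>.\<close>

definition cscale :: "complex \<Rightarrow> 'e::real_vector \<times> 'e \<Rightarrow> 'e \<times> 'e" where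
  "cscale a z = (Re a *\<^sub>R fst z - Im a *\<^sub>R snd z, Re a *\<^sub>R snd z + Im a *\<^sub>R fst z)"

definition conj_vec :: "'e::real_vector \<times> 'e \<Rightarrow> 'e \<times> 'e" where
  "conj_vec z = (fst z, - snd z)"

definition cbilinear_ext ::
  "('e list \<Rightarrow> real) \<Rightarrow> 'e \<times> 'e \<Rightarrow> 'e \<times> 'e \<Rightarrow> complex" where
  "cbilinear_ext \<alpha> z w =
     Complex (\<alpha> [fst z, fst w] - \<alpha> [snd z, snd w]) (\<alpha> [fst z, snd w] + \<alpha> [snd z, fst w])"

text \<open>Lie bracket of complex vector fields, i.e. the complex bilinear extension of
  \<open>[Z, W] = DW(Z) - DZ(W)\<close>.\<close>

definition directional ::
  "('e::real_normed_vector \<Rightarrow> 'e \<times> 'e) \<Rightarrow> ('e \<Rightarrow> 'e \<times> 'e) \<Rightarrow> 'e \<Rightarrow> 'e \<times> 'e" where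
  "directional Z W x =
     frechet_derivative W (at x) (fst (Z x)) + cscale \<i> (frechet_derivative W (at x) (snd (Z x)))"

definition lie_bracket ::
  "('e::real_normed_vector \<Rightarrow> 'e \<times> 'e) \<Rightarrow> ('e \<Rightarrow> 'e \<times> 'e) \<Rightarrow> 'e \<Rightarrow> 'e \<times> 'e" where
  "lie_bracket Z W x = directional Z W x - directional W Z x"

text \<open>As for forms, a subbundle of the complexified tangent bundle is given by its local
  expressions \<open>T c x\<close> in the charts.  Being of complex rank \<open>n\<close> (and smooth) means having local
  smooth frames with \<open>n\<close> elements.\<close>

type_synonym ('a, 'e) distribution = "('a, 'e) chart \<Rightarrow> 'e \<Rightarrow> ('e \<times> 'e) set"

definition complex_distribution ::
  "nat \<Rightarrow> ('a, 'e::euclidean_space) chart set \<Rightarrow> ('a, 'e) distribution \<Rightarrow> bool" where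
  "complex_distribution n \<A> T \<longleftrightarrow>
     (\<forall>c \<in> \<A>. \<forall>c' \<in> \<A>. \<forall>x \<in> coords c (fst c').
        T c' (transition c c' x) =
          map_prod (transition_deriv c c' x) (transition_deriv c c' x) ` T c x) \<and>
     (\<forall>c \<in> \<A>. \<forall>x \<in> coords c UNIV. \<exists>S Z. open S \<and> x \<in> S \<and> S \<subseteq> coords c UNIV \<and>
        (\<forall>i < n. smooth_on S (Z i)) \<and>
        (\<forall>y \<in> S. T c y = {\<Sum>i < n. cscale (a i) (Z i y) | a. True} \<and>
           (\<forall>a. (\<Sum>i < n. cscale (a i) (Z i y)) = 0 \<longrightarrow> (\<forall>i < n. a i = 0))))"

definition involutive :: "('a, 'e::euclidean_space) chart set \<Rightarrow> ('a, 'e) distribution \<Rightarrow> bool" where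
  "involutive \<A> T \<longleftrightarrow>
     (\<forall>c \<in> \<A>. \<forall>S Z W. open S \<longrightarrow> S \<subseteq> coords c UNIV \<longrightarrow> smooth_on S Z \<longrightarrow> smooth_on S W \<longrightarrow>
        (\<forall>x \<in> S. Z x \<in> T c x \<and> W x \<in> T c x) \<longrightarrow> (\<forall>x \<in> S. lie_bracket Z W x \<in> T c x))"

text \<open>The fibre of \<open>H\<close>, from the fibre \<open>S\<close> of the holomorphic tangent bundle.\<close>

definition real_part :: "('e::real_vector \<times> 'e) set \<Rightarrow> 'e set" where
  "real_part S = {fst (z + conj_vec w) | z w. z \<in> S \<and> w \<in> S}"

text \<open>The contact forms on \<open>V\<close>; on a given \<open>V\<close> there may be none.\<close>

definition contact_forms ::
  "('a, 'e::euclidean_space) chart set \<Rightarrow> ('a, 'e) distribution \<Rightarrow> 'a set \<Rightarrow> ('a, 'e) form set" where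
  "contact_forms \<A> T V =
     {\<theta> \<in> forms \<A> V 1. \<forall>c \<in> \<A>. \<forall>x \<in> coords c V. {v. \<theta> c x [v] = 0} = real_part (T c x)}"

definition nondegenerate_hermitian_on ::
  "('e::real_vector \<times> 'e) set \<Rightarrow> ('e \<times> 'e \<Rightarrow> 'e \<times> 'e \<Rightarrow> complex) \<Rightarrow> bool" where
  "nondegenerate_hermitian_on S L \<longleftrightarrow>
     (\<forall>z \<in> S. \<forall>z' \<in> S. \<forall>w \<in> S. \<forall>a b. L (cscale a z + cscale b z') w = a * L z w + b * L z' w) \<and>
     (\<forall>z \<in> S. \<forall>w \<in> S. L w z = cnj (L z w)) \<and>
     (\<forall>z \<in> S. (\<forall>w \<in> S. L z w = 0) \<longrightarrow> z = 0)"

text \<open>The manifold is the (Hausdorff, second countable) type \<open>'a\<close> with the atlas \<open>\<A>\<close>, which need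
  not be maximal.\<close>

definition CR_manifold ::
  "nat \<Rightarrow> ('a::{t2_space, second_countable_topology}, 'e::euclidean_space) chart set \<Rightarrow>
   ('a, 'e) distribution \<Rightarrow> bool" where
  "CR_manifold n \<A> T \<longleftrightarrow>
     DIM('e) = 2 * n + 1 \<and> connected (UNIV :: 'a set) \<and> smooth_atlas \<A> \<and>
     complex_distribution n \<A> T \<and>
     (\<forall>c \<in> \<A>. \<forall>x \<in> coords c UNIV. T c x \<inter> conj_vec ` T c x = {0}) \<and>
     involutive \<A> T \<and>
     (\<forall>V \<theta>. open V \<longrightarrow> \<theta> \<in> contact_forms \<A> T V \<longrightarrow>
        (\<forall>c \<in> \<A>. \<forall>x \<in> coords c V.
           nondegenerate_hermitian_on (T c x)
             (\<lambda>z w. - \<i> * cbilinear_ext (d_form V \<theta> c x) z (conj_vec w))))"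


section \<open>The Rumin complex and its operations\<close>

definition rumin ::
  "nat \<Rightarrow> ('a::topological_space, 'e::euclidean_space) chart set \<Rightarrow> ('a, 'e) distribution \<Rightarrow>
   'a set \<Rightarrow> int \<Rightarrow> ('a, 'e) form set" where
  "rumin n \<A> T V k = (if k < 0 \<or> k > 2 * int n + 1 then {0} else
     {\<omega> \<in> forms \<A> V k. \<forall>W \<theta>. open W \<longrightarrow> W \<subseteq> V \<longrightarrow> \<theta> \<in> contact_forms \<A> T W \<longrightarrow>
        (let \<omega>' = restrict_form W \<omega>; d\<theta> = wedge_power \<A> W (d_form W \<theta>) in
         if k \<le> int n then
           \<theta> \<and>\<^sub>d \<omega>' \<and>\<^sub>d d\<theta> (nat (int n + 1 - k)) = 0 \<and>
           \<theta> \<and>\<^sub>d d_form W \<omega>' \<and>\<^sub>d d\<theta> (nat (int n - k)) = 0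
         else \<theta> \<and>\<^sub>d \<omega>' = 0 \<and> \<theta> \<and>\<^sub>d d_form W \<omega>' = 0)})"

text \<open>Since a contact form need not exist on all of \<open>V\<close>, the form \<open>\<Gamma> \<omega>\<close> is the one whose
  restriction to each open \<open>W \<subseteq> V\<close> is as prescribed, for each contact form on \<open>W\<close>.  The degree \<open>k\<close>
  of \<open>\<omega>\<close> is an argument.\<close>

definition Gamma ::
  "nat \<Rightarrow> ('a::topological_space, 'e::euclidean_space) chart set \<Rightarrow> ('a, 'e) distribution \<Rightarrow>
   'a set \<Rightarrow> int \<Rightarrow> ('a, 'e) form \<Rightarrow> ('a, 'e) form" where
  "Gamma n \<A> T V k \<omega> = (THE \<gamma>. \<gamma> \<in> forms \<A> V (k - 1) \<and>
     (\<forall>W \<theta>. open W \<longrightarrow> W \<subseteq> V \<longrightarrow> \<theta> \<in> contact_forms \<A> T W \<longrightarrow>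
        (let \<omega>' = restrict_form W \<omega>; \<gamma>' = restrict_form W \<gamma>;
             d\<theta> = wedge_power \<A> W (d_form W \<theta>) in
         if k \<le> int n then
           \<exists>\<xi> \<in> forms \<A> W (k - 2).
             \<theta> \<and>\<^sub>d \<omega>' \<and>\<^sub>d d\<theta> (nat (int n + 1 - k)) = \<theta> \<and>\<^sub>d \<xi> \<and>\<^sub>d d\<theta> (nat (int n + 2 - k)) \<and>
             \<gamma>' = \<theta> \<and>\<^sub>d \<xi>
         else
           \<exists>\<xi> \<in> forms \<A> W (2 * int n - k).
             \<theta> \<and>\<^sub>d \<omega>' = \<theta> \<and>\<^sub>d \<xi> \<and>\<^sub>d d\<theta> (nat (k - int n)) \<and>
             \<gamma>' = \<theta> \<and>\<^sub>d \<xi> \<and>\<^sub>d d\<theta> (nat (k - int n - 1)))))"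

definition rumin_proj ::
  "nat \<Rightarrow> ('a::topological_space, 'e::euclidean_space) chart set \<Rightarrow> ('a, 'e) distribution \<Rightarrow>
   'a set \<Rightarrow> int \<Rightarrow> ('a, 'e) form \<Rightarrow> ('a, 'e) form" where
  "rumin_proj n \<A> T V k \<omega> =
     \<omega> - d_form V (Gamma n \<A> T V k \<omega>) - Gamma n \<A> T V (k + 1) (d_form V \<omega>)"

fun rumin_op ::
  "nat \<Rightarrow> ('a::topological_space, 'e::euclidean_space) chart set \<Rightarrow> ('a, 'e) distribution \<Rightarrow>
   'a set \<Rightarrow> (int \<times> ('a, 'e) form) list \<Rightarrow> ('a, 'e) form" where
  "rumin_op n \<A> T V [(i, \<omega>)] = d_form V \<omega>"
| "rumin_op n \<A> T V [(i, \<omega>), (j, \<tau>)] = rumin_proj n \<A> T V (i + j) (\<omega> \<and>\<^sub>d \<tau>)"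
| "rumin_op n \<A> T V [(i, \<omega>), (j, \<tau>), (k, \<eta>)] =
     rumin_proj n \<A> T V (i + j + k - 1)
       (Gamma n \<A> T V (i + j) (\<omega> \<and>\<^sub>d \<tau>) \<and>\<^sub>d \<eta>
        - (-1) powi i *\<^sub>R (\<omega> \<and>\<^sub>d Gamma n \<A> T V (j + k) (\<tau> \<and>\<^sub>d \<eta>)))"
| "rumin_op n \<A> T V _ = 0"

end

theory Submission
  imports Defs
begin

text \<open>On forms divisible by a contact form \<open>\<theta>\<close> the differential is multiplication by \<open>d\<theta>\<close> modulo
  \<open>\<theta>\<close>, and \<open>\<Gamma>\<close> inverts it there by the Lefschetz isomorphisms
  \<open>\<xi> \<mapsto> \<theta> \<and> \<xi> \<and> d\<theta>\<^sup>n\<^sup>-\<^sup>j\<close>.  This gives \<open>\<Gamma> d \<Gamma> = \<Gamma>\<close>, so that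
  \<open>\<pi>\<close> is a projection onto the common kernel of \<open>\<Gamma>\<close> and \<open>\<Gamma> d\<close>, which is the Rumin complex.
  The \<open>A\<^sub>\<infinity>\<close> structure is then the homotopy transfer of the algebra of differential forms.  The
  values of \<open>\<Gamma>\<close> lie in the ideal of multiples of \<open>\<theta>\<close>, which has zero square and is killed by
  \<open>\<Gamma>\<close>: any composite in which \<open>\<Gamma>\<close> acts on a product with a value of \<open>\<Gamma>\<close> is zero, and nothing is
  left beyond the ternary operation.\<close>

section \<open>Shuffles and exterior products\<close>


text \<open>Forms are functions on lists of vectors, multiplied by shuffle sums. Identities about
  them are reduced to contraction in the first argument, under which the exterior product obeys a
  graded Leibniz rule and the exterior derivative obeys Cartan's formula; then induction on the list
  applies. Contact forms exist only locally, so \<Gamma> has to be exhibited as a pointwise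
  construction: its value depends only on \<theta>, d\<theta> and \<omega> at the point, does not
  change when \<theta> is rescaled by a function, commutes with linear isomorphisms, and preserves
  smoothness. Smoothness shapes the Lefschetz argument: the sl(2) computation is abstract and is
  applied to the space of smooth horizontal fields instead of a single fibre, so that surjectivity
  produces smooth preimages at once. The CR structure enters at two places. The rank condition and
  transversality give local contact forms; integrability and the nondegenerate Levi form together
  make d\<theta> nondegenerate on H. The rest is contact geometry and algebra.\<close>

definition insert_zero :: "nat \<Rightarrow> (nat \<Rightarrow> nat) \<Rightarrow> nat \<Rightarrow> nat" where
  "insert_zero p \<sigma> i = (if i < p then Suc (\<sigma> i) else if i = p then 0 else Suc (\<sigma> (i - 1)))"

lemma insert_zero_permutes:
  assumes "\<sigma> permutes {..<N}" "p \<le> N"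
  shows "insert_zero p \<sigma> permutes {..<Suc N}"
proof (rule bij_imp_permutes)
  have lt: "\<sigma> i < N" if "i < N" for i
    using permutes_in_image[OF assms(1), of i] that by simp
  have "inj_on (insert_zero p \<sigma>) {..<Suc N}"
    using permutes_inj[OF assms(1)]
    by (intro inj_onI) (auto simp: insert_zero_def inj_eq split: if_splits)
  moreover have "insert_zero p \<sigma> ` {..<Suc N} \<subseteq> {..<Suc N}"
    using lt assms(2) by (auto simp: insert_zero_def)
  ultimately show "bij_betw (insert_zero p \<sigma>) {..<Suc N} {..<Suc N}"
    by (simp add: bij_betw_def endo_inj_surj)
  show "insert_zero p \<sigma> x = x" if "x \<notin> {..<Suc N}" for x
    using that assms permutes_not_in[OF assms(1), of "x - 1"] by (auto simp: insert_zero_def)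
qed

lemma sign_insert_zero_0:
  assumes "\<sigma> permutes {..<N}"
  shows "sign (insert_zero 0 \<sigma>) = sign \<sigma>"
  using assms finite_lessThan[of N]
proof (induction \<sigma> rule: permutes_induct)
  case id
  have "insert_zero 0 id = id" by (auto simp: insert_zero_def fun_eq_iff)
  then show ?case by (simp only: sign_id)
next
  case (swap a b \<sigma>)
  have eq: "insert_zero 0 (Transposition.transpose a b \<circ> \<sigma>) = Transposition.transpose (Suc a) (Suc b) \<circ> insert_zero 0 \<sigma>"
    by (auto simp: insert_zero_def fun_eq_iff Transposition.transpose_def)
  have "permutation (insert_zero 0 \<sigma>)" "permutation \<sigma>"
    using insert_zero_permutes[OF swap(4), of 0] swap(4) permutation_permutes by (blast, blast)
  then show ?case
    using swap(3,5) unfolding eq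
    by (subst (1 2) sign_compose) (auto simp: permutation_swap_id sign_swap_id)
qed

text \<open>Moving the value 0 one place to the right is composition with an adjacent transposition,
  so every place costs one sign.\<close>

lemma sign_insert_zero:
  assumes "\<sigma> permutes {..<N}" "p \<le> N"
  shows "sign (insert_zero p \<sigma>) = (-1) ^ p * sign \<sigma>"
  using assms(2)
proof (induction p)
  case 0
  then show ?case using sign_insert_zero_0[OF assms(1)] by simp
next
  case (Suc p)
  have eq: "insert_zero (Suc p) \<sigma> = insert_zero p \<sigma> \<circ> Transposition.transpose p (Suc p)"
  proof
    fix i
    consider "i = p" | "i = Suc p" | "i \<noteq> p" "i \<noteq> Suc p" by blast
    then show "insert_zero (Suc p) \<sigma> i = (insert_zero p \<sigma> \<circ> Transposition.transpose p (Suc p)) i"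
      by cases (auto simp: insert_zero_def)
  qed
  have "permutation (insert_zero p \<sigma>)"
    using insert_zero_permutes[OF assms(1), of p] Suc.prems permutation_permutes by fastforce
  then show ?case
    using Suc unfolding eq by (subst sign_compose) (auto simp: permutation_swap_id sign_swap_id)
qed

definition remove_zero :: "nat \<Rightarrow> (nat \<Rightarrow> nat) \<Rightarrow> nat \<Rightarrow> nat" where
  "remove_zero p \<sigma> i = \<sigma> (if i < p then i else Suc i) - 1"

lemma remove_insert_zero [simp]: "remove_zero p (insert_zero p \<sigma>) = \<sigma>"
  by (auto simp: remove_zero_def insert_zero_def fun_eq_iff)

lemma insert_remove_zero:
  assumes "\<sigma> permutes {..<Suc N}" "\<sigma> p = 0"
  shows "insert_zero p (remove_zero p \<sigma>) = \<sigma>"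
proof
  fix i
  have "\<sigma> i \<noteq> 0" if "i \<noteq> p" for i
    using that assms(2) permutes_inj[OF assms(1)] by (metis injD)
  then show "insert_zero p (remove_zero p \<sigma>) i = \<sigma> i"
    using assms(2) by (auto simp: insert_zero_def remove_zero_def)
qed

lemma remove_zero_permutes:
  assumes "\<sigma> permutes {..<Suc N}" "\<sigma> p = 0" "p \<le> N"
  shows "remove_zero p \<sigma> permutes {..<N}"
proof (rule bij_imp_permutes)
  have nz: "\<sigma> i \<noteq> 0" if "i \<noteq> p" for i
    using that assms(2) permutes_inj[OF assms(1)] by (metis injD)
  have lt: "\<sigma> i < Suc N" if "i < Suc N" for i
    using permutes_in_image[OF assms(1), of i] that by simp
  have "inj_on (remove_zero p \<sigma>) {..<N}"
  proof (rule inj_onI)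
    fix i j assume "remove_zero p \<sigma> i = remove_zero p \<sigma> j"
    then have "insert_zero p (remove_zero p \<sigma>) (if i < p then i else Suc i)
        = insert_zero p (remove_zero p \<sigma>) (if j < p then j else Suc j)"
      by (auto simp: insert_zero_def)
    then have "(if i < p then i else Suc i) = (if j < p then j else Suc j)"
      unfolding insert_remove_zero[OF assms(1,2)] using permutes_inj[OF assms(1)] by (rule injD[rotated])
    then show "i = j" by (auto split: if_splits)
  qed
  moreover have "remove_zero p \<sigma> ` {..<N} \<subseteq> {..<N}"
  proof safe
    fix i assume "i < N"
    then show "remove_zero p \<sigma> i < N"
      using lt[of "if i < p then i else Suc i"] nz[of "if i < p then i else Suc i"] assms(3)
      by (auto simp: remove_zero_def split: if_splits)
  qed
  ultimately show "bij_betw (remove_zero p \<sigma>) {..<N} {..<N}"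
    by (simp add: bij_betw_def endo_inj_surj)
  show "remove_zero p \<sigma> x = x" if "x \<notin> {..<N}" for x
    using that assms permutes_not_in[OF assms(1), of "Suc x"] by (auto simp: remove_zero_def)
qed

lemma Sh_permutes: "\<sigma> \<in> Sh p q \<Longrightarrow> \<sigma> permutes {..<p + q}"
  by (simp add: Sh_def)

lemma finite_Sh [simp]: "finite (Sh p q)"
  by (rule finite_subset[OF _ finite_permutations[of "{..<p + q}"]]) (auto simp: Sh_def)

lemma insert_zero_Sh_left:
  assumes "\<sigma> \<in> Sh p q" shows "insert_zero 0 \<sigma> \<in> Sh (Suc p) q"
proof -
  have "insert_zero 0 \<sigma> r < insert_zero 0 \<sigma> s"
    if "r < s" "s < Suc p \<or> Suc p \<le> r \<and> s < Suc p + q" for r s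
  proof (cases r)
    case (Suc r')
    with that obtain s' where "s = Suc s'" by (cases s) auto
    with Suc that assms show ?thesis by (auto simp: Sh_def strict_mono_on_def insert_zero_def)
  qed (use that in \<open>auto simp: insert_zero_def\<close>)
  then show ?thesis
    using insert_zero_permutes[OF Sh_permutes[OF assms], of 0] by (auto simp: Sh_def strict_mono_on_def)
qed

lemma insert_zero_Sh_right:
  assumes "\<sigma> \<in> Sh p q" shows "insert_zero p \<sigma> \<in> Sh p (Suc q)"
proof -
  have "insert_zero p \<sigma> r < insert_zero p \<sigma> s"
    if "r < s" "s < p \<or> p \<le> r \<and> s < p + Suc q" for r s
  proof (cases "r = p \<or> s < p")
    case False
    with that obtain s' r' where "s = Suc s'" "r = Suc r'" by (cases s; cases r) auto
    with False that assms show ?thesis by (auto simp: Sh_def strict_mono_on_def insert_zero_def)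
  qed (use that assms in \<open>auto simp: Sh_def strict_mono_on_def insert_zero_def\<close>)
  then show ?thesis
    using insert_zero_permutes[OF Sh_permutes[OF assms], of p] by (auto simp: Sh_def strict_mono_on_def)
qed

lemma remove_zero_Sh_left:
  assumes "\<sigma> \<in> Sh (Suc p) q" "\<sigma> 0 = 0"
  shows "remove_zero 0 \<sigma> \<in> Sh p q"
proof -
  have nz: "0 < \<sigma> i" if "i \<noteq> 0" for i
    using that assms(2) permutes_inj[OF Sh_permutes[OF assms(1)]] by (metis injD neq0_conv)
  have "remove_zero 0 \<sigma> r < remove_zero 0 \<sigma> s"
    if "r < s" "s < p \<or> p \<le> r \<and> s < p + q" for r s
  proof -
    have "\<sigma> (Suc r) < \<sigma> (Suc s)"
      using that assms(1) by (auto simp: Sh_def strict_mono_on_def)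
    then show ?thesis using nz[of "Suc r"] by (auto simp: remove_zero_def)
  qed
  then show ?thesis
    using remove_zero_permutes[of \<sigma> "p + q" 0] assms by (auto simp: Sh_def strict_mono_on_def)
qed

lemma remove_zero_Sh_right:
  assumes "\<sigma> \<in> Sh p (Suc q)" "\<sigma> p = 0"
  shows "remove_zero p \<sigma> \<in> Sh p q"
proof -
  have nz: "0 < \<sigma> i" if "i \<noteq> p" for i
    using that assms(2) permutes_inj[OF Sh_permutes[OF assms(1)]] by (metis injD neq0_conv)
  have "remove_zero p \<sigma> r < remove_zero p \<sigma> s"
    if "r < s" "s < p \<or> p \<le> r \<and> s < p + q" for r s
  proof -
    have "\<sigma> (if r < p then r else Suc r) < \<sigma> (if s < p then s else Suc s)"
      using that assms(1) by (auto simp: Sh_def strict_mono_on_def)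
    then show ?thesis
      using nz[of "if r < p then r else Suc r"] by (auto simp: remove_zero_def split: if_splits)
  qed
  then show ?thesis
    using remove_zero_permutes[of \<sigma> "p + q" p] assms by (auto simp: Sh_def strict_mono_on_def)
qed

text \<open>Both blocks of a shuffle are increasing, so the smallest value can only sit at the head
  of one of them.\<close>

lemma Sh_zero_cases:
  assumes "\<sigma> \<in> Sh p q" "0 < p + q"
  shows "(0 < p \<and> \<sigma> 0 = 0) \<or> (0 < q \<and> \<sigma> p = 0)"
proof -
  obtain j where j: "j < p + q" "\<sigma> j = 0"
    using permutes_image[OF Sh_permutes[OF assms(1)]] assms(2) by (metis image_iff lessThan_iff)
  show ?thesis
  proof (cases "j < p")
    case True
    then have "\<sigma> 0 < \<sigma> j" if "j \<noteq> 0"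
      using assms(1) that by (simp add: Sh_def strict_mono_on_def)
    then have "\<sigma> 0 = 0" using j(2) by (cases "j = 0") auto
    with True show ?thesis by simp
  next
    case False
    then have "\<sigma> p < \<sigma> j" if "j \<noteq> p"
      using assms(1) that j(1) by (simp add: Sh_def strict_mono_on_def)
    then have "\<sigma> p = 0" using j(2) by (cases "j = p") auto
    with False j show ?thesis by auto
  qed
qed

lemma Sh_0 [simp]: "Sh 0 q = {id}" and Sh_0_right [simp]: "Sh p 0 = {id}"
proof -
  have *: "\<sigma> = id" if "\<sigma> permutes {..<n}" "strict_mono_on {..<n} \<sigma>" for \<sigma> :: "nat \<Rightarrow> nat" and n
    using that
  proof (induction n arbitrary: \<sigma>)
    case 0
    then show ?case by simp
  next
    case (Suc n)
    have Sh: "\<sigma> \<in> Sh (Suc n) 0" using Suc.prems by (auto simp: Sh_def strict_mono_on_def)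
    then have z: "\<sigma> 0 = 0" using Sh_zero_cases[OF Sh] by simp
    have "remove_zero 0 \<sigma> \<in> Sh n 0" using remove_zero_Sh_left[OF Sh z] .
    then have "remove_zero 0 \<sigma> = id" using Suc.IH[of "remove_zero 0 \<sigma>"] by (simp add: Sh_def del: id_apply)
    then have "\<sigma> = insert_zero 0 id" using insert_remove_zero[of \<sigma> n 0] Suc.prems z by metis
    then show ?case by (auto simp: insert_zero_def fun_eq_iff)
  qed
  show "Sh 0 q = {id}"
    using *[of _ q] by (auto simp: Sh_def strict_mono_on_def permutes_id)
  show "Sh p 0 = {id}"
    using *[of _ p] by (auto simp: Sh_def strict_mono_on_def permutes_id)
qed

text \<open>Deleting the value 0 from the head of its block leaves a shuffle of one element less.
  This recursion gives the Leibniz rule for contractions, and later enumerates the shuffles in the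
  balance condition.\<close>

lemma sum_Sh:
  assumes "0 < p + q"
  shows "(\<Sum>\<sigma>\<in>Sh p q. f \<sigma>) =
    (if 0 < p then \<Sum>\<sigma>\<in>Sh (p - 1) q. f (insert_zero 0 \<sigma>) else 0) +
    (if 0 < q then \<Sum>\<sigma>\<in>Sh p (q - 1). f (insert_zero p \<sigma>) else (0::'b::comm_monoid_add))"
proof -
  let ?A = "{\<sigma> \<in> Sh p q. 0 < p \<and> \<sigma> 0 = 0}" and ?B = "{\<sigma> \<in> Sh p q. 0 < q \<and> \<sigma> p = 0}"
  have disj: "?A \<inter> ?B = {}"
  proof (rule Int_emptyI)
    fix \<sigma> assume A: "\<sigma> \<in> ?A" and B: "\<sigma> \<in> ?B"
    then have "inj \<sigma>" "\<sigma> 0 = \<sigma> p" using permutes_inj[OF Sh_permutes[of \<sigma> p q]] by auto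
    then show False using A injD[OF \<open>inj \<sigma>\<close> \<open>\<sigma> 0 = \<sigma> p\<close>] by simp
  qed
  have "Sh p q = ?A \<union> ?B" using Sh_zero_cases[of _ p q] assms by blast
  then have "(\<Sum>\<sigma>\<in>Sh p q. f \<sigma>) = sum f (?A \<union> ?B)" by simp
  also have "\<dots> = sum f ?A + sum f ?B" using disj by (intro sum.union_disjoint) auto
  also have "sum f ?A = (if 0 < p then \<Sum>\<sigma>\<in>Sh (p - 1) q. f (insert_zero 0 \<sigma>) else 0)"
  proof (cases p)
    case (Suc p')
    show ?thesis unfolding Suc
      apply simp
      apply (rule sum.reindex_bij_witness[of _ "insert_zero 0" "remove_zero 0"])
      using insert_remove_zero[of _ "p' + q" 0] remove_zero_Sh_left[of _ p' q] insert_zero_Sh_left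
      by (auto simp: Sh_def insert_zero_def)
  qed simp
  also have "sum f ?B = (if 0 < q then \<Sum>\<sigma>\<in>Sh p (q - 1). f (insert_zero p \<sigma>) else 0)"
  proof (cases q)
    case (Suc q')
    show ?thesis unfolding Suc
      apply simp
      apply (rule sum.reindex_bij_witness[of _ "insert_zero p" "remove_zero p"])
      using insert_remove_zero[of _ "p + q'" p] remove_zero_Sh_right[of _ p q'] insert_zero_Sh_right
      by (auto simp: Sh_def insert_zero_def)
  qed simp
  finally show ?thesis .
qed

section \<open>Contraction and the algebra of exterior products\<close>

definition contract :: "'e \<Rightarrow> ('e list \<Rightarrow> real) \<Rightarrow> 'e list \<Rightarrow> real" where
  "contract v \<alpha> = (\<lambda>vs. \<alpha> (v # vs))"

text \<open>The grading automorphism. It carries the sign of the graded Leibniz rule without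
  reference to a degree, so that the rule holds for arbitrary functions on lists.\<close>

definition parity :: "('e list \<Rightarrow> real) \<Rightarrow> 'e list \<Rightarrow> real" where
  "parity \<alpha> = (\<lambda>vs. (-1) ^ length vs * \<alpha> vs)"

lemma wedge_alt_Nil [simp]: "wedge_alt \<alpha> \<beta> [] = \<alpha> [] * \<beta> []"
  by (simp add: wedge_alt_def)

text \<open>The first argument goes either to \<open>\<alpha>\<close> or to \<open>\<beta>\<close>,
  by \<open>sum_Sh\<close>. In the second case it passes the \<open>p\<close> arguments of
  \<open>\<alpha>\<close>; the resulting sign is absorbed into \<open>parity\<close>.\<close>

lemma wedge_alt_Cons:
  "wedge_alt \<alpha> \<beta> (v # vs) = wedge_alt (contract v \<alpha>) \<beta> vs + wedge_alt (parity \<alpha>) (contract v \<beta>) vs"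
proof -
  let ?N = "length vs"
  define F where "F = (\<lambda>p \<sigma>. of_int (sign \<sigma>) * \<alpha> (map (\<lambda>i. (v # vs) ! \<sigma> i) [0..<p])
       * \<beta> (map (\<lambda>i. (v # vs) ! \<sigma> i) [p..<Suc ?N]))"
  have "wedge_alt \<alpha> \<beta> (v # vs) = (\<Sum>p \<le> Suc ?N. \<Sum>\<sigma> \<in> Sh p (Suc ?N - p). F p \<sigma>)"
    by (simp add: wedge_alt_def F_def)
  also have "\<dots> = (\<Sum>p \<le> Suc ?N.
      (if 0 < p then \<Sum>\<sigma>\<in>Sh (p - 1) (Suc ?N - p). F p (insert_zero 0 \<sigma>) else 0) +
      (if p < Suc ?N then \<Sum>\<sigma>\<in>Sh p (?N - p). F p (insert_zero p \<sigma>) else 0))"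
  proof (rule sum.cong[OF refl])
    fix p assume "p \<in> {..Suc ?N}"
    then show "(\<Sum>\<sigma> \<in> Sh p (Suc ?N - p). F p \<sigma>) =
      (if 0 < p then \<Sum>\<sigma>\<in>Sh (p - 1) (Suc ?N - p). F p (insert_zero 0 \<sigma>) else 0) +
      (if p < Suc ?N then \<Sum>\<sigma>\<in>Sh p (?N - p). F p (insert_zero p \<sigma>) else 0)"
      by (subst sum_Sh) (auto simp: Suc_diff_le)
  qed
  also have "\<dots> = (\<Sum>p \<le> Suc ?N. if 0 < p then \<Sum>\<sigma>\<in>Sh (p - 1) (Suc ?N - p). F p (insert_zero 0 \<sigma>) else 0)
     + (\<Sum>p \<le> Suc ?N. if p < Suc ?N then \<Sum>\<sigma>\<in>Sh p (?N - p). F p (insert_zero p \<sigma>) else 0)"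
    by (rule sum.distrib)
  also have "(\<Sum>p \<le> Suc ?N. if 0 < p then \<Sum>\<sigma>\<in>Sh (p - 1) (Suc ?N - p). F p (insert_zero 0 \<sigma>) else 0)
      = (\<Sum>p \<le> ?N. \<Sum>\<sigma>\<in>Sh p (?N - p). F (Suc p) (insert_zero 0 \<sigma>))"
    by (subst sum.atMost_Suc_shift) simp
  also have "(\<Sum>p \<le> Suc ?N. if p < Suc ?N then \<Sum>\<sigma>\<in>Sh p (?N - p). F p (insert_zero p \<sigma>) else 0)
      = (\<Sum>p \<le> ?N. \<Sum>\<sigma>\<in>Sh p (?N - p). F p (insert_zero p \<sigma>))"
    by simp
  also have "(\<Sum>p \<le> ?N. \<Sum>\<sigma>\<in>Sh p (?N - p). F (Suc p) (insert_zero 0 \<sigma>))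
      = wedge_alt (contract v \<alpha>) \<beta> vs"
    unfolding wedge_alt_def
  proof (intro sum.cong refl)
    fix p \<sigma> assume p: "p \<in> {..?N}" and s: "\<sigma> \<in> Sh p (?N - p)"
    have "map (\<lambda>i. (v # vs) ! insert_zero 0 \<sigma> i) [0..<Suc p] = v # map (\<lambda>i. vs ! \<sigma> i) [0..<p]"
      by (simp add: upt_conv_Cons insert_zero_def del: upt_Suc) (simp add: map_Suc_upt[symmetric] del: map_Suc_upt upt_Suc)
    moreover have "map (\<lambda>i. (v # vs) ! insert_zero 0 \<sigma> i) [Suc p..<Suc ?N] = map (\<lambda>i. vs ! \<sigma> i) [p..<?N]"
      by (simp add: insert_zero_def map_Suc_upt[symmetric] del: map_Suc_upt upt_Suc)
    moreover have "sign (insert_zero 0 \<sigma>) = sign \<sigma>"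
      using sign_insert_zero_0[OF Sh_permutes[OF s]] .
    ultimately show "F (Suc p) (insert_zero 0 \<sigma>) = of_int (sign \<sigma>) *
        contract v \<alpha> (map (\<lambda>i. vs ! \<sigma> i) [0..<p]) * \<beta> (map (\<lambda>i. vs ! \<sigma> i) [p..<?N])"
      by (simp add: F_def contract_def del: upt_Suc)
  qed
  also have "(\<Sum>p \<le> ?N. \<Sum>\<sigma>\<in>Sh p (?N - p). F p (insert_zero p \<sigma>))
      = wedge_alt (parity \<alpha>) (contract v \<beta>) vs"
    unfolding wedge_alt_def
  proof (intro sum.cong refl)
    fix p \<sigma> assume p: "p \<in> {..?N}" and s: "\<sigma> \<in> Sh p (?N - p)"
    have "map (\<lambda>i. (v # vs) ! insert_zero p \<sigma> i) [0..<p] = map (\<lambda>i. vs ! \<sigma> i) [0..<p]"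
      by (rule map_cong) (auto simp: insert_zero_def)
    moreover have "map (\<lambda>i. (v # vs) ! insert_zero p \<sigma> i) [p..<Suc ?N]
        = v # map (\<lambda>i. vs ! \<sigma> i) [p..<?N]"
      using p by (simp add: upt_conv_Cons insert_zero_def del: upt_Suc)
        (simp add: insert_zero_def map_Suc_upt[symmetric] del: map_Suc_upt upt_Suc)
    moreover have "sign (insert_zero p \<sigma>) = (-1) ^ p * sign \<sigma>"
      using sign_insert_zero[OF Sh_permutes[OF s], of p] p by simp
    ultimately show "F p (insert_zero p \<sigma>) = of_int (sign \<sigma>) *
        parity \<alpha> (map (\<lambda>i. vs ! \<sigma> i) [0..<p]) * contract v \<beta> (map (\<lambda>i. vs ! \<sigma> i) [p..<?N])"
      by (simp only: F_def contract_def parity_def) (simp del: upt_Suc)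
  qed
  finally show ?thesis .
qed

lemma contract_apply: "contract v \<alpha> vs = \<alpha> (v # vs)"
  by (simp add: contract_def)

lemma parity_apply: "parity \<alpha> vs = (-1) ^ length vs * \<alpha> vs"
  by (simp add: parity_def)

lemma scaleR_fun_apply [simp]: "(r *\<^sub>R f) x = r *\<^sub>R f x"
  by (simp add: scaleR_fun_def)

lemma contract_add [simp]: "contract v (\<alpha> + \<beta>) = contract v \<alpha> + contract v \<beta>"
  and contract_diff [simp]: "contract v (\<alpha> - \<beta>) = contract v \<alpha> - contract v \<beta>"
  and contract_scaleR [simp]: "contract v (r *\<^sub>R \<alpha>) = r *\<^sub>R contract v \<alpha>"
  and contract_zero [simp]: "contract v 0 = 0"
  and contract_minus [simp]: "contract v (- \<alpha>) = - contract v \<alpha>"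
  by (auto simp: fun_eq_iff contract_apply)

lemma parity_add [simp]: "parity (\<alpha> + \<beta>) = parity \<alpha> + parity \<beta>"
  and parity_diff [simp]: "parity (\<alpha> - \<beta>) = parity \<alpha> - parity \<beta>"
  and parity_scaleR [simp]: "parity (r *\<^sub>R \<alpha>) = r *\<^sub>R parity \<alpha>"
  and parity_zero [simp]: "parity 0 = 0"
  and parity_minus [simp]: "parity (- \<alpha>) = - parity \<alpha>"
  and contract_parity [simp]: "contract v (parity \<alpha>) = - parity (contract v \<alpha>)"
  by (simp_all add: fun_eq_iff algebra_simps parity_apply contract_apply)

lemma parity_parity [simp]: "parity (parity \<alpha>) = \<alpha>"
  by (simp add: fun_eq_iff parity_apply flip: mult.assoc power_mult_distrib)

lemma list_fun_eqI:
  assumes "\<alpha> [] = \<beta> []" "\<And>v. contract v \<alpha> = contract v \<beta>"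
  shows "\<alpha> = \<beta>"
proof
  fix vs show "\<alpha> vs = \<beta> vs"
    using assms(1) fun_cong[OF assms(2)] by (cases vs) (auto simp: contract_apply)
qed

lemma wedge_alt_add_left: "wedge_alt (\<alpha> + \<alpha>') \<beta> = wedge_alt \<alpha> \<beta> + wedge_alt \<alpha>' \<beta>"
  and wedge_alt_add_right: "wedge_alt \<alpha> (\<beta> + \<beta>') = wedge_alt \<alpha> \<beta> + wedge_alt \<alpha> \<beta>'"
  and wedge_alt_diff_left: "wedge_alt (\<alpha> - \<alpha>') \<beta> = wedge_alt \<alpha> \<beta> - wedge_alt \<alpha>' \<beta>"
  and wedge_alt_diff_right: "wedge_alt \<alpha> (\<beta> - \<beta>') = wedge_alt \<alpha> \<beta> - wedge_alt \<alpha> \<beta>'"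
  and wedge_alt_scaleR_left: "wedge_alt (r *\<^sub>R \<alpha>) \<beta> = r *\<^sub>R wedge_alt \<alpha> \<beta>"
  and wedge_alt_scaleR_right: "wedge_alt \<alpha> (r *\<^sub>R \<beta>) = r *\<^sub>R wedge_alt \<alpha> \<beta>"
  and wedge_alt_zero_left [simp]: "wedge_alt 0 \<beta> = 0"
  and wedge_alt_zero_right [simp]: "wedge_alt \<alpha> 0 = 0"
  and wedge_alt_minus_left: "wedge_alt (- \<alpha>) \<beta> = - wedge_alt \<alpha> \<beta>"
  and wedge_alt_minus_right: "wedge_alt \<alpha> (- \<beta>) = - wedge_alt \<alpha> \<beta>"
  by (auto simp: fun_eq_iff wedge_alt_def algebra_simps sum.distrib sum_subtractf
      sum_distrib_left sum_negf)

lemmas wedge_alt_linear = wedge_alt_add_left wedge_alt_add_right wedge_alt_diff_left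
  wedge_alt_diff_right wedge_alt_scaleR_left wedge_alt_scaleR_right
  wedge_alt_minus_left wedge_alt_minus_right

lemma contract_wedge:
  "contract v (wedge_alt \<alpha> \<beta>) = wedge_alt (contract v \<alpha>) \<beta> + wedge_alt (parity \<alpha>) (contract v \<beta>)"
  by (auto simp: fun_eq_iff wedge_alt_Cons contract_apply)

lemma parity_wedge: "parity (wedge_alt \<alpha> \<beta>) = wedge_alt (parity \<alpha>) (parity \<beta>)"
proof
  fix vs
  have "(-1) ^ length vs * wedge_alt \<alpha> \<beta> vs = wedge_alt (parity \<alpha>) (parity \<beta>) vs"
  proof (induction vs arbitrary: \<alpha> \<beta>)
    case Nil
    show ?case by (simp, simp add: parity_apply)
  next
    case (Cons v vs)
    show ?case
      using Cons[of "contract v \<alpha>" \<beta>] Cons[of "parity \<alpha>" "contract v \<beta>"]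
      by (simp add: wedge_alt_Cons wedge_alt_minus_left wedge_alt_minus_right algebra_simps)
  qed
  then show "parity (wedge_alt \<alpha> \<beta>) vs = wedge_alt (parity \<alpha>) (parity \<beta>) vs"
    by (subst parity_apply)
qed

text \<open>Contraction distributes over both sides in the same way, so induction on the arguments
  needs neither alternation nor a degree.\<close>

lemma wedge_alt_assoc: "wedge_alt (wedge_alt \<alpha> \<beta>) \<gamma> = wedge_alt \<alpha> (wedge_alt \<beta> \<gamma>)"
proof
  fix vs show "wedge_alt (wedge_alt \<alpha> \<beta>) \<gamma> vs = wedge_alt \<alpha> (wedge_alt \<beta> \<gamma>) vs"
    by (induction vs arbitrary: \<alpha> \<beta> \<gamma>)
      (simp_all add: wedge_alt_Cons contract_wedge parity_wedge wedge_alt_linear)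
qed

definition scalar_form :: "real \<Rightarrow> 'e list \<Rightarrow> real" where
  "scalar_form r vs = (if vs = [] then r else 0)"

lemma contract_scalar_form [simp]: "contract v (scalar_form r) = 0"
  by (auto simp: scalar_form_def fun_eq_iff contract_apply)

lemma parity_scalar_form [simp]: "parity (scalar_form r) = scalar_form r"
  by (auto simp: scalar_form_def fun_eq_iff parity_apply)

lemma wedge_scalar_left [simp]: "wedge_alt (scalar_form r) \<beta> = r *\<^sub>R \<beta>"
proof
  fix vs show "wedge_alt (scalar_form r) \<beta> vs = (r *\<^sub>R \<beta>) vs"
    by (induction vs arbitrary: \<beta>) (simp_all add: wedge_alt_Cons contract_apply scalar_form_def)
qed

lemma wedge_scalar_right [simp]: "wedge_alt \<alpha> (scalar_form r) = r *\<^sub>R \<alpha>"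
proof
  fix vs show "wedge_alt \<alpha> (scalar_form r) vs = (r *\<^sub>R \<alpha>) vs"
    by (induction vs arbitrary: \<alpha>) (simp_all add: wedge_alt_Cons contract_apply scalar_form_def)
qed

definition of_degree :: "nat \<Rightarrow> ('e list \<Rightarrow> real) \<Rightarrow> bool" where
  "of_degree k \<alpha> \<longleftrightarrow> (\<forall>vs. length vs \<noteq> k \<longrightarrow> \<alpha> vs = 0)"

lemma of_degree_contract: "of_degree (Suc k) \<alpha> \<Longrightarrow> of_degree k (contract v \<alpha>)"
  and of_degree_0_contract: "of_degree 0 \<alpha> \<Longrightarrow> contract v \<alpha> = 0"
  by (auto simp: of_degree_def fun_eq_iff contract_apply)

lemma of_degree_parity: "of_degree k \<alpha> \<Longrightarrow> parity \<alpha> = (-1) ^ k *\<^sub>R \<alpha>"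
  by (force simp: of_degree_def fun_eq_iff parity_apply)

lemma alternating_of_degree: "alternating k \<alpha> \<Longrightarrow> of_degree k \<alpha>"
  by (simp add: alternating_def of_degree_def)

lemmas alternating_parity = of_degree_parity[OF alternating_of_degree]

lemma of_degree_0_scalar: "of_degree 0 \<alpha> \<Longrightarrow> \<alpha> = scalar_form (\<alpha> [])"
  by (auto simp: of_degree_def scalar_form_def fun_eq_iff)

text \<open>Graded commutativity is a matter of degrees alone: contraction lowers one of the two
  degrees by one, and the signs are compared by parity.\<close>

lemma wedge_alt_comm:
  assumes "of_degree p \<alpha>" "of_degree q \<beta>"
  shows "wedge_alt \<alpha> \<beta> = (-1) ^ (p * q) *\<^sub>R wedge_alt \<beta> \<alpha>"
proof
  fix vs show "wedge_alt \<alpha> \<beta> vs = ((-1) ^ (p * q) *\<^sub>R wedge_alt \<beta> \<alpha>) vs"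
    using assms
  proof (induction vs arbitrary: p q \<alpha> \<beta>)
    case Nil
    then show ?case by (cases "p = 0 \<or> q = 0") (auto simp: of_degree_def)
  next
    case (Cons v vs)
    have 1: "wedge_alt (contract v \<alpha>) \<beta> vs = (-1) ^ (p * q + q) * wedge_alt \<beta> (contract v \<alpha>) vs"
    proof (cases p)
      case 0
      then show ?thesis using of_degree_0_contract[of \<alpha> v] Cons.prems by simp
    next
      case (Suc p')
      show ?thesis using Cons.IH[OF of_degree_contract Cons.prems(2), of p' \<alpha> v] Cons.prems Suc
        by (simp add: power_add mult.commute)
    qed
    have 2: "wedge_alt \<alpha> (contract v \<beta>) vs = (-1) ^ (p * q + p) * wedge_alt (contract v \<beta>) \<alpha> vs"
    proof (cases q)
      case 0
      then show ?thesis using of_degree_0_contract[of \<beta> v] Cons.prems by simp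
    next
      case (Suc q')
      show ?thesis using Cons.IH[OF Cons.prems(1) of_degree_contract, of q' \<beta> v] Cons.prems Suc
        by (simp add: power_add mult.commute)
    qed
    show ?case
      using Cons.prems
      by (simp add: wedge_alt_Cons of_degree_parity wedge_alt_scaleR_left 1 2)
        (cases "even p"; cases "even q"; simp add: power_add algebra_simps)
  qed
qed

subsection \<open>Alternating forms\<close>

lemma alternating_zero [simp]: "alternating k 0"
  by (simp add: alternating_def linear_zero)

lemma scaleR_scalar_form: "r *\<^sub>R scalar_form s = scalar_form (r * s)"
  by (auto simp: fun_eq_iff scalar_form_def)

lemma sum_fun_apply: "(\<Sum>i\<in>I. f i) x = (\<Sum>i\<in>I. f i x)"
  by (induction I rule: infinite_finite_induct) auto

lemma alternating_add: "alternating k \<alpha> \<Longrightarrow> alternating k \<beta> \<Longrightarrow> alternating k (\<alpha> + \<beta>)"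
  by (simp add: alternating_def linear_compose_add)

lemma alternating_scaleR: "alternating k \<alpha> \<Longrightarrow> alternating k (r *\<^sub>R \<alpha>)"
  by (simp add: alternating_def linear_iff algebra_simps)

lemma alternating_minus: "alternating k \<alpha> \<Longrightarrow> alternating k (- \<alpha>)"
  using alternating_scaleR[of k \<alpha> "-1"] by simp

lemma alternating_diff: "alternating k \<alpha> \<Longrightarrow> alternating k \<beta> \<Longrightarrow> alternating k (\<alpha> - \<beta>)"
  using alternating_add[of k \<alpha> "- \<beta>"] alternating_minus[of k \<beta>] by simp

lemma alternating_sum: "(\<And>i. i \<in> I \<Longrightarrow> alternating k (f i)) \<Longrightarrow> alternating k (sum f I)"
  by (induction I rule: infinite_finite_induct) (auto intro: alternating_add)

lemma alternating_0_iff: "alternating 0 \<alpha> \<longleftrightarrow> of_degree 0 \<alpha>"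
proof
  assume *: "of_degree 0 \<alpha>"
  have "\<alpha> vs = 0" if "\<not> distinct vs" for vs
    using * that by (cases vs) (simp_all add: of_degree_def)
  with * show "alternating 0 \<alpha>" by (simp add: alternating_def of_degree_def)
qed (simp add: alternating_of_degree)

lemma alternating_scalar_form [simp]: "alternating 0 (scalar_form r)"
  unfolding alternating_0_iff of_degree_def by (simp add: scalar_form_def)

lemma alternatingD_linear:
  "alternating k \<alpha> \<Longrightarrow> length us + 1 + length ws = k \<Longrightarrow> linear (\<lambda>v. \<alpha> (us @ v # ws))"
  by (simp add: alternating_def)

lemma alternating_contract:
  assumes "alternating (Suc k) \<alpha>"
  shows "alternating k (contract v \<alpha>)"
  using assms alternatingD_linear[OF assms, of "v # us" for us]
  by (simp add: alternating_def contract_apply)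

lemma alternating_contract_linear:
  assumes "alternating (Suc k) \<alpha>"
  shows "linear (\<lambda>v. contract v \<alpha>)"
proof -
  have "linear (\<lambda>v. \<alpha> (v # ws))" for ws
  proof (cases "length ws = k")
    case True
    then show ?thesis using alternatingD_linear[OF assms, of "[]" ws] by simp
  next
    case False
    then have "\<alpha> (v # ws) = 0" for v using assms by (auto simp: alternating_def)
    then show ?thesis by (simp add: linear_zero)
  qed
  then show ?thesis by (auto simp: linear_iff fun_eq_iff contract_apply)
qed

lemma alternating_swap:
  assumes "alternating k \<alpha>"
  shows "\<alpha> (v # w # vs) = - \<alpha> (w # v # vs)"
proof (cases "length vs + 2 = k")
  case True
  have l1: "linear (\<lambda>v. \<alpha> (v # w # vs))" for w
    using alternatingD_linear[OF assms, of "[]" "w # vs"] True by simp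
  have l2: "linear (\<lambda>w. \<alpha> (v # w # vs))" for v
    using alternatingD_linear[OF assms, of "[v]" "vs"] True by simp
  have z: "\<alpha> (u # u # vs) = 0" for u
    using assms by (auto simp: alternating_def)
  have "\<alpha> ((v + w) # (v + w) # vs) = \<alpha> (v # w # vs) + \<alpha> (w # v # vs)"
    using z[of v] z[of w] by (simp add: linear_add[OF l1] linear_add[OF l2])
  then show ?thesis using z[of "v + w"] by linarith
next
  case False
  then show ?thesis using assms by (auto simp: alternating_def)
qed

text \<open>Alternation is checked one degree at a time through contractions. This is the form in
  which it is proved for \<open>wedge_alt\<close> and \<open>ext_deriv\<close>, whose contractions
  are known.\<close>

lemma alternating_SucI:
  assumes "\<alpha> [] = 0" "\<And>v. alternating k (contract v \<alpha>)" "linear (\<lambda>v. contract v \<alpha>)"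
    and "\<And>v w. contract v (contract w \<alpha>) = - contract w (contract v \<alpha>)"
  shows "alternating (Suc k) \<alpha>"
  unfolding alternating_def
proof (intro conjI allI impI)
  fix vs :: "'a list" assume "length vs \<noteq> Suc k"
  then show "\<alpha> vs = 0"
    using assms(1) assms(2)[of "hd vs"] by (cases vs) (auto simp: alternating_def contract_apply)
next
  fix us ws :: "'a list" assume l: "length us + 1 + length ws = Suc k"
  show "linear (\<lambda>v. \<alpha> (us @ v # ws))"
  proof (cases us)
    case Nil
    then show ?thesis using assms(3) by (auto simp: linear_iff fun_eq_iff contract_apply)
  next
    case (Cons u us')
    then show ?thesis using alternatingD_linear[OF assms(2)[of u], of us' ws] l by (simp add: contract_apply)
  qed
next
  fix vs :: "'a list" assume nd: "\<not> distinct vs"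
  then obtain v ws where vs: "vs = v # ws" by (cases vs) auto
  have z: "\<alpha> (v # v # us) = 0" for v us
    using fun_cong[OF assms(4)[of v v], of us] by (simp add: contract_apply)
  show "\<alpha> vs = 0"
  proof (cases "distinct ws")
    case False
    then show ?thesis using assms(2)[of v] by (auto simp: vs alternating_def contract_apply)
  next
    case True
    then obtain us us' where ws: "ws = us @ v # us'" using nd vs by (auto simp: in_set_conv_decomp)
    show ?thesis
    proof (cases us)
      case Nil
      then show ?thesis by (simp add: vs ws z)
    next
      case (Cons u us2)
      \<comment> \<open>Exchanging the first two entries leaves two copies of \<open>v\<close>
        behind \<open>u\<close>, where the contraction by \<open>u\<close> is already
        alternating.\<close>
      have "\<alpha> (v # u # us2 @ v # us') = - \<alpha> (u # v # us2 @ v # us')"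
        using fun_cong[OF assms(4)[of u v], of "us2 @ v # us'"] by (simp add: contract_apply)
      also have "\<dots> = 0" using assms(2)[of u] by (force simp: alternating_def contract_apply)
      finally show ?thesis by (simp add: vs ws Cons)
    qed
  qed
qed

lemma alternating_parity_alternating: "alternating k \<alpha> \<Longrightarrow> alternating k (parity \<alpha>)"
  by (simp add: alternating_parity alternating_scaleR)

lemma contract_anticommute:
  "alternating k \<alpha> \<Longrightarrow> contract v (contract w \<alpha>) = - contract w (contract v \<alpha>)"
  by (rule ext) (simp add: contract_apply alternating_swap[of k \<alpha> w v])

lemma contract_linear: "alternating k \<alpha> \<Longrightarrow> linear (\<lambda>v. contract v \<alpha>)"
  by (cases k) (auto simp: alternating_contract_linear alternating_0_iff of_degree_0_contract linear_zero)

lemma alternating_wedge: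
  assumes "alternating p \<alpha>" "alternating q \<beta>"
  shows "alternating (p + q) (wedge_alt \<alpha> \<beta>)"
  using assms
proof (induction "p + q" arbitrary: p q \<alpha> \<beta>)
  case 0
  then have "p = 0" "q = 0" by auto
  with 0 obtain a b where "\<alpha> = scalar_form a" "\<beta> = scalar_form b"
    using of_degree_0_scalar alternating_0_iff by blast
  then have "wedge_alt \<alpha> \<beta> = scalar_form (a * b)" by (simp add: scaleR_scalar_form mult.commute)
  then show ?case using \<open>p = 0\<close> \<open>q = 0\<close> by simp
next
  case (Suc N)
  show ?case unfolding Suc(2)[symmetric]
  proof (rule alternating_SucI)
    show "wedge_alt \<alpha> \<beta> [] = 0"
      using Suc.prems Suc(2) by (cases p; cases q) (auto simp: alternating_def)
    show "alternating N (contract v (wedge_alt \<alpha> \<beta>))" for v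
    proof -
      have "alternating N (wedge_alt (contract v \<alpha>) \<beta>)"
      proof (cases p)
        case 0
        then show ?thesis using Suc.prems by (simp add: alternating_0_iff of_degree_0_contract)
      next
        case (Suc p')
        then show ?thesis using Suc.hyps(1)[of p' q "contract v \<alpha>" \<beta>] Suc.hyps(2) Suc.prems alternating_contract[of p' \<alpha> v] by auto
      qed
      moreover have "alternating N (wedge_alt (parity \<alpha>) (contract v \<beta>))"
      proof (cases q)
        case 0
        then show ?thesis using Suc.prems by (simp add: alternating_0_iff of_degree_0_contract)
      next
        case (Suc q')
        then show ?thesis using Suc.hyps(1)[of p q' "parity \<alpha>" "contract v \<beta>"] Suc.hyps(2) Suc.prems
          alternating_contract[of q' \<beta> v] alternating_parity_alternating[of p \<alpha>] by auto
      qed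
      ultimately show ?thesis by (simp add: contract_wedge alternating_add)
    qed
    show "linear (\<lambda>v. contract v (wedge_alt \<alpha> \<beta>))"
      using contract_linear[OF Suc.prems(1)] contract_linear[OF Suc.prems(2)]
      by (simp add: linear_iff contract_wedge wedge_alt_linear algebra_simps)
    show "contract v (contract w (wedge_alt \<alpha> \<beta>)) = - contract w (contract v (wedge_alt \<alpha> \<beta>))" for v w
      using contract_anticommute[OF Suc.prems(1), of v w] contract_anticommute[OF Suc.prems(2), of v w]
      by (simp add: contract_wedge wedge_alt_linear)
  qed
qed

lemma alternating_eq_0:
  fixes \<alpha> :: "'e::euclidean_space list \<Rightarrow> real"
  assumes "alternating k \<alpha>" "\<And>bs. set bs \<subseteq> Basis \<Longrightarrow> \<alpha> bs = 0"
  shows "\<alpha> = 0"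
proof
  fix vs
  show "\<alpha> vs = 0 vs"
    using assms
  proof (induction vs arbitrary: k \<alpha>)
    case Nil
    then show ?case by simp
  next
    case (Cons v vs)
    have "contract b \<alpha> vs = 0" if b: "b \<in> Basis" for b
    proof (cases k)
      case 0
      then show ?thesis using Cons.prems by (simp add: alternating_0_iff of_degree_0_contract)
    next
      case (Suc k')
      then show ?thesis
        using Cons.IH[of k' "contract b \<alpha>"] alternating_contract[of k' \<alpha> b] Cons.prems b
        by (auto simp: contract_def)
    qed
    moreover have "contract v \<alpha> = contract (\<Sum>b\<in>Basis. (v \<bullet> b) *\<^sub>R b) \<alpha>"
      by (simp add: euclidean_representation)
    then have "contract v \<alpha> = (\<Sum>b\<in>Basis. (v \<bullet> b) *\<^sub>R contract b \<alpha>)"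
      by (simp add: linear_sum[OF contract_linear[OF Cons.prems(1)]]
          linear_scale[OF contract_linear[OF Cons.prems(1)]])
    then have "\<alpha> (v # vs) = (\<Sum>b\<in>Basis. (v \<bullet> b) * contract b \<alpha> vs)"
      by (drule_tac fun_cong[of _ _ vs]) (simp add: sum_fun_apply contract_def)
    ultimately show ?case by simp
  qed
qed

text \<open>A list of basis vectors longer than the dimension has a repetition, and basis vectors
  suffice for testing a form.\<close>

lemma alternating_above_DIM:
  fixes \<alpha> :: "'e::euclidean_space list \<Rightarrow> real"
  assumes "alternating k \<alpha>" "DIM('e) < k"
  shows "\<alpha> = 0"
proof (rule alternating_eq_0[OF assms(1)])
  fix bs :: "'e list" assume "set bs \<subseteq> Basis"
  then have "card (set bs) \<le> DIM('e)" by (intro card_mono) auto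
  then have "length bs = k \<Longrightarrow> \<not> distinct bs" using assms(2) distinct_card[of bs] by auto
  then show "\<alpha> bs = 0" using assms(1) by (auto simp: alternating_def)
qed

section \<open>Pullback of forms\<close>

definition pullback :: "('d \<Rightarrow> 'e) \<Rightarrow> ('e list \<Rightarrow> real) \<Rightarrow> 'd list \<Rightarrow> real" where
  "pullback A \<alpha> = (\<lambda>vs. \<alpha> (map A vs))"

lemma pullback_apply: "pullback A \<alpha> vs = \<alpha> (map A vs)"
  by (simp add: pullback_def)

lemma contract_pullback: "contract v (pullback A \<alpha>) = pullback A (contract (A v) \<alpha>)"
  by (auto simp: fun_eq_iff contract_apply pullback_apply)

lemma parity_pullback: "parity (pullback A \<alpha>) = pullback A (parity \<alpha>)"
  by (auto simp: fun_eq_iff parity_apply pullback_apply)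

lemma pullback_wedge: "pullback A (wedge_alt \<alpha> \<beta>) = wedge_alt (pullback A \<alpha>) (pullback A \<beta>)"
proof
  fix vs show "pullback A (wedge_alt \<alpha> \<beta>) vs = wedge_alt (pullback A \<alpha>) (pullback A \<beta>) vs"
    by (induction vs arbitrary: \<alpha> \<beta>)
      (simp_all add: pullback_apply wedge_alt_Cons contract_pullback parity_pullback)
qed

lemma pullback_linear: "pullback A (\<alpha> + \<beta>) = pullback A \<alpha> + pullback A \<beta>"
  "pullback A (\<alpha> - \<beta>) = pullback A \<alpha> - pullback A \<beta>"
  "pullback A (r *\<^sub>R \<alpha>) = r *\<^sub>R pullback A \<alpha>" "pullback A 0 = 0"
  "pullback A (- \<alpha>) = - pullback A \<alpha>"
  by (auto simp: fun_eq_iff pullback_apply)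

lemma pullback_scalar_form [simp]: "pullback A (scalar_form r) = scalar_form r"
  by (auto simp: fun_eq_iff scalar_form_def pullback_apply)

lemma alternating_pullback:
  assumes "linear A" "alternating k \<alpha>"
  shows "alternating k (pullback A \<alpha>)"
proof -
  have "linear (\<lambda>v. \<alpha> (map A us @ A v # map A ws))" if "length us + 1 + length ws = k" for us ws
    using linear_compose[OF assms(1), of "\<lambda>v. \<alpha> (map A us @ v # map A ws)"] assms(2) that
    by (simp add: alternating_def o_def)
  then show ?thesis using assms(2) by (auto simp: alternating_def distinct_map pullback_apply)
qed

subsection \<open>One-forms\<close>

lemma contract_1: "alternating 1 \<theta> \<Longrightarrow> contract v \<theta> = scalar_form (\<theta> [v])"
  by (rule ext) (auto simp: alternating_def scalar_form_def contract_apply)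

lemma parity_1: "alternating 1 \<theta> \<Longrightarrow> parity \<theta> = - \<theta>"
  by (simp add: alternating_parity)

lemma contract_wedge_1:
  "alternating 1 \<theta> \<Longrightarrow> contract v (wedge_alt \<theta> \<alpha>) = \<theta> [v] *\<^sub>R \<alpha> - wedge_alt \<theta> (contract v \<alpha>)"
  by (simp add: contract_wedge contract_1 parity_1 wedge_alt_linear)

lemma wedge_1_self:
  assumes "alternating 1 \<theta>" shows "wedge_alt \<theta> \<theta> = 0"
  using wedge_alt_comm[of 1 \<theta> 1 \<theta>] alternating_of_degree[OF assms] by (simp add: fun_eq_iff)

lemma wedge_1_1_self [simp]:
  assumes "alternating 1 \<theta>" shows "wedge_alt \<theta> (wedge_alt \<theta> \<alpha>) = 0"
  by (simp add: wedge_1_self[OF assms] flip: wedge_alt_assoc)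

text \<open>Contract \<open>wedge_alt \<theta> \<alpha> = 0\<close> with \<open>R\<close>. This
  turns annihilation by \<theta> into divisibility by \<theta>, the two descriptions of vertical
  forms.\<close>

lemma wedge_contract_eq:
  assumes "alternating 1 \<theta>" "\<theta> [R] = 1" "wedge_alt \<theta> \<alpha> = 0"
  shows "wedge_alt \<theta> (contract R \<alpha>) = \<alpha>"
  using contract_wedge_1[OF assms(1), of R \<alpha>] assms(2,3) by simp

section \<open>Smooth maps on open sets\<close>

lemma frechet_derivative_cong_open:
  assumes "open S" "x \<in> S" "\<And>y. y \<in> S \<Longrightarrow> f y = g y"
  shows "frechet_derivative f (at x) = frechet_derivative g (at x)"
proof -
  have "(f has_derivative f') (at x) \<longleftrightarrow> (g has_derivative f') (at x)" for f'
    using has_derivative_transform_within_open[of f f' x UNIV S g]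
      has_derivative_transform_within_open[of g f' x UNIV S f] assms by auto
  then show ?thesis by (simp add: frechet_derivative_def)
qed

lemma differentiable_cong_open:
  assumes "open S" "x \<in> S" "\<And>y. y \<in> S \<Longrightarrow> f y = g y" "f differentiable (at x)"
  shows "g differentiable (at x)"
  using assms(4) has_derivative_transform_within_open[of f _ x UNIV S g] assms(1-3)
  unfolding differentiable_def by blast

lemma C_diff_on_subset: "C_diff_on k S f \<Longrightarrow> T \<subseteq> S \<Longrightarrow> C_diff_on k T f"
  by (induction k arbitrary: f) (auto intro: continuous_on_subset)

lemma C_diff_on_cong:
  assumes "open S"
  shows "C_diff_on k S f \<Longrightarrow> (\<And>x. x \<in> S \<Longrightarrow> f x = g x) \<Longrightarrow> C_diff_on k S g"
proof (induction k arbitrary: f g)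
  case 0
  then show ?case using continuous_on_cong[of S S f g] by simp
next
  case (Suc k)
  have "C_diff_on k S (\<lambda>x. frechet_derivative g (at x) v)" for v
    using Suc.IH[of "\<lambda>x. frechet_derivative f (at x) v" "\<lambda>x. frechet_derivative g (at x) v"] Suc.prems
      frechet_derivative_cong_open[OF assms, of _ f g] by auto
  then show ?case using Suc.prems differentiable_cong_open[OF assms, of _ f g] by auto
qed

lemma C_diff_on_has_derivative:
  "C_diff_on (Suc k) S f \<Longrightarrow> x \<in> S \<Longrightarrow> (f has_derivative frechet_derivative f (at x)) (at x)"
  using frechet_derivative_works by auto

lemma C_diff_on_continuous: "C_diff_on k S f \<Longrightarrow> continuous_on S f"
  by (cases k) (auto intro: continuous_at_imp_continuous_on differentiable_imp_continuous_within)

lemma C_diff_on_SucD: "C_diff_on (Suc k) S f \<Longrightarrow> C_diff_on k S f"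
proof (induction k arbitrary: f)
  case 0
  then show ?case using C_diff_on_continuous[of "Suc 0"] by simp
qed auto

lemma C_diff_on_local:
  assumes "\<And>x. x \<in> S \<Longrightarrow> \<exists>T. open T \<and> x \<in> T \<and> C_diff_on k T f"
  shows "C_diff_on k S f"
  using assms
proof (induction k arbitrary: f)
  case 0
  then have "continuous_on S f"
    by (intro continuous_at_imp_continuous_on) (metis C_diff_on.simps(1) continuous_on_eq_continuous_at)
  then show ?case by simp
next
  case (Suc k)
  have "\<exists>T. open T \<and> x \<in> T \<and> C_diff_on k T (\<lambda>x. frechet_derivative f (at x) v)" if "x \<in> S" for x v
    using Suc.prems[OF that] by auto
  then show ?case using Suc.IH Suc.prems by fastforce
qed

lemma smooth_on_subset: "smooth_on S f \<Longrightarrow> T \<subseteq> S \<Longrightarrow> smooth_on T f"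
  unfolding smooth_on_def by (blast intro: C_diff_on_subset)

lemma smooth_on_cong:
  "open S \<Longrightarrow> smooth_on S f \<Longrightarrow> (\<And>x. x \<in> S \<Longrightarrow> f x = g x) \<Longrightarrow> smooth_on S g"
  using C_diff_on_cong[of S _ f g] by (simp add: smooth_on_def)

lemma smooth_on_local:
  "(\<And>x. x \<in> S \<Longrightarrow> \<exists>T. open T \<and> x \<in> T \<and> smooth_on T f) \<Longrightarrow> smooth_on S f"
  unfolding smooth_on_def by (intro allI C_diff_on_local) blast

lemma smooth_on_continuous: "smooth_on S f \<Longrightarrow> continuous_on S f"
  unfolding smooth_on_def by (drule spec[of _ 0]) simp

lemma smooth_on_differentiable: "smooth_on S f \<Longrightarrow> x \<in> S \<Longrightarrow> f differentiable (at x)"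
  unfolding smooth_on_def by (drule spec[of _ 1]) simp

lemma smooth_on_has_derivative:
  "smooth_on S f \<Longrightarrow> x \<in> S \<Longrightarrow> (f has_derivative frechet_derivative f (at x)) (at x)"
  using smooth_on_differentiable frechet_derivative_works by blast

lemma smooth_on_frechet_derivative:
  "smooth_on S f \<Longrightarrow> smooth_on S (\<lambda>x. frechet_derivative f (at x) v)"
  unfolding smooth_on_def by (rule allI) (metis C_diff_on.simps(2))

lemma smooth_on_linear_derivative:
  "smooth_on S f \<Longrightarrow> x \<in> S \<Longrightarrow> linear (frechet_derivative f (at x))"
  using linear_frechet_derivative smooth_on_differentiable by blast

lemma C_diff_on_const: "C_diff_on k S (\<lambda>_. c)"
  by (induction k arbitrary: c) (auto simp: frechet_derivative_const)

lemma smooth_on_const [simp]: "smooth_on S (\<lambda>_. c)"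
  by (simp add: smooth_on_def C_diff_on_const)

context
  fixes S :: "'e::real_normed_vector set"
  assumes op: "open S"
begin

lemma C_diff_on_bounded_linear:
  assumes "bounded_linear L"
  shows "C_diff_on k S f \<Longrightarrow> C_diff_on k S (\<lambda>x. L (f x))"
proof (induction k arbitrary: f)
  case 0
  then show ?case
    using bounded_linear.continuous_on[OF assms] by auto
next
  case (Suc k)
  have D: "((\<lambda>x. L (f x)) has_derivative (\<lambda>v. L (frechet_derivative f (at x) v))) (at x)" if "x \<in> S" for x
    by (rule bounded_linear.has_derivative[OF assms C_diff_on_has_derivative[OF Suc.prems that]])
  have "C_diff_on k S (\<lambda>x. frechet_derivative (\<lambda>x. L (f x)) (at x) v)" for v
  proof (rule C_diff_on_cong[OF op])
    show "C_diff_on k S (\<lambda>x. L (frechet_derivative f (at x) v))" using Suc by auto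
  qed (simp add: frechet_derivative_at[OF D, symmetric])
  then show ?case using D by (auto simp: differentiable_def)
qed

lemma C_diff_on_add:
  "C_diff_on k S f \<Longrightarrow> C_diff_on k S g \<Longrightarrow> C_diff_on k S (\<lambda>x. f x + g x)"
proof (induction k arbitrary: f g)
  case 0
  then show ?case by (auto intro: continuous_on_add)
next
  case (Suc k)
  have D: "((\<lambda>x. f x + g x) has_derivative
      (\<lambda>v. frechet_derivative f (at x) v + frechet_derivative g (at x) v)) (at x)" if "x \<in> S" for x
    by (rule has_derivative_add[OF Suc.prems(1,2)[THEN C_diff_on_has_derivative, OF that]])
  have "C_diff_on k S (\<lambda>x. frechet_derivative (\<lambda>x. f x + g x) (at x) v)" for v
  proof (rule C_diff_on_cong[OF op])
    show "C_diff_on k S (\<lambda>x. frechet_derivative f (at x) v + frechet_derivative g (at x) v)"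
      using Suc by auto
  qed (simp add: frechet_derivative_at[OF D, symmetric])
  then show ?case using D by (auto simp: differentiable_def)
qed

lemma C_diff_on_sum:
  "(\<And>i. i \<in> I \<Longrightarrow> C_diff_on k S (f i)) \<Longrightarrow> C_diff_on k S (\<lambda>x. \<Sum>i\<in>I. f i x)"
  by (induction I rule: infinite_finite_induct) (auto intro: C_diff_on_add C_diff_on_const)

lemma C_diff_on_bounded_bilinear:
  assumes "bounded_bilinear h"
  shows "C_diff_on k S f \<Longrightarrow> C_diff_on k S g \<Longrightarrow> C_diff_on k S (\<lambda>x. h (f x) (g x))"
proof (induction k arbitrary: f g)
  case 0
  then show ?case using bounded_bilinear.continuous_on[OF assms] by auto
next
  case (Suc k)
  have D: "((\<lambda>x. h (f x) (g x)) has_derivative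
      (\<lambda>v. h (f x) (frechet_derivative g (at x) v) + h (frechet_derivative f (at x) v) (g x))) (at x)"
    if "x \<in> S" for x
    by (rule bounded_bilinear.FDERIV[OF assms Suc.prems(1,2)[THEN C_diff_on_has_derivative, OF that]])
  have "C_diff_on k S (\<lambda>x. frechet_derivative (\<lambda>x. h (f x) (g x)) (at x) v)" for v
  proof (rule C_diff_on_cong[OF op])
    show "C_diff_on k S (\<lambda>x. h (f x) (frechet_derivative g (at x) v) + h (frechet_derivative f (at x) v) (g x))"
      using Suc.prems[THEN C_diff_on_SucD] Suc by (intro C_diff_on_add) auto
  qed (simp add: frechet_derivative_at[OF D, symmetric])
  then show ?case using D by (auto simp: differentiable_def)
qed

lemma C_diff_on_inverse:
  fixes f :: "'e \<Rightarrow> real"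
  assumes "\<And>x. x \<in> S \<Longrightarrow> f x \<noteq> 0"
  shows "C_diff_on k S f \<Longrightarrow> C_diff_on k S (\<lambda>x. inverse (f x))"
proof (induction k)
  case 0
  then show ?case using assms by (auto intro: continuous_on_inverse)
next
  case (Suc k)
  have D: "((\<lambda>x. inverse (f x)) has_derivative
      (\<lambda>v. - (inverse (f x) * frechet_derivative f (at x) v * inverse (f x)))) (at x)"
    if "x \<in> S" for x
    by (rule Deriv.has_derivative_inverse[OF assms[OF that] C_diff_on_has_derivative[OF Suc.prems that]])
  note mult = C_diff_on_bounded_bilinear[OF bounded_bilinear_mult]
  have "C_diff_on k S (\<lambda>x. frechet_derivative (\<lambda>x. inverse (f x)) (at x) v)" for v
  proof (rule C_diff_on_cong[OF op])
    show "C_diff_on k S (\<lambda>x. - (inverse (f x) * frechet_derivative f (at x) v * inverse (f x)))"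
      using Suc C_diff_on_SucD[of k S f]
      by (intro C_diff_on_bounded_linear[OF bounded_linear_minus[OF bounded_linear_ident]] mult) auto
  qed (simp add: frechet_derivative_at[OF D, symmetric])
  then show ?case using D by (auto simp: differentiable_def)
qed

lemma smooth_on_bounded_linear:
  "bounded_linear L \<Longrightarrow> smooth_on S f \<Longrightarrow> smooth_on S (\<lambda>x. L (f x))"
  by (simp add: smooth_on_def C_diff_on_bounded_linear)

lemma smooth_on_bounded_bilinear:
  "bounded_bilinear h \<Longrightarrow> smooth_on S f \<Longrightarrow> smooth_on S g \<Longrightarrow> smooth_on S (\<lambda>x. h (f x) (g x))"
  by (simp add: smooth_on_def C_diff_on_bounded_bilinear)

lemma smooth_on_add: "smooth_on S f \<Longrightarrow> smooth_on S g \<Longrightarrow> smooth_on S (\<lambda>x. f x + g x)"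
  by (simp add: smooth_on_def C_diff_on_add)

lemma smooth_on_minus: "smooth_on S f \<Longrightarrow> smooth_on S (\<lambda>x. - f x)"
  by (rule smooth_on_bounded_linear[OF bounded_linear_minus[OF bounded_linear_ident]])

lemma smooth_on_diff: "smooth_on S f \<Longrightarrow> smooth_on S g \<Longrightarrow> smooth_on S (\<lambda>x. f x - g x)"
  using smooth_on_add[of f "\<lambda>x. - g x"] smooth_on_minus[of g] by simp

lemma smooth_on_sum:
  "(\<And>i. i \<in> I \<Longrightarrow> smooth_on S (f i)) \<Longrightarrow> smooth_on S (\<lambda>x. \<Sum>i\<in>I. f i x)"
  by (induction I rule: infinite_finite_induct) (auto intro: smooth_on_add)

lemmas smooth_on_mult = smooth_on_bounded_bilinear[OF bounded_bilinear_mult]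
lemmas smooth_on_scaleR = smooth_on_bounded_bilinear[OF bounded_bilinear_scaleR]
lemmas smooth_on_inner = smooth_on_bounded_bilinear[OF bounded_bilinear_inner]

lemma smooth_on_inverse:
  fixes f :: "'e \<Rightarrow> real"
  shows "smooth_on S f \<Longrightarrow> (\<And>x. x \<in> S \<Longrightarrow> f x \<noteq> 0) \<Longrightarrow> smooth_on S (\<lambda>x. inverse (f x))"
  by (simp add: smooth_on_def C_diff_on_inverse)

lemma smooth_on_divide:
  fixes f g :: "'e \<Rightarrow> real"
  shows "smooth_on S f \<Longrightarrow> smooth_on S g \<Longrightarrow> (\<And>x. x \<in> S \<Longrightarrow> g x \<noteq> 0) \<Longrightarrow> smooth_on S (\<lambda>x. f x / g x)"
  unfolding divide_inverse by (intro smooth_on_mult smooth_on_inverse)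

lemma smooth_on_inner_const: "smooth_on S f \<Longrightarrow> smooth_on S (\<lambda>x. f x \<bullet> b)"
  by (intro smooth_on_inner smooth_on_const)

lemma smooth_on_componentwise:
  fixes f :: "'e \<Rightarrow> 'b::euclidean_space"
  assumes "\<And>b. b \<in> Basis \<Longrightarrow> smooth_on S (\<lambda>x. f x \<bullet> b)"
  shows "smooth_on S f"
proof (rule smooth_on_cong[OF op])
  show "smooth_on S (\<lambda>x. \<Sum>b\<in>Basis. (f x \<bullet> b) *\<^sub>R b)"
    using assms by (intro smooth_on_sum smooth_on_scaleR smooth_on_const)
qed (rule euclidean_representation)

text \<open>In the chain rule the derivative of \<open>g\<close> is applied to a moving vector.
  Expanding that vector in the basis leaves compositions of \<open>f\<close> with fixed partial
  derivatives of \<open>g\<close>, which are of one order less.\<close>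

lemma C_diff_on_compose:
  fixes f :: "'e \<Rightarrow> 'b::euclidean_space"
  assumes "smooth_on S f" "f ` S \<subseteq> T"
  shows "C_diff_on k T g \<Longrightarrow> C_diff_on k S (\<lambda>x. g (f x))"
proof (induction k arbitrary: g)
  case 0
  then show ?case
    using continuous_on_compose2[of T g S f] assms smooth_on_continuous by auto
next
  case (Suc k)
  have D: "((\<lambda>x. g (f x)) has_derivative
      (\<lambda>v. frechet_derivative g (at (f x)) (frechet_derivative f (at x) v))) (at x)" if "x \<in> S" for x
  proof -
    have "(g has_derivative frechet_derivative g (at (f x))) (at (f x))"
      using Suc.prems that assms(2) frechet_derivative_works by auto
    then show ?thesis
      using diff_chain_at[OF smooth_on_has_derivative[OF assms(1) that]] by (simp add: o_def)
  qed
  have "C_diff_on k S (\<lambda>x. frechet_derivative (\<lambda>x. g (f x)) (at x) v)" for v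
  proof (rule C_diff_on_cong[OF op])
    show "C_diff_on k S (\<lambda>x. \<Sum>b\<in>Basis. (frechet_derivative f (at x) v \<bullet> b) *\<^sub>R
        frechet_derivative g (at (f x)) b)"
      using Suc.prems smooth_on_inner_const[OF smooth_on_frechet_derivative[OF assms(1)]]
        Suc.IH[of "\<lambda>y. frechet_derivative g (at y) b" for b]
      by (intro C_diff_on_sum C_diff_on_bounded_bilinear[OF bounded_bilinear_scaleR]) (auto simp: smooth_on_def)
    show "(\<Sum>b\<in>Basis. (frechet_derivative f (at x) v \<bullet> b) *\<^sub>R frechet_derivative g (at (f x)) b)
        = frechet_derivative (\<lambda>x. g (f x)) (at x) v" if "x \<in> S" for x
    proof -
      have "linear (frechet_derivative g (at (f x)))"
        using Suc.prems that assms(2) by (intro linear_frechet_derivative) auto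
      then have "frechet_derivative g (at (f x)) (\<Sum>b\<in>Basis. (frechet_derivative f (at x) v \<bullet> b) *\<^sub>R b)
        = (\<Sum>b\<in>Basis. (frechet_derivative f (at x) v \<bullet> b) *\<^sub>R frechet_derivative g (at (f x)) b)"
        by (simp add: linear_sum linear_scale)
      then show ?thesis
        by (simp add: euclidean_representation frechet_derivative_at[OF D[OF that], symmetric])
    qed
  qed
  then show ?case using D by (auto simp: differentiable_def)
qed

lemma smooth_on_compose:
  fixes f :: "'e \<Rightarrow> 'b::euclidean_space"
  shows "smooth_on S f \<Longrightarrow> smooth_on T g \<Longrightarrow> f ` S \<subseteq> T \<Longrightarrow> smooth_on S (\<lambda>x. g (f x))"
  by (auto simp: smooth_on_def[of T] smooth_on_def[of S "\<lambda>x. g (f x)"] intro: C_diff_on_compose)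

lemma frechet_derivative_bounded_linear:
  assumes "bounded_linear L" "smooth_on S f" "x \<in> S"
  shows "frechet_derivative (\<lambda>x. L (f x)) (at x) v = L (frechet_derivative f (at x) v)"
  using frechet_derivative_at[OF bounded_linear.has_derivative[OF assms(1)
        smooth_on_has_derivative[OF assms(2,3)]], symmetric] by simp

lemma frechet_derivative_add:
  assumes "smooth_on S f" "smooth_on S g" "x \<in> S"
  shows "frechet_derivative (\<lambda>x. f x + g x) (at x) v =
    frechet_derivative f (at x) v + frechet_derivative g (at x) v"
  using frechet_derivative_at[OF has_derivative_add[OF smooth_on_has_derivative[OF assms(1,3)]
        smooth_on_has_derivative[OF assms(2,3)]], symmetric] by simp

lemma frechet_derivative_minus:
  assumes "smooth_on S f" "x \<in> S"
  shows "frechet_derivative (\<lambda>x. - f x) (at x) v = - frechet_derivative f (at x) v"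
  by (rule frechet_derivative_bounded_linear[OF bounded_linear_minus[OF bounded_linear_ident] assms])

lemma frechet_derivative_diff:
  assumes "smooth_on S f" "smooth_on S g" "x \<in> S"
  shows "frechet_derivative (\<lambda>x. f x - g x) (at x) v =
    frechet_derivative f (at x) v - frechet_derivative g (at x) v"
  using frechet_derivative_at[OF has_derivative_diff[OF smooth_on_has_derivative[OF assms(1,3)]
        smooth_on_has_derivative[OF assms(2,3)]], symmetric] by simp

lemma frechet_derivative_sum:
  assumes "\<And>i. i \<in> I \<Longrightarrow> smooth_on S (f i)" "x \<in> S"
  shows "frechet_derivative (\<lambda>x. \<Sum>i\<in>I. f i x) (at x) v = (\<Sum>i\<in>I. frechet_derivative (f i) (at x) v)"
  using frechet_derivative_at[OF has_derivative_sum[of I f "\<lambda>i. frechet_derivative (f i) (at x)" "at x"], symmetric]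
    smooth_on_has_derivative[OF assms] by simp

lemma frechet_derivative_bilinear:
  assumes "bounded_bilinear h" "smooth_on S f" "smooth_on S g" "x \<in> S"
  shows "frechet_derivative (\<lambda>x. h (f x) (g x)) (at x) v =
    h (f x) (frechet_derivative g (at x) v) + h (frechet_derivative f (at x) v) (g x)"
  using frechet_derivative_at[OF bounded_bilinear.FDERIV[OF assms(1)
      smooth_on_has_derivative[OF assms(2,4)] smooth_on_has_derivative[OF assms(3,4)]], symmetric]
  by simp

lemmas frechet_derivative_mult = frechet_derivative_bilinear[OF bounded_bilinear_mult]

lemma frechet_derivative_chain:
  fixes f :: "'e \<Rightarrow> 'b::real_normed_vector"
  assumes "smooth_on S f" "smooth_on T g" "f x \<in> T" "x \<in> S"
  shows "frechet_derivative (\<lambda>x. g (f x)) (at x) v =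
    frechet_derivative g (at (f x)) (frechet_derivative f (at x) v)"
  using frechet_derivative_at[OF diff_chain_at[OF smooth_on_has_derivative[OF assms(1,4)]
      smooth_on_has_derivative[OF assms(2,3)]], symmetric] by (simp add: o_def)

end

section \<open>Symmetry of second derivatives\<close>

lemma second_difference_mvt:
  fixes f :: "'e::euclidean_space \<Rightarrow> real"
  assumes f: "smooth_on S f" and op: "open S" and h: "0 < h"
    and S: "\<And>s t. 0 \<le> s \<Longrightarrow> s \<le> h \<Longrightarrow> 0 \<le> t \<Longrightarrow> t \<le> h \<Longrightarrow> x + s *\<^sub>R u + t *\<^sub>R v \<in> S"
  shows "\<exists>s t. 0 < s \<and> s < h \<and> 0 < t \<and> t < h \<and>
    f (x + h *\<^sub>R u + h *\<^sub>R v) - f (x + h *\<^sub>R u) - f (x + h *\<^sub>R v) + f x =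
    h * (h * frechet_derivative (\<lambda>y. frechet_derivative f (at y) u) (at (x + s *\<^sub>R u + t *\<^sub>R v)) v)"
proof -
  let ?u = "\<lambda>y. frechet_derivative f (at y) u"
  have line: "((\<lambda>s. g (p + s *\<^sub>R w)) has_real_derivative frechet_derivative g (at (p + s *\<^sub>R w)) w) (at s)"
    if g: "smooth_on S g" "p + s *\<^sub>R w \<in> S" for g :: "'e \<Rightarrow> real" and p s w
  proof -
    have "((\<lambda>s. p + s *\<^sub>R w) has_derivative (\<lambda>r. r *\<^sub>R w)) (at s)"
      by (auto intro!: derivative_eq_intros)
    from diff_chain_at[OF this smooth_on_has_derivative[OF g]]
    show ?thesis
      unfolding has_field_derivative_def o_def
      by (rule has_derivative_eq_rhs) (rule ext, simp add: linear_scale[OF smooth_on_linear_derivative[OF g]])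
  qed
  \<comment> \<open>The mean value theorem is applied in the parameter of \<open>u\<close> to the
    increment of \<open>f\<close> along \<open>h *\<^sub>R v\<close>; the second application runs
    along \<open>v\<close>.\<close>
  have "\<exists>z>0. z < h \<and> (f (x + h *\<^sub>R v + h *\<^sub>R u) - f (x + h *\<^sub>R u)) - (f (x + h *\<^sub>R v + 0 *\<^sub>R u) - f (x + 0 *\<^sub>R u))
      = (h - 0) * (?u (x + h *\<^sub>R v + z *\<^sub>R u) - ?u (x + z *\<^sub>R u))"
  proof (rule MVT2[OF h, of "\<lambda>s. f (x + h *\<^sub>R v + s *\<^sub>R u) - f (x + s *\<^sub>R u)"])
    fix s assume "0 \<le> s" "s \<le> h"
    then have "x + h *\<^sub>R v + s *\<^sub>R u \<in> S" "x + s *\<^sub>R u \<in> S"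
      using S[of s h] S[of s 0] h by (simp_all add: algebra_simps)
    then show "((\<lambda>s. f (x + h *\<^sub>R v + s *\<^sub>R u) - f (x + s *\<^sub>R u)) has_real_derivative
       (?u (x + h *\<^sub>R v + s *\<^sub>R u) - ?u (x + s *\<^sub>R u))) (at s)"
      by (intro DERIV_diff line f)
  qed
  then obtain s where s: "0 < s" "s < h" and e1:
    "f (x + h *\<^sub>R v + h *\<^sub>R u) - f (x + h *\<^sub>R u) - f (x + h *\<^sub>R v) + f x
      = h * (?u (x + h *\<^sub>R v + s *\<^sub>R u) - ?u (x + s *\<^sub>R u))" by auto
  have "\<exists>z>0. z < h \<and> ?u (x + s *\<^sub>R u + h *\<^sub>R v) - ?u (x + s *\<^sub>R u + 0 *\<^sub>R v)
      = (h - 0) * frechet_derivative ?u (at (x + s *\<^sub>R u + z *\<^sub>R v)) v"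
  proof (rule MVT2[OF h, of "\<lambda>t. ?u (x + s *\<^sub>R u + t *\<^sub>R v)"])
    fix t assume "0 \<le> t" "t \<le> h"
    then show "((\<lambda>t. ?u (x + s *\<^sub>R u + t *\<^sub>R v)) has_real_derivative
       frechet_derivative ?u (at (x + s *\<^sub>R u + t *\<^sub>R v)) v) (at t)"
      using S[of s t] s by (intro line smooth_on_frechet_derivative f) auto
  qed
  then obtain t where t: "0 < t" "t < h" and e2:
    "?u (x + s *\<^sub>R u + h *\<^sub>R v) - ?u (x + s *\<^sub>R u) = h * frechet_derivative ?u (at (x + s *\<^sub>R u + t *\<^sub>R v)) v"
    by auto
  show ?thesis
    using s t e1 e2 by (intro exI[of _ s] exI[of _ t]) (simp add: algebra_simps)
qed

text \<open>The second difference does not depend on the order of \<open>u\<close> and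
  \<open>v\<close>, so the two mixed derivatives agree at two points of a small parallelogram at
  \<open>x\<close>. By continuity they cannot differ at \<open>x\<close>.\<close>

lemma second_derivative_symmetric:
  fixes f :: "'e::euclidean_space \<Rightarrow> real"
  assumes f: "smooth_on S f" and op: "open S" and x: "x \<in> S"
  shows "frechet_derivative (\<lambda>y. frechet_derivative f (at y) u) (at x) v =
         frechet_derivative (\<lambda>y. frechet_derivative f (at y) v) (at x) u"
proof (rule ccontr)
  let ?P = "\<lambda>u v y. frechet_derivative (\<lambda>y. frechet_derivative f (at y) u) (at y) v"
  assume ne: "?P u v x \<noteq> ?P v u x"
  \<comment> \<open>Half the gap: two values within \<open>e\<close> of the two limits cannot
    coincide.\<close>
  define e where "e = \<bar>?P u v x - ?P v u x\<bar> / 2"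
  have e: "0 < e" using ne by (simp add: e_def)
  have cont: "continuous_on S (?P a b)" for a b
    by (intro smooth_on_continuous smooth_on_frechet_derivative f)
  have near: "\<exists>d>0. \<forall>y. dist y x < d \<longrightarrow> y \<in> S \<and> dist (?P a b y) (?P a b x) < e" for a b
  proof -
    obtain d1 where "0 < d1" "\<forall>y\<in>S. dist y x < d1 \<longrightarrow> dist (?P a b y) (?P a b x) < e"
      using cont[of a b] x e unfolding continuous_on_iff by blast
    moreover obtain d2 where "0 < d2" "ball x d2 \<subseteq> S" using op x openE by blast
    ultimately show ?thesis
      by (intro exI[of _ "min d1 d2"]) (auto simp: subset_eq dist_commute)
  qed
  obtain d1 where d1: "0 < d1" "\<And>y. dist y x < d1 \<Longrightarrow> y \<in> S \<and> dist (?P u v y) (?P u v x) < e"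
    using near by blast
  obtain d2 where d2: "0 < d2" "\<And>y. dist y x < d2 \<Longrightarrow> y \<in> S \<and> dist (?P v u y) (?P v u x) < e"
    using near by blast
  define d where "d = min d1 d2"
  \<comment> \<open>Small enough for the parallelogram with sides along \<open>u\<close> and
    \<open>v\<close> to stay within distance \<open>d\<close> of \<open>x\<close>; the summand 1
    keeps the denominator positive when both vectors vanish.\<close>
  define h where "h = d / (2 * (norm u + norm v + 1))"
  have pos: "0 < norm u + norm v + 1" by (simp add: add_nonneg_pos)
  have h: "0 < h" using d1(1) d2(1) pos by (simp add: h_def d_def)
  have dist: "dist (x + s *\<^sub>R u + t *\<^sub>R v) x < d" if "0 \<le> s" "s \<le> h" "0 \<le> t" "t \<le> h" for s t
  proof -
    have "norm (s *\<^sub>R u + t *\<^sub>R v) \<le> s * norm u + t * norm v"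
      using that norm_triangle_ineq[of "s *\<^sub>R u" "t *\<^sub>R v"] by simp
    also have "\<dots> \<le> h * norm u + h * norm v" using that by (intro add_mono mult_right_mono) auto
    also have "\<dots> < 2 * (h * (norm u + norm v + 1))"
      using h mult_nonneg_nonneg[of h "norm u"] mult_nonneg_nonneg[of h "norm v"]
      by (simp add: distrib_left add_nonneg_pos)
    also have "\<dots> = d" using pos by (simp add: h_def field_simps)
    finally show ?thesis by (simp add: dist_norm add.assoc)
  qed
  have S: "x + s *\<^sub>R u + t *\<^sub>R v \<in> S" if "0 \<le> s" "s \<le> h" "0 \<le> t" "t \<le> h" for s t
    using dist[OF that] d1 by (simp add: d_def)
  obtain s t where st: "0 < s" "s < h" "0 < t" "t < h" and
    e1: "f (x + h *\<^sub>R u + h *\<^sub>R v) - f (x + h *\<^sub>R u) - f (x + h *\<^sub>R v) + f x = h * (h * ?P u v (x + s *\<^sub>R u + t *\<^sub>R v))"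
    using second_difference_mvt[OF f op h S] by blast
  have S': "x + s *\<^sub>R v + t *\<^sub>R u \<in> S" if "0 \<le> s" "s \<le> h" "0 \<le> t" "t \<le> h" for s t
    using S[of t s] that by (simp add: algebra_simps)
  obtain s' t' where st': "0 < s'" "s' < h" "0 < t'" "t' < h" and
    e2: "f (x + h *\<^sub>R v + h *\<^sub>R u) - f (x + h *\<^sub>R v) - f (x + h *\<^sub>R u) + f x = h * (h * ?P v u (x + s' *\<^sub>R v + t' *\<^sub>R u))"
    using second_difference_mvt[OF f op h S'] by blast
  have "h * (h * ?P u v (x + s *\<^sub>R u + t *\<^sub>R v)) = h * (h * ?P v u (x + t' *\<^sub>R u + s' *\<^sub>R v))"
    using e1 e2 by (simp add: algebra_simps)
  then have "?P u v (x + s *\<^sub>R u + t *\<^sub>R v) = ?P v u (x + t' *\<^sub>R u + s' *\<^sub>R v)" using h by simp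
  moreover have "dist (?P u v (x + s *\<^sub>R u + t *\<^sub>R v)) (?P u v x) < e"
    using d1(2) dist[of s t] st by (simp add: d_def)
  moreover have "dist (?P v u (x + t' *\<^sub>R u + s' *\<^sub>R v)) (?P v u x) < e"
    using d2(2) dist[of t' s'] st' by (simp add: d_def)
  ultimately show False by (simp add: e_def dist_real_def abs_if split: if_splits)
qed

text \<open>Gaussian elimination: a pivot stays nonzero nearby.\<close>

lemma smooth_linear_solution:
  fixes a :: "'j \<Rightarrow> 'i \<Rightarrow> 'e::euclidean_space \<Rightarrow> real"
  assumes "finite I" "open S" "x0 \<in> S"
    and "\<And>j i. j \<in> J \<Longrightarrow> i \<in> I \<Longrightarrow> smooth_on S (a j i)" "\<And>j. j \<in> J \<Longrightarrow> smooth_on S (b j)"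
    and "\<And>y j. y \<in> S \<Longrightarrow> j \<in> J \<Longrightarrow> (\<Sum>i\<in>I. a j i y * t i y) = b j y"
    and "\<And>s i. (\<forall>j\<in>J. (\<Sum>i\<in>I. a j i x0 * s i) = 0) \<Longrightarrow> i \<in> I \<Longrightarrow> s i = 0"
  shows "\<exists>S'. open S' \<and> x0 \<in> S' \<and> S' \<subseteq> S \<and> (\<forall>i\<in>I. smooth_on S' (t i))"
  using assms
proof (induction I arbitrary: S a b rule: finite_induct)
  case empty
  then show ?case by blast
next
  case (insert k I)
  have "\<exists>j\<in>J. a j k x0 \<noteq> 0"
  proof (rule ccontr)
    assume "\<not> ?thesis"
    \<comment> \<open>Without a pivot in column \<open>k\<close>, the unit vector at
      \<open>k\<close> would be a nontrivial solution of the homogeneous system at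
      \<open>x0\<close>.\<close>
    then have "\<forall>j\<in>J. (\<Sum>i\<in>insert k I. a j i x0 * (if i = k then 1 else 0)) = 0" by (auto intro!: sum.neutral)
    from insert.prems(6)[OF this, of k] show False by simp
  qed
  then obtain l where l: "l \<in> J" "a l k x0 \<noteq> 0" by blast
  have ca: "continuous_on S (a l k)" using insert.prems(3) l smooth_on_continuous by blast
  define T where "T = {y \<in> S. a l k y \<noteq> 0}"
  have "T = S \<inter> a l k -` (- {0})" by (auto simp: T_def)
  then have T: "open T" "x0 \<in> T" "T \<subseteq> S"
    using continuous_on_open_vimage[OF insert.prems(1), of "a l k"] ca l insert.prems(2)
    by (auto simp: T_def Int_commute)
  have nz: "a l k y \<noteq> 0" if "y \<in> T" for y using that by (simp add: T_def)
  \<comment> \<open>Coefficients after the unknown \<open>k\<close> has been eliminated by means of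
    row \<open>l\<close>.\<close>
  define a' where "a' = (\<lambda>j i y. a j i y - a j k y * a l i y / a l k y)"
  define b' where "b' = (\<lambda>j y. b j y - a j k y * b l y / a l k y)"
  have sa: "smooth_on T (a j i)" if "j \<in> J" "i \<in> insert k I" for i j
    using insert.prems(3)[OF that] T smooth_on_subset by blast
  have sb: "smooth_on T (b j)" if "j \<in> J" for j
    using insert.prems(4)[OF that] T smooth_on_subset by blast
  have "\<exists>S'. open S' \<and> x0 \<in> S' \<and> S' \<subseteq> T \<and> (\<forall>i\<in>I. smooth_on S' (t i))"
  proof (rule insert.IH[OF T(1,2)])
    show "smooth_on T (a' j i)" if "j \<in> J" "i \<in> I" for j i
      unfolding a'_def using that l sa nz T
      by (intro smooth_on_diff smooth_on_divide smooth_on_mult) auto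
    show "smooth_on T (b' j)" if "j \<in> J" for j
      unfolding b'_def using that l sa sb nz T
      by (intro smooth_on_diff smooth_on_divide smooth_on_mult) auto
    show "(\<Sum>i\<in>I. a' j i y * t i y) = b' j y" if y: "y \<in> T" "j \<in> J" for y j
    proof -
      have 1: "a j k y * t k y + (\<Sum>i\<in>I. a j i y * t i y) = b j y"
        and 2: "a l k y * t k y + (\<Sum>i\<in>I. a l i y * t i y) = b l y"
        using insert.prems(5)[of y j] insert.prems(5)[of y l] insert.hyps y l T by auto
      have A: "(\<Sum>i\<in>I. a j i y * t i y) = b j y - a j k y * t k y" using 1 by linarith
      have B: "(\<Sum>i\<in>I. a l i y * t i y) = b l y - a l k y * t k y" using 2 by linarith
      have "(\<Sum>i\<in>I. a' j i y * t i y) = (\<Sum>i\<in>I. a j i y * t i y) - a j k y / a l k y * (\<Sum>i\<in>I. a l i y * t i y)"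
        by (simp add: a'_def sum_subtractf sum_distrib_left algebra_simps)
      also have "\<dots> = (b j y - a j k y * t k y) - a j k y / a l k y * (b l y - a l k y * t k y)"
        unfolding A B ..
      also have "\<dots> = b' j y" using nz[OF y(1)] by (simp add: b'_def field_simps)
      finally show ?thesis .
    qed
    show "s i = 0" if s: "\<forall>j\<in>J. (\<Sum>i\<in>I. a' j i x0 * s i) = 0" and i: "i \<in> I" for s i
    proof -
      \<comment> \<open>The value at \<open>k\<close> is forced by row \<open>l\<close>, so a
        homogeneous solution of the reduced system extends to one of the full system.\<close>
      define s' where "s' = s(k := - (\<Sum>i\<in>I. a l i x0 * s i) / a l k x0)"
      have eqs: "(\<Sum>i\<in>I. a j i x0 * s' i) = (\<Sum>i\<in>I. a j i x0 * s i)" for j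
        using insert.hyps by (intro sum.cong) (auto simp: s'_def)
      have "(\<Sum>i\<in>insert k I. a j i x0 * s' i) = 0" if "j \<in> J" for j
      proof -
        have "(\<Sum>i\<in>I. a' j i x0 * s i) = (\<Sum>i\<in>I. a j i x0 * s i) - a j k x0 / a l k x0 * (\<Sum>i\<in>I. a l i x0 * s i)"
          by (simp add: a'_def sum_subtractf sum_distrib_left algebra_simps)
        then show ?thesis using s that insert.hyps by (simp add: eqs) (simp add: s'_def)
      qed
      then have "s' i = 0" using insert.prems(6)[of s' i] i by auto
      then show ?thesis using i insert.hyps by (auto simp: s'_def split: if_splits)
    qed
  qed
  then obtain S' where S': "open S'" "x0 \<in> S'" "S' \<subseteq> T" "\<forall>i\<in>I. smooth_on S' (t i)" by blast
  have sub: "smooth_on S' f" if "smooth_on T f" for f :: "'e \<Rightarrow> real" using smooth_on_subset that S' by blast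
  have "smooth_on S' (\<lambda>y. (b l y - (\<Sum>i\<in>I. a l i y * t i y)) / a l k y)"
  proof (intro smooth_on_diff smooth_on_divide smooth_on_mult smooth_on_sum S')
    show "smooth_on S' (b l)" "smooth_on S' (a l k)" using sub sa sb l by auto
    show "smooth_on S' (a l i)" "smooth_on S' (t i)" if "i \<in> I" for i using sub sa l that S' by auto
    show "a l k y \<noteq> 0" if "y \<in> S'" for y using nz that S' by auto
  qed
  then have "smooth_on S' (t k)"
  proof (rule smooth_on_cong[OF S'(1)])
    fix y assume "y \<in> S'"
    then have y: "y \<in> T" using S' by auto
    have "a l k y * t k y + (\<Sum>i\<in>I. a l i y * t i y) = b l y"
      using insert.prems(5)[of y l] insert.hyps y l T by auto
    then show "(b l y - (\<Sum>i\<in>I. a l i y * t i y)) / a l k y = t k y"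
      using nz[OF y] by (auto simp: field_simps)
  qed
  then show ?case using S' T by (intro exI[of _ S']) auto
qed

declare plus_fun_apply [simp del] minus_apply [simp del] uminus_apply [simp del]
  scaleR_fun_apply [simp del]

lemmas fun_simps = plus_fun_apply minus_apply uminus_apply scaleR_fun_apply sum_fun_apply

section \<open>Smooth fields of forms\<close>

definition smooth_field :: "'e::euclidean_space set \<Rightarrow> ('e \<Rightarrow> 'd list \<Rightarrow> real) \<Rightarrow> bool" where
  "smooth_field S \<alpha> \<longleftrightarrow> (\<forall>vs. smooth_on S (\<lambda>y. \<alpha> y vs))"

definition dir_deriv :: "'e::euclidean_space \<Rightarrow> ('e \<Rightarrow> 'd list \<Rightarrow> real) \<Rightarrow> 'e \<Rightarrow> 'd list \<Rightarrow> real" where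
  "dir_deriv v \<alpha> x = (\<lambda>vs. frechet_derivative (\<lambda>y. \<alpha> y vs) (at x) v)"

lemma smooth_fieldD: "smooth_field S \<alpha> \<Longrightarrow> smooth_on S (\<lambda>y. \<alpha> y vs)"
  by (simp add: smooth_field_def)

lemma smooth_field_subset: "smooth_field S \<alpha> \<Longrightarrow> T \<subseteq> S \<Longrightarrow> smooth_field T \<alpha>"
  unfolding smooth_field_def by (blast intro: smooth_on_subset)

lemma smooth_field_contract: "smooth_field S \<alpha> \<Longrightarrow> smooth_field S (\<lambda>y. contract v (\<alpha> y))"
  by (simp add: smooth_field_def contract_def)

lemma smooth_field_const [simp]: "smooth_field S (\<lambda>_. \<alpha>)"
  by (simp add: smooth_field_def)

lemma contract_dir_deriv: "contract w (dir_deriv v \<alpha> x) = dir_deriv v (\<lambda>y. contract w (\<alpha> y)) x"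
  by (rule ext) (simp add: contract_def dir_deriv_def)

lemma ext_deriv_Nil [simp]: "ext_deriv \<alpha> x [] = 0"
  by (simp add: ext_deriv_def)

lemma ext_deriv_Cons:
  "ext_deriv \<alpha> x (v # vs) = dir_deriv v \<alpha> x vs - ext_deriv (\<lambda>y. contract v (\<alpha> y)) x vs"
  by (simp add: ext_deriv_def lessThan_Suc_eq_insert_0 sum.reindex zero_notin_Suc_image
      dir_deriv_def contract_apply sum_negf del: sum.lessThan_Suc)

text \<open>Cartan's formula for a constant vector field; it lets properties of the exterior derivative
  be proved by induction on the list of arguments.\<close>

lemma contract_ext_deriv:
  "contract v (ext_deriv \<alpha> x) = dir_deriv v \<alpha> x - ext_deriv (\<lambda>y. contract v (\<alpha> y)) x"
  by (rule ext) (simp add: contract_apply ext_deriv_Cons fun_simps)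

context
  fixes S :: "'e::euclidean_space set"
  assumes op: "open S"
begin

lemma smooth_field_cong:
  "smooth_field S \<alpha> \<Longrightarrow> (\<And>y. y \<in> S \<Longrightarrow> \<alpha> y = \<beta> y) \<Longrightarrow> smooth_field S \<beta>"
  unfolding smooth_field_def by (auto intro: smooth_on_cong[OF op])

lemma smooth_field_add: "smooth_field S \<alpha> \<Longrightarrow> smooth_field S \<beta> \<Longrightarrow> smooth_field S (\<lambda>y. \<alpha> y + \<beta> y)"
  unfolding smooth_field_def fun_simps by (auto intro: smooth_on_add[OF op])

lemma smooth_field_scaleR:
  "smooth_on S f \<Longrightarrow> smooth_field S \<alpha> \<Longrightarrow> smooth_field S (\<lambda>y. f y *\<^sub>R \<alpha> y)"
  unfolding smooth_field_def fun_simps real_scaleR_def by (auto intro: smooth_on_mult[OF op])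

lemma smooth_field_sum:
  "(\<And>i. i \<in> I \<Longrightarrow> smooth_field S (\<alpha> i)) \<Longrightarrow> smooth_field S (\<lambda>y. \<Sum>i\<in>I. \<alpha> i y)"
  unfolding smooth_field_def sum_fun_apply by (auto intro: smooth_on_sum[OF op])

lemma smooth_field_parity: "smooth_field S \<alpha> \<Longrightarrow> smooth_field S (\<lambda>y. parity (\<alpha> y))"
  unfolding smooth_field_def parity_def by (auto intro: smooth_on_mult[OF op])

lemma smooth_field_scalar: "smooth_on S f \<Longrightarrow> smooth_field S (\<lambda>y. scalar_form (f y))"
  unfolding smooth_field_def
proof
  fix vs :: "'d list"
  assume "smooth_on S f"
  then show "smooth_on S (\<lambda>y. scalar_form (f y) vs)" by (cases "vs = []") (simp_all add: scalar_form_def)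
qed

lemma smooth_field_wedge:
  assumes "smooth_field S \<alpha>" "smooth_field S \<beta>"
  shows "smooth_field S (\<lambda>y. wedge_alt (\<alpha> y) (\<beta> y))"
  unfolding smooth_field_def
proof
  fix vs
  show "smooth_on S (\<lambda>y. wedge_alt (\<alpha> y) (\<beta> y) vs)"
    using assms
  proof (induction vs arbitrary: \<alpha> \<beta>)
    case Nil
    then show ?case by (simp add: smooth_on_mult[OF op] smooth_fieldD)
  next
    case (Cons v vs)
    show ?case unfolding wedge_alt_Cons
      using Cons.prems by (intro smooth_on_add[OF op] Cons.IH smooth_field_contract smooth_field_parity)
  qed
qed

lemma smooth_field_dir_deriv: "smooth_field S \<alpha> \<Longrightarrow> smooth_field S (dir_deriv v \<alpha>)"
  unfolding smooth_field_def dir_deriv_def by (auto intro: smooth_on_frechet_derivative)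

lemma smooth_field_ext_deriv: "smooth_field S \<alpha> \<Longrightarrow> smooth_field S (ext_deriv \<alpha>)"
  unfolding smooth_field_def ext_deriv_def
  by (intro allI smooth_on_sum[OF op] smooth_on_mult[OF op] smooth_on_const smooth_on_frechet_derivative) simp

context
  fixes x assumes x: "x \<in> S"
begin

lemma ext_deriv_cong: "(\<And>y. y \<in> S \<Longrightarrow> \<alpha> y = \<beta> y) \<Longrightarrow> ext_deriv \<alpha> x = ext_deriv \<beta> x"
  unfolding ext_deriv_def
  by (intro ext sum.cong refl, subst frechet_derivative_cong_open[OF op x, of _ "\<lambda>y. \<beta> y _"]) auto

lemma dir_deriv_linear:
  assumes "smooth_field S \<alpha>" "smooth_field S \<beta>"
  shows "dir_deriv v (\<lambda>y. \<alpha> y + \<beta> y) x = dir_deriv v \<alpha> x + dir_deriv v \<beta> x"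
    and "dir_deriv v (\<lambda>y. \<alpha> y - \<beta> y) x = dir_deriv v \<alpha> x - dir_deriv v \<beta> x"
    and "dir_deriv v (\<lambda>y. - \<alpha> y) x = - dir_deriv v \<alpha> x"
  using frechet_derivative_add[OF op assms[THEN smooth_fieldD] x]
    frechet_derivative_diff[OF op assms[THEN smooth_fieldD] x]
    frechet_derivative_minus[OF op assms(1)[THEN smooth_fieldD] x]
  by (simp_all add: dir_deriv_def fun_eq_iff fun_simps)

lemma dir_deriv_parity:
  assumes "smooth_field S \<alpha>"
  shows "dir_deriv v (\<lambda>y. parity (\<alpha> y)) x = parity (dir_deriv v \<alpha> x)"
  using frechet_derivative_mult[OF op smooth_on_const smooth_fieldD[OF assms] x]
  by (simp add: dir_deriv_def parity_def fun_eq_iff fun_simps)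

lemma dir_deriv_wedge:
  assumes "smooth_field S \<alpha>" "smooth_field S \<beta>"
  shows "dir_deriv v (\<lambda>y. wedge_alt (\<alpha> y) (\<beta> y)) x =
    wedge_alt (dir_deriv v \<alpha> x) (\<beta> x) + wedge_alt (\<alpha> x) (dir_deriv v \<beta> x)"
proof
  fix vs
  show "dir_deriv v (\<lambda>y. wedge_alt (\<alpha> y) (\<beta> y)) x vs =
    (wedge_alt (dir_deriv v \<alpha> x) (\<beta> x) + wedge_alt (\<alpha> x) (dir_deriv v \<beta> x)) vs"
    using assms
  proof (induction vs arbitrary: \<alpha> \<beta>)
    case Nil
    then show ?case
      using frechet_derivative_mult[OF op Nil[THEN smooth_fieldD] x] by (simp add: dir_deriv_def fun_simps)
  next
    case (Cons w vs)
    note sm = Cons.prems smooth_field_contract[OF Cons.prems(1)] smooth_field_contract[OF Cons.prems(2)]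
      smooth_field_parity[OF Cons.prems(1)]
    have "dir_deriv v (\<lambda>y. wedge_alt (\<alpha> y) (\<beta> y)) x (w # vs) =
      dir_deriv v (\<lambda>y. wedge_alt (contract w (\<alpha> y)) (\<beta> y) + wedge_alt (parity (\<alpha> y)) (contract w (\<beta> y))) x vs"
      by (simp add: dir_deriv_def wedge_alt_Cons fun_simps)
    also have "\<dots> = dir_deriv v (\<lambda>y. wedge_alt (contract w (\<alpha> y)) (\<beta> y)) x vs
      + dir_deriv v (\<lambda>y. wedge_alt (parity (\<alpha> y)) (contract w (\<beta> y))) x vs"
      by (subst dir_deriv_linear(1)) (auto intro: smooth_field_wedge sm simp: fun_simps)
    also have "\<dots> = (wedge_alt (dir_deriv v \<alpha> x) (\<beta> x) + wedge_alt (\<alpha> x) (dir_deriv v \<beta> x)) (w # vs)"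
      by (simp add: Cons.IH sm wedge_alt_Cons dir_deriv_parity contract_dir_deriv fun_simps)
    finally show ?case .
  qed
qed

lemma dir_deriv_commute:
  assumes "smooth_field S \<alpha>"
  shows "dir_deriv v (dir_deriv w \<alpha>) x = dir_deriv w (dir_deriv v \<alpha>) x"
  using second_derivative_symmetric[OF smooth_fieldD[OF assms] op x]
  by (simp add: dir_deriv_def fun_eq_iff fun_simps)

lemma ext_deriv_linear:
  assumes "smooth_field S \<alpha>" "smooth_field S \<beta>"
  shows "ext_deriv (\<lambda>y. \<alpha> y + \<beta> y) x = ext_deriv \<alpha> x + ext_deriv \<beta> x"
    and "ext_deriv (\<lambda>y. \<alpha> y - \<beta> y) x = ext_deriv \<alpha> x - ext_deriv \<beta> x"
    and "ext_deriv (\<lambda>y. - \<alpha> y) x = - ext_deriv \<alpha> x"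
    and "ext_deriv (\<lambda>y. r *\<^sub>R \<alpha> y) x = r *\<^sub>R ext_deriv \<alpha> x"
  by (simp_all add: ext_deriv_def fun_eq_iff fun_simps
      frechet_derivative_add[OF op assms[THEN smooth_fieldD] x]
      frechet_derivative_diff[OF op assms[THEN smooth_fieldD] x]
      frechet_derivative_minus[OF op assms(1)[THEN smooth_fieldD] x]
      frechet_derivative_mult[OF op smooth_on_const smooth_fieldD[OF assms(1)] x]
      frechet_derivative_const
      distrib_left right_diff_distrib sum.distrib sum_subtractf sum_negf sum_distrib_left mult.left_commute)

lemma ext_deriv_sum:
  assumes "\<And>i. i \<in> I \<Longrightarrow> smooth_field S (\<alpha> i)"
  shows "ext_deriv (\<lambda>y. \<Sum>i\<in>I. \<alpha> i y) x = (\<Sum>i\<in>I. ext_deriv (\<alpha> i) x)"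
  using assms
proof (induction I rule: infinite_finite_induct)
  case (insert i I)
  then show ?case by (simp add: ext_deriv_linear(1) smooth_field_sum)
qed (auto simp: ext_deriv_def fun_eq_iff frechet_derivative_const)

lemma ext_deriv_parity:
  assumes "smooth_field S \<alpha>"
  shows "ext_deriv (\<lambda>y. parity (\<alpha> y)) x = - parity (ext_deriv \<alpha> x)"
proof
  fix vs
  show "ext_deriv (\<lambda>y. parity (\<alpha> y)) x vs = (- parity (ext_deriv \<alpha> x)) vs"
    using assms
  proof (induction vs arbitrary: \<alpha>)
    case Nil
    then show ?case by (simp add: fun_simps) (simp add: parity_apply)
  next
    case (Cons v vs)
    have IH: "ext_deriv (\<lambda>y. parity (contract v (\<alpha> y))) x vs = - parity (ext_deriv (\<lambda>y. contract v (\<alpha> y)) x) vs"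
      using Cons.IH[OF smooth_field_contract[OF Cons.prems]] by (simp add: fun_simps)
    have "ext_deriv (\<lambda>y. parity (\<alpha> y)) x (v # vs)
      = parity (dir_deriv v \<alpha> x) vs + ext_deriv (\<lambda>y. parity (contract v (\<alpha> y))) x vs"
      using Cons.prems
      by (simp add: ext_deriv_Cons dir_deriv_parity ext_deriv_linear(3) smooth_field_parity smooth_field_contract)
        (simp add: fun_simps)
    also have "\<dots> = parity (contract v (ext_deriv \<alpha> x)) vs"
      by (simp add: IH contract_ext_deriv) (simp add: fun_simps)
    finally show ?case by (simp add: parity_def contract_def fun_simps)
  qed
qed

lemma ext_deriv_wedge:
  assumes "smooth_field S \<alpha>" "smooth_field S \<beta>"
  shows "ext_deriv (\<lambda>y. wedge_alt (\<alpha> y) (\<beta> y)) x =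
    wedge_alt (ext_deriv \<alpha> x) (\<beta> x) + wedge_alt (parity (\<alpha> x)) (ext_deriv \<beta> x)"
proof
  fix vs
  show "ext_deriv (\<lambda>y. wedge_alt (\<alpha> y) (\<beta> y)) x vs =
    (wedge_alt (ext_deriv \<alpha> x) (\<beta> x) + wedge_alt (parity (\<alpha> x)) (ext_deriv \<beta> x)) vs"
    using assms
  proof (induction vs arbitrary: \<alpha> \<beta>)
    case Nil
    then show ?case by (simp add: fun_simps)
  next
    case (Cons v vs)
    note sm = Cons.prems smooth_field_contract[OF Cons.prems(1)] smooth_field_contract[OF Cons.prems(2)]
      smooth_field_parity[OF Cons.prems(1)]
    have "ext_deriv (\<lambda>y. contract v (wedge_alt (\<alpha> y) (\<beta> y))) x vs =
      (wedge_alt (ext_deriv (\<lambda>y. contract v (\<alpha> y)) x) (\<beta> x)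
       + wedge_alt (parity (contract v (\<alpha> x))) (ext_deriv \<beta> x)
       - wedge_alt (parity (ext_deriv \<alpha> x)) (contract v (\<beta> x))
       + wedge_alt (\<alpha> x) (ext_deriv (\<lambda>y. contract v (\<beta> y)) x)) vs"
      unfolding contract_wedge
      by (subst ext_deriv_linear(1))
        (auto intro!: smooth_field_wedge sm simp: plus_fun_apply[of _ _ vs] minus_apply[of _ _ vs] uminus_apply[of _ vs]
          Cons.IH sm ext_deriv_parity wedge_alt_linear)
    then show ?case
      by (simp add: ext_deriv_Cons dir_deriv_wedge sm wedge_alt_Cons contract_ext_deriv wedge_alt_linear)
        (simp add: fun_simps wedge_alt_Cons contract_ext_deriv wedge_alt_linear)
  qed
qed

lemma ext_deriv_scaleR:
  assumes "smooth_on S f" "smooth_field S \<alpha>"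
  shows "ext_deriv (\<lambda>y. f y *\<^sub>R \<alpha> y) x =
    f x *\<^sub>R ext_deriv \<alpha> x + wedge_alt (ext_deriv (\<lambda>y. scalar_form (f y)) x) (\<alpha> x)"
  using ext_deriv_wedge[OF smooth_field_scalar[OF assms(1)] assms(2)] by (simp add: algebra_simps)

end

lemma ext_deriv_ext_deriv:
  assumes "smooth_field S \<alpha>" "x \<in> S"
  shows "ext_deriv (ext_deriv \<alpha>) x = 0"
proof
  fix vs
  show "ext_deriv (ext_deriv \<alpha>) x vs = 0 vs"
    using assms
  proof (induction vs arbitrary: \<alpha>)
    case Nil
    then show ?case by simp
  next
    case (Cons v vs)
    note sm = Cons.prems(1) smooth_field_contract[OF Cons.prems(1)]
    \<comment> \<open>Differentiation along a constant vector commutes with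
      \<open>ext_deriv\<close>. This is where the symmetry of second derivatives enters; with it the
      two middle terms of Cartan's formula applied twice cancel.\<close>
    have *: "dir_deriv v (ext_deriv \<alpha>) x us = ext_deriv (dir_deriv v \<alpha>) x us" for us
      using sm(1)
    proof (induction us arbitrary: \<alpha>)
      case Nil
      then show ?case by (simp add: dir_deriv_def frechet_derivative_const)
    next
      case (Cons u us)
      note sm = Cons.prems(1) smooth_field_contract[OF Cons.prems(1)]
      have "dir_deriv v (ext_deriv \<alpha>) x (u # us) =
        dir_deriv v (\<lambda>y. dir_deriv u \<alpha> y - ext_deriv (\<lambda>y. contract u (\<alpha> y)) y) x us"
        by (simp add: dir_deriv_def[of v] ext_deriv_Cons fun_simps)
      also have "\<dots> = dir_deriv v (dir_deriv u \<alpha>) x us - dir_deriv v (ext_deriv (\<lambda>y. contract u (\<alpha> y))) x us"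
        using sm Cons.prems \<open>x \<in> S\<close>
        by (subst dir_deriv_linear(2)) (auto intro: smooth_field_dir_deriv smooth_field_ext_deriv simp: fun_simps)
      also have "\<dots> = dir_deriv u (dir_deriv v \<alpha>) x us - ext_deriv (\<lambda>y. contract u (dir_deriv v \<alpha> y)) x us"
        using Cons.IH[OF sm(2)] dir_deriv_commute[OF \<open>x \<in> S\<close> sm(1), of v u]
        by (simp add: contract_dir_deriv)
      finally show ?case by (simp add: ext_deriv_Cons)
    qed
    have "ext_deriv (\<lambda>y. contract v (ext_deriv \<alpha> y)) x vs
      = ext_deriv (dir_deriv v \<alpha>) x vs - ext_deriv (ext_deriv (\<lambda>y. contract v (\<alpha> y))) x vs"
      unfolding contract_ext_deriv using sm Cons.prems
      by (subst ext_deriv_linear(2)) (auto intro: smooth_field_dir_deriv smooth_field_ext_deriv simp: fun_simps)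
    then show ?case
      using Cons.IH[OF sm(2) Cons.prems(2)] by (simp add: ext_deriv_Cons *)
  qed
qed

lemma alternating_dir_deriv:
  assumes "smooth_field S \<alpha>" "\<And>y. y \<in> S \<Longrightarrow> alternating k (\<alpha> y)" "x \<in> S"
  shows "alternating k (dir_deriv v \<alpha> x)"
proof -
  have z: "dir_deriv v \<alpha> x vs = 0" if "\<And>y. y \<in> S \<Longrightarrow> \<alpha> y vs = 0" for vs
    using frechet_derivative_cong_open[OF op assms(3), of "\<lambda>y. \<alpha> y vs" "\<lambda>_. 0"] that
    by (simp add: dir_deriv_def frechet_derivative_const)
  have "linear (\<lambda>w. dir_deriv v \<alpha> x (us @ w # ws))" if "length us + 1 + length ws = k" for us ws
  proof
    fix u w :: 'a and r :: real
    have lin: "linear (\<lambda>w. \<alpha> y (us @ w # ws))" if "y \<in> S" for y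
      using alternatingD_linear[OF assms(2)[OF that]] \<open>length us + 1 + length ws = k\<close> by blast
    have "frechet_derivative (\<lambda>y. \<alpha> y (us @ (u + w) # ws)) (at x)
        = frechet_derivative (\<lambda>y. \<alpha> y (us @ u # ws) + \<alpha> y (us @ w # ws)) (at x)"
      by (rule frechet_derivative_cong_open[OF op assms(3)]) (simp add: linear_add[OF lin])
    then show "dir_deriv v \<alpha> x (us @ (u + w) # ws) = dir_deriv v \<alpha> x (us @ u # ws) + dir_deriv v \<alpha> x (us @ w # ws)"
      using frechet_derivative_add[OF op smooth_fieldD[OF assms(1)] smooth_fieldD[OF assms(1)] assms(3)]
      by (simp add: dir_deriv_def)
    have "frechet_derivative (\<lambda>y. \<alpha> y (us @ (r *\<^sub>R w) # ws)) (at x)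
        = frechet_derivative (\<lambda>y. r * \<alpha> y (us @ w # ws)) (at x)"
      by (rule frechet_derivative_cong_open[OF op assms(3)]) (simp add: linear_scale[OF lin])
    then show "dir_deriv v \<alpha> x (us @ (r *\<^sub>R w) # ws) = r *\<^sub>R dir_deriv v \<alpha> x (us @ w # ws)"
      using frechet_derivative_mult[OF op smooth_on_const smooth_fieldD[OF assms(1)] assms(3)]
      by (simp add: dir_deriv_def)
  qed
  then show ?thesis
    unfolding alternating_def using z assms(2) by (auto simp: alternating_def)
qed

text \<open>Write \<open>i\<close> for contraction and \<open>D\<close> for directional derivative.
  Contracting \<open>ext_deriv \<alpha>\<close> by \<open>w\<close> and then by \<open>v\<close>
  gives \<open>i_v D_w \<alpha> - i_w D_v \<alpha> + d (i_v i_w \<alpha>)\<close>, since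
  \<open>D\<close> and \<open>i\<close> commute for constant vectors; this is antisymmetric in
  \<open>v\<close> and \<open>w\<close>.\<close>

lemma alternating_ext_deriv:
  assumes "smooth_field S \<alpha>" "\<And>y. y \<in> S \<Longrightarrow> alternating k (\<alpha> y)" "x \<in> S"
  shows "alternating (Suc k) (ext_deriv \<alpha> x)"
  using assms
proof (induction k arbitrary: \<alpha>)
  case 0
  show ?case
  proof (rule alternating_SucI)
    have z: "ext_deriv (\<lambda>y. contract v (\<alpha> y)) x = 0" for v
      using ext_deriv_cong[OF 0(3), of "\<lambda>y. contract v (\<alpha> y)" "\<lambda>_. 0"] 0(2)
      by (auto simp: alternating_0_iff of_degree_0_contract ext_deriv_def frechet_derivative_const fun_eq_iff fun_simps)
    show "ext_deriv \<alpha> x [] = 0" by simp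
    show "alternating 0 (contract v (ext_deriv \<alpha> x))" for v
      using alternating_dir_deriv[OF 0] by (simp add: contract_ext_deriv z)
    show "linear (\<lambda>v. contract v (ext_deriv \<alpha> x))"
      using smooth_on_linear_derivative[OF smooth_fieldD[OF 0(1)] 0(3)]
      by (simp add: contract_ext_deriv z linear_iff dir_deriv_def fun_eq_iff fun_simps)
    show "contract v (contract w (ext_deriv \<alpha> x)) = - contract w (contract v (ext_deriv \<alpha> x))" for v w
      using alternating_dir_deriv[OF 0]
      by (simp add: contract_ext_deriv z alternating_0_iff of_degree_0_contract)
  qed
next
  case (Suc k)
  note sm = Suc.prems(1) smooth_field_contract[OF Suc.prems(1)]
  show ?case
  proof (rule alternating_SucI)
    show "ext_deriv \<alpha> x [] = 0" by simp
    show "alternating (Suc k) (contract v (ext_deriv \<alpha> x))" for v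
      using alternating_dir_deriv[OF Suc.prems]
        Suc.IH[OF sm(2) alternating_contract[OF Suc.prems(2)] Suc.prems(3)]
      by (simp add: contract_ext_deriv alternating_diff)
    have lin: "linear (\<lambda>v. contract v (\<alpha> y))" if "y \<in> S" for y
      using contract_linear Suc.prems(2) that by blast
    show "linear (\<lambda>v. contract v (ext_deriv \<alpha> x))"
    proof
      fix u w and r :: real
      have "ext_deriv (\<lambda>y. contract (u + w) (\<alpha> y)) x = ext_deriv (\<lambda>y. contract u (\<alpha> y) + contract w (\<alpha> y)) x"
        "ext_deriv (\<lambda>y. contract (r *\<^sub>R w) (\<alpha> y)) x = ext_deriv (\<lambda>y. r *\<^sub>R contract w (\<alpha> y)) x"
        using linear_add[OF lin] linear_scale[OF lin] by (auto intro!: ext_deriv_cong Suc.prems)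
      moreover have "linear (\<lambda>v. dir_deriv v \<alpha> x)"
        using smooth_on_linear_derivative[OF smooth_fieldD[OF sm(1)] Suc.prems(3)]
        by (simp add: linear_iff dir_deriv_def fun_eq_iff fun_simps)
      ultimately show
        "contract (u + w) (ext_deriv \<alpha> x) = contract u (ext_deriv \<alpha> x) + contract w (ext_deriv \<alpha> x)"
        "contract (r *\<^sub>R w) (ext_deriv \<alpha> x) = r *\<^sub>R contract w (ext_deriv \<alpha> x)"
        using ext_deriv_linear(1)[OF Suc.prems(3) sm(2) sm(2)] ext_deriv_linear(4)[OF Suc.prems(3) sm(2) sm(2)]
        by (simp_all add: contract_ext_deriv linear_iff algebra_simps)
    qed
    have "ext_deriv (\<lambda>y. contract v (contract w (\<alpha> y))) x = ext_deriv (\<lambda>y. - contract w (contract v (\<alpha> y))) x" for v w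
      using contract_anticommute[OF Suc.prems(2)] by (intro ext_deriv_cong Suc.prems)
    then show "contract v (contract w (ext_deriv \<alpha> x)) = - contract w (contract v (ext_deriv \<alpha> x))" for v w
      using ext_deriv_linear(3)[OF Suc.prems(3) smooth_field_contract[OF sm(2)] sm(2), of w v]
      by (simp add: contract_ext_deriv contract_dir_deriv)
  qed
qed

end

declare zero_fun_apply [simp del]

section \<open>Forms evaluated on moving vectors\<close>

lemma alternating_contract':
  assumes "alternating k \<alpha>" shows "alternating (k - Suc 0) (contract v \<alpha>)"
  using assms by (cases k) (auto simp: alternating_contract alternating_0_iff of_degree_0_contract)

lemma contract_Basis:
  fixes v :: "'e::euclidean_space"
  assumes "alternating k \<alpha>"
  shows "contract v \<alpha> = (\<Sum>b\<in>Basis. (v \<bullet> b) *\<^sub>R contract b \<alpha>)"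
proof -
  have "contract v \<alpha> = contract (\<Sum>b\<in>Basis. (v \<bullet> b) *\<^sub>R b) \<alpha>"
    by (simp add: euclidean_representation)
  then show ?thesis
    by (simp add: linear_sum[OF contract_linear[OF assms]] linear_scale[OF contract_linear[OF assms]])
qed

lemma contract_sum: "contract v (\<Sum>i\<in>I. h i) = (\<Sum>i\<in>I. contract v (h i))"
  by (rule ext) (simp add: contract_apply sum_fun_apply)

lemma pullback_sum: "pullback C (\<Sum>i\<in>I. h i) = (\<Sum>i\<in>I. pullback C (h i))"
  by (rule ext) (simp add: pullback_apply sum_fun_apply)

lemma wedge_alt_sum_right: "wedge_alt \<alpha> (\<Sum>i\<in>I. h i) = (\<Sum>i\<in>I. wedge_alt \<alpha> (h i))"
  by (induction I rule: infinite_finite_induct) (simp_all add: wedge_alt_add_right)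

text \<open>Smoothness of a field was defined on fixed arguments. A moving argument is expanded in
  the basis, one position at a time, with its coordinates as smooth coefficients.\<close>

lemma smooth_on_multilinear:
  fixes \<alpha> :: "'e::euclidean_space \<Rightarrow> 'b::euclidean_space list \<Rightarrow> real"
  assumes "open S" "smooth_field S \<alpha>" "\<And>y. y \<in> S \<Longrightarrow> alternating k (\<alpha> y)"
    and "\<And>f. f \<in> set fs \<Longrightarrow> smooth_on S f"
  shows "smooth_on S (\<lambda>y. \<alpha> y (map (\<lambda>f. f y) fs))"
  using assms(2-4)
proof (induction fs arbitrary: k \<alpha>)
  case Nil
  then show ?case by (simp add: smooth_fieldD)
next
  case (Cons f fs)
  have "smooth_on S (\<lambda>y. \<Sum>b\<in>Basis. (f y \<bullet> b) * contract b (\<alpha> y) (map (\<lambda>f. f y) fs))"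
    using Cons.prems
    by (intro smooth_on_sum[OF assms(1)] smooth_on_mult[OF assms(1)] smooth_on_inner_const[OF assms(1)]
        Cons.IH[of _ "k - Suc 0"]) (auto intro: smooth_field_contract alternating_contract')
  then show ?case
  proof (rule smooth_on_cong[OF assms(1)])
    fix y assume "y \<in> S"
    from contract_Basis[OF Cons.prems(2)[OF this], of "f y"]
    have "contract (f y) (\<alpha> y) (map (\<lambda>f. f y) fs)
      = (\<Sum>b\<in>Basis. (f y \<bullet> b) *\<^sub>R contract b (\<alpha> y)) (map (\<lambda>f. f y) fs)" by (rule arg_cong)
    then show "(\<Sum>b\<in>Basis. (f y \<bullet> b) * contract b (\<alpha> y) (map (\<lambda>f. f y) fs)) = \<alpha> y (map (\<lambda>f. f y) (f # fs))"
      by (simp add: fun_simps contract_apply)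
  qed
qed

lemma smooth_field_pullback:
  fixes \<alpha> :: "'e::euclidean_space \<Rightarrow> 'b::euclidean_space list \<Rightarrow> real"
  assumes "open S" "smooth_field S \<alpha>" "\<And>y. y \<in> S \<Longrightarrow> alternating k (\<alpha> y)"
    and "\<And>v. smooth_on S (\<lambda>y. A y v)"
  shows "smooth_field S (\<lambda>y. pullback (A y) (\<alpha> y))"
  unfolding smooth_field_def
proof
  fix vs
  show "smooth_on S (\<lambda>y. pullback (A y) (\<alpha> y) vs)"
    using smooth_on_multilinear[OF assms(1-3), of "map (\<lambda>v y. A y v) vs"] assms(4)
    by (auto simp: pullback_apply o_def)
qed

lemma smooth_field_contract_smooth:
  fixes \<alpha> :: "'e::euclidean_space \<Rightarrow> 'b::euclidean_space list \<Rightarrow> real"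
  assumes "open S" "smooth_field S \<alpha>" "\<And>y. y \<in> S \<Longrightarrow> alternating k (\<alpha> y)" "smooth_on S R"
  shows "smooth_field S (\<lambda>y. contract (R y) (\<alpha> y))"
  unfolding smooth_field_def
proof
  fix vs
  show "smooth_on S (\<lambda>y. contract (R y) (\<alpha> y) vs)"
  proof -
    have "smooth_on S (\<lambda>y. \<alpha> y (map (\<lambda>f. f y) (R # map (\<lambda>v y. v) vs)))"
      by (rule smooth_on_multilinear[OF assms(1-3)]) (use assms(4) in auto)
    then show ?thesis by (simp add: contract_apply o_def)
  qed
qed

lemma smooth_field_compose:
  fixes f :: "'e::euclidean_space \<Rightarrow> 'b::euclidean_space"
  assumes "open S" "smooth_on S f" "f ` S \<subseteq> T" "smooth_field T \<alpha>"
  shows "smooth_field S (\<lambda>y. \<alpha> (f y))"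
  unfolding smooth_field_def
  using smooth_on_compose[OF assms(1,2) smooth_fieldD[OF assms(4)] assms(3)] by blast

definition one_form_of :: "('e \<Rightarrow> real) \<Rightarrow> 'e list \<Rightarrow> real" where
  "one_form_of g vs = (if length vs = 1 then g (hd vs) else 0)"

lemma contract_one_form_of: "contract w (one_form_of g) = scalar_form (g w)"
  by (rule ext) (auto simp: contract_apply one_form_of_def scalar_form_def)

lemma parity_one_form_of: "parity (one_form_of g) = - one_form_of g"
  by (rule ext) (auto simp: parity_apply one_form_of_def fun_simps)

lemma one_form_of_Nil [simp]: "one_form_of g [] = 0"
  by (simp add: one_form_of_def)

lemma alternating_one_form_of: "linear g \<Longrightarrow> alternating 1 (one_form_of g)"
  by (auto simp: alternating_def one_form_of_def length_Suc_conv)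

lemma one_form_of_alternating: "alternating 1 \<theta> \<Longrightarrow> one_form_of (\<lambda>v. \<theta> [v]) = \<theta>"
proof
  fix vs
  assume "alternating 1 \<theta>"
  then show "one_form_of (\<lambda>v. \<theta> [v]) vs = \<theta> vs"
    by (cases vs rule: remdups_adj.cases) (auto simp: one_form_of_def alternating_def)
qed

lemma ext_deriv_scalar_form:
  fixes x :: "'a::euclidean_space"
  shows "ext_deriv (\<lambda>y. scalar_form (g y)) x = one_form_of (frechet_derivative g (at x))"
proof (rule list_fun_eqI)
  fix w
  have "dir_deriv w (\<lambda>y. scalar_form (g y)) x vs = scalar_form (frechet_derivative g (at x) w) vs" for vs :: "'a list"
    by (cases "vs = []") (simp_all add: dir_deriv_def scalar_form_def frechet_derivative_const)
  moreover have "ext_deriv (\<lambda>y. 0::'a list \<Rightarrow> real) x = 0"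
    by (rule ext) (simp add: ext_deriv_def frechet_derivative_const zero_fun_apply)
  ultimately show "contract w (ext_deriv (\<lambda>y. scalar_form (g y)) x) = contract w (one_form_of (frechet_derivative g (at x)))"
    by (intro ext) (simp add: contract_ext_deriv contract_one_form_of fun_simps)
qed simp

section \<open>Naturality of the exterior derivative under smooth maps\<close>

context
  fixes S :: "'e::euclidean_space set" and T :: "'b::euclidean_space set" and f A B x
  assumes op: "open S" "open T" and f: "smooth_on S f" "f ` S \<subseteq> T" and x: "x \<in> S"
  defines "A \<equiv> \<lambda>y. frechet_derivative f (at y)"
    and "B \<equiv> \<lambda>v w. frechet_derivative (\<lambda>y. frechet_derivative f (at y) w) (at x) v"
begin

text \<open>The derivation replacing each argument in turn by its image under \<open>C\<close>.\<close>

definition slot_derivation :: "('e \<Rightarrow> 'b) \<Rightarrow> ('b list \<Rightarrow> real) \<Rightarrow> 'e list \<Rightarrow> real" where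
  "slot_derivation C \<alpha> = (\<Sum>b\<in>Basis. wedge_alt (one_form_of (\<lambda>w. C w \<bullet> b)) (pullback (A x) (contract b \<alpha>)))"

lemma slot_derivation_Nil: "slot_derivation C \<alpha> [] = 0"
  by (simp add: slot_derivation_def sum_fun_apply)

lemma contract_slot_derivation:
  assumes "alternating k \<alpha>"
  shows "contract w (slot_derivation C \<alpha>) =
    pullback (A x) (contract (C w) \<alpha>) + slot_derivation C (contract (A x w) \<alpha>)"
proof -
  have "contract w (slot_derivation C \<alpha>) = (\<Sum>b\<in>Basis. (C w \<bullet> b) *\<^sub>R pullback (A x) (contract b \<alpha>)
      - wedge_alt (one_form_of (\<lambda>w. C w \<bullet> b)) (pullback (A x) (contract (A x w) (contract b \<alpha>))))"
    by (simp add: slot_derivation_def contract_sum contract_wedge contract_one_form_of parity_one_form_of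
        contract_pullback wedge_alt_minus_left)
  also have "\<dots> = (\<Sum>b\<in>Basis. pullback (A x) ((C w \<bullet> b) *\<^sub>R contract b \<alpha>)) +
     (\<Sum>b\<in>Basis. wedge_alt (one_form_of (\<lambda>w. C w \<bullet> b)) (pullback (A x) (contract b (contract (A x w) \<alpha>))))"
    unfolding contract_anticommute[OF assms, of "A x w"]
    by (simp add: pullback_linear wedge_alt_linear sum.distrib sum_negf)
  also have "(\<Sum>b\<in>Basis. pullback (A x) ((C w \<bullet> b) *\<^sub>R contract b \<alpha>)) = pullback (A x) (contract (C w) \<alpha>)"
    by (simp add: contract_Basis[OF assms, of "C w"] pullback_sum)
  finally show ?thesis by (simp add: slot_derivation_def)
qed

lemma slot_derivation_Basis:
  assumes "alternating k \<alpha>"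
  shows "slot_derivation C (contract v \<alpha>) = (\<Sum>b\<in>Basis. (v \<bullet> b) *\<^sub>R slot_derivation C (contract b \<alpha>))"
proof -
  have "slot_derivation C (contract v \<alpha>) = (\<Sum>c\<in>Basis. \<Sum>b\<in>Basis. (v \<bullet> b) *\<^sub>R
     wedge_alt (one_form_of (\<lambda>w. C w \<bullet> c)) (pullback (A x) (contract c (contract b \<alpha>))))"
    by (subst contract_Basis[OF assms])
      (simp add: slot_derivation_def contract_sum pullback_sum pullback_linear wedge_alt_sum_right wedge_alt_scaleR_right)
  also have "\<dots> = (\<Sum>b\<in>Basis. (v \<bullet> b) *\<^sub>R slot_derivation C (contract b \<alpha>))"
    by (subst sum.swap) (simp add: slot_derivation_def scaleR_sum_right)
  finally show ?thesis .
qed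

lemma smooth_A: "smooth_on S (\<lambda>y. A y w)"
  unfolding A_def by (rule smooth_on_frechet_derivative[OF f(1)])

lemma smooth_field_pullback_map:
  assumes "smooth_field T \<omega>" "\<And>z. z \<in> T \<Longrightarrow> alternating k (\<omega> z)"
  shows "smooth_field S (\<lambda>y. pullback (A y) (\<omega> (f y)))"
  using assms f
  by (intro smooth_field_pullback[OF op(1), of _ k] smooth_A smooth_field_compose[OF op(1)]) auto

text \<open>Both the base point \<open>f y\<close> and the arguments \<open>A y w\<close> move with
  \<open>y\<close>. The first motion gives the pulled back directional derivative, the second
  inserts the second derivative \<open>B v w\<close> of \<open>f\<close> into every slot in
  turn.\<close>

lemma dir_deriv_pullback:
  assumes "smooth_field T \<omega>" "\<And>z. z \<in> T \<Longrightarrow> alternating k (\<omega> z)"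
  shows "dir_deriv v (\<lambda>y. pullback (A y) (\<omega> (f y))) x =
    pullback (A x) (dir_deriv (A x v) \<omega> (f x)) + slot_derivation (B v) (\<omega> (f x))"
proof
  fix ws
  show "dir_deriv v (\<lambda>y. pullback (A y) (\<omega> (f y))) x ws =
    (pullback (A x) (dir_deriv (A x v) \<omega> (f x)) + slot_derivation (B v) (\<omega> (f x))) ws"
    using assms
  proof (induction ws arbitrary: \<omega> k)
    case Nil
    have "f x \<in> T" using f x by auto
    then show ?case
      using frechet_derivative_chain[OF op(1) f(1) smooth_fieldD[OF Nil(1)] _ x, of "[]" v]
      by (simp add: fun_simps slot_derivation_Nil) (simp add: dir_deriv_def pullback_apply A_def)
  next
    case (Cons w ws)
    have fT: "f y \<in> T" if "y \<in> S" for y using f that by auto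
    have alt: "alternating k (dir_deriv (A x v) \<omega> (f x))"
      by (rule alternating_dir_deriv[OF op(2) Cons.prems(1,2) fT[OF x]])
    have sm: "smooth_field S (\<lambda>y. pullback (A y) (contract b (\<omega> (f y))))" for b
      using Cons.prems
      by (intro smooth_field_pullback_map[of "\<lambda>z. contract b (\<omega> z)" "k - Suc 0"])
         (auto intro: smooth_field_contract alternating_contract')
    have IH: "dir_deriv v (\<lambda>y. pullback (A y) (contract b (\<omega> (f y)))) x ws =
       pullback (A x) (contract b (dir_deriv (A x v) \<omega> (f x))) ws + slot_derivation (B v) (contract b (\<omega> (f x))) ws" for b
      using Cons.IH[of "\<lambda>z. contract b (\<omega> z)" "k - Suc 0"] Cons.prems
      by (simp add: smooth_field_contract alternating_contract' contract_dir_deriv fun_simps)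
    have "dir_deriv v (\<lambda>y. pullback (A y) (\<omega> (f y))) x (w # ws)
      = frechet_derivative (\<lambda>y. \<Sum>b\<in>Basis. (A y w \<bullet> b) * pullback (A y) (contract b (\<omega> (f y))) ws) (at x) v"
      unfolding dir_deriv_def
    proof (rule arg_cong[where f = "\<lambda>F. F v"], rule frechet_derivative_cong_open[OF op(1) x])
      fix y assume "y \<in> S"
      from contract_Basis[OF Cons.prems(2)[OF fT[OF this]], of "A y w"]
      have "contract (A y w) (\<omega> (f y)) (map (A y) ws)
        = (\<Sum>b\<in>Basis. (A y w \<bullet> b) *\<^sub>R contract b (\<omega> (f y))) (map (A y) ws)" by (rule arg_cong)
      then show "pullback (A y) (\<omega> (f y)) (w # ws) =
          (\<Sum>b\<in>Basis. (A y w \<bullet> b) * pullback (A y) (contract b (\<omega> (f y))) ws)"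
        by (simp add: pullback_apply contract_apply fun_simps)
    qed
    also have "\<dots> = (\<Sum>b\<in>Basis. frechet_derivative (\<lambda>y. (A y w \<bullet> b) * pullback (A y) (contract b (\<omega> (f y))) ws) (at x) v)"
      by (intro frechet_derivative_sum[OF op(1) _ x] smooth_on_mult[OF op(1)] smooth_on_inner_const[OF op(1)]
          smooth_A smooth_fieldD[OF sm])
    also have "\<dots> = (\<Sum>b\<in>Basis. (A x w \<bullet> b) * dir_deriv v (\<lambda>y. pullback (A y) (contract b (\<omega> (f y)))) x ws
        + (B v w \<bullet> b) * pullback (A x) (contract b (\<omega> (f x))) ws)"
    proof (rule sum.cong[OF refl])
      fix b :: 'b
      have "frechet_derivative (\<lambda>y. A y w \<bullet> b) (at x) v = B v w \<bullet> b"
        unfolding A_def B_def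
        by (rule frechet_derivative_bounded_linear[OF op(1) bounded_linear_inner_left
              smooth_on_frechet_derivative[OF f(1)] x])
      then show "frechet_derivative (\<lambda>y. (A y w \<bullet> b) * pullback (A y) (contract b (\<omega> (f y))) ws) (at x) v =
        (A x w \<bullet> b) * dir_deriv v (\<lambda>y. pullback (A y) (contract b (\<omega> (f y)))) x ws
        + (B v w \<bullet> b) * pullback (A x) (contract b (\<omega> (f x))) ws"
        using frechet_derivative_mult[OF op(1) smooth_on_inner_const[OF op(1) smooth_A[of w], of b] smooth_fieldD[OF sm] x]
        by (simp add: dir_deriv_def)
    qed
    also have "\<dots> = (\<Sum>b\<in>Basis. (A x w \<bullet> b) *\<^sub>R pullback (A x) (contract b (dir_deriv (A x v) \<omega> (f x)))) ws
       + ((\<Sum>b\<in>Basis. (A x w \<bullet> b) *\<^sub>R slot_derivation (B v) (contract b (\<omega> (f x)))) ws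
       + (\<Sum>b\<in>Basis. (B v w \<bullet> b) *\<^sub>R pullback (A x) (contract b (\<omega> (f x)))) ws)"
      by (simp add: IH fun_simps distrib_left sum.distrib)
    also have "(\<Sum>b\<in>Basis. (A x w \<bullet> b) *\<^sub>R pullback (A x) (contract b (dir_deriv (A x v) \<omega> (f x))))
       = contract w (pullback (A x) (dir_deriv (A x v) \<omega> (f x)))"
      unfolding contract_pullback
      unfolding contract_Basis[OF alt, of "A x w"]
        pullback_sum pullback_linear ..
    also have "(\<Sum>b\<in>Basis. (A x w \<bullet> b) *\<^sub>R slot_derivation (B v) (contract b (\<omega> (f x))))
       = slot_derivation (B v) (contract (A x w) (\<omega> (f x)))"
      by (rule slot_derivation_Basis[OF Cons.prems(2)[OF fT[OF x]], symmetric])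
    also have "(\<Sum>b\<in>Basis. (B v w \<bullet> b) *\<^sub>R pullback (A x) (contract b (\<omega> (f x))))
       = pullback (A x) (contract (B v w) (\<omega> (f x)))"
      by (subst contract_Basis[OF Cons.prems(2)[OF fT[OF x]], of "B v w"])
        (simp add: pullback_sum pullback_linear)
    finally show ?case
      using fun_cong[OF contract_slot_derivation[OF Cons.prems(2)[OF fT[OF x]], of w "B v"], of ws]
      by (simp add: fun_simps contract_apply[where vs = ws])
  qed
qed

text \<open>By Cartan's formula the second derivatives of \<open>f\<close> appear twice, once from
  differentiating the pullback along \<open>v\<close> and once from the exterior derivative of the
  coordinates of \<open>A y v\<close>. Their symmetry makes the two slot derivations equal, and they
  cancel.\<close>

lemma ext_deriv_pullback:
  assumes "smooth_field T \<omega>" "\<And>z. z \<in> T \<Longrightarrow> alternating k (\<omega> z)"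
  shows "ext_deriv (\<lambda>y. pullback (A y) (\<omega> (f y))) x = pullback (A x) (ext_deriv \<omega> (f x))"
proof
  fix vs
  show "ext_deriv (\<lambda>y. pullback (A y) (\<omega> (f y))) x vs = pullback (A x) (ext_deriv \<omega> (f x)) vs"
    using assms
  proof (induction vs arbitrary: \<omega> k)
    case Nil
    then show ?case by (simp add: pullback_apply)
  next
    case (Cons v vs)
    have fT: "f y \<in> T" if "y \<in> S" for y using f that by auto
    let ?F = "\<lambda>b y. pullback (A y) (contract b (\<omega> (f y)))"
    have sm: "smooth_field S (?F b)" for b
      using Cons.prems
      by (intro smooth_field_pullback_map[of "\<lambda>z. contract b (\<omega> z)" "k - Suc 0"])
         (auto intro: smooth_field_contract alternating_contract')
    have IH: "ext_deriv (?F b) x vs = pullback (A x) (ext_deriv (\<lambda>z. contract b (\<omega> z)) (f x)) vs" for b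
      using Cons.IH[of "\<lambda>z. contract b (\<omega> z)" "k - Suc 0"] Cons.prems
      by (simp add: smooth_field_contract alternating_contract')
    \<comment> \<open>The symmetry is known for real functions and is therefore used for each
      coordinate of \<open>f\<close>.\<close>
    have sym: "frechet_derivative (\<lambda>y. A y v \<bullet> b) (at x) w = B v w \<bullet> b" for w b
    proof -
      have D: "frechet_derivative (\<lambda>z. f z \<bullet> b) (at y) u = A y u \<bullet> b" if "y \<in> S" for u y
        unfolding A_def by (rule frechet_derivative_bounded_linear[OF op(1) bounded_linear_inner_left f(1) that])
      have "frechet_derivative (\<lambda>y. A y v \<bullet> b) (at x) w
        = frechet_derivative (\<lambda>y. frechet_derivative (\<lambda>z. f z \<bullet> b) (at y) v) (at x) w"
        by (rule arg_cong[where f = "\<lambda>F. F w"], rule frechet_derivative_cong_open[OF op(1) x]) (simp add: D)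
      also have "\<dots> = frechet_derivative (\<lambda>y. frechet_derivative (\<lambda>z. f z \<bullet> b) (at y) w) (at x) v"
        by (rule second_derivative_symmetric[OF smooth_on_inner_const[OF op(1) f(1)] op(1) x])
      also have "\<dots> = frechet_derivative (\<lambda>y. A y w \<bullet> b) (at x) v"
        by (rule arg_cong[where f = "\<lambda>F. F v"], rule frechet_derivative_cong_open[OF op(1) x]) (simp add: D)
      also have "\<dots> = B v w \<bullet> b"
        unfolding A_def B_def
        by (rule frechet_derivative_bounded_linear[OF op(1) bounded_linear_inner_left
              smooth_on_frechet_derivative[OF f(1)] x])
      finally show ?thesis .
    qed
    have "ext_deriv (\<lambda>y. contract v (pullback (A y) (\<omega> (f y)))) x
      = ext_deriv (\<lambda>y. \<Sum>b\<in>Basis. (A y v \<bullet> b) *\<^sub>R ?F b y) x"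
    proof (rule ext_deriv_cong[OF op(1) x])
      fix y assume "y \<in> S"
      then show "contract v (pullback (A y) (\<omega> (f y))) = (\<Sum>b\<in>Basis. (A y v \<bullet> b) *\<^sub>R ?F b y)"
        unfolding contract_pullback
        by (subst contract_Basis[OF Cons.prems(2)[OF fT], of y "A y v"]) (simp_all add: pullback_sum pullback_linear)
    qed
    also have "\<dots> = (\<Sum>b\<in>Basis. ext_deriv (\<lambda>y. (A y v \<bullet> b) *\<^sub>R ?F b y) x)"
      by (intro ext_deriv_sum[OF op(1) x] smooth_field_scaleR[OF op(1)] smooth_on_inner_const[OF op(1)] smooth_A sm)
    also have "\<dots> = (\<Sum>b\<in>Basis. (A x v \<bullet> b) *\<^sub>R ext_deriv (?F b) x) + slot_derivation (B v) (\<omega> (f x))"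
      by (simp add: ext_deriv_scaleR[OF op(1) x smooth_on_inner_const[OF op(1) smooth_A] sm]
          ext_deriv_scalar_form sum.distrib slot_derivation_def sym[abs_def])
    finally have 1: "ext_deriv (\<lambda>y. contract v (pullback (A y) (\<omega> (f y)))) x vs
      = (\<Sum>b\<in>Basis. (A x v \<bullet> b) * pullback (A x) (ext_deriv (\<lambda>z. contract b (\<omega> z)) (f x)) vs)
        + slot_derivation (B v) (\<omega> (f x)) vs" by (simp add: fun_simps IH)
    have "ext_deriv (\<lambda>z. contract (A x v) (\<omega> z)) (f x)
       = ext_deriv (\<lambda>z. \<Sum>b\<in>Basis. (A x v \<bullet> b) *\<^sub>R contract b (\<omega> z)) (f x)"
      by (rule ext_deriv_cong[OF op(2) fT[OF x]]) (rule contract_Basis[OF Cons.prems(2)])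
    also have "\<dots> = (\<Sum>b\<in>Basis. (A x v \<bullet> b) *\<^sub>R ext_deriv (\<lambda>z. contract b (\<omega> z)) (f x))"
      using smooth_field_contract[OF Cons.prems(1)]
      by (subst ext_deriv_sum[OF op(2) fT[OF x]])
        (auto simp: ext_deriv_linear(4)[OF op(2) fT[OF x] smooth_field_contract[OF Cons.prems(1)] smooth_field_contract[OF Cons.prems(1)]]
          intro!: smooth_field_scaleR[OF op(2)])
    finally have 2: "pullback (A x) (ext_deriv (\<lambda>z. contract (A x v) (\<omega> z)) (f x)) vs
      = (\<Sum>b\<in>Basis. (A x v \<bullet> b) * pullback (A x) (ext_deriv (\<lambda>z. contract b (\<omega> z)) (f x)) vs)"
      by (simp add: pullback_sum pullback_linear) (simp add: fun_simps)
    have "pullback (A x) (ext_deriv \<omega> (f x)) (v # vs)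
      = pullback (A x) (contract (A x v) (ext_deriv \<omega> (f x))) vs"
      by (simp add: pullback_apply contract_apply)
    also have "\<dots> = pullback (A x) (dir_deriv (A x v) \<omega> (f x)) vs
      - pullback (A x) (ext_deriv (\<lambda>z. contract (A x v) (\<omega> z)) (f x)) vs"
      by (simp add: contract_ext_deriv pullback_linear) (simp add: fun_simps)
    finally show ?case
      using dir_deriv_pullback[OF Cons.prems, of v]
      by (simp add: ext_deriv_Cons 1 2 fun_simps)
  qed
qed

end

section \<open>The Lefschetz isomorphism\<close>

text \<open>The relations of an sl(2) representation with weight \<open>n - k\<close> in degree
  \<open>k\<close>. The spaces stay abstract because they will be spaces of smooth fields, which are
  infinite-dimensional; only the degrees are bounded.\<close>

locale lefschetz =
  fixes H :: "nat \<Rightarrow> 'v::real_vector set" and L \<Lambda> :: "'v \<Rightarrow> 'v" and n :: nat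
  assumes subspace_H: "subspace (H k)"
    and linear_L: "linear L" and linear_\<Lambda>: "linear \<Lambda>"
    and L_H: "x \<in> H k \<Longrightarrow> L x \<in> H (k + 2)"
    and \<Lambda>_H: "x \<in> H (k + 2) \<Longrightarrow> \<Lambda> x \<in> H k"
    and \<Lambda>_low: "x \<in> H k \<Longrightarrow> k < 2 \<Longrightarrow> \<Lambda> x = 0"
    and H_top: "x \<in> H k \<Longrightarrow> 2 * n < k \<Longrightarrow> x = 0"
    and commutator: "x \<in> H k \<Longrightarrow> \<Lambda> (L x) = L (\<Lambda> x) + (real n - real k) *\<^sub>R x"
begin

lemma linear_L_pow: "linear (L ^^ m)"
proof (induction m)
  case (Suc m)
  show ?case unfolding funpow.simps by (rule linear_compose[OF Suc linear_L])
qed (simp only: funpow.simps linear_id)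

lemma L_pow_H: "x \<in> H k \<Longrightarrow> (L ^^ m) x \<in> H (k + 2 * m)"
  using L_H by (induction m) (auto simp: algebra_simps)

lemma \<Lambda>_pow_H: "x \<in> H (k + 2 * m) \<Longrightarrow> (\<Lambda> ^^ m) x \<in> H k"
  by (induction m arbitrary: k) (fastforce intro: \<Lambda>_H simp: algebra_simps)+

text \<open>The constant is the sum of the weights \<open>n - (k + 2 * i)\<close> for
  \<open>i\<close> from 0 to \<open>m\<close>, met one after the other when \<open>\<Lambda>\<close>
  passes the factors \<open>L\<close>.\<close>

lemma \<Lambda>_L_pow:
  assumes "x \<in> H k"
  shows "\<Lambda> ((L ^^ Suc m) x) = (L ^^ Suc m) (\<Lambda> x) + (real (Suc m) * (real n - real k - real m)) *\<^sub>R (L ^^ m) x"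
proof (induction m)
  case 0
  show ?case using commutator[OF assms] by simp
next
  case (Suc m)
  have "\<Lambda> ((L ^^ Suc (Suc m)) x) = L (\<Lambda> ((L ^^ Suc m) x)) + (real n - real (k + 2 * Suc m)) *\<^sub>R (L ^^ Suc m) x"
    using commutator[OF L_pow_H[OF assms, of "Suc m"]] by simp
  also have "L (\<Lambda> ((L ^^ Suc m) x)) = (L ^^ Suc (Suc m)) (\<Lambda> x)
      + (real (Suc m) * (real n - real k - real m)) *\<^sub>R (L ^^ Suc m) x"
    using Suc by (simp add: linear_add[OF linear_L] linear_scale[OF linear_L])
  finally show ?case
    by (simp add: algebra_simps flip: scaleR_add_left)
qed

lemma L_\<Lambda>_pow:
  assumes "x \<in> H l" "2 * m \<le> l"
  shows "L ((\<Lambda> ^^ Suc m) x) = (\<Lambda> ^^ Suc m) (L x) - (real (Suc m) * (real n - real l + real m)) *\<^sub>R (\<Lambda> ^^ m) x"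
  using assms(2)
proof (induction m)
  case 0
  show ?case using commutator[OF assms(1)] by simp
next
  case (Suc m)
  obtain k where k: "l = k + 2 * Suc m" using Suc.prems by (metis le_iff_add add.commute)
  have "(\<Lambda> ^^ Suc m) x \<in> H k" using \<Lambda>_pow_H[of x k "Suc m"] assms(1) k by simp
  from commutator[OF this]
  have "L ((\<Lambda> ^^ Suc (Suc m)) x) = \<Lambda> (L ((\<Lambda> ^^ Suc m) x)) - (real n - real k) *\<^sub>R (\<Lambda> ^^ Suc m) x"
    by simp
  also have "\<Lambda> (L ((\<Lambda> ^^ Suc m) x)) = (\<Lambda> ^^ Suc (Suc m)) (L x)
      - (real (Suc m) * (real n - real l + real m)) *\<^sub>R (\<Lambda> ^^ Suc m) x"
    using Suc by (simp add: linear_diff[OF linear_\<Lambda>] linear_scale[OF linear_\<Lambda>])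
  finally show ?case
    by (simp add: k algebra_simps flip: scaleR_add_left)
qed

text \<open>If \<open>L\<close> to the power \<open>n - k\<close> kills \<open>x\<close>, then one
  more power kills \<open>\<Lambda> x\<close>, which vanishes by induction, its degree being
  \<open>k - 2\<close>. For such a primitive \<open>x\<close> the commutator turns the vanishing of
  a power of \<open>L\<close> into that of the next lower one, since the constants are nonzero, down
  to \<open>x\<close> itself.\<close>

lemma L_pow_injective:
  assumes "k \<le> n" "x \<in> H k" "(L ^^ (n - k)) x = 0"
  shows "x = 0"
  using assms
proof (induction k arbitrary: x rule: less_induct)
  case (less k)
  have L0: "L 0 = 0" "(L ^^ m) 0 = 0" for m
    using linear_0[OF linear_L] linear_0[OF linear_L_pow] by auto
  have \<Lambda>0: "\<Lambda> 0 = 0" using linear_0[OF linear_\<Lambda>] .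
  have prim: "\<Lambda> x = 0"
  proof (cases "k < 2")
    case True
    then show ?thesis using \<Lambda>_low less.prems by blast
  next
    case False
    then obtain j where j: "k = j + 2" by (metis add.commute le_iff_add not_less)
    have nj: "n - j = Suc (Suc (n - k))" using j less.prems(1) by simp
    have "(L ^^ Suc (n - k)) x = 0" using less.prems by (simp add: L0)
    then have "(L ^^ Suc (n - k)) (\<Lambda> x) = 0"
      using \<Lambda>_L_pow[OF less.prems(2), of "n - k"] less.prems(3) by (simp add: \<Lambda>0)
    then have "(L ^^ (n - j)) (\<Lambda> x) = 0" unfolding nj by (simp add: L0)
    then show ?thesis
      using less.IH[of j "\<Lambda> x"] \<Lambda>_H[of x j] less.prems j by (simp del: funpow.simps)
  qed
  have "(L ^^ (n - k - i)) x = 0" if "i \<le> n - k" for i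
    using that
  proof (induction i)
    case 0
    then show ?case using less.prems by simp
  next
    case (Suc i)
    define m where "m = n - k - Suc i"
    have m: "Suc m = n - k - i" "real n - real k - real m > 0"
      using Suc.prems less.prems(1) by (auto simp: m_def)
    have "(L ^^ Suc m) x = 0" using Suc m by simp
    then have "(real (Suc m) * (real n - real k - real m)) *\<^sub>R (L ^^ m) x = 0"
      using \<Lambda>_L_pow[OF less.prems(2), of m] by (simp add: prim L0 \<Lambda>0)
    moreover have "real (Suc m) * (real n - real k - real m) \<noteq> 0" using m(2) by simp
    ultimately have "(L ^^ m) x = 0" using scaleR_eq_0_iff by blast
    then show ?case by (simp only: m_def)
  qed
  from this[of "n - k"] show ?case by simp
qed

text \<open>An element killed by \<open>L\<close> is, up to a nonzero factor, recovered from its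
  image under \<open>\<Lambda>\<close> to the power \<open>n - k\<close>. The general case is
  reduced to this one by subtracting a preimage of \<open>L y\<close> found by induction.\<close>

lemma L_pow_surjective:
  assumes "k \<le> n" "y \<in> H (2 * n - k)"
  shows "\<exists>x \<in> H k. (L ^^ (n - k)) x = y"
  using assms
proof (induction k arbitrary: y rule: less_induct)
  case (less k)
  have lift: "\<exists>x \<in> H k. (L ^^ (n - k)) x = y" if y: "y \<in> H (2 * n - k)" "L y = 0" for y
  proof -
    have "\<exists>c. c \<noteq> 0 \<and> (L ^^ m) ((\<Lambda> ^^ m) y) = c *\<^sub>R y" if "m \<le> n - k" for m
      using that
    proof (induction m)
      case 0
      show ?case by (intro exI[of _ 1]) simp
    next
      case (Suc m)
      then obtain c where c: "c \<noteq> 0" "(L ^^ m) ((\<Lambda> ^^ m) y) = c *\<^sub>R y" by auto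
      have \<Lambda>0: "(\<Lambda> ^^ i) 0 = 0" for i using linear_0[OF linear_\<Lambda>] by (induction i) auto
      \<comment> \<open>The scalar by which \<open>L\<close> undoes one \<open>\<Lambda>\<close>; it
        is positive as long as \<open>m < n - k\<close>.\<close>
      define d where "d = - (real (Suc m) * (real n - real (2 * n - k) + real m))"
      have d: "d \<noteq> 0" using Suc.prems less.prems(1) by (simp add: d_def of_nat_diff)
      have "L ((\<Lambda> ^^ Suc m) y) = d *\<^sub>R (\<Lambda> ^^ m) y"
        using L_\<Lambda>_pow[OF y(1), of m] Suc.prems y(2) less.prems(1) \<Lambda>0[of "Suc m"] by (simp add: d_def)
      then have "(L ^^ Suc m) ((\<Lambda> ^^ Suc m) y) = (d * c) *\<^sub>R y"
        by (simp add: funpow_swap1 linear_scale[OF linear_L_pow] c)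
      then show ?case using c d by (intro exI[of _ "d * c"]) simp
    qed
    then obtain c where c: "c \<noteq> 0" "(L ^^ (n - k)) ((\<Lambda> ^^ (n - k)) y) = c *\<^sub>R y" by blast
    have "(\<Lambda> ^^ (n - k)) y \<in> H k" using \<Lambda>_pow_H[of y k "n - k"] y(1) less.prems(1)
      by (simp add: diff_mult_distrib2)
    then show ?thesis
      using c subspace_scale[OF subspace_H, of "(\<Lambda> ^^ (n - k)) y" k "inverse c"]
      by (intro bexI[of _ "inverse c *\<^sub>R (\<Lambda> ^^ (n - k)) y"]) (simp_all add: linear_scale[OF linear_L_pow])
  qed
  show ?case
  proof (cases "k < 2")
    case True
    then have "L y = 0" using H_top[OF L_H[OF less.prems(2)]] less.prems(1) by simp
    then show ?thesis using lift less.prems by blast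
  next
    case False
    then obtain j where j: "k = j + 2" by (metis add.commute le_iff_add not_less)
    have "2 * n - k + 2 = 2 * n - j" using j less.prems(1) by simp
    then have "L y \<in> H (2 * n - j)" using L_H[OF less.prems(2)] by simp
    then obtain z where z: "z \<in> H j" "(L ^^ (n - j)) z = L y"
      using less.IH[of j "L y"] j less.prems(1) by auto
    have nj: "n - j = Suc (Suc (n - k))" using j less.prems(1) by simp
    \<comment> \<open>The correction has the degree of \<open>y\<close>, and \<open>L\<close> of it
      is \<open>L y\<close>, so the difference falls under \<open>lift\<close>.\<close>
    let ?y = "y - (L ^^ Suc (n - k)) z"
    have "j + 2 * Suc (n - k) = 2 * n - k" using j less.prems(1) by simp
    then have "?y \<in> H (2 * n - k)"
      using L_pow_H[OF z(1), of "Suc (n - k)"] less.prems(2) subspace_diff[OF subspace_H] by metis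
    moreover have "L ?y = 0" using z(2) by (simp add: linear_diff[OF linear_L] nj)
    ultimately obtain x where x: "x \<in> H k" "(L ^^ (n - k)) x = ?y" using lift by blast
    have "(L ^^ (n - k)) (x + L z) = y"
      using x(2) by (simp add: linear_add[OF linear_L_pow] funpow_swap1)
    moreover have "x + L z \<in> H k"
      using x(1) L_H[OF z(1)] j subspace_add[OF subspace_H] by simp
    ultimately show ?thesis by blast
  qed
qed

end

section \<open>Contact forms at a point\<close>

text \<open>The data at one point, with \<open>\<beta>\<close> for the value of d\<theta> there.
  Keeping \<open>\<beta>\<close> as a separate argument leaves the fibrewise algebra free of
  derivatives.\<close>

definition contact_pair :: "nat \<Rightarrow> ('e::euclidean_space list \<Rightarrow> real) \<Rightarrow> ('e list \<Rightarrow> real) \<Rightarrow> bool" where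
  "contact_pair n \<theta> \<beta> \<longleftrightarrow> DIM('e) = 2 * n + 1 \<and> alternating 1 \<theta> \<and> alternating 2 \<beta> \<and> \<theta> \<noteq> 0 \<and>
     (\<forall>u. \<theta> [u] = 0 \<longrightarrow> (\<forall>v. \<theta> [v] = 0 \<longrightarrow> \<beta> [u, v] = 0) \<longrightarrow> u = 0)"

lemma linear_alternating_1: "alternating 1 \<theta> \<Longrightarrow> linear (\<lambda>v. \<theta> [v])"
  using alternatingD_linear[of 1 \<theta> "[]" "[]"] by simp

lemma linear_alternating_2:
  assumes "alternating 2 \<beta>"
  shows "linear (\<lambda>v. \<beta> [u, v])" "linear (\<lambda>v. \<beta> [v, u])"
  using alternatingD_linear[OF assms, of "[u]" "[]"] alternatingD_linear[OF assms, of "[]" "[u]"] by simp_all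

text \<open>The vector corresponding to a linear functional under the nondegenerate form
  \<open>\<beta> + \<theta> \<otimes> \<theta>\<close>; the Reeb field corresponds to \<open>\<theta>\<close> itself.\<close>

definition sharp :: "('e::euclidean_space list \<Rightarrow> real) \<Rightarrow> ('e list \<Rightarrow> real) \<Rightarrow> ('e \<Rightarrow> real) \<Rightarrow> 'e" where
  "sharp \<theta> \<beta> g = (THE u. \<forall>v. \<beta> [u, v] + \<theta> [u] * \<theta> [v] = g v)"

definition reeb :: "('e::euclidean_space list \<Rightarrow> real) \<Rightarrow> ('e list \<Rightarrow> real) \<Rightarrow> 'e" where
  "reeb \<theta> \<beta> = sharp \<theta> \<beta> (\<lambda>v. \<theta> [v])"

text \<open>Taking \<open>v = u\<close> removes the term of \<open>\<beta>\<close> and gives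
  \<open>\<theta> [u] = 0\<close>; then the nondegeneracy on the kernel of \<theta> applies.\<close>

lemma contact_nondegenerate:
  assumes "contact_pair n \<theta> \<beta>" "\<And>v. \<beta> [u, v] + \<theta> [u] * \<theta> [v] = 0"
  shows "u = 0"
proof -
  have "\<beta> [u, u] = 0" using assms(1) by (simp add: contact_pair_def alternating_def)
  then have "\<theta> [u] = 0" using assms(2)[of u] by simp
  then show ?thesis using assms by (simp add: contact_pair_def)
qed

lemma sharp_ex1:
  assumes "contact_pair n \<theta> \<beta>" "linear g"
  shows "\<exists>!u. \<forall>v. \<beta> [u, v] + \<theta> [u] * \<theta> [v] = g v"
proof -
  have alt: "alternating 1 \<theta>" "alternating 2 \<beta>" using assms(1) by (auto simp: contact_pair_def)
  note lin = linear_alternating_1[OF alt(1)] linear_alternating_2[OF alt(2)]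
  define G where "G = (\<lambda>u. \<Sum>e\<in>Basis. (\<beta> [u, e] + \<theta> [u] * \<theta> [e]) *\<^sub>R e)"
  have G: "G u \<bullet> v = \<beta> [u, v] + \<theta> [u] * \<theta> [v]" for u v
  proof -
    have "\<beta> [u, v] = \<beta> [u, \<Sum>e\<in>Basis. (v \<bullet> e) *\<^sub>R e]" "\<theta> [v] = \<theta> [\<Sum>e\<in>Basis. (v \<bullet> e) *\<^sub>R e]"
      by (simp_all add: euclidean_representation)
    then have "\<beta> [u, v] = (\<Sum>e\<in>Basis. (v \<bullet> e) * \<beta> [u, e])" "\<theta> [v] = (\<Sum>e\<in>Basis. (v \<bullet> e) * \<theta> [e])"
      by (simp_all add: linear_sum[OF lin(1)] linear_scale[OF lin(1)] linear_sum[OF lin(2)] linear_scale[OF lin(2)])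
    then show ?thesis
      by (simp add: G_def inner_sum_left inner_add_left inner_commute[of v] algebra_simps sum.distrib sum_distrib_left)
  qed
  have linG: "linear G"
    by (rule linearI)
      (simp_all add: G_def linear_add[OF lin(1)] linear_add[OF lin(3)] linear_scale[OF lin(1)] linear_scale[OF lin(3)]
        algebra_simps sum.distrib scaleR_sum_right)
  have "inj G"
    unfolding linear_injective_0[OF linG]
  proof (intro allI impI)
    fix u assume "G u = 0"
    then have "\<beta> [u, v] + \<theta> [u] * \<theta> [v] = 0" for v using G[of u v] by simp
    then show "u = 0" by (rule contact_nondegenerate[OF assms(1)])
  qed
  then have "surj G" using linear_injective_imp_surjective linG by blast
  then obtain u where u: "G u = (\<Sum>e\<in>Basis. g e *\<^sub>R e)" by (metis surjD)
  have "\<beta> [u, v] + \<theta> [u] * \<theta> [v] = g v" for v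
  proof -
    have "g v = g (\<Sum>e\<in>Basis. (v \<bullet> e) *\<^sub>R e)" by (simp add: euclidean_representation)
    then show ?thesis
      using G[of u v] by (simp add: u inner_sum_left inner_commute[of v] linear_sum[OF assms(2)] linear_scale[OF assms(2)] mult.commute)
  qed
  moreover have "w = u" if "\<forall>v. \<beta> [w, v] + \<theta> [w] * \<theta> [v] = g v" "\<forall>v. \<beta> [u, v] + \<theta> [u] * \<theta> [v] = g v" for w u
  proof -
    have "\<beta> [w - u, v] + \<theta> [w - u] * \<theta> [v] = 0" for v
      using that[rule_format, of v] by (simp add: linear_diff[OF lin(1)] linear_diff[OF lin(3)] algebra_simps)
    then show ?thesis using contact_nondegenerate[OF assms(1)] by fastforce
  qed
  ultimately show ?thesis by blast
qed

lemma sharp_eq: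
  assumes "contact_pair n \<theta> \<beta>" "linear g"
  shows "\<beta> [sharp \<theta> \<beta> g, v] + \<theta> [sharp \<theta> \<beta> g] * \<theta> [v] = g v"
  using theI'[OF sharp_ex1[OF assms]] by (simp add: sharp_def)

lemma sharp_eqI:
  assumes "contact_pair n \<theta> \<beta>" "linear g" "\<And>v. \<beta> [u, v] + \<theta> [u] * \<theta> [v] = g v"
  shows "sharp \<theta> \<beta> g = u"
  unfolding sharp_def using the1_equality[OF sharp_ex1[OF assms(1,2)]] assms(3) by blast

lemma reeb:
  assumes "contact_pair n \<theta> \<beta>"
  shows "\<theta> [reeb \<theta> \<beta>] = 1" "\<beta> [reeb \<theta> \<beta>, v] = 0"
proof -
  have alt: "alternating 1 \<theta>" "alternating 2 \<beta>" using assms(1) by (auto simp: contact_pair_def)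
  let ?R = "reeb \<theta> \<beta>"
  have eq: "\<beta> [?R, v] + \<theta> [?R] * \<theta> [v] = \<theta> [v]" for v
    using sharp_eq[OF assms linear_alternating_1[OF alt(1)]] by (simp add: reeb_def)
  have "\<theta> [?R] \<noteq> 0"
  proof
    assume 0: "\<theta> [?R] = 0"
    then have "?R = 0" using assms eq unfolding contact_pair_def by (metis add.right_neutral mult_zero_left)
    then have "\<theta> [v] = 0" for v
      using eq[of v] linear_0[OF linear_alternating_2(2)[OF alt(2)]] 0 by simp
    then have "\<theta> = 0"
      using one_form_of_alternating[OF alt(1)] by (auto simp: one_form_of_def fun_eq_iff zero_fun_apply)
    then show False using assms by (simp add: contact_pair_def)
  qed
  moreover have "\<beta> [?R, ?R] = 0" using alt by (simp add: alternating_def)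
  ultimately show 1: "\<theta> [?R] = 1" using eq[of ?R] by simp
  show "\<beta> [?R, v] = 0" using eq[of v] 1 by simp
qed

lemma reeb_eqI:
  assumes "contact_pair n \<theta> \<beta>" "\<theta> [u] = 1" "\<And>v. \<beta> [u, v] = 0"
  shows "reeb \<theta> \<beta> = u"
  unfolding reeb_def
  using assms linear_alternating_1 by (intro sharp_eqI[OF assms(1)]) (auto simp: contact_pair_def)

lemma contract_reeb:
  assumes "contact_pair n \<theta> \<beta>"
  shows "contract (reeb \<theta> \<beta>) \<beta> = 0"
proof (rule list_fun_eqI)
  have alt: "alternating 2 \<beta>" using assms(1) by (auto simp: contact_pair_def)
  then show "contract (reeb \<theta> \<beta>) \<beta> [] = 0 []" by (simp add: contract_def alternating_def zero_fun_apply)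
  have "contract v (contract (reeb \<theta> \<beta>) \<beta>) = scalar_form (\<beta> [reeb \<theta> \<beta>, v])" for v
    using alternating_contract[of 1 \<beta> "reeb \<theta> \<beta>"] alt
    by (subst contract_1) (simp_all add: numeral_2_eq_2 contract_def)
  then show "contract v (contract (reeb \<theta> \<beta>) \<beta>) = contract v 0" for v
    using reeb(2)[OF assms] by (simp add: fun_eq_iff scalar_form_def zero_fun_apply)
qed

text \<open>The vector solves a linear system with smooth coefficients, one equation for each
  \<open>v\<close>. \<open>smooth_linear_solution\<close> asks only for uniqueness at the point,
  which is nondegeneracy.\<close>

lemma smooth_on_sharp:
  fixes \<theta> \<beta> :: "'e::euclidean_space \<Rightarrow> 'e list \<Rightarrow> real"
  assumes op: "open S" and sm: "smooth_field S \<theta>" "smooth_field S \<beta>"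
    and pair: "\<And>y. y \<in> S \<Longrightarrow> contact_pair n (\<theta> y) (\<beta> y)"
    and g: "\<And>v. smooth_on S (\<lambda>y. g y v)" "\<And>y. y \<in> S \<Longrightarrow> linear (g y)"
  shows "smooth_on S (\<lambda>y. sharp (\<theta> y) (\<beta> y) (g y))"
proof (rule smooth_on_local)
  fix x assume x: "x \<in> S"
  let ?u = "\<lambda>y. sharp (\<theta> y) (\<beta> y) (g y)"
  have lin: "linear (\<lambda>v. \<theta> y [v])" "linear (\<lambda>v. \<beta> y [v, w])" if "y \<in> S" for y w
    using pair[OF that] linear_alternating_1 linear_alternating_2 by (auto simp: contact_pair_def)
  have exp: "(\<Sum>e\<in>Basis. (\<beta> y [e, v] + \<theta> y [e] * \<theta> y [v]) * (u \<bullet> e)) = \<beta> y [u, v] + \<theta> y [u] * \<theta> y [v]"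
    if y: "y \<in> S" for y u v
  proof -
    have "\<beta> y [u, v] = \<beta> y [\<Sum>e\<in>Basis. (u \<bullet> e) *\<^sub>R e, v]" "\<theta> y [u] = \<theta> y [\<Sum>e\<in>Basis. (u \<bullet> e) *\<^sub>R e]"
      by (simp_all add: euclidean_representation)
    then have "\<beta> y [u, v] = (\<Sum>e\<in>Basis. (u \<bullet> e) * \<beta> y [e, v])" "\<theta> y [u] = (\<Sum>e\<in>Basis. (u \<bullet> e) * \<theta> y [e])"
      by (simp_all add: linear_sum[OF lin(1)[OF y]] linear_scale[OF lin(1)[OF y]]
          linear_sum[OF lin(2)[OF y]] linear_scale[OF lin(2)[OF y]])
    then show ?thesis by (simp add: algebra_simps sum.distrib sum_distrib_left)
  qed
  have "\<exists>S'. open S' \<and> x \<in> S' \<and> S' \<subseteq> S \<and> (\<forall>e\<in>Basis. smooth_on S' (\<lambda>y. ?u y \<bullet> e))"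
  proof (rule smooth_linear_solution[OF finite_Basis op x, of UNIV])
    show "smooth_on S (\<lambda>y. \<beta> y [e, v] + \<theta> y [e] * \<theta> y [v])" for e v
      by (intro smooth_on_add[OF op] smooth_on_mult[OF op] smooth_fieldD sm)
    show "smooth_on S (\<lambda>y. g y v)" for v using g by blast
    show "(\<Sum>e\<in>Basis. (\<beta> y [e, v] + \<theta> y [e] * \<theta> y [v]) * (?u y \<bullet> e)) = g y v" if "y \<in> S" for y v
      using exp[OF that] sharp_eq[OF pair[OF that] g(2)[OF that]] by simp
    fix s and e :: 'e
    assume s: "\<forall>v\<in>UNIV. (\<Sum>e\<in>Basis. (\<beta> x [e, v] + \<theta> x [e] * \<theta> x [v]) * s e) = 0" and e: "e \<in> Basis"
    define u where "u = (\<Sum>e\<in>Basis. s e *\<^sub>R e)"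
    have ue: "u \<bullet> e = s e" if "e \<in> Basis" for e using that by (simp add: u_def)
    have "\<beta> x [u, v] + \<theta> x [u] * \<theta> x [v] = 0" for v
    proof -
      have "\<beta> x [u, v] + \<theta> x [u] * \<theta> x [v] = (\<Sum>e\<in>Basis. (\<beta> x [e, v] + \<theta> x [e] * \<theta> x [v]) * (u \<bullet> e))"
        by (rule exp[OF x, symmetric])
      also have "\<dots> = (\<Sum>e\<in>Basis. (\<beta> x [e, v] + \<theta> x [e] * \<theta> x [v]) * s e)"
        by (rule sum.cong) (simp_all add: ue)
      finally show ?thesis using s by simp
    qed
    then have "u = 0" by (rule contact_nondegenerate[OF pair[OF x]])
    then show "s e = 0" using ue[OF e] by simp
  qed
  then obtain S' where "open S'" "x \<in> S'" "\<forall>e\<in>Basis. smooth_on S' (\<lambda>y. ?u y \<bullet> e)" by blast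
  moreover from this have "smooth_on S' ?u"
    by (rule_tac smooth_on_componentwise) auto
  ultimately show "\<exists>T. open T \<and> x \<in> T \<and> smooth_on T ?u" by blast
qed

lemma smooth_on_reeb:
  fixes \<theta> \<beta> :: "'e::euclidean_space \<Rightarrow> 'e list \<Rightarrow> real"
  assumes "open S" "smooth_field S \<theta>" "smooth_field S \<beta>" "\<And>y. y \<in> S \<Longrightarrow> contact_pair n (\<theta> y) (\<beta> y)"
  shows "smooth_on S (\<lambda>y. reeb (\<theta> y) (\<beta> y))"
  unfolding reeb_def
proof (rule smooth_on_sharp[OF assms])
  show "smooth_on S (\<lambda>y. \<theta> y [v])" for v by (rule smooth_fieldD[OF assms(2)])
  show "linear (\<lambda>v. \<theta> y [v])" if "y \<in> S" for y
    using assms(4)[OF that] linear_alternating_1[of "\<theta> y"] by (simp add: contact_pair_def)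
qed

text \<open>Euler's identity for horizontal forms. The vectors \<open>u i\<close> need not be
  independent, only resolve the projection along \<open>R\<close>; so projections of the ambient
  basis can serve instead of a basis of the kernel.\<close>

lemma sum_wedge_contract:
  assumes "alternating k \<alpha>" "contract R \<alpha> = 0" "\<And>v. (\<Sum>i\<in>I. g i v *\<^sub>R u i) = v - \<theta> v *\<^sub>R R"
  shows "(\<Sum>i\<in>I. wedge_alt (one_form_of (g i)) (contract (u i) \<alpha>)) = real k *\<^sub>R \<alpha>"
  using assms(1,2)
proof (induction k arbitrary: \<alpha>)
  case 0
  then show ?case by (simp add: alternating_0_iff of_degree_0_contract)
next
  case (Suc k)
  show ?case
  proof (rule list_fun_eqI)
    show "(\<Sum>i\<in>I. wedge_alt (one_form_of (g i)) (contract (u i) \<alpha>)) [] = (real (Suc k) *\<^sub>R \<alpha>) []"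
      using Suc.prems(1) by (simp add: fun_simps alternating_def)
    fix v
    note lin = contract_linear[OF Suc.prems(1)]
    have IH: "(\<Sum>i\<in>I. wedge_alt (one_form_of (g i)) (contract (u i) (contract v \<alpha>))) = real k *\<^sub>R contract v \<alpha>"
      using alternating_contract[OF Suc.prems(1)] contract_anticommute[OF Suc.prems(1), of R v] Suc.prems(2)
      by (intro Suc.IH) simp_all
    have "contract v (\<Sum>i\<in>I. wedge_alt (one_form_of (g i)) (contract (u i) \<alpha>))
      = (\<Sum>i\<in>I. g i v *\<^sub>R contract (u i) \<alpha>) + (\<Sum>i\<in>I. wedge_alt (one_form_of (g i)) (contract (u i) (contract v \<alpha>)))"
      unfolding contract_sum contract_wedge contract_one_form_of parity_one_form_of wedge_scalar_left
        contract_anticommute[OF Suc.prems(1), of v] wedge_alt_minus_left wedge_alt_minus_right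
      by (simp add: sum.distrib)
    also have "(\<Sum>i\<in>I. g i v *\<^sub>R contract (u i) \<alpha>) = contract (\<Sum>i\<in>I. g i v *\<^sub>R u i) \<alpha>"
      by (simp add: linear_sum[OF lin] linear_scale[OF lin])
    also have "\<dots> = contract v \<alpha>" by (simp add: assms(3) linear_diff[OF lin] linear_scale[OF lin] Suc.prems(2))
    finally show "contract v (\<Sum>i\<in>I. wedge_alt (one_form_of (g i)) (contract (u i) \<alpha>))
      = contract v (real (Suc k) *\<^sub>R \<alpha>)" by (simp add: IH algebra_simps)
  qed
qed

primrec wpow :: "('e list \<Rightarrow> real) \<Rightarrow> nat \<Rightarrow> 'e list \<Rightarrow> real" where
  "wpow \<beta> 0 = scalar_form 1"
| "wpow \<beta> (Suc m) = wedge_alt \<beta> (wpow \<beta> m)"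

lemma alternating_wpow: "alternating 2 \<beta> \<Longrightarrow> alternating (2 * m) (wpow \<beta> m)"
proof (induction m)
  case (Suc m)
  then show ?case using alternating_wedge[of 2 \<beta> "2 * m" "wpow \<beta> m"] by simp
qed simp

lemma wedge_even_comm:
  assumes "alternating (2 * m) \<beta>" "alternating k \<alpha>"
  shows "wedge_alt \<beta> \<alpha> = wedge_alt \<alpha> \<beta>"
  using wedge_alt_comm[OF assms[THEN alternating_of_degree]] by simp

lemma wedge_2_comm: "alternating 2 \<beta> \<Longrightarrow> alternating k \<alpha> \<Longrightarrow> wedge_alt \<beta> \<alpha> = wedge_alt \<alpha> \<beta>"
  using wedge_even_comm[of 1 \<beta> k \<alpha>] by simp

lemma wedge_1_1_comm:
  "alternating 1 \<theta> \<Longrightarrow> alternating 1 \<phi> \<Longrightarrow> wedge_alt \<theta> \<phi> = - wedge_alt \<phi> \<theta>"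
  using wedge_alt_comm[of 1 \<theta> 1 \<phi>] alternating_of_degree by force

lemma wpow_Suc_right: "alternating 2 \<beta> \<Longrightarrow> wpow \<beta> (Suc m) = wedge_alt (wpow \<beta> m) \<beta>"
  using wedge_2_comm[OF _ alternating_wpow] by simp

lemma contract_2: "alternating 2 \<beta> \<Longrightarrow> contract u \<beta> = one_form_of (\<lambda>v. \<beta> [u, v])"
  using alternating_contract[of 1 \<beta> u] one_form_of_alternating[of "contract u \<beta>"]
  by (simp add: numeral_2_eq_2 contract_def)

lemma parity_2: "alternating 2 \<beta> \<Longrightarrow> parity \<beta> = \<beta>"
  using alternating_parity[of 2 \<beta>] by simp

lemma contract_wpow: "alternating 2 \<beta> \<Longrightarrow> contract R \<beta> = 0 \<Longrightarrow> contract R (wpow \<beta> m) = 0"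
  by (induction m) (simp_all add: contract_wedge)

lemma pullback_wpow: "pullback A (wpow \<beta> m) = wpow (pullback A \<beta>) m"
  by (induction m) (simp_all add: pullback_wedge)

lemma smooth_field_wpow:
  "open S \<Longrightarrow> smooth_field S \<beta> \<Longrightarrow> smooth_field S (\<lambda>y. wpow (\<beta> y) m)"
  by (induction m) (auto intro: smooth_field_wedge)

section \<open>The dual Lefschetz operator at a point\<close>

definition proj :: "('e::euclidean_space list \<Rightarrow> real) \<Rightarrow> ('e list \<Rightarrow> real) \<Rightarrow> 'e \<Rightarrow> 'e" where
  "proj \<theta> \<beta> v = v - \<theta> [v] *\<^sub>R reeb \<theta> \<beta>"

text \<open>The family dual under \<open>\<beta>\<close> to the projected basis vectors. It has one
  member more than the dimension of the kernel of \<theta>, but it is globally defined and smooth in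
  \<theta> and \<open>\<beta>\<close>, which a chosen symplectic basis would not be.\<close>

definition codual :: "('e::euclidean_space list \<Rightarrow> real) \<Rightarrow> ('e list \<Rightarrow> real) \<Rightarrow> 'e \<Rightarrow> 'e" where
  "codual \<theta> \<beta> e = sharp \<theta> \<beta> (\<lambda>v. - (e \<bullet> proj \<theta> \<beta> v))"

text \<open>Contraction with the bivector inverse to \<open>\<beta>\<close>. It is twice the usual
  dual Lefschetz operator, so \<open>op_\<Lambda>\<close> halves it.\<close>

definition dual_L :: "('e::euclidean_space list \<Rightarrow> real) \<Rightarrow> ('e list \<Rightarrow> real) \<Rightarrow> ('e list \<Rightarrow> real) \<Rightarrow> 'e list \<Rightarrow> real" where
  "dual_L \<theta> \<beta> \<alpha> = (\<Sum>e\<in>Basis. contract (codual \<theta> \<beta> e) (contract (proj \<theta> \<beta> e) \<alpha>))"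

lemma dual_L_linear:
  "dual_L \<theta> \<beta> (\<alpha> + \<alpha>') = dual_L \<theta> \<beta> \<alpha> + dual_L \<theta> \<beta> \<alpha>'"
  "dual_L \<theta> \<beta> (r *\<^sub>R \<alpha>) = r *\<^sub>R dual_L \<theta> \<beta> \<alpha>"
  "dual_L \<theta> \<beta> 0 = 0"
  by (simp_all add: dual_L_def sum.distrib scaleR_sum_right)

lemma field_apply:
  fixes \<alpha> \<beta> :: "'e \<Rightarrow> 'd list \<Rightarrow> real"
  shows "(\<alpha> + \<beta>) y = \<alpha> y + \<beta> y" "(\<alpha> - \<beta>) y = \<alpha> y - \<beta> y" "(r *\<^sub>R \<alpha>) y = r *\<^sub>R \<alpha> y"
    "(0 :: 'e \<Rightarrow> 'd list \<Rightarrow> real) y = 0"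
  by (simp_all add: fun_simps zero_fun_apply)

context
  fixes n and \<theta> \<beta> :: "'e::euclidean_space list \<Rightarrow> real"
  assumes pair: "contact_pair n \<theta> \<beta>"
begin

lemma alt1: "alternating 1 \<theta>" and alt2: "alternating 2 \<beta>" and DIM: "DIM('e) = 2 * n + 1"
  using pair by (auto simp: contact_pair_def)

lemmas lin1 = linear_alternating_1[OF alt1]
lemmas lin2 = linear_alternating_2[OF alt2]

lemma beta_swap: "\<beta> [u, v] = - \<beta> [v, u]"
  by (rule alternating_swap[OF alt2])

lemma linear_proj: "linear (proj \<theta> \<beta>)"
  by (rule linearI)
    (simp_all add: proj_def linear_add[OF lin1] linear_scale[OF lin1] algebra_simps)

lemma theta_proj: "\<theta> [proj \<theta> \<beta> v] = 0"
  by (simp add: proj_def linear_diff[OF lin1] linear_scale[OF lin1] reeb[OF pair])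

lemma beta_proj: "\<beta> [proj \<theta> \<beta> u, v] = \<beta> [u, v]" "\<beta> [v, proj \<theta> \<beta> u] = \<beta> [v, u]"
proof -
  show 1: "\<beta> [proj \<theta> \<beta> u, v] = \<beta> [u, v]" for u v
    by (simp add: proj_def linear_diff[OF lin2(2)] linear_scale[OF lin2(2)] reeb[OF pair])
  show "\<beta> [v, proj \<theta> \<beta> u] = \<beta> [v, u]"
    using 1[of u v] beta_swap[of v] by simp
qed

lemma proj_proj: "proj \<theta> \<beta> (proj \<theta> \<beta> v) = proj \<theta> \<beta> v"
  by (subst proj_def) (simp add: theta_proj)

lemma codual:
  "\<theta> [codual \<theta> \<beta> e] = 0" "\<beta> [codual \<theta> \<beta> e, v] = - (e \<bullet> proj \<theta> \<beta> v)"
proof -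
  have lin: "linear (\<lambda>v. - (e \<bullet> proj \<theta> \<beta> v))"
    by (rule linearI) (simp_all add: linear_add[OF linear_proj] linear_scale[OF linear_proj] inner_add_right)
  note eq = sharp_eq[OF pair lin, folded codual_def]
  have "proj \<theta> \<beta> (reeb \<theta> \<beta>) = 0" by (simp add: proj_def reeb[OF pair])
  then show 1: "\<theta> [codual \<theta> \<beta> e] = 0"
    using eq[of "reeb \<theta> \<beta>"] beta_swap[of _ "reeb \<theta> \<beta>"] by (simp add: reeb[OF pair])
  show "\<beta> [codual \<theta> \<beta> e, v] = - (e \<bullet> proj \<theta> \<beta> v)" using eq[of v] 1 by simp
qed

lemma sum_inner_proj: "(\<Sum>e\<in>Basis. (e \<bullet> proj \<theta> \<beta> v) *\<^sub>R proj \<theta> \<beta> e) = proj \<theta> \<beta> v"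
proof -
  have "proj \<theta> \<beta> (proj \<theta> \<beta> v) = proj \<theta> \<beta> (\<Sum>e\<in>Basis. (proj \<theta> \<beta> v \<bullet> e) *\<^sub>R e)"
    by (simp add: euclidean_representation)
  then show ?thesis
    by (simp add: proj_proj linear_sum[OF linear_proj] linear_scale[OF linear_proj] inner_commute)
qed

text \<open>Both sides lie in the kernel of \<theta> and pair under \<open>\<beta>\<close> alike
  with every vector, so nondegeneracy identifies them.\<close>

lemma sum_beta_codual: "(\<Sum>e\<in>Basis. \<beta> [proj \<theta> \<beta> e, v] *\<^sub>R codual \<theta> \<beta> e) = proj \<theta> \<beta> v"
proof -
  let ?u = "(\<Sum>e\<in>Basis. \<beta> [proj \<theta> \<beta> e, v] *\<^sub>R codual \<theta> \<beta> e) - proj \<theta> \<beta> v"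
  have t: "\<theta> [?u] = 0"
    by (simp add: linear_diff[OF lin1] linear_sum[OF lin1] linear_scale[OF lin1] codual theta_proj)
  have "\<beta> [?u, w] + \<theta> [?u] * \<theta> [w] = 0" for w
  proof -
    have "\<beta> [\<Sum>e\<in>Basis. \<beta> [proj \<theta> \<beta> e, v] *\<^sub>R codual \<theta> \<beta> e, w]
      = - (\<Sum>e\<in>Basis. (e \<bullet> proj \<theta> \<beta> w) * \<beta> [proj \<theta> \<beta> e, v])"
      by (simp add: linear_sum[OF lin2(2)] linear_scale[OF lin2(2)] codual sum_negf mult.commute)
    also have "\<dots> = - \<beta> [\<Sum>e\<in>Basis. (e \<bullet> proj \<theta> \<beta> w) *\<^sub>R proj \<theta> \<beta> e, v]"
      by (simp add: linear_sum[OF lin2(2)] linear_scale[OF lin2(2)])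
    also have "\<dots> = \<beta> [proj \<theta> \<beta> v, w]"
      using beta_swap[of w v] by (simp add: sum_inner_proj beta_proj)
    finally show ?thesis by (simp only: t linear_diff[OF lin2(2)] diff_self mult_zero_left add_0_right)
  qed
  then show ?thesis using contact_nondegenerate[OF pair] by fastforce
qed

text \<open>The sum is the trace of the projection onto the kernel of \<theta>: the dimension
  \<open>2 * n + 1\<close> minus the value 1 of \<theta> on the Reeb vector.\<close>

lemma trace_codual: "(\<Sum>e\<in>Basis. \<beta> [proj \<theta> \<beta> e, codual \<theta> \<beta> e]) = 2 * real n"
proof -
  have "\<theta> [reeb \<theta> \<beta>] = \<theta> [\<Sum>e\<in>Basis. (reeb \<theta> \<beta> \<bullet> e) *\<^sub>R e]" by (simp add: euclidean_representation)
  then have 1: "(\<Sum>e\<in>Basis. (reeb \<theta> \<beta> \<bullet> e) * \<theta> [e]) = 1"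
    by (simp add: linear_sum[OF lin1] linear_scale[OF lin1] reeb[OF pair])
  have "(\<Sum>e\<in>Basis. \<beta> [proj \<theta> \<beta> e, codual \<theta> \<beta> e]) = (\<Sum>e\<in>Basis. e \<bullet> proj \<theta> \<beta> e)"
    by (rule sum.cong) (simp_all add: beta_swap[of "proj \<theta> \<beta> _"] codual proj_proj)
  also have "\<dots> = (\<Sum>e\<in>Basis. 1 - (reeb \<theta> \<beta> \<bullet> e) * \<theta> [e])"
    by (rule sum.cong) (simp_all add: proj_def inner_diff_right inner_commute)
  also have "\<dots> = 2 * real n" by (simp add: sum_subtractf 1 DIM)
  finally show ?thesis .
qed

text \<open>Two contractions of the product hit \<open>\<beta>\<close> twice, once, or not at all.
  The first case gives the trace \<open>2 * n\<close>, the two mixed terms are Euler sums equal to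
  \<open>k\<close> times \<open>\<alpha>\<close>, and the last is the product of
  \<open>\<beta>\<close> with \<open>dual_L\<close>.\<close>

lemma dual_L_commutator:
  assumes "alternating k \<alpha>" "contract (reeb \<theta> \<beta>) \<alpha> = 0"
  shows "dual_L \<theta> \<beta> (wedge_alt \<beta> \<alpha>) = wedge_alt \<beta> (dual_L \<theta> \<beta> \<alpha>) + (2 * (real n - real k)) *\<^sub>R \<alpha>"
proof -
  have contr: "contract (codual \<theta> \<beta> e) (contract (proj \<theta> \<beta> e) (wedge_alt \<beta> \<alpha>))
    = \<beta> [proj \<theta> \<beta> e, codual \<theta> \<beta> e] *\<^sub>R \<alpha>
      - wedge_alt (one_form_of (\<lambda>v. \<beta> [proj \<theta> \<beta> e, v])) (contract (codual \<theta> \<beta> e) \<alpha>)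
      - wedge_alt (one_form_of (\<lambda>v. e \<bullet> proj \<theta> \<beta> v)) (contract (proj \<theta> \<beta> e) \<alpha>)
      + wedge_alt \<beta> (contract (codual \<theta> \<beta> e) (contract (proj \<theta> \<beta> e) \<alpha>))" for e
  proof -
    have "one_form_of (\<lambda>v. - (e \<bullet> proj \<theta> \<beta> v)) = - one_form_of (\<lambda>v. e \<bullet> proj \<theta> \<beta> v)"
      by (rule ext) (simp add: one_form_of_def uminus_apply)
    then show ?thesis
      by (simp add: contract_wedge parity_2[OF alt2] contract_2[OF alt2] contract_one_form_of
          parity_one_form_of codual wedge_alt_minus_left)
  qed
  have 1: "(\<Sum>e\<in>Basis. wedge_alt (one_form_of (\<lambda>v. \<beta> [proj \<theta> \<beta> e, v])) (contract (codual \<theta> \<beta> e) \<alpha>)) = real k *\<^sub>R \<alpha>"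
    by (rule sum_wedge_contract[OF assms, of _ _ _ "\<lambda>v. \<theta> [v]"]) (simp only: sum_beta_codual, simp only: proj_def)
  have 2: "(\<Sum>e\<in>Basis. wedge_alt (one_form_of (\<lambda>v. e \<bullet> proj \<theta> \<beta> v)) (contract (proj \<theta> \<beta> e) \<alpha>)) = real k *\<^sub>R \<alpha>"
    by (rule sum_wedge_contract[OF assms, of _ _ _ "\<lambda>v. \<theta> [v]"]) (simp only: sum_inner_proj, simp only: proj_def)
  have "dual_L \<theta> \<beta> (wedge_alt \<beta> \<alpha>) = (\<Sum>e\<in>Basis. \<beta> [proj \<theta> \<beta> e, codual \<theta> \<beta> e]) *\<^sub>R \<alpha> - real k *\<^sub>R \<alpha> - real k *\<^sub>R \<alpha>
    + wedge_alt \<beta> (dual_L \<theta> \<beta> \<alpha>)"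
    by (simp add: dual_L_def contr sum.distrib sum_subtractf 1 2 scaleR_sum_left wedge_alt_sum_right)
  moreover have "(2 * (real n - real k)) *\<^sub>R \<alpha> = (2 * real n) *\<^sub>R \<alpha> - real k *\<^sub>R \<alpha> - real k *\<^sub>R \<alpha>"
    by (simp flip: scaleR_diff_left)
  ultimately show ?thesis by (simp add: trace_codual)
qed

end

section \<open>The Lefschetz isomorphism on smooth fields\<close>

locale contact_field =
  fixes S :: "'e::euclidean_space set" and n and \<theta> \<beta> :: "'e \<Rightarrow> 'e list \<Rightarrow> real"
  assumes op: "open S"
    and sm1: "smooth_field S \<theta>" and sm2: "smooth_field S \<beta>"
    and pair: "y \<in> S \<Longrightarrow> contact_pair n (\<theta> y) (\<beta> y)"
begin

abbreviation "R \<equiv> \<lambda>y. reeb (\<theta> y) (\<beta> y)"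

lemma smooth_R: "smooth_on S R"
  by (rule smooth_on_reeb[OF op sm1 sm2 pair])

lemma smooth_proj: "smooth_on S (\<lambda>y. proj (\<theta> y) (\<beta> y) v)"
  unfolding proj_def
  by (intro smooth_on_diff[OF op] smooth_on_const smooth_on_scaleR[OF op] smooth_R smooth_fieldD sm1)

lemma smooth_codual: "smooth_on S (\<lambda>y. codual (\<theta> y) (\<beta> y) e)"
  unfolding codual_def
proof (rule smooth_on_sharp[OF op sm1 sm2 pair])
  show "smooth_on S (\<lambda>y. - (e \<bullet> proj (\<theta> y) (\<beta> y) v))" for v
    by (intro smooth_on_minus[OF op] smooth_on_inner[OF op] smooth_on_const smooth_proj)
  show "linear (\<lambda>v. - (e \<bullet> proj (\<theta> y) (\<beta> y) v))" if "y \<in> S" for y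
    using linear_proj[OF pair[OF that]]
    by (auto intro!: linearI simp: linear_add linear_scale inner_add_right)
qed

text \<open>Extension by zero off \<open>S\<close> makes a field determined by its values on
  \<open>S\<close>, so that the equalities of the abstract locale become equalities of
  functions.\<close>

definition horizontal :: "nat \<Rightarrow> ('e \<Rightarrow> 'e list \<Rightarrow> real) set" where
  "horizontal k = {\<alpha>. smooth_field S \<alpha> \<and> (\<forall>y. y \<notin> S \<longrightarrow> \<alpha> y = 0) \<and>
     (\<forall>y\<in>S. alternating k (\<alpha> y) \<and> contract (R y) (\<alpha> y) = 0)}"

definition op_L :: "('e \<Rightarrow> 'e list \<Rightarrow> real) \<Rightarrow> 'e \<Rightarrow> 'e list \<Rightarrow> real" where
  "op_L \<alpha> = (\<lambda>y. wedge_alt (\<beta> y) (\<alpha> y))"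

definition op_\<Lambda> :: "('e \<Rightarrow> 'e list \<Rightarrow> real) \<Rightarrow> 'e \<Rightarrow> 'e list \<Rightarrow> real" where
  "op_\<Lambda> \<alpha> = (\<lambda>y. (1/2) *\<^sub>R dual_L (\<theta> y) (\<beta> y) (\<alpha> y))"

text \<open>Multiplication by \<theta> pushes the degree beyond the dimension, and contraction with
  the Reeb vector recovers the horizontal form.\<close>

lemma horizontal_top:
  assumes "contact_pair n \<theta>' \<beta>'" "alternating k \<alpha>" "contract (reeb \<theta>' \<beta>') \<alpha> = 0" "2 * n < k"
  shows "\<alpha> = 0"
proof -
  have "alternating (1 + k) (wedge_alt \<theta>' \<alpha>)" using alternating_wedge[OF alt1[OF assms(1)] assms(2)] .
  then have "wedge_alt \<theta>' \<alpha> = 0" using alternating_above_DIM DIM[OF assms(1)] assms(4) by fastforce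
  then show ?thesis using contract_wedge_1[OF alt1[OF assms(1)], of "reeb \<theta>' \<beta>'" \<alpha>] assms(3)
    by (simp add: reeb[OF assms(1)])
qed

sublocale lefschetz horizontal op_L op_\<Lambda> n
proof (rule lefschetz.intro)
  show "subspace (horizontal k)" for k
    by (auto simp: subspace_def horizontal_def fun_simps zero_fun_apply
        intro: smooth_field_add[OF op] smooth_field_scaleR[OF op] alternating_add alternating_scaleR)
      (auto simp: smooth_field_def fun_simps zero_fun_apply intro: smooth_on_add[OF op] smooth_on_mult[OF op])
  show "linear op_L"
    by (rule linearI) (simp_all add: op_L_def fun_eq_iff[where f = "_ :: 'e \<Rightarrow> 'e list \<Rightarrow> real"] field_apply  wedge_alt_linear)
  show "linear op_\<Lambda>"
    by (rule linearI) (simp_all add: op_\<Lambda>_def fun_eq_iff[where f = "_ :: 'e \<Rightarrow> 'e list \<Rightarrow> real"] field_apply  dual_L_linear algebra_simps)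
  show "op_L \<alpha> \<in> horizontal (k + 2)" if "\<alpha> \<in> horizontal k" for \<alpha> k
    unfolding horizontal_def
  proof (intro CollectI conjI allI impI ballI)
    show "smooth_field S (op_L \<alpha>)"
      unfolding op_L_def using that by (intro smooth_field_wedge[OF op] sm2) (simp add: horizontal_def)
    show "op_L \<alpha> y = 0" if "y \<notin> S" for y
      using that \<open>\<alpha> \<in> horizontal k\<close> by (simp add: op_L_def horizontal_def)
    fix y assume y: "y \<in> S"
    then show "alternating (k + 2) (op_L \<alpha> y)"
      using that alternating_wedge[OF alt2[OF pair[OF y]], of k "\<alpha> y"]
      by (simp add: op_L_def horizontal_def add.commute)
    show "contract (R y) (op_L \<alpha> y) = 0"
      using that y by (simp add: op_L_def horizontal_def contract_wedge contract_reeb[OF pair[OF y]])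
  qed
  show "op_\<Lambda> \<alpha> \<in> horizontal k" if "\<alpha> \<in> horizontal (k + 2)" for \<alpha> k
    unfolding horizontal_def
  proof (intro CollectI conjI allI impI ballI)
    have a: "smooth_field S \<alpha>" "\<And>y. y \<in> S \<Longrightarrow> alternating (Suc (Suc k)) (\<alpha> y)" using that by (auto simp: horizontal_def)
    show "smooth_field S (op_\<Lambda> \<alpha>)"
      unfolding op_\<Lambda>_def dual_L_def
      by (intro smooth_field_scaleR[OF op] smooth_on_const smooth_field_sum[OF op]
          smooth_field_contract_smooth[OF op _ _ smooth_codual, of _ "Suc k"]
          smooth_field_contract_smooth[OF op _ _ smooth_proj, of _ "Suc (Suc k)"] a alternating_contract)
    show "op_\<Lambda> \<alpha> y = 0" if "y \<notin> S" for y
      using that \<open>\<alpha> \<in> horizontal (k + 2)\<close> by (simp add: op_\<Lambda>_def horizontal_def dual_L_linear)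
    fix y assume y: "y \<in> S"
    show "alternating k (op_\<Lambda> \<alpha> y)"
      using a(2)[OF y] by (simp add: op_\<Lambda>_def dual_L_def alternating_scaleR alternating_sum alternating_contract)
    have "contract (R y) (contract v (contract u (\<alpha> y))) = 0" for u v
      using that y contract_anticommute[OF alternating_contract[OF a(2)[OF y]], of "R y" v u]
        contract_anticommute[OF a(2)[OF y], of "R y" u]
      by (simp add: horizontal_def)
    then show "contract (R y) (op_\<Lambda> \<alpha> y) = 0" by (simp add: op_\<Lambda>_def dual_L_def contract_sum)
  qed
  show "op_\<Lambda> \<alpha> = 0" if "\<alpha> \<in> horizontal k" "k < 2" for \<alpha> k
  proof
    fix y
    have "contract v (contract u (\<alpha> y)) = 0" if "y \<in> S" for u v
    proof -
      have "alternating 0 (contract u (\<alpha> y))"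
        using \<open>\<alpha> \<in> horizontal k\<close> \<open>k < 2\<close> that alternating_contract'[of k "\<alpha> y" u]
        by (cases "k = 0") (auto simp: horizontal_def less_2_cases_iff)
      then show ?thesis by (simp add: alternating_0_iff of_degree_0_contract)
    qed
    then show "op_\<Lambda> \<alpha> y = 0 y"
      using that by (cases "y \<in> S") (auto simp: op_\<Lambda>_def dual_L_def horizontal_def field_apply)
  qed
  show "\<alpha> = 0" if "\<alpha> \<in> horizontal k" "2 * n < k" for \<alpha> k
  proof
    fix y show "\<alpha> y = 0 y"
      using that horizontal_top[OF pair, of y k "\<alpha> y"]
      by (cases "y \<in> S") (auto simp: horizontal_def field_apply)
  qed
  show "op_\<Lambda> (op_L \<alpha>) = op_L (op_\<Lambda> \<alpha>) + (real n - real k) *\<^sub>R \<alpha>" if "\<alpha> \<in> horizontal k" for \<alpha> k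
  proof
    fix y
    show "op_\<Lambda> (op_L \<alpha>) y = (op_L (op_\<Lambda> \<alpha>) + (real n - real k) *\<^sub>R \<alpha>) y"
      using that dual_L_commutator[OF pair, of y k "\<alpha> y"]
      by (cases "y \<in> S")
        (auto simp: op_\<Lambda>_def op_L_def horizontal_def dual_L_linear wedge_alt_linear scaleR_add_right
          field_apply )
  qed
qed

lemma op_L_pow: "(op_L ^^ m) \<alpha> y = wedge_alt (wpow (\<beta> y) m) (\<alpha> y)"
  by (induction m arbitrary: y) (simp_all add: op_L_def wedge_alt_assoc)

text \<open>Abstract surjectivity, applied to the space of smooth fields, yields a single smooth
  cofactor on all of \<open>S\<close>.\<close>

lemma lefschetz_field:
  assumes "j \<le> n" "smooth_field S \<alpha>" "\<And>y. y \<in> S \<Longrightarrow> alternating (2 * n - j) (\<alpha> y)"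
  shows "\<exists>\<xi>. smooth_field S \<xi> \<and> (\<forall>y\<in>S. alternating j (\<xi> y) \<and> contract (R y) (\<xi> y) = 0 \<and>
    wedge_alt (\<theta> y) (\<alpha> y) = wedge_alt (wedge_alt (\<theta> y) (\<xi> y)) (wpow (\<beta> y) (n - j)))"
proof -
  \<comment> \<open>The horizontal part of \<open>\<alpha>\<close>, which differs from
    \<open>\<alpha>\<close> by a multiple of \<theta> and so has the same product with
    \<theta>.\<close>
  define \<alpha>' where "\<alpha>' = (\<lambda>y. if y \<in> S then contract (R y) (wedge_alt (\<theta> y) (\<alpha> y)) else 0)"
  have alt: "alternating (Suc (2 * n - j)) (wedge_alt (\<theta> y) (\<alpha> y))" if "y \<in> S" for y
    using alternating_wedge[OF alt1[OF pair[OF that]] assms(3)[OF that]] by simp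
  have "smooth_field S (\<lambda>y. contract (R y) (wedge_alt (\<theta> y) (\<alpha> y)))"
    by (rule smooth_field_contract_smooth[OF op smooth_field_wedge[OF op sm1 assms(2)] alt smooth_R])
  then have "smooth_field S \<alpha>'" by (rule smooth_field_cong[OF op]) (simp add: \<alpha>'_def)
  moreover have "contract (R y) (contract (R y) (wedge_alt (\<theta> y) (\<alpha> y))) = 0" if "y \<in> S" for y
    using contract_anticommute[OF alt[OF that], of "R y" "R y"] by (simp add: eq_neg_iff_add_eq_0 flip: scaleR_2)
  ultimately have "\<alpha>' \<in> horizontal (2 * n - j)"
    using alternating_contract[OF alt] by (auto simp: horizontal_def \<alpha>'_def)
  then obtain \<xi> where \<xi>: "\<xi> \<in> horizontal j" "(op_L ^^ (n - j)) \<xi> = \<alpha>'"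
    using L_pow_surjective[OF assms(1)] by blast
  have "wedge_alt (\<theta> y) (\<alpha> y) = wedge_alt (wedge_alt (\<theta> y) (\<xi> y)) (wpow (\<beta> y) (n - j))" if y: "y \<in> S" for y
  proof -
    note p = pair[OF y]
    have "wedge_alt (wedge_alt (\<theta> y) (\<xi> y)) (wpow (\<beta> y) (n - j)) = wedge_alt (\<theta> y) ((op_L ^^ (n - j)) \<xi> y)"
      using wedge_even_comm[OF alternating_wpow[OF alt2[OF p]], of j "\<xi> y"] \<xi>(1) y
      by (simp add: op_L_pow wedge_alt_assoc horizontal_def)
    also have "\<dots> = wedge_alt (\<theta> y) (\<alpha> y)"
      using y by (simp add: \<xi>(2) \<alpha>'_def contract_wedge_1[OF alt1[OF p]] reeb[OF p] wedge_alt_linear wedge_1_1_self[OF alt1[OF p]])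
    finally show ?thesis by simp
  qed
  then show ?thesis using \<xi>(1) by (intro exI[of _ \<xi>]) (auto simp: horizontal_def)
qed

lemma lefschetz_injective_field:
  assumes "j \<le> n" "\<xi> \<in> horizontal j"
    and "\<And>y. y \<in> S \<Longrightarrow> wedge_alt (wedge_alt (\<theta> y) (\<xi> y)) (wpow (\<beta> y) (n - j)) = 0"
  shows "\<xi> = 0"
proof (rule L_pow_injective[OF assms(1,2)])
  show "(op_L ^^ (n - j)) \<xi> = 0"
  proof
    fix y
    show "(op_L ^^ (n - j)) \<xi> y = 0 y"
    proof (cases "y \<in> S")
      case True
      note p = pair[OF True]
      let ?X = "wedge_alt (wpow (\<beta> y) (n - j)) (\<xi> y)"
      have "contract (R y) ?X = 0"
        using assms(2) True by (simp add: contract_wedge contract_wpow[OF alt2[OF p] contract_reeb[OF p]] horizontal_def)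
      moreover have "wedge_alt (\<theta> y) ?X = 0"
        using assms(3)[OF True] wedge_even_comm[OF alternating_wpow[OF alt2[OF p]], of j "\<xi> y"] assms(2) True
        by (simp add: wedge_alt_assoc horizontal_def)
      ultimately have "?X = 0"
        using contract_wedge_1[OF alt1[OF p], of "R y" ?X] by (simp add: reeb[OF p])
      then show ?thesis by (simp add: op_L_pow field_apply)
    next
      case False
      then show ?thesis using assms(2) by (simp add: op_L_pow horizontal_def field_apply)
    qed
  qed
qed

end

text \<open>A single fibre is treated as a constant field on the whole space, so the pointwise
  statements are instances of those for fields.\<close>

lemma contact_field_const: "contact_pair n \<theta> \<beta> \<Longrightarrow> contact_field UNIV n (\<lambda>_. \<theta>) (\<lambda>_. \<beta>)"
  by unfold_locales auto

lemma lefschetz_injective: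
  assumes "contact_pair n \<theta> \<beta>" "j \<le> n" "alternating j \<xi>" "contract (reeb \<theta> \<beta>) \<xi> = 0"
    and "wedge_alt (wedge_alt \<theta> \<xi>) (wpow \<beta> (n - j)) = 0"
  shows "\<xi> = 0"
proof -
  interpret contact_field UNIV n "\<lambda>_. \<theta>" "\<lambda>_. \<beta>" by (rule contact_field_const[OF assms(1)])
  have "(\<lambda>_::'a. \<xi>) = 0"
    by (rule lefschetz_injective_field[OF assms(2)]) (use assms in \<open>auto simp: horizontal_def\<close>)
  then show ?thesis using fun_cong[of "\<lambda>_::'a. \<xi>" 0 undefined] by (simp add: field_apply)
qed

section \<open>The inverse Lefschetz map and the operator at a point\<close>

definition lef :: "nat \<Rightarrow> nat \<Rightarrow> ('e::euclidean_space list \<Rightarrow> real) \<Rightarrow> ('e list \<Rightarrow> real) \<Rightarrow> ('e list \<Rightarrow> real) \<Rightarrow> 'e list \<Rightarrow> real" where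
  "lef n j \<theta> \<beta> \<alpha> = (THE \<xi>. alternating j \<xi> \<and> contract (reeb \<theta> \<beta>) \<xi> = 0 \<and>
     wedge_alt \<theta> \<alpha> = wedge_alt (wedge_alt \<theta> \<xi>) (wpow \<beta> (n - j)))"

text \<open>The product \<open>wedge_alt \<theta> \<xi>\<close> determines \<open>\<xi>\<close> only
  modulo \<theta>. Vanishing contraction with the Reeb vector is the normalisation that makes the
  cofactor unique.\<close>

lemma lef_eqI:
  assumes "contact_pair n \<theta> \<beta>" "j \<le> n" "alternating j \<xi>" "contract (reeb \<theta> \<beta>) \<xi> = 0"
    "wedge_alt \<theta> \<alpha> = wedge_alt (wedge_alt \<theta> \<xi>) (wpow \<beta> (n - j))"
  shows "lef n j \<theta> \<beta> \<alpha> = \<xi>"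
  unfolding lef_def
proof (rule the_equality)
  fix \<zeta> assume \<zeta>: "alternating j \<zeta> \<and> contract (reeb \<theta> \<beta>) \<zeta> = 0 \<and>
    wedge_alt \<theta> \<alpha> = wedge_alt (wedge_alt \<theta> \<zeta>) (wpow \<beta> (n - j))"
  then have "\<zeta> - \<xi> = 0"
    using assms(3-5)
    by (rule_tac lefschetz_injective[OF assms(1,2)]) (auto simp: alternating_diff wedge_alt_linear)
  then show "\<zeta> = \<xi>" by simp
qed (use assms in auto)

lemma lef:
  assumes "contact_pair n \<theta> \<beta>" "j \<le> n" "alternating (2 * n - j) \<alpha>"
  shows "alternating j (lef n j \<theta> \<beta> \<alpha>)" "contract (reeb \<theta> \<beta>) (lef n j \<theta> \<beta> \<alpha>) = 0"
    "wedge_alt \<theta> \<alpha> = wedge_alt (wedge_alt \<theta> (lef n j \<theta> \<beta> \<alpha>)) (wpow \<beta> (n - j))"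
proof -
  interpret contact_field UNIV n "\<lambda>_. \<theta>" "\<lambda>_. \<beta>" by (rule contact_field_const[OF assms(1)])
  obtain \<xi> where "alternating j \<xi>" "contract (reeb \<theta> \<beta>) \<xi> = 0"
    "wedge_alt \<theta> \<alpha> = wedge_alt (wedge_alt \<theta> \<xi>) (wpow \<beta> (n - j))"
    using lefschetz_field[OF assms(2), of "\<lambda>_. \<alpha>"] assms(3) by auto
  with lef_eqI[OF assms(1,2) this] show "alternating j (lef n j \<theta> \<beta> \<alpha>)" "contract (reeb \<theta> \<beta>) (lef n j \<theta> \<beta> \<alpha>) = 0"
    "wedge_alt \<theta> \<alpha> = wedge_alt (wedge_alt \<theta> (lef n j \<theta> \<beta> \<alpha>)) (wpow \<beta> (n - j))" by auto
qed

text \<open>By uniqueness at each point, the pointwise choice agrees with the smooth solution of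
  \<open>lefschetz_field\<close>.\<close>

lemma (in contact_field) smooth_field_lef:
  assumes "j \<le> n" "smooth_field S \<alpha>" "\<And>y. y \<in> S \<Longrightarrow> alternating (2 * n - j) (\<alpha> y)"
  shows "smooth_field S (\<lambda>y. lef n j (\<theta> y) (\<beta> y) (\<alpha> y))"
proof -
  obtain \<xi> where \<xi>: "smooth_field S \<xi>" "\<forall>y\<in>S. alternating j (\<xi> y) \<and> contract (R y) (\<xi> y) = 0 \<and>
    wedge_alt (\<theta> y) (\<alpha> y) = wedge_alt (wedge_alt (\<theta> y) (\<xi> y)) (wpow (\<beta> y) (n - j))"
    using lefschetz_field[OF assms] by blast
  show ?thesis
  proof (rule smooth_field_cong[OF op \<xi>(1)])
    fix y assume "y \<in> S"
    with \<xi>(2) show "\<xi> y = lef n j (\<theta> y) (\<beta> y) (\<alpha> y)"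
      by (rule_tac lef_eqI[OF pair assms(1), symmetric]) auto
  qed
qed

text \<open>The value of \<Gamma> at a point. The zero branches are the degrees in which the
  cofactor would have negative degree; in the lower range the power of \<open>\<beta>\<close> raises
  \<omega> to degree \<open>2 * n - (k - 2)\<close>, to which \<open>lef\<close> applies.\<close>

definition gam :: "nat \<Rightarrow> nat \<Rightarrow> ('e::euclidean_space list \<Rightarrow> real) \<Rightarrow> ('e list \<Rightarrow> real) \<Rightarrow> ('e list \<Rightarrow> real) \<Rightarrow> 'e list \<Rightarrow> real" where
  "gam n k \<theta> \<beta> \<omega> =
    (if k \<le> n then if k < 2 then 0 else wedge_alt \<theta> (lef n (k - 2) \<theta> \<beta> (wedge_alt \<omega> (wpow \<beta> (n + 1 - k))))
     else if k \<le> 2 * n then wedge_alt (wedge_alt \<theta> (lef n (2 * n - k) \<theta> \<beta> \<omega>)) (wpow \<beta> (k - n - 1))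
     else 0)"

text \<open>Any cofactor may be used once it is multiplied by \<theta>: replacing it by its
  horizontal part does not change that product.\<close>

lemma lef_eqI':
  assumes "contact_pair n \<theta> \<beta>" "j \<le> n" "alternating j \<xi>"
    "wedge_alt \<theta> \<alpha> = wedge_alt (wedge_alt \<theta> \<xi>) (wpow \<beta> (n - j))"
  shows "wedge_alt \<theta> (lef n j \<theta> \<beta> \<alpha>) = wedge_alt \<theta> \<xi>"
proof -
  let ?R = "reeb \<theta> \<beta>" and ?\<xi> = "contract (reeb \<theta> \<beta>) (wedge_alt \<theta> \<xi>)"
  note alt = alternating_wedge[OF alt1[OF assms(1)] assms(3)]
  have "wedge_alt \<theta> ?\<xi> = wedge_alt \<theta> \<xi>"
    by (simp add: contract_wedge_1[OF alt1[OF assms(1)]] reeb[OF assms(1)] wedge_alt_linear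
        wedge_1_1_self[OF alt1[OF assms(1)]])
  moreover have "alternating j ?\<xi>" using alternating_contract[of j] alt by simp
  moreover have "contract ?R ?\<xi> = 0"
    using contract_anticommute[OF alt, of ?R ?R] by (simp add: eq_neg_iff_add_eq_0 flip: scaleR_2)
  ultimately show ?thesis
    using lef_eqI[OF assms(1,2), of ?\<xi> \<alpha>] assms(4) by simp
qed

lemma gam_cases [case_names trivial low high above]:
  fixes k n :: nat
  obtains "k < 2" "k \<le> n" | "2 \<le> k" "k \<le> n" | "n < k" "k \<le> 2 * n" | "2 * n < k"
  by linarith

context
  fixes n and \<theta> \<beta> :: "'e::euclidean_space list \<Rightarrow> real"
  assumes pair: "contact_pair n \<theta> \<beta>"
begin

lemma alternating_low:
  assumes "alternating k \<omega>" "2 \<le> k" "k \<le> n"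
  shows "alternating (2 * n - (k - 2)) (wedge_alt \<omega> (wpow \<beta> (n + 1 - k)))"
proof -
  have "k + 2 * (n + 1 - k) = 2 * n - (k - 2)" using assms by simp
  then show ?thesis
    using alternating_wedge[OF assms(1) alternating_wpow[OF alt2[OF pair]], of "n + 1 - k"] by simp
qed

lemma gam_low_eqI:
  assumes "2 \<le> k" "k \<le> n" "alternating (k - 2) \<xi>"
    "wedge_alt (wedge_alt \<theta> \<omega>) (wpow \<beta> (n + 1 - k)) = wedge_alt (wedge_alt \<theta> \<xi>) (wpow \<beta> (n + 2 - k))"
  shows "gam n k \<theta> \<beta> \<omega> = wedge_alt \<theta> \<xi>"
proof -
  have "n - (k - 2) = n + 2 - k" using assms by simp
  then show ?thesis
    using lef_eqI'[OF pair, of "k - 2" \<xi> "wedge_alt \<omega> (wpow \<beta> (n + 1 - k))"] assms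
    by (simp add: gam_def wedge_alt_assoc)
qed

lemma gam_low:
  assumes "2 \<le> k" "k \<le> n" "alternating k \<omega>"
  defines "\<xi> \<equiv> lef n (k - 2) \<theta> \<beta> (wedge_alt \<omega> (wpow \<beta> (n + 1 - k)))"
  shows "alternating (k - 2) \<xi>" "contract (reeb \<theta> \<beta>) \<xi> = 0" "gam n k \<theta> \<beta> \<omega> = wedge_alt \<theta> \<xi>"
    "wedge_alt (wedge_alt \<theta> \<omega>) (wpow \<beta> (n + 1 - k)) = wedge_alt (wedge_alt \<theta> \<xi>) (wpow \<beta> (n + 2 - k))"
proof -
  have "n - (k - 2) = n + 2 - k" using assms by simp
  then show "alternating (k - 2) \<xi>" "contract (reeb \<theta> \<beta>) \<xi> = 0"
    "wedge_alt (wedge_alt \<theta> \<omega>) (wpow \<beta> (n + 1 - k)) = wedge_alt (wedge_alt \<theta> \<xi>) (wpow \<beta> (n + 2 - k))"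
    using lef[OF pair, of "k - 2", OF _ alternating_low[OF assms(3,1,2)]] assms
    by (simp_all add: wedge_alt_assoc)
  show "gam n k \<theta> \<beta> \<omega> = wedge_alt \<theta> \<xi>" using assms by (simp add: gam_def)
qed

lemma gam_high_eqI:
  assumes "n < k" "k \<le> 2 * n" "alternating (2 * n - k) \<xi>"
    "wedge_alt \<theta> \<omega> = wedge_alt (wedge_alt \<theta> \<xi>) (wpow \<beta> (k - n))"
  shows "gam n k \<theta> \<beta> \<omega> = wedge_alt (wedge_alt \<theta> \<xi>) (wpow \<beta> (k - n - 1))"
  using lef_eqI'[OF pair, of "2 * n - k" \<xi> \<omega>] assms by (simp add: gam_def)

lemma gam_high:
  assumes "n < k" "k \<le> 2 * n" "alternating k \<omega>"
  defines "\<xi> \<equiv> lef n (2 * n - k) \<theta> \<beta> \<omega>"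
  shows "alternating (2 * n - k) \<xi>" "contract (reeb \<theta> \<beta>) \<xi> = 0"
    "gam n k \<theta> \<beta> \<omega> = wedge_alt (wedge_alt \<theta> \<xi>) (wpow \<beta> (k - n - 1))"
    "wedge_alt \<theta> \<omega> = wedge_alt (wedge_alt \<theta> \<xi>) (wpow \<beta> (k - n))"
  using lef[OF pair, of "2 * n - k" \<omega>] assms by (simp_all add: gam_def)

lemma gam_trivial: "k < 2 \<Longrightarrow> k \<le> n \<Longrightarrow> gam n k \<theta> \<beta> \<omega> = 0" "2 * n < k \<Longrightarrow> gam n k \<theta> \<beta> \<omega> = 0"
  by (simp_all add: gam_def)

lemma alternating_gam:
  assumes "alternating (Suc k) \<omega>" shows "alternating k (gam n (Suc k) \<theta> \<beta> \<omega>)"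
proof (rule gam_cases[of "Suc k" n])
  assume k: "2 \<le> Suc k" "Suc k \<le> n"
  have "1 + (Suc k - 2) = k" using k by simp
  then show ?thesis
    using alternating_wedge[OF alt1[OF pair] gam_low(1)[OF k assms]] gam_low(3)[OF k assms] by simp
next
  assume k: "n < Suc k" "Suc k \<le> 2 * n"
  have eq: "1 + (2 * n - Suc k) + 2 * (Suc k - n - 1) = k" using k by simp
  have "alternating (1 + (2 * n - Suc k) + 2 * (Suc k - n - 1)) (gam n (Suc k) \<theta> \<beta> \<omega>)"
    unfolding gam_high(3)[OF k assms]
    by (intro alternating_wedge alternating_wpow alt1[OF pair] alt2[OF pair] gam_high(1)[OF k assms])
  then show ?thesis unfolding eq .
qed (auto simp: gam_trivial)

lemma theta_gam: "wedge_alt \<theta> (gam n k \<theta> \<beta> \<omega>) = 0"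
  using alt1[OF pair] by (simp add: gam_def wedge_alt_assoc)

lemma gam_add:
  assumes "alternating k \<omega>" "alternating k \<omega>'"
  shows "gam n k \<theta> \<beta> (\<omega> + \<omega>') = gam n k \<theta> \<beta> \<omega> + gam n k \<theta> \<beta> \<omega>'"
proof (rule gam_cases[of k n])
  assume k: "2 \<le> k" "k \<le> n"
  have "gam n k \<theta> \<beta> (\<omega> + \<omega>') = wedge_alt \<theta> (lef n (k - 2) \<theta> \<beta> (wedge_alt \<omega> (wpow \<beta> (n + 1 - k)))
      + lef n (k - 2) \<theta> \<beta> (wedge_alt \<omega>' (wpow \<beta> (n + 1 - k))))"
    using gam_low(1,4)[OF k assms(1)] gam_low(1,4)[OF k assms(2)]
    by (intro gam_low_eqI[OF k]) (auto simp: alternating_add wedge_alt_linear)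
  then show ?thesis using gam_low(3)[OF k assms(1)] gam_low(3)[OF k assms(2)] by (simp add: wedge_alt_linear)
next
  assume k: "n < k" "k \<le> 2 * n"
  have "gam n k \<theta> \<beta> (\<omega> + \<omega>') = wedge_alt (wedge_alt \<theta> (lef n (2 * n - k) \<theta> \<beta> \<omega> + lef n (2 * n - k) \<theta> \<beta> \<omega>')) (wpow \<beta> (k - n - 1))"
    using gam_high(1,4)[OF k assms(1)] gam_high(1,4)[OF k assms(2)]
    by (intro gam_high_eqI[OF k]) (auto simp: alternating_add wedge_alt_linear)
  then show ?thesis using gam_high(3)[OF k assms(1)] gam_high(3)[OF k assms(2)] by (simp add: wedge_alt_linear)
qed (auto simp: gam_trivial)

lemma gam_scaleR:
  assumes "alternating k \<omega>"
  shows "gam n k \<theta> \<beta> (r *\<^sub>R \<omega>) = r *\<^sub>R gam n k \<theta> \<beta> \<omega>"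
proof (rule gam_cases[of k n])
  assume k: "2 \<le> k" "k \<le> n"
  have "gam n k \<theta> \<beta> (r *\<^sub>R \<omega>) = wedge_alt \<theta> (r *\<^sub>R lef n (k - 2) \<theta> \<beta> (wedge_alt \<omega> (wpow \<beta> (n + 1 - k))))"
    using gam_low(1,4)[OF k assms]
    by (intro gam_low_eqI[OF k]) (auto simp: alternating_scaleR wedge_alt_linear)
  then show ?thesis using gam_low(3)[OF k assms] by (simp add: wedge_alt_linear)
next
  assume k: "n < k" "k \<le> 2 * n"
  have "gam n k \<theta> \<beta> (r *\<^sub>R \<omega>) = wedge_alt (wedge_alt \<theta> (r *\<^sub>R lef n (2 * n - k) \<theta> \<beta> \<omega>)) (wpow \<beta> (k - n - 1))"
    using gam_high(1,4)[OF k assms]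
    by (intro gam_high_eqI[OF k]) (auto simp: alternating_scaleR wedge_alt_linear)
  then show ?thesis using gam_high(3)[OF k assms] by (simp add: wedge_alt_linear)
qed (auto simp: gam_trivial)

text \<open>This is the first of the Rumin conditions. For \<open>k < 2\<close> it holds by itself,
  as the product has degree \<open>2 * n + 3 - k\<close>, above the dimension.\<close>

lemma gam_eq_0_low:
  assumes "k \<le> n" "alternating k \<omega>"
  shows "gam n k \<theta> \<beta> \<omega> = 0 \<longleftrightarrow> wedge_alt (wedge_alt \<theta> \<omega>) (wpow \<beta> (n + 1 - k)) = 0"
proof (cases "k < 2")
  case True
  have "alternating (1 + k + 2 * (n + 1 - k)) (wedge_alt (wedge_alt \<theta> \<omega>) (wpow \<beta> (n + 1 - k)))"
    by (intro alternating_wedge alternating_wpow alt1[OF pair] alt2[OF pair] assms)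
  then have "wedge_alt (wedge_alt \<theta> \<omega>) (wpow \<beta> (n + 1 - k)) = 0"
    using True assms(1) DIM[OF pair] by (intro alternating_above_DIM) auto
  then show ?thesis using True assms by (simp add: gam_trivial)
next
  case False
  then have k: "2 \<le> k" "k \<le> n" using assms by auto
  show ?thesis
  proof
    assume "gam n k \<theta> \<beta> \<omega> = 0"
    then show "wedge_alt (wedge_alt \<theta> \<omega>) (wpow \<beta> (n + 1 - k)) = 0"
      using gam_low(3,4)[OF k assms(2)] by simp
  next
    assume "wedge_alt (wedge_alt \<theta> \<omega>) (wpow \<beta> (n + 1 - k)) = 0"
    then show "gam n k \<theta> \<beta> \<omega> = 0" using gam_low_eqI[OF k, of 0 \<omega>] by simp
  qed
qed

text \<open>Multiplying the value of \<open>gam\<close> by one more \<open>\<beta>\<close> gives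
  back \<open>wedge_alt \<theta> \<omega>\<close>.\<close>

lemma gam_eq_0_high:
  assumes "n < k" "alternating k \<omega>"
  shows "gam n k \<theta> \<beta> \<omega> = 0 \<longleftrightarrow> wedge_alt \<theta> \<omega> = 0"
proof (cases "k \<le> 2 * n")
  case True
  note k = assms(1) True
  have kn: "k - n = Suc (k - n - 1)" using assms(1) by simp
  show ?thesis
  proof
    assume "gam n k \<theta> \<beta> \<omega> = 0"
    then have "wedge_alt (wedge_alt (wedge_alt \<theta> (lef n (2 * n - k) \<theta> \<beta> \<omega>)) (wpow \<beta> (k - n - 1))) \<beta> = 0"
      using gam_high(3)[OF k assms(2)] by simp
    then show "wedge_alt \<theta> \<omega> = 0"
      using gam_high(4)[OF k assms(2)] wpow_Suc_right[OF alt2[OF pair], of "k - n - 1"] kn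
      by (simp add: wedge_alt_assoc)
  next
    assume "wedge_alt \<theta> \<omega> = 0"
    then show "gam n k \<theta> \<beta> \<omega> = 0" using gam_high_eqI[OF k, of 0 \<omega>] by simp
  qed
next
  case False
  have "alternating (1 + k) (wedge_alt \<theta> \<omega>)"
    by (intro alternating_wedge alt1[OF pair] assms)
  then have "wedge_alt \<theta> \<omega> = 0"
    using False DIM[OF pair] by (intro alternating_above_DIM) auto
  then show ?thesis using False by (simp add: gam_trivial)
qed

lemma gam_vertical:
  assumes "alternating k \<omega>" "wedge_alt \<theta> \<omega> = 0"
  shows "gam n k \<theta> \<beta> \<omega> = 0"
  using gam_eq_0_low[of k \<omega>] gam_eq_0_high[of k \<omega>] assms by (cases "k \<le> n") auto

end

section \<open>Naturality and independence of the contact form\<close>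

lemma gam_pullback:
  assumes pair: "contact_pair n \<theta> \<beta>" and "linear A" "contact_pair n (pullback A \<theta>) (pullback A \<beta>)" "alternating k \<omega>"
  shows "gam n k (pullback A \<theta>) (pullback A \<beta>) (pullback A \<omega>) = pullback A (gam n k \<theta> \<beta> \<omega>)"
proof (rule gam_cases[of k n])
  assume k: "2 \<le> k" "k \<le> n"
  show ?thesis
    using gam_low_eqI[OF assms(3) k, of "pullback A (lef n (k - 2) \<theta> \<beta> (wedge_alt \<omega> (wpow \<beta> (n + 1 - k))))" "pullback A \<omega>"]
      gam_low[OF pair k assms(4)] alternating_pullback[OF assms(2)]
    by (simp flip: pullback_wedge pullback_wpow)
next
  assume k: "n < k" "k \<le> 2 * n"
  show ?thesis
    using gam_high_eqI[OF assms(3) k, of "pullback A (lef n (2 * n - k) \<theta> \<beta> \<omega>)" "pullback A \<omega>"]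
      gam_high[OF pair k assms(4)] alternating_pullback[OF assms(2)]
    by (simp flip: pullback_wedge pullback_wpow)
qed (auto simp: gam_trivial[OF pair] gam_trivial[OF assms(3)] pullback_linear)

text \<open>\<open>A\<close> carries the Reeb vector of the pulled back pair to that of the original
  one, so the normalisation of the cofactor is respected. Surjectivity of \<open>A\<close> is needed
  because the Reeb vector is characterised by testing \<open>\<beta>\<close> on all vectors.\<close>

lemma lef_pullback:
  assumes pair: "contact_pair n \<theta> \<beta>" and "linear A" "surj A" "contact_pair n (pullback A \<theta>) (pullback A \<beta>)" "j \<le> n" "alternating (2 * n - j) \<alpha>"
  shows "lef n j (pullback A \<theta>) (pullback A \<beta>) (pullback A \<alpha>) = pullback A (lef n j \<theta> \<beta> \<alpha>)"
proof (rule lef_eqI[OF assms(4,5)])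
  have "A (reeb (pullback A \<theta>) (pullback A \<beta>)) = reeb \<theta> \<beta>"
  proof (rule reeb_eqI[OF pair, symmetric])
    show "\<theta> [A (reeb (pullback A \<theta>) (pullback A \<beta>))] = 1"
      using reeb(1)[OF assms(4)] by (simp add: pullback_apply)
    show "\<beta> [A (reeb (pullback A \<theta>) (pullback A \<beta>)), v] = 0" for v
      using reeb(2)[OF assms(4)] surjD[OF assms(3), of v] by (auto simp: pullback_apply)
  qed
  then show "contract (reeb (pullback A \<theta>) (pullback A \<beta>)) (pullback A (lef n j \<theta> \<beta> \<alpha>)) = 0"
    using lef(2)[OF pair assms(5,6)] by (simp add: contract_pullback pullback_linear)
  show "alternating j (pullback A (lef n j \<theta> \<beta> \<alpha>))"
    using lef(1)[OF pair assms(5,6)] alternating_pullback[OF assms(2)] by blast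
  show "wedge_alt (pullback A \<theta>) (pullback A \<alpha>) =
    wedge_alt (wedge_alt (pullback A \<theta>) (pullback A (lef n j \<theta> \<beta> \<alpha>))) (wpow (pullback A \<beta>) (n - j))"
    using lef(3)[OF pair assms(5,6)] by (simp flip: pullback_wedge pullback_wpow)
qed

text \<open>Independence of the contact form: a rescaled form \<open>f \<theta>\<close> has differential
  \<open>f d\<theta>\<close> modulo \<open>\<theta>\<close>.\<close>

lemma wpow_rescale:
  assumes pair: "contact_pair n \<theta> \<beta>" and "wedge_alt \<theta> \<beta>' = f *\<^sub>R wedge_alt \<theta> \<beta>" "alternating 2 \<beta>'"
  shows "wedge_alt \<theta> (wpow \<beta>' m) = f ^ m *\<^sub>R wedge_alt \<theta> (wpow \<beta> m)"
proof (induction m)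
  case (Suc m)
  have "wedge_alt \<theta> (wpow \<beta>' (Suc m)) = wedge_alt (wedge_alt \<theta> (wpow \<beta>' m)) \<beta>'"
    by (simp only: wpow_Suc_right[OF assms(3)] wedge_alt_assoc)
  also have "\<dots> = f ^ m *\<^sub>R wedge_alt (wedge_alt \<theta> (wpow \<beta> m)) \<beta>'"
    by (simp add: Suc wedge_alt_linear)
  also have "wedge_alt (wedge_alt \<theta> (wpow \<beta> m)) \<beta>' = wedge_alt (wedge_alt \<theta> \<beta>') (wpow \<beta> m)"
    using wedge_2_comm[OF assms(3) alternating_wpow[OF alt2[OF pair]]] by (simp add: wedge_alt_assoc)
  finally show ?case using assms(2) by (simp add: wedge_alt_linear wedge_alt_assoc)
qed simp

text \<open>In the product of \<theta>, a form and the power \<open>m\<close> of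
  \<open>\<beta>\<close>, each of the \<open>m + 1\<close> contact factors contributes one
  \<open>f\<close>. The powers of \<open>f\<close> in the defining equation and in the value of
  \<open>gam\<close> then compensate.\<close>

lemma gam_rescale:
  assumes pair: "contact_pair n \<theta> \<beta>" and "f \<noteq> 0" "wedge_alt \<theta> \<beta>' = f *\<^sub>R wedge_alt \<theta> \<beta>" "contact_pair n (f *\<^sub>R \<theta>) \<beta>'" "alternating k \<omega>"
  shows "gam n k (f *\<^sub>R \<theta>) \<beta>' \<omega> = gam n k \<theta> \<beta> \<omega>"
proof -
  let ?\<theta> = "f *\<^sub>R \<theta>"
  note resc = wpow_rescale[OF pair assms(3) alt2[OF assms(4)]]
  have pow: "wedge_alt (wedge_alt ?\<theta> \<alpha>) (wpow \<beta>' m) = (f ^ Suc m) *\<^sub>R wedge_alt (wedge_alt \<theta> \<alpha>) (wpow \<beta> m)"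
    if "alternating j \<alpha>" for \<alpha> j m
  proof -
    have "wedge_alt (wedge_alt ?\<theta> \<alpha>) (wpow \<beta>' m) = f *\<^sub>R wedge_alt (wedge_alt \<theta> (wpow \<beta>' m)) \<alpha>"
      using wedge_even_comm[OF alternating_wpow[OF alt2[OF assms(4)]] that, of m]
      by (simp add: wedge_alt_linear wedge_alt_assoc)
    also have "\<dots> = (f ^ Suc m) *\<^sub>R wedge_alt (wedge_alt \<theta> (wpow \<beta> m)) \<alpha>"
      by (simp add: resc wedge_alt_linear)
    finally show ?thesis
      using wedge_even_comm[OF alternating_wpow[OF alt2[OF pair]] that, of m] by (simp add: wedge_alt_assoc)
  qed
  show ?thesis
  proof (rule gam_cases[of k n])
    assume k: "2 \<le> k" "k \<le> n"
    note g = gam_low[OF assms(4) k assms(5)]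
    let ?\<xi> = "lef n (k - 2) ?\<theta> \<beta>' (wedge_alt \<omega> (wpow \<beta>' (n + 1 - k)))"
    have nk: "n + 2 - k = Suc (n + 1 - k)" using k by simp
    have "f ^ (n + 2 - k) *\<^sub>R wedge_alt (wedge_alt \<theta> \<omega>) (wpow \<beta> (n + 1 - k))
      = f ^ (n + 2 - k) *\<^sub>R (f *\<^sub>R wedge_alt (wedge_alt \<theta> ?\<xi>) (wpow \<beta> (n + 2 - k)))"
      using g(4) unfolding pow[OF assms(5)] pow[OF g(1)] by (simp only: nk[symmetric] power_Suc scaleR_scaleR mult.commute)
    then have "wedge_alt (wedge_alt \<theta> \<omega>) (wpow \<beta> (n + 1 - k)) = f *\<^sub>R wedge_alt (wedge_alt \<theta> ?\<xi>) (wpow \<beta> (n + 2 - k))"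
      using assms(2) by (subst (asm) scaleR_cancel_left) auto
    then have "gam n k \<theta> \<beta> \<omega> = wedge_alt \<theta> (f *\<^sub>R ?\<xi>)"
      using g(1) by (intro gam_low_eqI[OF pair k]) (auto simp: alternating_scaleR wedge_alt_linear)
    then show ?thesis using g(3) by (simp add: wedge_alt_linear)
  next
    assume k: "n < k" "k \<le> 2 * n"
    note g = gam_high[OF assms(4) k assms(5)]
    let ?\<xi> = "lef n (2 * n - k) ?\<theta> \<beta>' \<omega>"
    have kn: "k - n = Suc (k - n - 1)" using k by simp
    have "f *\<^sub>R wedge_alt \<theta> \<omega> = f *\<^sub>R (f ^ (k - n) *\<^sub>R wedge_alt (wedge_alt \<theta> ?\<xi>) (wpow \<beta> (k - n)))"
      using g(4) unfolding pow[OF g(1)] by (simp add: wedge_alt_linear)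
    then have "wedge_alt \<theta> \<omega> = f ^ (k - n) *\<^sub>R wedge_alt (wedge_alt \<theta> ?\<xi>) (wpow \<beta> (k - n))"
      using assms(2) by (subst (asm) scaleR_cancel_left) auto
    then have "gam n k \<theta> \<beta> \<omega> = wedge_alt (wedge_alt \<theta> (f ^ (k - n) *\<^sub>R ?\<xi>)) (wpow \<beta> (k - n - 1))"
      using g(1) by (intro gam_high_eqI[OF pair k]) (auto simp: alternating_scaleR wedge_alt_linear)
    then show ?thesis unfolding g(3) pow[OF g(1)] using kn by (simp add: wedge_alt_linear)
  qed (auto simp: gam_trivial[OF pair] gam_trivial[OF assms(4)])
qed


lemma (in contact_field) smooth_field_gam:
  assumes "smooth_field S \<omega>" "\<And>y. y \<in> S \<Longrightarrow> alternating k (\<omega> y)"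
  shows "smooth_field S (\<lambda>y. gam n k (\<theta> y) (\<beta> y) (\<omega> y))"
proof -
  consider "k < 2" "k \<le> n" | "2 \<le> k" "k \<le> n" | "n < k" "k \<le> 2 * n" | "2 * n < k" by linarith
  then show ?thesis
  proof cases
    case 2
    then show ?thesis
      unfolding gam_def
      using assms alternating_low[OF pair]
      by (auto intro!: smooth_field_wedge[OF op] sm1 sm2 smooth_field_lef smooth_field_wpow[OF op])
  next
    case 3
    then show ?thesis
      unfolding gam_def
      using assms by (auto intro!: smooth_field_wedge[OF op] sm1 sm2 smooth_field_lef smooth_field_wpow[OF op])
  qed (auto simp: gam_def)
qed

text \<open>The identity \<open>\<Gamma> d \<Gamma> = \<Gamma>\<close>: modulo \<open>\<theta>\<close>, applying \<open>d\<close> to \<open>\<theta> \<and> \<xi>\<close> multiplies by \<open>d\<theta>\<close>.\<close>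

lemma gam_ext_deriv_gam:
  assumes op: "open S" and x: "x \<in> S" and sm: "smooth_field S \<theta>" "smooth_field S \<omega>"
    and pair: "\<And>y. y \<in> S \<Longrightarrow> contact_pair n (\<theta> y) (ext_deriv \<theta> y)"
    and alt: "\<And>y. y \<in> S \<Longrightarrow> alternating k (\<omega> y)"
  shows "gam n k (\<theta> x) (ext_deriv \<theta> x) (ext_deriv (\<lambda>y. gam n k (\<theta> y) (ext_deriv \<theta> y) (\<omega> y)) x)
    = gam n k (\<theta> x) (ext_deriv \<theta> x) (\<omega> x)"
proof -
  let ?\<beta> = "ext_deriv \<theta>"
  interpret contact_field S n \<theta> ?\<beta>
    by unfold_locales (use op sm pair smooth_field_ext_deriv[OF op] in auto)
  note p = pair[OF x]
  have zero: "ext_deriv (\<lambda>y. 0 :: 'a list \<Rightarrow> real) x = 0"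
    by (rule ext) (simp add: ext_deriv_def frechet_derivative_const zero_fun_apply)
  have d: "wedge_alt (\<theta> x) (ext_deriv (\<lambda>y. wedge_alt (\<theta> y) (\<xi> y)) x) = wedge_alt (wedge_alt (\<theta> x) (\<xi> x)) (?\<beta> x)"
    if "smooth_field S \<xi>" "alternating j (\<xi> x)" for \<xi> j
    using wedge_2_comm[OF alt2[OF p] that(2)]
    by (simp add: ext_deriv_wedge[OF op x sm(1) that(1)] parity_1[OF alt1[OF p]] wedge_alt_linear
        wedge_1_1_self[OF alt1[OF p]] wedge_alt_assoc)
  have dw: "ext_deriv (\<lambda>y. wpow (?\<beta> y) m) x = 0" for m
  proof (induction m)
    case 0
    show ?case by (simp add: ext_deriv_scalar_form frechet_derivative_const) (rule ext, simp add: one_form_of_def zero_fun_apply)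
  next
    case (Suc m)
    show ?case
      using ext_deriv_wedge[OF op x sm2 smooth_field_wpow[OF op sm2], of m]
      by (simp add: Suc ext_deriv_ext_deriv[OF op sm(1) x])
  qed
  show ?thesis
  proof (rule gam_cases[of k n])
    assume k: "2 \<le> k" "k \<le> n"
    let ?\<xi> = "\<lambda>y. lef n (k - 2) (\<theta> y) (?\<beta> y) (wedge_alt (\<omega> y) (wpow (?\<beta> y) (n + 1 - k)))"
    have sm\<xi>: "smooth_field S ?\<xi>"
      using k alternating_low[OF pair alt k]
      by (intro smooth_field_lef smooth_field_wedge[OF op] sm smooth_field_wpow[OF op] sm2) auto
    note g = gam_low[OF p k alt[OF x]]
    have "ext_deriv (\<lambda>y. gam n k (\<theta> y) (?\<beta> y) (\<omega> y)) x = ext_deriv (\<lambda>y. wedge_alt (\<theta> y) (?\<xi> y)) x"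
      using k by (simp add: gam_def)
    moreover have "n + 2 - k = Suc (n + 1 - k)" using k by simp
    ultimately have "wedge_alt (wedge_alt (\<theta> x) (ext_deriv (\<lambda>y. gam n k (\<theta> y) (?\<beta> y) (\<omega> y)) x)) (wpow (?\<beta> x) (n + 1 - k))
      = wedge_alt (wedge_alt (\<theta> x) (?\<xi> x)) (wpow (?\<beta> x) (n + 2 - k))"
      using d[OF sm\<xi> g(1)] by (simp add: wedge_alt_assoc)
    then show ?thesis using gam_low_eqI[OF p k g(1)] g(3) by simp
  next
    assume k: "n < k" "k \<le> 2 * n"
    let ?\<xi> = "\<lambda>y. lef n (2 * n - k) (\<theta> y) (?\<beta> y) (\<omega> y)"
    have sm\<xi>: "smooth_field S ?\<xi>"
      using k alt by (intro smooth_field_lef sm) auto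
    note g = gam_high[OF p k alt[OF x]]
    \<comment> \<open>In the upper range the value of \<Gamma> is \<theta> times the whole product
      \<open>?\<zeta>\<close>, so \<open>d\<close> applies to it without differentiating the power
      of \<open>?\<beta>\<close>.\<close>
    let ?\<zeta> = "\<lambda>y. wedge_alt (?\<xi> y) (wpow (?\<beta> y) (k - n - 1))"
    have sm\<zeta>: "smooth_field S ?\<zeta>" by (intro smooth_field_wedge[OF op] sm\<xi> smooth_field_wpow[OF op] sm2)
    have alt\<zeta>: "alternating (2 * n - k + 2 * (k - n - 1)) (?\<zeta> x)"
      by (intro alternating_wedge g(1) alternating_wpow alt2[OF p])
    have "ext_deriv (\<lambda>y. gam n k (\<theta> y) (?\<beta> y) (\<omega> y)) x = ext_deriv (\<lambda>y. wedge_alt (\<theta> y) (?\<zeta> y)) x"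
      using k by (simp add: gam_def wedge_alt_assoc)
    moreover have "k - n = Suc (k - n - 1)" using k by simp
    then have "wpow (?\<beta> x) (k - n) = wedge_alt (wpow (?\<beta> x) (k - n - 1)) (?\<beta> x)"
      using wpow_Suc_right[OF alt2[OF p]] by metis
    ultimately have "wedge_alt (\<theta> x) (ext_deriv (\<lambda>y. gam n k (\<theta> y) (?\<beta> y) (\<omega> y)) x)
      = wedge_alt (wedge_alt (\<theta> x) (?\<xi> x)) (wpow (?\<beta> x) (k - n))"
      using d[OF sm\<zeta> alt\<zeta>] by (simp add: wedge_alt_assoc)
    then show ?thesis using gam_high_eqI[OF p k g(1)] g(3) by simp
  qed (auto simp: gam_def)
qed

section \<open>Forms on a manifold\<close>

definition chart_point :: "('a, 'e) chart \<Rightarrow> 'e \<Rightarrow> 'a" where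
  "chart_point c = inv_into (fst c) (snd c)"

locale smooth_manifold =
  fixes \<A> :: "('a::topological_space, 'e::euclidean_space) chart set"
  assumes atlas: "smooth_atlas \<A>"
begin

lemma chart_cover: "\<exists>c\<in>\<A>. p \<in> fst c"
  using atlas by (auto simp: smooth_atlas_def)

lemma chart_open: "c \<in> \<A> \<Longrightarrow> open (fst c)"
  using atlas by (auto simp: smooth_atlas_def)

lemma chart_homeo: "c \<in> \<A> \<Longrightarrow> homeomorphism (fst c) (snd c ` fst c) (snd c) (chart_point c)"
  using atlas by (auto simp: smooth_atlas_def chart_point_def)

lemma chart_image_open: "c \<in> \<A> \<Longrightarrow> open (snd c ` fst c)"
  using atlas by (auto simp: smooth_atlas_def)

lemma chart_point [simp]: "c \<in> \<A> \<Longrightarrow> p \<in> fst c \<Longrightarrow> chart_point c (snd c p) = p"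
  using chart_homeo[of c] by (simp add: homeomorphism_apply1)

lemma open_coords: "c \<in> \<A> \<Longrightarrow> open V \<Longrightarrow> open (coords c V)"
proof -
  assume c: "c \<in> \<A>" and V: "open V"
  have "openin (top_of_set (fst c)) (fst c \<inter> V)" using V by (simp add: openin_open_Int)
  then have "openin (top_of_set (snd c ` fst c)) (snd c ` (fst c \<inter> V))"
    using homeomorphism_imp_open_map[OF chart_homeo[OF c]] by blast
  then show ?thesis
    using chart_image_open[OF c] openin_open_trans unfolding coords_def by blast
qed

lemma coords_iff:
  "c \<in> \<A> \<Longrightarrow> x \<in> coords c V \<longleftrightarrow> x \<in> snd c ` fst c \<and> chart_point c x \<in> V"
  by (auto simp: coords_def)

lemma coords_Int: "c \<in> \<A> \<Longrightarrow> coords c (V \<inter> W) = coords c V \<inter> coords c W"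
  by (auto simp: coords_iff)

lemma coords_mono: "V \<subseteq> W \<Longrightarrow> coords c V \<subseteq> coords c W"
  by (auto simp: coords_def)

lemma coords_monoD: "x \<in> coords c V \<Longrightarrow> V \<subseteq> W \<Longrightarrow> x \<in> coords c W"
  by (auto simp: coords_def)

lemma transition_apply: "transition c c' x = snd c' (chart_point c x)"
  by (simp add: transition_def chart_point_def)

context
  fixes c c' assumes c: "c \<in> \<A>" "c' \<in> \<A>"
begin

lemma transition_coords: "x \<in> coords c (V \<inter> fst c') \<Longrightarrow> transition c c' x \<in> coords c' (V \<inter> fst c)"
  using c by (auto simp: coords_def transition_apply)

lemma transition_coords': "x \<in> coords c (V \<inter> fst c') \<Longrightarrow> transition c c' x \<in> coords c' V"
  using transition_coords[of x V] coords_mono[of "V \<inter> fst c" V c'] by blast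

lemma chart_point_transition: "x \<in> coords c (fst c') \<Longrightarrow> chart_point c' (transition c c' x) = chart_point c x"
  using c by (auto simp: coords_def transition_apply)

lemma transition_transition: "x \<in> coords c (fst c') \<Longrightarrow> transition c' c'' (transition c c' x) = transition c c'' x"
  using chart_point_transition by (simp add: transition_apply)

lemma transition_self: "x \<in> coords c V \<Longrightarrow> transition c c x = x"
  using c by (auto simp: coords_def transition_apply)

lemma smooth_transition: "V \<subseteq> fst c' \<Longrightarrow> smooth_on (coords c V) (transition c c')"
proof -
  assume "V \<subseteq> fst c'"
  moreover have "smooth_on (coords c (fst c')) (transition c c')"
    using atlas c unfolding smooth_atlas_def by blast
  ultimately show ?thesis by (auto intro: smooth_on_subset[OF _ coords_mono])
qed

lemma open_overlap: "open V \<Longrightarrow> open (coords c (V \<inter> fst c'))"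
  using open_coords c chart_open by (simp add: open_Int)

lemma linear_transition_deriv: "x \<in> coords c (fst c') \<Longrightarrow> linear (transition_deriv c c' x)"
  unfolding transition_deriv_def by (rule smooth_on_linear_derivative[OF smooth_transition]) auto

end

lemma transition_deriv_chain:
  assumes c: "c \<in> \<A>" "c' \<in> \<A>" "c'' \<in> \<A>" and x: "x \<in> coords c (fst c' \<inter> fst c'')"
  shows "transition_deriv c c'' x v = transition_deriv c' c'' (transition c c' x) (transition_deriv c c' x v)"
proof -
  let ?S = "coords c (fst c' \<inter> fst c'')"
  have S: "open ?S" by (intro open_coords open_Int chart_open c)
  have "transition_deriv c c'' x v = frechet_derivative (\<lambda>y. transition c' c'' (transition c c' y)) (at x) v"
    unfolding transition_deriv_def
    using frechet_derivative_cong_open[OF S x, of "transition c c''" "\<lambda>y. transition c' c'' (transition c c' y)"]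
      transition_transition[OF c(1,2), of _ c''] coords_mono[of "fst c' \<inter> fst c''" "fst c'" c]
    by (metis Int_lower1 subset_iff)
  also have "\<dots> = transition_deriv c' c'' (transition c c' x) (transition_deriv c c' x v)"
    unfolding transition_deriv_def
  proof (rule frechet_derivative_chain[OF S _ _ _ x])
    show "smooth_on ?S (transition c c')" by (rule smooth_transition) (use c in auto)
    show "smooth_on (coords c' (fst c'')) (transition c' c'')" by (rule smooth_transition) (use c in auto)
    show "transition c c' x \<in> coords c' (fst c'')"
      using transition_coords'[OF c(1,2), of x "fst c''"] x by (simp add: Int_commute)
  qed
  finally show ?thesis .
qed

lemma transition_deriv_self:
  assumes c: "c \<in> \<A>" and x: "x \<in> coords c V"
  shows "transition_deriv c c x v = v"
proof -
  have S: "open (coords c UNIV)" using open_coords c by auto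
  have "frechet_derivative (transition c c) (at x) = frechet_derivative (\<lambda>y. y) (at x)"
    by (rule frechet_derivative_cong_open[OF S]) (use x coords_mono[of V UNIV c] transition_self[OF c c] in auto)
  then show ?thesis by (simp add: transition_deriv_def)
qed

lemma transition_deriv_inverse:
  assumes c: "c \<in> \<A>" "c' \<in> \<A>" and x: "x \<in> coords c (fst c')"
  shows "transition_deriv c' c (transition c c' x) (transition_deriv c c' x v) = v"
    "transition_deriv c c' x (transition_deriv c' c (transition c c' x) v) = v"
proof -
  have x': "x \<in> coords c (fst c' \<inter> fst c)" using x by (auto simp: coords_def)
  show "transition_deriv c' c (transition c c' x) (transition_deriv c c' x v) = v"
    using transition_deriv_chain[OF c c(1) x', of v] transition_deriv_self[OF c(1) x] by simp
  have y: "transition c c' x \<in> coords c' (fst c \<inter> fst c')"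
    using transition_coords[OF c, of x UNIV] x by (auto simp: coords_def)
  then show "transition_deriv c c' x (transition_deriv c' c (transition c c' x) v) = v"
    using transition_deriv_chain[OF c(2,1,2) y, of v] transition_deriv_self[OF c(2) y]
      transition_transition[OF c x] transition_self[OF c(1,1) x] by simp
qed

lemma surj_transition_deriv:
  "c \<in> \<A> \<Longrightarrow> c' \<in> \<A> \<Longrightarrow> x \<in> coords c (fst c') \<Longrightarrow> surj (transition_deriv c c' x)"
  using transition_deriv_inverse(2) by (metis surjI)

lemma forms_iff:
  "\<omega> \<in> forms \<A> V (int k) \<longleftrightarrow>
    (\<forall>c x. c \<notin> \<A> \<or> x \<notin> coords c V \<longrightarrow> \<omega> c x = 0) \<and>
    (\<forall>c\<in>\<A>. \<forall>x\<in>coords c V. alternating k (\<omega> c x)) \<and>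
    (\<forall>c\<in>\<A>. smooth_field (coords c V) (\<omega> c)) \<and>
    (\<forall>c\<in>\<A>. \<forall>c'\<in>\<A>. \<forall>x\<in>coords c (V \<inter> fst c').
       \<omega> c x = pullback (transition_deriv c c' x) (\<omega> c' (transition c c' x)))"
  by (auto simp: forms_def smooth_field_def fun_eq_iff pullback_apply)

lemma forms_neg: "k < 0 \<Longrightarrow> forms \<A> V k = {0}"
  by (simp add: forms_def)

lemma int_cases_neg:
  fixes k :: int
  obtains "k < 0" | m where "k = int m"
  by (metis nat_0_le not_less)

context
  fixes V :: "'a set" and k :: nat and \<omega>
  assumes \<omega>: "\<omega> \<in> forms \<A> V (int k)"
begin

lemma form_outside: "c \<notin> \<A> \<or> x \<notin> coords c V \<Longrightarrow> \<omega> c x = 0"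
  and form_alternating: "c \<in> \<A> \<Longrightarrow> alternating k (\<omega> c x)"
  and form_smooth: "c \<in> \<A> \<Longrightarrow> smooth_field (coords c V) (\<omega> c)"
  and form_transition: "c \<in> \<A> \<Longrightarrow> c' \<in> \<A> \<Longrightarrow> x \<in> coords c (V \<inter> fst c') \<Longrightarrow>
    \<omega> c x = pullback (transition_deriv c c' x) (\<omega> c' (transition c c' x))"
proof -
  note * = \<omega>[unfolded forms_iff]
  show 1: "c \<notin> \<A> \<or> x \<notin> coords c V \<Longrightarrow> \<omega> c x = 0" using * by blast
  show "c \<in> \<A> \<Longrightarrow> alternating k (\<omega> c x)" using * 1 by (cases "x \<in> coords c V") auto
  show "c \<in> \<A> \<Longrightarrow> smooth_field (coords c V) (\<omega> c)" using * by blast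
  show "c \<in> \<A> \<Longrightarrow> c' \<in> \<A> \<Longrightarrow> x \<in> coords c (V \<inter> fst c') \<Longrightarrow>
    \<omega> c x = pullback (transition_deriv c c' x) (\<omega> c' (transition c c' x))" using * by blast
qed

end

lemma form_apply:
  fixes \<omega> \<tau> :: "('a, 'e) form"
  shows "(\<omega> + \<tau>) c x = \<omega> c x + \<tau> c x" "(\<omega> - \<tau>) c x = \<omega> c x - \<tau> c x" "(r *\<^sub>R \<omega>) c x = r *\<^sub>R \<omega> c x"
    "(0 :: ('a, 'e) form) c x = 0"
  by (simp_all add: fun_simps zero_fun_apply)

lemma form_eqI:
  fixes \<omega> \<tau> :: "('a, 'e) form"
  assumes "\<And>c x. \<omega> c x = \<tau> c x" shows "\<omega> = \<tau>"
  using assms by (intro ext) metis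

lemma form_outside': "\<omega> \<in> forms \<A> V k \<Longrightarrow> c \<notin> \<A> \<or> x \<notin> coords c V \<Longrightarrow> \<omega> c x = 0"
  by (cases k rule: int_cases_neg) (auto simp: forms_neg form_apply dest: form_outside)

lemma forms_eqI:
  assumes "\<omega> \<in> forms \<A> V k" "\<tau> \<in> forms \<A> V l"
    and "\<And>c x. c \<in> \<A> \<Longrightarrow> x \<in> coords c V \<Longrightarrow> \<omega> c x = \<tau> c x"
  shows "\<omega> = \<tau>"
  using assms form_outside'[OF assms(1)] form_outside'[OF assms(2)] by (intro form_eqI) metis

lemma zero_forms: "0 \<in> forms \<A> V k"
proof (cases k rule: int_cases_neg)
  case (2 m)
  then show ?thesis by (simp add: forms_iff form_apply pullback_linear, simp add: smooth_field_def fun_simps zero_fun_apply)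
qed (simp add: forms_neg)

context
  fixes V :: "'a set" assumes V: "open V"
begin

lemmas op = open_coords[OF _ V]

lemma subspace_forms: "subspace (forms \<A> V k)"
proof (cases k rule: int_cases_neg)
  case (2 m)
  show ?thesis unfolding 2
  proof (intro subspaceI)
    show "0 \<in> forms \<A> V (int m)" by (rule zero_forms)
    fix \<omega> assume \<omega>: "\<omega> \<in> forms \<A> V (int m)"
    show "r *\<^sub>R \<omega> \<in> forms \<A> V (int m)" for r
      unfolding forms_iff form_apply
    proof (intro conjI allI impI ballI)
      show "smooth_field (coords c V) (\<lambda>y. r *\<^sub>R \<omega> c y)" if "c \<in> \<A>" for c
        by (rule smooth_field_scaleR[OF op[OF that] smooth_on_const form_smooth[OF \<omega> that]])
    qed (use form_outside[OF \<omega>] form_alternating[OF \<omega>] form_transition[OF \<omega>] in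
        \<open>auto simp: pullback_linear intro: alternating_scaleR\<close>)
    show "\<omega> + \<tau> \<in> forms \<A> V (int m)" if \<tau>: "\<tau> \<in> forms \<A> V (int m)" for \<tau>
      unfolding forms_iff form_apply
    proof (intro conjI allI impI ballI)
      show "smooth_field (coords c V) (\<lambda>y. \<omega> c y + \<tau> c y)" if "c \<in> \<A>" for c
        by (rule smooth_field_add[OF op[OF that] form_smooth[OF \<omega> that] form_smooth[OF \<tau> that]])
    qed (use form_outside[OF \<omega>] form_alternating[OF \<omega>] form_transition[OF \<omega>]
         form_outside[OF \<tau>] form_alternating[OF \<tau>] form_transition[OF \<tau>] in
        \<open>auto simp: pullback_linear intro: alternating_add\<close>)
  qed
qed (simp add: forms_neg)

lemma wedge_apply:
  fixes \<omega> \<tau> :: "('a, 'e) form"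
  shows "(\<omega> \<and>\<^sub>d \<tau>) c x = wedge_alt (\<omega> c x) (\<tau> c x)"
  by (simp add: wedge_def)

lemma wedge_zero: "(0 :: ('a, 'e) form) \<and>\<^sub>d \<tau> = 0" "\<tau> \<and>\<^sub>d (0 :: ('a, 'e) form) = 0"
  by (auto intro!: form_eqI simp: wedge_apply form_apply)

lemma wedge_forms:
  assumes "\<omega> \<in> forms \<A> V k" "\<tau> \<in> forms \<A> V l"
  shows "\<omega> \<and>\<^sub>d \<tau> \<in> forms \<A> V (k + l)"
proof (cases "k < 0 \<or> l < 0")
  case True
  then have "\<omega> \<and>\<^sub>d \<tau> = 0" using assms wedge_zero by (auto simp: forms_neg)
  then show ?thesis using zero_forms by simp
next
  case False
  then obtain i j where ij: "k = int i" "l = int j" by (metis nat_0_le not_less)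
  note f = assms[unfolded ij]
  have "\<omega> \<and>\<^sub>d \<tau> \<in> forms \<A> V (int (i + j))"
    unfolding forms_iff wedge_apply
  proof (intro conjI allI impI ballI)
    show "wedge_alt (\<omega> c x) (\<tau> c x) = 0" if "c \<notin> \<A> \<or> x \<notin> coords c V" for c x
      using form_outside[OF f(1) that] by simp
    show "alternating (i + j) (wedge_alt (\<omega> c x) (\<tau> c x))" if "c \<in> \<A>" for c x
      using that form_alternating f by (blast intro: alternating_wedge)
    show "smooth_field (coords c V) (\<lambda>x. wedge_alt (\<omega> c x) (\<tau> c x))" if "c \<in> \<A>" for c
      using smooth_field_wedge[OF op form_smooth[OF f(1)] form_smooth[OF f(2)]] that by blast
    show "wedge_alt (\<omega> c x) (\<tau> c x) = pullback (transition_deriv c c' x)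
       (wedge_alt (\<omega> c' (transition c c' x)) (\<tau> c' (transition c c' x)))"
      if "c \<in> \<A>" "c' \<in> \<A>" "x \<in> coords c (V \<inter> fst c')" for c c' x
      using form_transition[OF f(1) that] form_transition[OF f(2) that] by (simp add: pullback_wedge)
  qed
  then show ?thesis by (simp add: ij)
qed

lemma d_form_apply:
  fixes \<omega> :: "('a, 'e) form"
  shows "x \<in> coords c V \<Longrightarrow> d_form V \<omega> c x = ext_deriv (\<omega> c) x"
  by (simp add: d_form_def restrict_form_def)

lemma ext_deriv_0: "ext_deriv (0 :: 'e \<Rightarrow> 'e list \<Rightarrow> real) x = 0"
  by (rule ext) (simp add: ext_deriv_def zero_fun_apply frechet_derivative_const)

lemma d_form_zero: "d_form V (0 :: ('a, 'e) form) = 0"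
proof (rule form_eqI)
  fix c :: "('a, 'e) chart" and x
  have "(0 :: ('a, 'e) form) c = 0" by (rule ext) (simp add: form_apply field_apply)
  then show "d_form V (0 :: ('a, 'e) form) c x = (0 :: ('a, 'e) form) c x"
    by (simp add: d_form_def restrict_form_def form_apply field_apply ext_deriv_0)
qed

lemma d_form_outside: "\<omega> \<in> forms \<A> V k \<Longrightarrow> c \<notin> \<A> \<or> x \<notin> coords c V \<Longrightarrow> d_form V \<omega> c x = 0"
proof -
  assume *: "\<omega> \<in> forms \<A> V k" "c \<notin> \<A> \<or> x \<notin> coords c V"
  have "\<omega> c = 0" if "c \<notin> \<A>"
    by (rule ext) (use form_outside'[OF *(1)] that in \<open>simp add: field_apply\<close>)
  then show ?thesis using * ext_deriv_0 by (auto simp: d_form_def restrict_form_def)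
qed

lemma d_form_forms:
  assumes "\<omega> \<in> forms \<A> V k"
  shows "d_form V \<omega> \<in> forms \<A> V (k + 1)"
proof (cases k rule: int_cases_neg)
  case 1
  then show ?thesis using assms d_form_zero zero_forms by (simp add: forms_neg)
next
  case (2 m)
  note f = assms[unfolded 2]
  have "d_form V \<omega> \<in> forms \<A> V (int (Suc m))"
    unfolding forms_iff
  proof (intro conjI allI impI ballI)
    show "d_form V \<omega> c x = 0" if "c \<notin> \<A> \<or> x \<notin> coords c V" for c x
      using d_form_outside[OF f that] .
    show "alternating (Suc m) (d_form V \<omega> c x)" if "c \<in> \<A>" "x \<in> coords c V" for c x
      using alternating_ext_deriv[OF op form_smooth[OF f] form_alternating[OF f]] that
      by (simp add: d_form_apply)
    show "smooth_field (coords c V) (d_form V \<omega> c)" if "c \<in> \<A>" for c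
      by (rule smooth_field_cong[OF op[OF that] smooth_field_ext_deriv[OF op[OF that] form_smooth[OF f that]]])
        (simp add: d_form_apply)
    fix c c' x assume c: "c \<in> \<A>" "c' \<in> \<A>" and x: "x \<in> coords c (V \<inter> fst c')"
    let ?S = "coords c (V \<inter> fst c')"
    have xV: "x \<in> coords c V" using coords_monoD[OF x] by simp
    have "ext_deriv (\<omega> c) x = ext_deriv (\<lambda>y. pullback (frechet_derivative (transition c c') (at y)) (\<omega> c' (transition c c' y))) x"
      using form_transition[OF f c] by (intro ext_deriv_cong[OF open_overlap[OF c V] x]) (simp add: transition_deriv_def)
    \<comment> \<open>Naturality of the exterior derivative under the transition map is what makes
      the local expressions fit together.\<close>
    also have "\<dots> = pullback (frechet_derivative (transition c c') (at x)) (ext_deriv (\<omega> c') (transition c c' x))"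
      using ext_deriv_pullback[OF open_overlap[OF c V] op[OF c(2)] smooth_transition[OF c] _ x form_smooth[OF f c(2)] form_alternating[OF f c(2)]]
        transition_coords'[OF c] by auto
    finally show "d_form V \<omega> c x = pullback (transition_deriv c c' x) (d_form V \<omega> c' (transition c c' x))"
      using xV transition_coords'[OF c x] by (simp add: d_form_apply transition_deriv_def)
  qed
  then show ?thesis by (simp add: 2 add.commute)
qed

lemma d_form_linear:
  assumes "\<omega> \<in> forms \<A> V k" "\<tau> \<in> forms \<A> V k"
  shows "d_form V (a *\<^sub>R \<omega> + b *\<^sub>R \<tau>) = a *\<^sub>R d_form V \<omega> + b *\<^sub>R d_form V \<tau>"
proof (cases k rule: int_cases_neg)
  case 1
  then show ?thesis using assms d_form_zero by (simp add: forms_neg)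
next
  case (2 m)
  note f = assms[unfolded 2]
  have sub: "a *\<^sub>R \<omega> + b *\<^sub>R \<tau> \<in> forms \<A> V k" "a *\<^sub>R d_form V \<omega> + b *\<^sub>R d_form V \<tau> \<in> forms \<A> V (k + 1)"
    using assms d_form_forms subspace_forms by (auto intro!: subspace_add subspace_scale)
  show ?thesis
  proof (rule forms_eqI[OF d_form_forms[OF sub(1)] sub(2)])
    fix c x assume c: "c \<in> \<A>" and x: "x \<in> coords c V"
    have "ext_deriv (\<lambda>y. a *\<^sub>R \<omega> c y + b *\<^sub>R \<tau> c y) x = a *\<^sub>R ext_deriv (\<omega> c) x + b *\<^sub>R ext_deriv (\<tau> c) x"
      using form_smooth[OF f(1) c] form_smooth[OF f(2) c]
      by (simp add: ext_deriv_linear(1)[OF op[OF c] x] ext_deriv_linear(4)[OF op[OF c] x, of _ "\<omega> c"]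
         smooth_field_scaleR[OF op[OF c]])
    then show "d_form V (a *\<^sub>R \<omega> + b *\<^sub>R \<tau>) c x = (a *\<^sub>R d_form V \<omega> + b *\<^sub>R d_form V \<tau>) c x"
      using x by (simp add: d_form_apply form_apply plus_fun_apply[of "a *\<^sub>R \<omega>"] scaleR_fun_def plus_fun_def)
  qed
qed

lemma d_form_d_form: "\<omega> \<in> forms \<A> V k \<Longrightarrow> d_form V (d_form V \<omega>) = 0"
proof (cases k rule: int_cases_neg)
  case 1
  assume "\<omega> \<in> forms \<A> V k"
  then show ?thesis using 1 d_form_zero by (simp add: forms_neg)
next
  case (2 m)
  assume a: "\<omega> \<in> forms \<A> V k"
  note f = a[unfolded 2]
  show ?thesis
  proof (rule forms_eqI[OF d_form_forms[OF d_form_forms[OF a]] zero_forms[of V k]])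
    fix c x assume c: "c \<in> \<A>" and x: "x \<in> coords c V"
    have "ext_deriv (d_form V \<omega> c) x = ext_deriv (ext_deriv (\<omega> c)) x"
      by (rule ext_deriv_cong[OF op[OF c] x]) (simp add: d_form_apply)
    then show "d_form V (d_form V \<omega>) c x = 0 c x"
      using ext_deriv_ext_deriv[OF op[OF c] form_smooth[OF f c] x] x by (simp add: d_form_apply form_apply)
  qed
qed

lemma d_form_wedge:
  assumes "\<omega> \<in> forms \<A> V k" "\<tau> \<in> forms \<A> V l"
  shows "d_form V (\<omega> \<and>\<^sub>d \<tau>) = d_form V \<omega> \<and>\<^sub>d \<tau> + (-1) powi k *\<^sub>R (\<omega> \<and>\<^sub>d d_form V \<tau>)"
proof (cases "k < 0 \<or> l < 0")
  case True
  then show ?thesis using assms wedge_zero d_form_zero by (auto simp: forms_neg)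
next
  case False
  then obtain i j where ij: "k = int i" "l = int j" by (metis nat_0_le not_less)
  note f = assms[unfolded ij]
  note df = d_form_forms[OF assms(1)] d_form_forms[OF assms(2)]
  have "d_form V \<omega> \<and>\<^sub>d \<tau> + (-1) powi k *\<^sub>R (\<omega> \<and>\<^sub>d d_form V \<tau>) \<in> forms \<A> V (k + l + 1)"
    using wedge_forms[OF df(1) assms(2)] wedge_forms[OF assms(1) df(2)]
    by (intro subspace_add[OF subspace_forms] subspace_scale[OF subspace_forms]) (simp_all add: algebra_simps)
  then show ?thesis
  proof (rule forms_eqI[OF d_form_forms[OF wedge_forms[OF assms]]])
    fix c x assume c: "c \<in> \<A>" and x: "x \<in> coords c V"
    show "d_form V (\<omega> \<and>\<^sub>d \<tau>) c x = (d_form V \<omega> \<and>\<^sub>d \<tau> + (-1) powi k *\<^sub>R (\<omega> \<and>\<^sub>d d_form V \<tau>)) c x"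
      using ext_deriv_wedge[OF op[OF c] x form_smooth[OF f(1) c] form_smooth[OF f(2) c]]
        alternating_parity[OF form_alternating[OF f(1) c]] x
      by (simp add: d_form_apply form_apply wedge_apply wedge_def[of \<omega> \<tau>] ij wedge_alt_scaleR_left)
  qed
qed

lemma wedge_assoc:
  fixes \<omega> \<tau> \<eta> :: "('a, 'e) form"
  shows "(\<omega> \<and>\<^sub>d \<tau>) \<and>\<^sub>d \<eta> = \<omega> \<and>\<^sub>d (\<tau> \<and>\<^sub>d \<eta>)"
  by (rule form_eqI) (simp add: wedge_apply wedge_alt_assoc)

lemma wedge_comm:
  assumes "\<omega> \<in> forms \<A> V k" "\<tau> \<in> forms \<A> V l"
  shows "\<omega> \<and>\<^sub>d \<tau> = (-1) powi (k * l) *\<^sub>R (\<tau> \<and>\<^sub>d \<omega>)"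
proof (cases "k < 0 \<or> l < 0")
  case True
  then show ?thesis using assms wedge_zero by (auto simp: forms_neg)
next
  case False
  then obtain i j where ij: "k = int i" "l = int j" by (metis nat_0_le not_less)
  note f = assms[unfolded ij]
  show ?thesis
  proof (rule forms_eqI[OF wedge_forms[OF assms]
        subspace_scale[OF subspace_forms wedge_forms[OF assms(2,1)]]])
    fix c x assume c: "c \<in> \<A>"
    show "(\<omega> \<and>\<^sub>d \<tau>) c x = ((-1) powi (k * l) *\<^sub>R (\<tau> \<and>\<^sub>d \<omega>)) c x"
      using wedge_alt_comm[OF form_alternating[OF f(1) c, THEN alternating_of_degree]
          form_alternating[OF f(2) c, THEN alternating_of_degree]]
      by (simp add: wedge_apply form_apply ij flip: of_nat_mult)
  qed
qed

lemma forms_above_DIM: "int DIM('e) < k \<Longrightarrow> forms \<A> V k = {0}"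
proof -
  assume k: "int DIM('e) < k"
  then obtain m where m: "k = int m" by (metis int_cases_neg not_less of_nat_0_le_iff order.strict_trans1 order_less_asym)
  have "\<omega> = 0" if "\<omega> \<in> forms \<A> V k" for \<omega>
    using alternating_above_DIM[OF form_alternating[OF that[unfolded m]]] k m
    by (intro forms_eqI[OF that zero_forms[of V k]]) (auto simp: form_apply)
  then show ?thesis using zero_forms by auto
qed

lemma one_form_forms: "one_form \<A> V \<in> forms \<A> V 0"
proof -
  have eq: "one_form \<A> V c x = (if c \<in> \<A> \<and> x \<in> coords c V then scalar_form 1 else 0)" for c x
    by (rule ext) (auto simp: one_form_def scalar_form_def zero_fun_apply)
  have "one_form \<A> V \<in> forms \<A> V (int 0)"
    unfolding forms_iff eq
  proof (intro conjI allI impI ballI)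
    show "smooth_field (coords c V) (\<lambda>x. if c \<in> \<A> \<and> x \<in> coords c V then scalar_form 1 else 0)" if "c \<in> \<A>" for c
      by (rule smooth_field_cong[OF op[OF that] smooth_field_const[of _ "scalar_form 1"]]) (simp add: that)
    show "(if c \<in> \<A> \<and> x \<in> coords c V then scalar_form 1 else 0) =
       pullback (transition_deriv c c' x) (if c' \<in> \<A> \<and> transition c c' x \<in> coords c' V then scalar_form 1 else 0)"
      if "c \<in> \<A>" "c' \<in> \<A>" "x \<in> coords c (V \<inter> fst c')" for c c' x
      using that transition_coords'[OF that] coords_mono[of "V \<inter> fst c'" V c] by auto
  qed auto
  then show ?thesis by simp
qed

lemma wedge_power_apply:
  fixes \<beta> :: "('a, 'e) form"
  shows "c \<in> \<A> \<Longrightarrow> x \<in> coords c V \<Longrightarrow> wedge_power \<A> V \<beta> m c x = wpow (\<beta> c x) m"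
proof (induction m)
  case 0
  then show ?case by (intro ext) (simp add: one_form_def scalar_form_def)
qed (simp add: wedge_apply)

lemma wedge_power_forms: "\<beta> \<in> forms \<A> V 2 \<Longrightarrow> wedge_power \<A> V \<beta> m \<in> forms \<A> V (2 * int m)"
proof (induction m)
  case 0
  then show ?case using one_form_forms by simp
next
  case (Suc m)
  then show ?case using wedge_forms[of \<beta> 2 _ "2 * int m"] by (simp add: algebra_simps)
qed

end

section \<open>Restriction of forms to smaller open sets\<close>

lemma restrict_apply:
  fixes \<omega> :: "('a, 'e) form"
  shows "x \<in> coords c W \<Longrightarrow> restrict_form W \<omega> c x = \<omega> c x"
  by (simp add: restrict_form_def)

lemma restrict_forms:
  assumes "open W" "W \<subseteq> V" "\<omega> \<in> forms \<A> V k"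
  shows "restrict_form W \<omega> \<in> forms \<A> W k"
proof (cases k rule: int_cases_neg)
  case 1
  then show ?thesis using assms(3) by (auto simp: forms_neg restrict_form_def form_apply intro!: form_eqI)
next
  case (2 m)
  note f = assms(3)[unfolded 2]
  show ?thesis unfolding 2 forms_iff
  proof (intro conjI allI impI ballI)
    show "restrict_form W \<omega> c x = 0" if "c \<notin> \<A> \<or> x \<notin> coords c W" for c x
      unfolding restrict_form_def using that form_outside[OF f, of c x] by auto
    show "alternating m (restrict_form W \<omega> c x)" if "c \<in> \<A>" "x \<in> coords c W" for c x
      using form_alternating[OF f that(1)] that by (simp add: restrict_apply)
    show "smooth_field (coords c W) (restrict_form W \<omega> c)" if "c \<in> \<A>" for c
      by (rule smooth_field_cong[OF open_coords[OF that assms(1)] smooth_field_subset[OF form_smooth[OF f that]]])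
        (use coords_mono[OF assms(2), of c] in \<open>auto simp: restrict_apply\<close>)
    fix c c' x assume c: "c \<in> \<A>" "c' \<in> \<A>" and x: "x \<in> coords c (W \<inter> fst c')"
    have "x \<in> coords c (V \<inter> fst c')" "x \<in> coords c W" 
    using coords_monoD[OF x, of "V \<inter> fst c'"] coords_monoD[OF x, of W] assms(2) by auto
    then show "restrict_form W \<omega> c x = pullback (transition_deriv c c' x) (restrict_form W \<omega> c' (transition c c' x))"
      using form_transition[OF f c] transition_coords'[OF c x] by (simp add: restrict_apply)
  qed
qed

lemma restrict_d_form:
  assumes "open W" "open V" "W \<subseteq> V" "\<omega> \<in> forms \<A> V k"
  shows "d_form W (restrict_form W \<omega>) = restrict_form W (d_form V \<omega>)"
proof (rule forms_eqI[OF d_form_forms[OF assms(1) restrict_forms[OF assms(1,3,4)]]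
      restrict_forms[OF assms(1,3) d_form_forms[OF assms(2,4)]]])
  fix c x assume c: "c \<in> \<A>" and x: "x \<in> coords c W"
  have "ext_deriv (restrict_form W \<omega> c) x = ext_deriv (\<omega> c) x"
    by (rule ext_deriv_cong[OF open_coords[OF c assms(1)] x]) (simp add: restrict_apply)
  moreover have "x \<in> coords c V" by (rule coords_monoD[OF x assms(3)])
  ultimately show "d_form W (restrict_form W \<omega>) c x = restrict_form W (d_form V \<omega>) c x"
    using x by (simp add: d_form_apply[OF assms(1)] d_form_apply[OF assms(2)] restrict_apply)
qed

lemma restrict_wedge:
  fixes \<omega> \<tau> :: "('a, 'e) form"
  shows "restrict_form W (\<omega> \<and>\<^sub>d \<tau>) = restrict_form W \<omega> \<and>\<^sub>d restrict_form W \<tau>"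
  by (rule form_eqI) (auto simp: restrict_form_def wedge_def)

lemma restrict_linear:
  fixes \<omega> \<tau> :: "('a, 'e) form"
  shows "restrict_form W (a *\<^sub>R \<omega> + b *\<^sub>R \<tau>) = a *\<^sub>R restrict_form W \<omega> + b *\<^sub>R restrict_form W \<tau>"
  "restrict_form W (\<omega> - \<tau>) = restrict_form W \<omega> - restrict_form W \<tau>"
  "restrict_form W (a *\<^sub>R \<omega>) = a *\<^sub>R restrict_form W \<omega>"
  "restrict_form W (0 :: ('a, 'e) form) = 0"
  by (auto intro!: form_eqI simp: restrict_form_def form_apply)

lemma restrict_restrict:
  fixes \<omega> :: "('a, 'e) form"
  assumes "O' \<subseteq> W" shows "restrict_form O' (restrict_form W \<omega>) = restrict_form O' \<omega>"
proof (rule form_eqI)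
  fix c :: "('a, 'e) chart" and x
  show "restrict_form O' (restrict_form W \<omega>) c x = restrict_form O' \<omega> c x"
    using coords_mono[OF assms, of c] by (auto simp: restrict_form_def)
qed

lemma restrict_self: "\<omega> \<in> forms \<A> V k \<Longrightarrow> restrict_form V \<omega> = \<omega>"
  using form_outside' by (intro form_eqI) (auto simp: restrict_form_def)

end

section \<open>Contact forms on a CR manifold\<close>

lemma cscale_simps:
  "fst (cscale a z) = Re a *\<^sub>R fst z - Im a *\<^sub>R snd z" "snd (cscale a z) = Re a *\<^sub>R snd z + Im a *\<^sub>R fst z"
  by (simp_all add: cscale_def)

lemma cscale_add: "cscale a z + cscale b z = cscale (a + b) z"
  and cscale_cscale: "cscale a (cscale b z) = cscale (a * b) z"
  by (simp_all add: prod_eq_iff cscale_simps algebra_simps)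

lemma cscale_zero [simp]: "cscale 0 z = 0" "cscale a 0 = 0"
  by (simp_all add: prod_eq_iff cscale_simps)

lemma cscale_sum: "cscale a (\<Sum>i\<in>I. f i) = (\<Sum>i\<in>I. cscale a (f i))"
  by (simp add: prod_eq_iff cscale_simps fst_sum snd_sum scaleR_sum_right sum_subtractf sum.distrib)

lemma linear_cscale: "bounded_linear (cscale a :: 'e::euclidean_space \<times> 'e \<Rightarrow> _)"
  by (intro linear_conv_bounded_linear[THEN iffD1] linearI)
    (simp_all add: prod_eq_iff cscale_simps algebra_simps)

section \<open>The real distribution of a complex frame\<close>

definition real_frame :: "nat \<Rightarrow> (nat \<Rightarrow> 'e::real_vector \<times> 'e) \<Rightarrow> nat \<Rightarrow> 'e" where
  "real_frame n Z i = (if i < n then fst (Z i) else snd (Z (i - n)))"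

locale complex_frame =
  fixes n and Z :: "nat \<Rightarrow> 'e::euclidean_space \<times> 'e" and T :: "('e \<times> 'e) set"
  assumes T: "T = {\<Sum>i<n. cscale (a i) (Z i) | a. True}"
begin

lemma T_I: "(\<Sum>i<n. cscale (a i) (Z i)) \<in> T"
  using T by blast

lemma T_cscale: "z \<in> T \<Longrightarrow> cscale b z \<in> T"
proof -
  assume "z \<in> T"
  then obtain a where "z = (\<Sum>i<n. cscale (a i) (Z i))" using T by blast
  then have "cscale b z = (\<Sum>i<n. cscale (b * a i) (Z i))" by (simp add: cscale_sum cscale_cscale)
  then show ?thesis using T_I by metis
qed

lemma T_add: "z \<in> T \<Longrightarrow> w \<in> T \<Longrightarrow> z + w \<in> T"
proof -
  assume "z \<in> T" "w \<in> T"
  then obtain a b where "z = (\<Sum>i<n. cscale (a i) (Z i))" "w = (\<Sum>i<n. cscale (b i) (Z i))" using T by blast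
  then have "z + w = (\<Sum>i<n. cscale (a i + b i) (Z i))" by (simp add: sum.distrib cscale_add[symmetric])
  then show ?thesis using T_I by metis
qed

lemma T_zero: "0 \<in> T"
  using T_I[of "\<lambda>_. 0"] by simp

text \<open>A vector and its conjugate have the same real part, so H already consists of the real
  parts of vectors of \<open>T\<close>.\<close>

lemma real_part_eq: "real_part T = fst ` T"
proof
  show "real_part T \<subseteq> fst ` T"
    using T_add by (force simp: real_part_def conj_vec_def)
  show "fst ` T \<subseteq> real_part T"
  proof safe
    fix x y assume "(x, y) \<in> T"
    then show "fst (x, y) \<in> real_part T"
      unfolding real_part_def using T_zero by (intro CollectI exI[of _ "(x, y)"] exI[of _ 0]) (simp add: conj_vec_def)
  qed
qed

text \<open>The imaginary part of \<open>z\<close> is the real part of \<open>- \<i>\<close> times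
  \<open>z\<close>.\<close>

lemma snd_real_part: "z \<in> T \<Longrightarrow> snd z \<in> real_part T"
  using T_cscale[of z "- \<i>"] unfolding real_part_eq by (force simp: cscale_simps)

lemma fst_real_part: "z \<in> T \<Longrightarrow> fst z \<in> real_part T"
  unfolding real_part_eq by blast

text \<open>The minus sign comes from
  \<open>Re ((a + \<i> * b) * (x + \<i> * y)) = a * x - b * y\<close>.\<close>

lemma sum_real_frame:
  "(\<Sum>i<2 * n. r i *\<^sub>R real_frame n Z i) = fst (\<Sum>i<n. cscale (Complex (r i) (- r (i + n))) (Z i))"
proof -
  have "(\<Sum>i<n + m. f i) = (\<Sum>i<n. f i) + (\<Sum>i<m. f (i + n))" for m and f :: "nat \<Rightarrow> 'e"
    by (induction m) (simp_all add: algebra_simps)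
  from this[of _ n]
  have "(\<Sum>i<2 * n. r i *\<^sub>R real_frame n Z i) = (\<Sum>i<n. r i *\<^sub>R real_frame n Z i) + (\<Sum>i<n. r (i + n) *\<^sub>R real_frame n Z (i + n))"
    by (simp add: mult_2)
  then show ?thesis by (simp add: real_frame_def fst_sum cscale_simps sum.distrib)
qed

lemma real_part_repr:
  assumes "v \<in> real_part T"
  shows "\<exists>r. v = (\<Sum>i<2 * n. r i *\<^sub>R real_frame n Z i)"
proof -
  obtain a where v: "v = fst (\<Sum>i<n. cscale (a i) (Z i))" using assms unfolding real_part_eq using T by auto
  define r where "r = (\<lambda>i. if i < n then Re (a i) else - Im (a (i - n)))"
  have "v = (\<Sum>i<2 * n. r i *\<^sub>R real_frame n Z i)"
    unfolding sum_real_frame v by (rule arg_cong[where f = fst], rule sum.cong) (simp_all add: r_def)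
  then show ?thesis by blast
qed

lemma real_part_span: "real_part T = span (real_frame n Z ` {..<2 * n})"
proof
  show "real_part T \<subseteq> span (real_frame n Z ` {..<2 * n})"
  proof
    fix v assume "v \<in> real_part T"
    then obtain r where v: "v = (\<Sum>i<2 * n. r i *\<^sub>R real_frame n Z i)" using real_part_repr by blast
    show "v \<in> span (real_frame n Z ` {..<2 * n})"
      unfolding v by (intro span_sum span_scale span_base imageI)
  qed
  have "subspace (real_part T)"
    unfolding real_part_eq
  proof (intro subspaceI)
    show "0 \<in> fst ` T" using T_zero by force
    show "x + y \<in> fst ` T" if "x \<in> fst ` T" "y \<in> fst ` T" for x y using that T_add by force
    show "r *\<^sub>R x \<in> fst ` T" if "x \<in> fst ` T" for r x using that T_cscale[of _ "Complex r 0"] by (force simp: cscale_simps image_iff)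
  qed
  moreover have "real_frame n Z ` {..<2 * n} \<subseteq> real_part T"
  proof safe
    fix i assume "i < 2 * n"
    then have "\<exists>a. real_frame n Z i = fst (\<Sum>j<n. cscale (a j) (Z j))"
      using sum_real_frame[of "\<lambda>j. if j = i then 1 else 0"] by (auto simp: if_distrib[of "\<lambda>r. r *\<^sub>R _"] sum.delta cong: if_cong)
    then show "real_frame n Z i \<in> real_part T" unfolding real_part_eq using T_I by blast
  qed
  ultimately show "span (real_frame n Z ` {..<2 * n}) \<subseteq> real_part T" by (rule span_minimal[rotated])
qed

lemma dim_real_part_le: "dim (real_part T) \<le> 2 * n"
proof -
  have "dim (real_frame n Z ` {..<2 * n}) \<le> card (real_frame n Z ` {..<2 * n})" by (rule dim_le_card') simp
  also have "\<dots> \<le> 2 * n" using card_image_le[of "{..<2 * n}" "real_frame n Z"] by simp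
  finally show ?thesis by (simp add: real_part_span)
qed

text \<open>A real relation says that some \<open>z\<close> in \<open>T\<close> is purely imaginary.
  Then the conjugate of \<open>z\<close> is \<open>- z\<close>, which lies in \<open>T\<close> and
  in its conjugate, so \<open>z\<close> vanishes; the complex frame is independent.\<close>

lemma real_frame_independent:
  assumes "T \<inter> conj_vec ` T = {0}" "\<forall>a. (\<Sum>i<n. cscale (a i) (Z i)) = 0 \<longrightarrow> (\<forall>i<n. a i = 0)"
    and "(\<Sum>i<2 * n. r i *\<^sub>R real_frame n Z i) = 0" "i < 2 * n"
  shows "r i = 0"
proof -
  let ?z = "\<Sum>i<n. cscale (Complex (r i) (- r (i + n))) (Z i)"
  have "fst ?z = 0" using assms(3) by (simp add: sum_real_frame)
  then have eq: "conj_vec ?z = cscale (-1) ?z" by (simp add: conj_vec_def cscale_def prod_eq_iff)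
  have "?z \<in> T" by (rule T_I)
  then have "conj_vec ?z \<in> conj_vec ` T" "cscale (-1) ?z \<in> T" by (rule imageI, rule T_cscale)
  then have "cscale (-1) ?z \<in> T \<inter> conj_vec ` T" unfolding eq by blast
  then have "cscale (-1) ?z = 0" using assms(1) by blast
  then have "?z = 0" by (simp add: cscale_def prod_eq_iff)
  then have z: "\<forall>i<n. Complex (r i) (- r (i + n)) = 0" by (rule mp[OF spec[OF assms(2)]])
  show ?thesis
  proof (cases "i < n")
    case True
    then show ?thesis using z by (auto simp: complex_eq_iff)
  next
    case False
    then show ?thesis using z[rule_format, of "i - n"] assms(4) by (auto simp: complex_eq_iff)
  qed
qed

lemma dim_real_part:
  assumes "T \<inter> conj_vec ` T = {0}" "\<forall>a. (\<Sum>i<n. cscale (a i) (Z i)) = 0 \<longrightarrow> (\<forall>i<n. a i = 0)"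
  shows "dim (real_part T) = 2 * n"
proof -
  note ind = real_frame_independent[OF assms]
  have inj: "inj_on (real_frame n Z) {..<2 * n}"
  proof (rule inj_onI, rule ccontr)
    fix i j assume ij: "i \<in> {..<2 * n}" "j \<in> {..<2 * n}" "real_frame n Z i = real_frame n Z j" "i \<noteq> j"
    let ?r = "\<lambda>k. (if k = i then 1 else 0) - (if k = j then 1 else (0::real))"
    have "(\<Sum>k<2 * n. ?r k *\<^sub>R real_frame n Z k) = 0"
      using ij by (simp add: scaleR_diff_left sum_subtractf if_distrib[of "\<lambda>r. r *\<^sub>R _"] sum.delta cong: if_cong)
    from ind[OF this, of i] show False using ij by auto
  qed
  have "independent (real_frame n Z ` {..<2 * n})"
  proof (rule independent_if_scalars_zero)
    fix f x assume "(\<Sum>x\<in>real_frame n Z ` {..<2 * n}. f x *\<^sub>R x) = 0" "x \<in> real_frame n Z ` {..<2 * n}"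
    then show "f x = 0" using ind[of "\<lambda>i. f (real_frame n Z i)"] by (auto simp: sum.reindex[OF inj])
  qed simp
  then show ?thesis using card_image[OF inj] by (simp add: real_part_span dim_eq_card_independent)
qed

end

locale CR = smooth_manifold \<A> for \<A> :: "('a::{t2_space, second_countable_topology}, 'e::euclidean_space) chart set" +
  fixes n :: nat and T :: "('a, 'e) distribution"
  assumes CR: "CR_manifold n \<A> T"
begin

lemma CR_dim: "DIM('e) = 2 * n + 1"
  using CR by (simp add: CR_manifold_def)

lemma CR_frame:
  assumes "c \<in> \<A>" "x \<in> coords c UNIV"
  obtains S Z where "open S" "x \<in> S" "S \<subseteq> coords c UNIV" "\<And>i. i < n \<Longrightarrow> smooth_on S (Z i)"
    "\<And>y. y \<in> S \<Longrightarrow> complex_frame n (\<lambda>i. Z i y) (T c y)"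
    "\<And>y. y \<in> S \<Longrightarrow> \<forall>a. (\<Sum>i<n. cscale (a i) (Z i y)) = 0 \<longrightarrow> (\<forall>i<n. a i = 0)"
proof -
  have "complex_distribution n \<A> T" using CR by (simp add: CR_manifold_def)
  then have "\<forall>c\<in>\<A>. \<forall>x\<in>coords c UNIV. \<exists>S Z. open S \<and> x \<in> S \<and> S \<subseteq> coords c UNIV \<and>
        (\<forall>i<n. smooth_on S (Z i)) \<and>
        (\<forall>y\<in>S. T c y = {\<Sum>i<n. cscale (a i) (Z i y) |a. True} \<and>
           (\<forall>a. (\<Sum>i<n. cscale (a i) (Z i y)) = 0 \<longrightarrow> (\<forall>i<n. a i = 0)))"
    unfolding complex_distribution_def by (rule conjunct2)
  from bspec[OF bspec[OF this assms(1)] assms(2)]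
  obtain S Z where "open S" "x \<in> S" "S \<subseteq> coords c UNIV" "\<forall>i<n. smooth_on S (Z i)"
    and *: "\<forall>y\<in>S. T c y = {\<Sum>i<n. cscale (a i) (Z i y) |a. True} \<and>
       (\<forall>a. (\<Sum>i<n. cscale (a i) (Z i y)) = 0 \<longrightarrow> (\<forall>i<n. a i = 0))" by (elim exE conjE) blast
  then show ?thesis
    by (intro that[of S Z]) (auto simp: complex_frame_def)
qed

lemma CR_transversal: "c \<in> \<A> \<Longrightarrow> x \<in> coords c UNIV \<Longrightarrow> T c x \<inter> conj_vec ` T c x = {0}"
  using CR by (simp add: CR_manifold_def)

lemma CR_transition:
  "c \<in> \<A> \<Longrightarrow> c' \<in> \<A> \<Longrightarrow> x \<in> coords c (fst c') \<Longrightarrow>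
    T c' (transition c c' x) = map_prod (transition_deriv c c' x) (transition_deriv c c' x) ` T c x"
  using CR by (simp add: CR_manifold_def complex_distribution_def)

lemma contact_forms_D:
  assumes "\<theta> \<in> contact_forms \<A> T W"
  shows "\<theta> \<in> forms \<A> W (int 1)" "c \<in> \<A> \<Longrightarrow> x \<in> coords c W \<Longrightarrow> \<theta> c x [v] = 0 \<longleftrightarrow> v \<in> real_part (T c x)"
  using assms by (auto simp: contact_forms_def)

text \<open>Integrability makes \<open>d\<theta>\<close> of type \<open>(1, 1)\<close> on \<open>T\<close>.\<close>

lemma ext_deriv_contact:
  assumes op: "open S" and x: "x \<in> S" and sm: "smooth_field S \<theta>"
    and alt: "\<And>y. y \<in> S \<Longrightarrow> alternating 1 (\<theta> y)"
    and X: "smooth_on S X" "\<And>y. y \<in> S \<Longrightarrow> \<theta> y [X y] = 0"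
    and Y: "smooth_on S Y" "\<And>y. y \<in> S \<Longrightarrow> \<theta> y [Y y] = 0"
  shows "ext_deriv \<theta> x [X x, Y x] =
    \<theta> x [frechet_derivative X (at x) (Y x)] - \<theta> x [frechet_derivative Y (at x) (X x)]"
proof -
  \<comment> \<open>Differentiating \<open>\<theta> y [Y y] = 0\<close>: the derivative falling on
    \<theta> is the negative of the one falling on \<open>Y\<close>.\<close>
  have D: "dir_deriv v \<theta> x [Y x] = - \<theta> x [frechet_derivative Y (at x) v]"
    if Y: "smooth_on S Y" "\<And>y. y \<in> S \<Longrightarrow> \<theta> y [Y y] = 0" for Y v
  proof -
    have lin: "linear (\<lambda>v. \<theta> y [v])" if "y \<in> S" for y using linear_alternating_1[OF alt[OF that]] .
    have exp: "\<theta> y [u] = (\<Sum>e\<in>Basis. (u \<bullet> e) * \<theta> y [e])" if "y \<in> S" for y u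
    proof -
      have "\<theta> y [u] = \<theta> y [\<Sum>e\<in>Basis. (u \<bullet> e) *\<^sub>R e]" by (simp add: euclidean_representation)
      then show ?thesis by (simp add: linear_sum[OF lin[OF that]] linear_scale[OF lin[OF that]])
    qed
    have smYe: "smooth_on S (\<lambda>y. Y y \<bullet> e)" for e by (rule smooth_on_inner_const[OF op Y(1)])
    have "0 = frechet_derivative (\<lambda>y. \<Sum>e\<in>Basis. (Y y \<bullet> e) * \<theta> y [e]) (at x) v"
    proof -
      have "frechet_derivative (\<lambda>y. \<Sum>e\<in>Basis. (Y y \<bullet> e) * \<theta> y [e]) (at x) = frechet_derivative (\<lambda>_. 0) (at x)"
        by (rule frechet_derivative_cong_open[OF op x]) (simp add: exp[symmetric] Y)
      then show ?thesis by (simp add: frechet_derivative_const)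
    qed
    also have "\<dots> = (\<Sum>e\<in>Basis. frechet_derivative (\<lambda>y. (Y y \<bullet> e) * \<theta> y [e]) (at x) v)"
      by (rule frechet_derivative_sum[OF op _ x]) (intro smooth_on_mult[OF op] smYe smooth_fieldD sm)
    also have "\<dots> = (\<Sum>e\<in>Basis. (Y x \<bullet> e) * dir_deriv v \<theta> x [e] + (frechet_derivative Y (at x) v \<bullet> e) * \<theta> x [e])"
      by (rule sum.cong[OF refl])
        (simp add: frechet_derivative_mult[OF op smYe smooth_fieldD[OF sm] x] dir_deriv_def
          frechet_derivative_bounded_linear[OF op bounded_linear_inner_left Y(1) x])
    also have "\<dots> = dir_deriv v \<theta> x [Y x] + \<theta> x [frechet_derivative Y (at x) v]"
    proof -
      have alt': "linear (\<lambda>u. dir_deriv v \<theta> x [u])"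
        using linear_alternating_1[OF alternating_dir_deriv[OF op sm alt x]] by simp
      have "dir_deriv v \<theta> x [Y x] = dir_deriv v \<theta> x [\<Sum>e\<in>Basis. (Y x \<bullet> e) *\<^sub>R e]" by (simp add: euclidean_representation)
      then show ?thesis
        by (simp add: sum.distrib exp[OF x, of "frechet_derivative Y (at x) v"] linear_sum[OF alt'] linear_scale[OF alt'])
    qed
    finally show ?thesis by simp
  qed
  have "ext_deriv \<theta> x [X x, Y x] = dir_deriv (X x) \<theta> x [Y x] - dir_deriv (Y x) \<theta> x [X x]"
    by (simp add: ext_deriv_Cons) (simp add: dir_deriv_def contract_apply)
  then show ?thesis using D[OF X] D[OF Y] by simp
qed

text \<open>For sections of the kernel of \<theta>, d\<theta> on a pair is minus \<theta> of the Lie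
  bracket. Extended complex bilinearly to sections of \<open>T\<close>, whose bracket is again in
  \<open>T\<close>, it vanishes.\<close>

lemma contact_form_type_1_1:
  assumes W: "open W" and \<theta>: "\<theta> \<in> contact_forms \<A> T W" and c: "c \<in> \<A>" and x: "x \<in> coords c W"
    and z: "z \<in> T c x" and w: "w \<in> T c x"
  shows "cbilinear_ext (ext_deriv (\<theta> c) x) z w = 0"
proof -
  obtain S Z where S: "open S" "x \<in> S" "S \<subseteq> coords c UNIV" "\<And>i. i < n \<Longrightarrow> smooth_on S (Z i)"
    "\<And>y. y \<in> S \<Longrightarrow> complex_frame n (\<lambda>i. Z i y) (T c y)"
    using CR_frame[OF c coords_monoD[OF x subset_UNIV]] by metis
  define S' where "S' = S \<inter> coords c W"
  have S': "open S'" "x \<in> S'" "S' \<subseteq> coords c W" "S' \<subseteq> S"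
    using S x open_coords[OF c W] by (auto simp: S'_def)
  \<comment> \<open>A vector of \<open>T\<close> is extended with constant coefficients in the local
    frame.\<close>
  have sec: "\<exists>F. smooth_on S' F \<and> F x = z \<and> (\<forall>y\<in>S'. F y \<in> T c y)" if z: "z \<in> T c x" for z
  proof -
    obtain a where a: "z = (\<Sum>i<n. cscale (a i) (Z i x))" using z S(5)[OF S(2)] by (auto simp: complex_frame_def)
    have "smooth_on S' (\<lambda>y. \<Sum>i<n. cscale (a i) (Z i y))"
      using S' smooth_on_subset[OF S(4) S'(4)]
      by (intro smooth_on_sum smooth_on_bounded_linear[OF S'(1) linear_cscale]) auto
    then show ?thesis
      using a complex_frame.T_I[OF S(5)] S' by (intro exI[of _ "\<lambda>y. \<Sum>i<n. cscale (a i) (Z i y)"]) auto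
  qed
  obtain F where F: "smooth_on S' F" "F x = z" "\<And>y. y \<in> S' \<Longrightarrow> F y \<in> T c y" using sec[OF z] by blast
  obtain G where G: "smooth_on S' G" "G x = w" "\<And>y. y \<in> S' \<Longrightarrow> G y \<in> T c y" using sec[OF w] by blast
  have "involutive \<A> T" using CR by (simp add: CR_manifold_def)
  then have "\<forall>S Z W. open S \<longrightarrow> S \<subseteq> coords c UNIV \<longrightarrow> smooth_on S Z \<longrightarrow> smooth_on S W \<longrightarrow>
     (\<forall>x\<in>S. Z x \<in> T c x \<and> W x \<in> T c x) \<longrightarrow> (\<forall>x\<in>S. lie_bracket Z W x \<in> T c x)"
    using c unfolding involutive_def by blast
  then have lie: "lie_bracket F G x \<in> T c x"
    using F G S' S(3) by (meson order_trans)
  note f = form_smooth[OF contact_forms_D(1)[OF \<theta>] c] form_alternating[OF contact_forms_D(1)[OF \<theta>] c]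
  have sm: "smooth_field S' (\<theta> c)" by (rule smooth_field_subset[OF f(1) S'(3)])
  have ker: "\<theta> c y [fst u] = 0" "\<theta> c y [snd u] = 0" if "y \<in> S'" "u \<in> T c y" for y u
  proof -
    have "y \<in> S" "y \<in> coords c W" using that S' by auto
    then show "\<theta> c y [fst u] = 0" "\<theta> c y [snd u] = 0"
      using contact_forms_D(2)[OF \<theta> c, of y] complex_frame.fst_real_part[OF S(5) that(2)]
        complex_frame.snd_real_part[OF S(5) that(2)] by auto
  qed
  note bl = smooth_on_bounded_linear[OF S'(1) bounded_linear_fst] smooth_on_bounded_linear[OF S'(1) bounded_linear_snd]
  note cart = ext_deriv_contact[OF S'(1,2) sm f(2)]
  have lin: "linear (\<lambda>v. \<theta> c x [v])" by (rule linear_alternating_1[OF f(2)])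
  note D = frechet_derivative_bounded_linear[OF S'(1) bounded_linear_fst _ S'(2)]
    frechet_derivative_bounded_linear[OF S'(1) bounded_linear_snd _ S'(2)]
  note e1 = cart[OF bl(1)[OF F(1)] _ bl(1)[OF G(1)]] and e2 = cart[OF bl(2)[OF F(1)] _ bl(2)[OF G(1)]]
    and e3 = cart[OF bl(1)[OF F(1)] _ bl(2)[OF G(1)]] and e4 = cart[OF bl(2)[OF F(1)] _ bl(1)[OF G(1)]]
  have "\<theta> c x [fst (lie_bracket F G x)] = 0" "\<theta> c x [snd (lie_bracket F G x)] = 0"
    using ker[OF S'(2) lie] by auto
  then show ?thesis
    using e1 e2 e3 e4 ker F G
    by (simp add: cbilinear_ext_def lie_bracket_def directional_def cscale_simps D complex_eq_iff
        linear_add[OF lin] linear_diff[OF lin] linear_neg[OF lin])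
qed

text \<open>A vector \<open>u\<close> in the radical is the real part of some \<open>z\<close> in
  \<open>T\<close>, and only the pairings of d\<theta> with \<open>fst z\<close> are known to
  vanish. The type (1,1) property transfers this to \<open>snd z\<close>, so the Levi form of
  \<open>z\<close> is zero and hence so is \<open>z\<close>.\<close>

lemma contact_pair:
  assumes W: "open W" and \<theta>: "\<theta> \<in> contact_forms \<A> T W" and c: "c \<in> \<A>" and x: "x \<in> coords c W"
  shows "contact_pair n (\<theta> c x) (ext_deriv (\<theta> c) x)"
  unfolding contact_pair_def
proof (intro conjI allI impI)
  let ?\<theta> = "\<theta> c x" and ?\<beta> = "ext_deriv (\<theta> c) x"
  note f = contact_forms_D(1)[OF \<theta>]
  show "DIM('e) = 2 * n + 1" by (rule CR_dim)
  show alt1: "alternating 1 ?\<theta>" by (rule form_alternating[OF f c])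
  show alt2: "alternating 2 ?\<beta>"
    using alternating_ext_deriv[OF open_coords[OF c W] form_smooth[OF f c] form_alternating[OF f c] x]
    by (simp add: numeral_2_eq_2)
  obtain S Z where S: "x \<in> S" "\<And>y. y \<in> S \<Longrightarrow> complex_frame n (\<lambda>i. Z i y) (T c y)"
    using CR_frame[OF c coords_monoD[OF x subset_UNIV]] by metis
  interpret complex_frame n "\<lambda>i. Z i x" "T c x" by (rule S(2)[OF S(1)])
  have ker: "?\<theta> [v] = 0 \<longleftrightarrow> v \<in> real_part (T c x)" for v by (rule contact_forms_D(2)[OF \<theta> c x])
  show "?\<theta> \<noteq> 0"
  \<comment> \<open>If \<theta> vanished, its kernel H would be everything, although H is spanned by
    \<open>2 * n\<close> vectors in dimension \<open>2 * n + 1\<close>.\<close>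
  proof
    assume "?\<theta> = 0"
    then have "real_part (T c x) = UNIV" using ker by (auto simp: zero_fun_apply)
    then show False using dim_real_part_le CR_dim by simp
  qed
  fix u assume u: "?\<theta> [u] = 0" and *: "\<forall>v. ?\<theta> [v] = 0 \<longrightarrow> ?\<beta> [u, v] = 0"
  then obtain z where z: "z \<in> T c x" "u = fst z" using ker real_part_eq by auto
  have "nondegenerate_hermitian_on (T c x) (\<lambda>z w. - \<i> * cbilinear_ext (d_form W \<theta> c x) z (conj_vec w))"
    using CR W \<theta> c x by (auto simp: CR_manifold_def)
  then have nd: "(\<forall>w\<in>T c x. - \<i> * cbilinear_ext ?\<beta> z (conj_vec w) = 0) \<Longrightarrow> z = 0"
    using z(1) unfolding nondegenerate_hermitian_on_def d_form_apply[OF W x] by blast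
  have lin: "linear (\<lambda>v. ?\<beta> [v', v])" for v' by (rule linear_alternating_2(1)[OF alt2])
  have "z = 0"
  proof (rule nd, rule ballI)
    fix w assume w: "w \<in> T c x"
    have "?\<beta> [fst z, fst w] = 0" "?\<beta> [fst z, snd w] = 0"
      using * ker fst_real_part[OF w] snd_real_part[OF w] z(2) by auto
    moreover have "cbilinear_ext ?\<beta> z w = 0" by (rule contact_form_type_1_1[OF W \<theta> c x z(1) w])
    ultimately show "- \<i> * cbilinear_ext ?\<beta> z (conj_vec w) = 0"
      by (simp add: cbilinear_ext_def conj_vec_def complex_eq_iff linear_neg[OF lin])
  qed
  then show "u = 0" by (simp add: z(2))
qed

end

section \<open>Existence and comparison of local contact forms\<close>

lemma real_part_map_prod:
  assumes "linear A"
  shows "real_part (map_prod A A ` S) = A ` real_part S"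
proof -
  have eq: "fst (map_prod A A z + conj_vec (map_prod A A w)) = A (fst (z + conj_vec w))" for z w
    by (simp add: conj_vec_def linear_add[OF assms])
  show ?thesis
  proof safe
    fix v assume "v \<in> real_part (map_prod A A ` S)"
    then obtain z w where "z \<in> S" "w \<in> S" "v = fst (map_prod A A z + conj_vec (map_prod A A w))"
      by (auto simp: real_part_def)
    moreover from this have "fst (z + conj_vec w) \<in> real_part S" unfolding real_part_def by blast
    ultimately show "v \<in> A ` real_part S" unfolding eq by blast
  next
    fix v assume "v \<in> real_part S"
    then obtain z w where "z \<in> S" "w \<in> S" "v = fst (z + conj_vec w)" by (auto simp: real_part_def)
    then show "A v \<in> real_part (map_prod A A ` S)"
      unfolding real_part_def
      by (intro CollectI exI[of _ "map_prod A A z"] exI[of _ "map_prod A A w"]) (simp only: eq, simp)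
  qed
qed

context CR
begin

text \<open>A normal to H at nearby points is obtained from a fixed vector outside H at
  \<open>x\<close> by subtracting its orthogonal projection to H. The coefficients of the projection
  solve the Gram system of the real frame, so they are smooth.\<close>

lemma local_normal:
  assumes c: "c \<in> \<A>" and V: "open V" and x: "x \<in> coords c V"
  shows "\<exists>S N. open S \<and> x \<in> S \<and> S \<subseteq> coords c V \<and> smooth_on S N \<and>
    (\<forall>y\<in>S. \<forall>v. N y \<bullet> v = 0 \<longleftrightarrow> v \<in> real_part (T c y))"
proof -
  obtain S0 Z where S0: "open S0" "x \<in> S0" "S0 \<subseteq> coords c UNIV" "\<And>i. i < n \<Longrightarrow> smooth_on S0 (Z i)"
    "\<And>y. y \<in> S0 \<Longrightarrow> complex_frame n (\<lambda>i. Z i y) (T c y)"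
    "\<And>y. y \<in> S0 \<Longrightarrow> \<forall>a. (\<Sum>i<n. cscale (a i) (Z i y)) = 0 \<longrightarrow> (\<forall>i<n. a i = 0)"
    by (rule CR_frame[OF c coords_monoD[OF x subset_UNIV]]) (rule that)
  define X where "X = (\<lambda>i y. real_frame n (\<lambda>i. Z i y) i)"
  have smX: "smooth_on S0 (X i)" if "i < 2 * n" for i
  proof (cases "i < n")
    case True
    then have "X i = (\<lambda>y. fst (Z i y))"
      by (simp add: X_def real_frame_def)
    then show ?thesis using smooth_on_bounded_linear[OF S0(1) bounded_linear_fst S0(4)[OF True]] by simp
  next
    case False
    then have "X i = (\<lambda>y. snd (Z (i - n) y))"
      by (simp add: X_def real_frame_def)
    moreover have "i - n < n" using that False by simp
    ultimately show ?thesis using smooth_on_bounded_linear[OF S0(1) bounded_linear_snd S0(4)] by simp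
  qed
  have ind: "r i = 0" if "y \<in> S0" "(\<Sum>i<2 * n. r i *\<^sub>R X i y) = 0" "i < 2 * n" for r i y
  proof -
    have "y \<in> coords c UNIV" using that(1) S0(3) by blast
    from complex_frame.real_frame_independent[OF S0(5)[OF that(1)] CR_transversal[OF c this] S0(6)[OF that(1)]]
    show ?thesis using that(2,3) by (simp add: X_def)
  qed
  have span: "real_part (T c y) = span ((\<lambda>i. X i y) ` {..<2 * n})" if "y \<in> S0" for y
    using complex_frame.real_part_span[OF S0(5)[OF that]] by (simp add: X_def)
  have repr: "\<exists>r. v = (\<Sum>i<2 * n. r i *\<^sub>R X i y)" if "y \<in> S0" "v \<in> real_part (T c y)" for y v
    using complex_frame.real_part_repr[OF S0(5)[OF that(1)] that(2)] by (simp add: X_def)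
  have dim: "dim (real_part (T c y)) = 2 * n" if "y \<in> S0" for y
    using complex_frame.dim_real_part[OF S0(5)[OF that] CR_transversal[OF c] S0(6)[OF that]] S0(3) that by blast
  have "real_part (T c x) \<noteq> UNIV" using dim[OF S0(2)] CR_dim by auto
  then obtain \<nu> where \<nu>: "\<nu> \<notin> real_part (T c x)" by auto
  have "\<exists>r. \<forall>i<2 * n. (\<nu> - (\<Sum>j<2 * n. r j *\<^sub>R X j y)) \<bullet> X i y = 0" if y: "y \<in> S0" for y
  proof -
    obtain u z where uz: "u \<in> span ((\<lambda>i. X i y) ` {..<2 * n})" "\<nu> = u + z"
      "\<And>w. w \<in> span ((\<lambda>i. X i y) ` {..<2 * n}) \<Longrightarrow> orthogonal z w"
      using orthogonal_subspace_decomp_exists[of "(\<lambda>i. X i y) ` {..<2 * n}" \<nu>] by metis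
    obtain r where r: "u = (\<Sum>i<2 * n. r i *\<^sub>R X i y)" using repr[OF y] uz(1) span[OF y] by blast
    have "(\<nu> - (\<Sum>j<2 * n. r j *\<^sub>R X j y)) \<bullet> X i y = 0" if "i < 2 * n" for i
    proof -
      have "X i y \<in> span ((\<lambda>i. X i y) ` {..<2 * n})" using that by (intro span_base) auto
      then show ?thesis using uz(2,3) by (simp add: r[symmetric] orthogonal_def)
    qed
    then show ?thesis by blast
  qed
  then obtain r where r: "\<And>y i. y \<in> S0 \<Longrightarrow> i < 2 * n \<Longrightarrow> (\<nu> - (\<Sum>j<2 * n. r y j *\<^sub>R X j y)) \<bullet> X i y = 0"
    by metis
  have "\<exists>S1. open S1 \<and> x \<in> S1 \<and> S1 \<subseteq> S0 \<and> (\<forall>i\<in>{..<2 * n}. smooth_on S1 (\<lambda>y. r y i))"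
  proof (rule smooth_linear_solution[where J = "{..<2 * n}" and a = "\<lambda>j i y. X i y \<bullet> X j y"
        and b = "\<lambda>j y. \<nu> \<bullet> X j y" and t = "\<lambda>i y. r y i", OF finite_lessThan S0(1,2)])
    show "smooth_on S0 (\<lambda>y. X i y \<bullet> X j y)" if "j \<in> {..<2 * n}" "i \<in> {..<2 * n}" for j i
      using that by (intro smooth_on_inner[OF S0(1)] smX) auto
    show "smooth_on S0 (\<lambda>y. \<nu> \<bullet> X j y)" if "j \<in> {..<2 * n}" for j
      using that by (intro smooth_on_inner[OF S0(1)] smX smooth_on_const) auto
    show "(\<Sum>i<2 * n. (X i y \<bullet> X j y) * r y i) = \<nu> \<bullet> X j y" if "y \<in> S0" "j \<in> {..<2 * n}" for y j
      using r[OF that(1), of j] that(2) by (simp add: inner_diff_left inner_sum_left mult.commute)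
    fix s i assume s: "\<forall>j\<in>{..<2 * n}. (\<Sum>i<2 * n. (X i x \<bullet> X j x) * s i) = 0" and i: "i \<in> {..<2 * n}"
    \<comment> \<open>The Gram matrix of independent vectors is invertible: a combination
      \<open>?w\<close> orthogonal to all of them is orthogonal to itself.\<close>
    let ?w = "\<Sum>i<2 * n. s i *\<^sub>R X i x"
    have w: "?w \<bullet> X j x = 0" if "j < 2 * n" for j
      using s that by (simp add: inner_sum_left mult.commute)
    have "?w \<bullet> ?w = (\<Sum>j<2 * n. s j * (?w \<bullet> X j x))" by (subst inner_sum_right) simp
    also have "\<dots> = 0" using w by simp
    finally have "?w = 0" by simp
    then show "s i = 0" using ind[OF S0(2), of s i] i by simp
  qed
  then obtain S1 where S1: "open S1" "x \<in> S1" "S1 \<subseteq> S0" "\<forall>i\<in>{..<2 * n}. smooth_on S1 (\<lambda>y. r y i)" by blast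
  define N where "N = (\<lambda>y. \<nu> - (\<Sum>j<2 * n. r y j *\<^sub>R X j y))"
  have smN: "smooth_on S1 N"
    unfolding N_def using S1 smooth_on_subset[OF smX S1(3)]
    by (intro smooth_on_diff[OF S1(1)] smooth_on_sum[OF S1(1)] smooth_on_scaleR[OF S1(1)] smooth_on_const) auto
  have "N x \<noteq> 0"
  proof
    assume "N x = 0"
    then have "\<nu> = (\<Sum>j<2 * n. r x j *\<^sub>R X j x)" by (simp add: N_def)
    then have "\<nu> \<in> real_part (T c x)" unfolding span[OF S0(2)]
      by (simp only:) (intro span_sum span_scale span_base imageI)
    then show False using \<nu> by simp
  qed
  \<comment> \<open>Shrinking to where \<open>N\<close> is nonzero makes its orthogonal complement a
    hyperplane; it contains H and has the same dimension \<open>2 * n\<close>.\<close>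
  define S where "S = (S1 \<inter> N -` (- {0})) \<inter> coords c V"
  have "open (S1 \<inter> N -` (- {0}))"
    using continuous_on_open_vimage[OF S1(1), of N] smooth_on_continuous[OF smN] by (auto simp: Int_commute)
  then have S: "open S" "x \<in> S" "S \<subseteq> coords c V" "S \<subseteq> S1"
    using open_coords[OF c V] x S1 \<open>N x \<noteq> 0\<close> by (auto simp: S_def)
  have "N y \<bullet> v = 0 \<longleftrightarrow> v \<in> real_part (T c y)" if y: "y \<in> S" for y v
  proof -
    have y0: "y \<in> S0" using y S S1 by auto
    have "N y \<noteq> 0" using y by (simp add: S_def)
    then have "dim {v. N y \<bullet> v = 0} = 2 * n" using dim_hyperplane[of "N y"] CR_dim by simp
    moreover have "real_part (T c y) \<subseteq> {v. N y \<bullet> v = 0}"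
      unfolding span[OF y0]
    proof (rule span_minimal)
      show "(\<lambda>i. X i y) ` {..<2 * n} \<subseteq> {v. N y \<bullet> v = 0}" using r[OF y0] by (auto simp: N_def)
      show "subspace {v. N y \<bullet> v = 0}" by (rule subspace_hyperplane)
    qed
    moreover have "subspace (real_part (T c y))" by (simp add: span[OF y0])
    ultimately have "real_part (T c y) = {v. N y \<bullet> v = 0}"
      using dim[OF y0] by (intro subspace_dim_equal subspace_hyperplane) auto
    then show ?thesis by blast
  qed
  moreover have "smooth_on S N" by (rule smooth_on_subset[OF smN S(4)])
  ultimately show ?thesis using S by blast
qed

text \<open>Inner product with the normal field defines a one-form in one chart \<open>c\<close>. On
  a set inside the domain of \<open>c\<close> it is carried to every other chart by pullback, and
  the chain rule for transition maps gives compatibility.\<close>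

lemma local_contact_form:
  assumes V: "open V" and p: "p \<in> V"
  obtains W \<theta> where "open W" "p \<in> W" "W \<subseteq> V" "\<theta> \<in> contact_forms \<A> T W"
proof -
  obtain c where c: "c \<in> \<A>" "p \<in> fst c" using chart_cover by blast
  have x: "snd c p \<in> coords c V" using c p by (auto simp: coords_def)
  obtain S N where S: "open S" "snd c p \<in> S" "S \<subseteq> coords c V" "smooth_on S N"
    and N: "\<And>y v. y \<in> S \<Longrightarrow> N y \<bullet> v = 0 \<longleftrightarrow> v \<in> real_part (T c y)"
    using local_normal[OF c(1) V x] by blast
  define W where "W = (fst c \<inter> snd c -` S) \<inter> V"
  have "continuous_on (fst c) (snd c)" using chart_homeo[OF c(1)] homeomorphism_def by blast
  then have "open (fst c \<inter> snd c -` S)"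
    using continuous_on_open_vimage[OF chart_open[OF c(1)]] S(1) by (auto simp: Int_commute)
  then have W: "open W" "p \<in> W" "W \<subseteq> V" "W \<subseteq> fst c" using V p c S by (auto simp: W_def)
  have SW: "coords c W \<subseteq> S" by (auto simp: coords_def W_def)
  define \<alpha> where "\<alpha> = (\<lambda>x. one_form_of (\<lambda>v. N x \<bullet> v))"
  define \<theta> where "\<theta> = (\<lambda>c' x. if c' \<in> \<A> \<and> x \<in> coords c' W
     then pullback (transition_deriv c' c x) (\<alpha> (transition c' c x)) else 0)"
  have Wc: "W \<inter> fst c = W" using W by auto
  have alt\<alpha>: "alternating 1 (\<alpha> y)" for y
    unfolding \<alpha>_def by (rule alternating_one_form_of) (simp add: linearI inner_add_right)
  have xc: "x \<in> coords c' (fst c)" "transition c' c x \<in> S" if "c' \<in> \<A>" "x \<in> coords c' W" for c' x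
    using that coords_monoD[OF that(2) W(4)] transition_coords'[OF that(1) c(1), of x W] SW by (auto simp: Wc)
  have "\<theta> \<in> forms \<A> W (int 1)"
    unfolding forms_iff
  proof (intro conjI allI impI ballI)
    show "\<theta> c' x = 0" if "c' \<notin> \<A> \<or> x \<notin> coords c' W" for c' x using that by (auto simp: \<theta>_def)
    show "alternating 1 (\<theta> c' x)" if "c' \<in> \<A>" "x \<in> coords c' W" for c' x
      using that alternating_pullback[OF linear_transition_deriv[OF that(1) c(1) xc(1)[OF that]] alt\<alpha>]
      by (simp add: \<theta>_def)
    show "smooth_field (coords c' W) (\<theta> c')" if c': "c' \<in> \<A>" for c'
    proof (rule smooth_field_cong)
      note o = open_coords[OF c' W(1)]
      show "open (coords c' W)" by (rule o)
      have t: "smooth_on (coords c' W) (transition c' c)" by (rule smooth_transition[OF c' c(1) W(4)])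
      have N': "smooth_on (coords c' W) (\<lambda>y. N (transition c' c y))"
        using xc(2)[OF c'] by (intro smooth_on_compose[OF o t S(4)]) auto
      have "smooth_field (coords c' W) (\<lambda>y. \<alpha> (transition c' c y))"
        unfolding smooth_field_def
      proof
        fix vs :: "'e list"
        show "smooth_on (coords c' W) (\<lambda>y. \<alpha> (transition c' c y) vs)"
          by (cases "length vs = 1") (simp_all add: \<alpha>_def one_form_of_def smooth_on_inner[OF o N'])
      qed
      then show "smooth_field (coords c' W) (\<lambda>y. pullback (transition_deriv c' c y) (\<alpha> (transition c' c y)))"
        using alt\<alpha> smooth_on_frechet_derivative[OF t]
        by (intro smooth_field_pullback[OF o, of _ 1]) (auto simp: transition_deriv_def)
    qed (simp add: \<theta>_def c')
    fix c1 c2 x assume cc: "c1 \<in> \<A>" "c2 \<in> \<A>" and x: "x \<in> coords c1 (W \<inter> fst c2)"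
    have x1: "x \<in> coords c1 W" "x \<in> coords c1 (fst c2)" "x \<in> coords c1 (fst c2 \<inter> fst c)"
      using coords_monoD[OF x, of W] coords_monoD[OF x, of "fst c2"] coords_monoD[OF x, of "fst c2 \<inter> fst c"] W(4) by auto
    have "transition_deriv c1 c x = (\<lambda>v. transition_deriv c2 c (transition c1 c2 x) (transition_deriv c1 c2 x v))"
      by (rule ext) (rule transition_deriv_chain[OF cc c(1) x1(3)])
    then have "pullback (transition_deriv c1 c x) \<gamma> =
        pullback (transition_deriv c1 c2 x) (pullback (transition_deriv c2 c (transition c1 c2 x)) \<gamma>)" for \<gamma>
      by (intro ext) (simp add: pullback_apply o_def)
    then show "\<theta> c1 x = pullback (transition_deriv c1 c2 x) (\<theta> c2 (transition c1 c2 x))"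
      using cc x1 transition_coords'[OF cc x] transition_transition[OF cc x1(2), of c] by (simp add: \<theta>_def)
  qed
  moreover have "{v. \<theta> c' x [v] = 0} = real_part (T c' x)" if c': "c' \<in> \<A>" and x: "x \<in> coords c' W" for c' x
  proof -
    let ?D = "transition_deriv c' c x"
    note x' = xc[OF c' x]
    have inj: "inj ?D" using transition_deriv_inverse(1)[OF c' c(1) x'(1)] by (metis injI)
    have "real_part (T c (transition c' c x)) = ?D ` real_part (T c' x)"
      unfolding CR_transition[OF c' c(1) x'(1)]
      by (rule real_part_map_prod[OF linear_transition_deriv[OF c' c(1) x'(1)]])
    moreover have "\<theta> c' x [v] = N (transition c' c x) \<bullet> ?D v" for v
      using c' x by (simp add: \<theta>_def \<alpha>_def pullback_apply one_form_of_def)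
    ultimately show ?thesis using N[OF x'(2)] inj by (auto simp: inj_image_mem_iff)
  qed
  ultimately have "\<theta> \<in> contact_forms \<A> T W" by (auto simp: contact_forms_def)
  then show ?thesis using that W by blast
qed

text \<open>Two contact forms have the same kernel, hence differ by a function \<open>g\<close>. In
  the derivative of \<open>g\<close> times \<theta> the term with the differential of
  \<open>g\<close> is a multiple of \<theta> and disappears on multiplication by \<theta>.\<close>

lemma contact_rescale:
  assumes W: "open W" "open W'" and \<theta>: "\<theta> \<in> contact_forms \<A> T W" "\<theta>' \<in> contact_forms \<A> T W'"
    and c: "c \<in> \<A>" and x: "x \<in> coords c W" "x \<in> coords c W'"
  obtains f where "f \<noteq> 0" "\<theta>' c x = f *\<^sub>R \<theta> c x"
    "wedge_alt (\<theta> c x) (ext_deriv (\<theta>' c) x) = f *\<^sub>R wedge_alt (\<theta> c x) (ext_deriv (\<theta> c) x)"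
proof -
  note p = contact_pair[OF W(1) \<theta>(1) c x(1)] and p' = contact_pair[OF W(2) \<theta>(2) c x(2)]
  \<comment> \<open>The Reeb vector at \<open>x\<close>, kept constant nearby: \<theta> is 1 on it
    at \<open>x\<close>, so it can serve as denominator in a neighbourhood.\<close>
  define v0 where "v0 = reeb (\<theta> c x) (ext_deriv (\<theta> c) x)"
  have v0: "\<theta> c x [v0] = 1" using reeb(1)[OF p] by (simp add: v0_def)
  note f = contact_forms_D(1)[OF \<theta>(1)] and f' = contact_forms_D(1)[OF \<theta>(2)]
  have sm: "smooth_on (coords c W \<inter> coords c W') (\<lambda>y. \<theta> c y [v0])" "smooth_field (coords c W \<inter> coords c W') (\<theta> c)"
    "smooth_on (coords c W \<inter> coords c W') (\<lambda>y. \<theta>' c y [v0])"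
    using smooth_field_subset[OF form_smooth[OF f c]] smooth_field_subset[OF form_smooth[OF f' c]]
    by (auto intro: smooth_fieldD)
  define S where "S = (coords c W \<inter> coords c W') \<inter> (\<lambda>y. \<theta> c y [v0]) -` (- {0})"
  have S: "open S" "x \<in> S" "S \<subseteq> coords c W \<inter> coords c W'"
    using continuous_on_open_vimage[of "coords c W \<inter> coords c W'" "\<lambda>y. \<theta> c y [v0]"] smooth_on_continuous[OF sm(1)]
      open_coords[OF c W(1)] open_coords[OF c W(2)] x v0
    by (auto simp: S_def Int_commute open_Int)
  define g where "g = (\<lambda>y. \<theta>' c y [v0] / \<theta> c y [v0])"
  have smg: "smooth_on S g"
    unfolding g_def using smooth_on_subset[OF sm(1) S(3)] smooth_on_subset[OF sm(3) S(3)]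
    by (intro smooth_on_divide[OF S(1)]) (auto simp: S_def)
  have eq: "\<theta>' c y = g y *\<^sub>R \<theta> c y" if y: "y \<in> S" for y
  proof -
    have nz: "\<theta> c y [v0] \<noteq> 0" using y by (simp add: S_def)
    have alt: "alternating 1 (\<theta> c y)" "alternating 1 (\<theta>' c y)" using form_alternating[OF f c] form_alternating[OF f' c] by auto
    note lin = linear_alternating_1[OF alt(1)] linear_alternating_1[OF alt(2)]
    have "\<theta>' c y [v] = g y * \<theta> c y [v]" for v
    proof -
      have "\<theta> c y [\<theta> c y [v0] *\<^sub>R v - \<theta> c y [v] *\<^sub>R v0] = 0"
        by (simp add: linear_diff[OF lin(1)] linear_scale[OF lin(1)])
      then have "\<theta>' c y [\<theta> c y [v0] *\<^sub>R v - \<theta> c y [v] *\<^sub>R v0] = 0"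
        using contact_forms_D(2)[OF \<theta>(1) c] contact_forms_D(2)[OF \<theta>(2) c] y S(3) by blast
      then have "\<theta> c y [v0] * \<theta>' c y [v] = \<theta> c y [v] * \<theta>' c y [v0]"
        by (simp add: linear_diff[OF lin(2)] linear_scale[OF lin(2)])
      then show ?thesis using nz by (simp add: g_def field_simps)
    qed
    then have "one_form_of (\<lambda>v. \<theta>' c y [v]) = g y *\<^sub>R one_form_of (\<lambda>v. \<theta> c y [v])"
      by (intro ext) (simp add: one_form_of_def scaleR_fun_apply)
    then show ?thesis
      unfolding one_form_of_alternating[OF alt(1)] one_form_of_alternating[OF alt(2)] .
  qed
  have "ext_deriv (\<theta>' c) x = ext_deriv (\<lambda>y. g y *\<^sub>R \<theta> c y) x"
    by (rule ext_deriv_cong[OF S(1,2)]) (rule eq)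
  also have "\<dots> = g x *\<^sub>R ext_deriv (\<theta> c) x + wedge_alt (one_form_of (frechet_derivative g (at x))) (\<theta> c x)"
    by (simp add: ext_deriv_scaleR[OF S(1,2) smg smooth_field_subset[OF sm(2) S(3)]] ext_deriv_scalar_form)
  finally have d: "ext_deriv (\<theta>' c) x = g x *\<^sub>R ext_deriv (\<theta> c) x + wedge_alt (one_form_of (frechet_derivative g (at x))) (\<theta> c x)" .
  have "wedge_alt (one_form_of (frechet_derivative g (at x))) (\<theta> c x)
     = - wedge_alt (\<theta> c x) (one_form_of (frechet_derivative g (at x)))"
    using alternating_one_form_of[OF smooth_on_linear_derivative[OF smg S(2)]] form_alternating[OF f c]
    by (intro wedge_1_1_comm) auto
  then have "wedge_alt (\<theta> c x) (ext_deriv (\<theta>' c) x) = g x *\<^sub>R wedge_alt (\<theta> c x) (ext_deriv (\<theta> c) x)"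
    using form_alternating[OF f c] by (simp add: d wedge_alt_linear)
  moreover have "g x \<noteq> 0"
    using eq[OF S(2)] p' by (auto simp: contact_pair_def)
  ultimately show ?thesis using that[of "g x"] eq[OF S(2)] by blast
qed

end

section \<open>The transferred algebra\<close>

text \<open>The algebraic situation behind the theorem: a graded commutative differential algebra with an
  operator \<open>G\<close> of degree \<open>-1\<close> whose values lie in an ideal \<open>N\<close> which is killed by \<open>G\<close> and
  has zero square, and with \<open>G d G = G\<close>.  Homotopy transfer along \<open>1 - d G - G d\<close> then
  stops at the ternary operation.\<close>

locale square_zero_transfer =
  fixes A N :: "int \<Rightarrow> 'v::real_vector set"
    and w :: "'v \<Rightarrow> 'v \<Rightarrow> 'v" and d :: "'v \<Rightarrow> 'v" and G :: "int \<Rightarrow> 'v \<Rightarrow> 'v"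
  assumes subspace_A: "subspace (A k)"
    and N_A: "x \<in> N k \<Longrightarrow> x \<in> A k"
    and subspace_N: "subspace (N k)"
    and w_A: "x \<in> A i \<Longrightarrow> y \<in> A j \<Longrightarrow> w x y \<in> A (i + j)"
    and w_add_left: "x \<in> A i \<Longrightarrow> x' \<in> A i \<Longrightarrow> y \<in> A j \<Longrightarrow> w (x + x') y = w x y + w x' y"
    and w_scale_left: "x \<in> A i \<Longrightarrow> y \<in> A j \<Longrightarrow> w (r *\<^sub>R x) y = r *\<^sub>R w x y"
    and w_assoc: "w (w x y) z = w x (w y z)"
    and w_comm: "x \<in> A i \<Longrightarrow> y \<in> A j \<Longrightarrow> w x y = (-1) powi (i * j) *\<^sub>R w y x"
    and d_A: "x \<in> A k \<Longrightarrow> d x \<in> A (k + 1)"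
    and d_linear: "x \<in> A k \<Longrightarrow> y \<in> A k \<Longrightarrow> d (a *\<^sub>R x + b *\<^sub>R y) = a *\<^sub>R d x + b *\<^sub>R d y"
    and d_d: "x \<in> A k \<Longrightarrow> d (d x) = 0"
    and d_w: "x \<in> A i \<Longrightarrow> y \<in> A j \<Longrightarrow> d (w x y) = w (d x) y + (-1) powi i *\<^sub>R w x (d y)"
    and G_N: "x \<in> A k \<Longrightarrow> G k x \<in> N (k - 1)"
    and G_linear: "x \<in> A k \<Longrightarrow> y \<in> A k \<Longrightarrow> G k (a *\<^sub>R x + b *\<^sub>R y) = a *\<^sub>R G k x + b *\<^sub>R G k y"
    and G_vanish: "x \<in> N k \<Longrightarrow> G k x = 0"
    and N_w: "x \<in> N i \<Longrightarrow> y \<in> A j \<Longrightarrow> w x y \<in> N (i + j)"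
    and N_N: "x \<in> N i \<Longrightarrow> y \<in> N j \<Longrightarrow> w x y = 0"
    and G_d_G: "x \<in> A k \<Longrightarrow> G k (d (G k x)) = G k x"
begin

lemma A_closed: "0 \<in> A k" "x \<in> A k \<Longrightarrow> y \<in> A k \<Longrightarrow> x + y \<in> A k" "x \<in> A k \<Longrightarrow> y \<in> A k \<Longrightarrow> x - y \<in> A k"
  "x \<in> A k \<Longrightarrow> r *\<^sub>R x \<in> A k" "x \<in> A k \<Longrightarrow> - x \<in> A k"
  by (simp_all add: subspace_0 subspace_add subspace_diff subspace_scale subspace_neg subspace_A)

lemma N_closed: "0 \<in> N k" "x \<in> N k \<Longrightarrow> y \<in> N k \<Longrightarrow> x + y \<in> N k" "x \<in> N k \<Longrightarrow> y \<in> N k \<Longrightarrow> x - y \<in> N k"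
  "x \<in> N k \<Longrightarrow> r *\<^sub>R x \<in> N k" "x \<in> N k \<Longrightarrow> - x \<in> N k"
  by (simp_all add: subspace_0 subspace_add subspace_diff subspace_scale subspace_neg subspace_N)

lemma w_add_right:
  assumes "x \<in> A i" "y \<in> A j" "y' \<in> A j" shows "w x (y + y') = w x y + w x y'"
  using w_comm[OF assms(1) A_closed(2)[OF assms(2,3)]] w_comm[OF assms(1,2)] w_comm[OF assms(1,3)]
    w_add_left[OF assms(2,3,1)] by (metis scaleR_add_right)

lemma w_scale_right:
  assumes "x \<in> A i" "y \<in> A j" shows "w x (r *\<^sub>R y) = r *\<^sub>R w x y"
  using w_comm[OF assms(1) A_closed(4)[OF assms(2)], of r] w_comm[OF assms]
    w_scale_left[OF assms(2,1)] by (metis scaleR_left_commute)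

lemma w_diff_left: "x \<in> A i \<Longrightarrow> x' \<in> A i \<Longrightarrow> y \<in> A j \<Longrightarrow> w (x - x') y = w x y - w x' y"
  using w_add_left[of x i "(-1) *\<^sub>R x'" y j] w_scale_left[of x' i y j "-1"] A_closed(4)[of x' i "-1"] by simp

lemma w_diff_right: "x \<in> A i \<Longrightarrow> y \<in> A j \<Longrightarrow> y' \<in> A j \<Longrightarrow> w x (y - y') = w x y - w x y'"
  using w_add_right[of x i y j "(-1) *\<^sub>R y'"] w_scale_right[of x i y' j "-1"] A_closed(4)[of y' j "-1"] by simp

lemma w_zero: "x \<in> A i \<Longrightarrow> w x 0 = 0" "x \<in> A i \<Longrightarrow> w 0 x = 0"
  using w_scale_right[of x i 0 0 0] w_scale_left[of 0 0 x i 0] A_closed(1) by auto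

lemma d_simps:
  assumes "x \<in> A k" "y \<in> A k"
  shows "d (x + y) = d x + d y" "d (x - y) = d x - d y" "d (r *\<^sub>R x) = r *\<^sub>R d x"
  using d_linear[OF assms, of 1 1] d_linear[OF assms, of 1 "-1"] d_linear[OF assms(1,1), of r 0] by auto

lemma d_zero: "d 0 = 0"
  using d_simps(3)[OF A_closed(1) A_closed(1), of 0] by simp

lemma G_simps:
  assumes "x \<in> A k" "y \<in> A k"
  shows "G k (x + y) = G k x + G k y" "G k (x - y) = G k x - G k y" "G k (r *\<^sub>R x) = r *\<^sub>R G k x"
  using G_linear[OF assms, of 1 1] G_linear[OF assms, of 1 "-1"] G_linear[OF assms(1,1), of r 0] by auto

lemma G_minus: "x \<in> A k \<Longrightarrow> G k (- x) = - G k x"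
  using G_simps(3)[of x k x "-1"] by simp

lemma G_zero: "G k 0 = 0"
  using G_vanish N_closed(1) by blast

lemma G_A: "x \<in> A k \<Longrightarrow> G k x \<in> A (k - 1)"
  using G_N N_A by blast

lemma N_w_right: "x \<in> A i \<Longrightarrow> y \<in> N j \<Longrightarrow> w x y \<in> N (i + j)"
  using w_comm[of x i y j] N_w[of y j x i] N_A N_closed(4) by (simp add: add.commute)

section \<open>The projection and its image\<close>

definition P :: "int \<Rightarrow> 'v \<Rightarrow> 'v" where
  "P k x = x - d (G k x) - G (k + 1) (d x)"

lemma dG_A: "x \<in> A k \<Longrightarrow> d (G k x) \<in> A k"
  using d_A[OF G_A] by fastforce

lemma Gd_N: "x \<in> A k \<Longrightarrow> G (k + 1) (d x) \<in> N k"
  using G_N[OF d_A] by fastforce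

lemma Gd_A: "x \<in> A k \<Longrightarrow> G (k + 1) (d x) \<in> A k"
  using Gd_N N_A by blast

lemma P_A: "x \<in> A k \<Longrightarrow> P k x \<in> A k"
  unfolding P_def by (intro A_closed dG_A Gd_A)

lemma P_linear: "x \<in> A k \<Longrightarrow> y \<in> A k \<Longrightarrow> P k (a *\<^sub>R x + b *\<^sub>R y) = a *\<^sub>R P k x + b *\<^sub>R P k y"
  unfolding P_def
  by (simp add: G_linear d_linear[OF G_A G_A] d_linear G_linear[OF d_A d_A])
    (simp add: algebra_simps)

lemma P_simps:
  assumes "x \<in> A k" "y \<in> A k"
  shows "P k (x + y) = P k x + P k y" "P k (x - y) = P k x - P k y" "P k (r *\<^sub>R x) = r *\<^sub>R P k x"
  using P_linear[OF assms, of 1 1] P_linear[OF assms, of 1 "-1"] P_linear[OF assms(1,1), of r 0] by auto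

lemma P_zero: "P k 0 = 0"
  by (simp add: P_def G_zero d_zero)

lemma P_N: "x \<in> N k \<Longrightarrow> P k x \<in> N k"
  unfolding P_def using G_vanish d_zero Gd_N N_A by (simp add: N_closed(3))

lemma d_P: "x \<in> A k \<Longrightarrow> d (P k x) = P (k + 1) (d x)"
proof -
  assume x: "x \<in> A k"
  have "d (P k x) = d x - d (d (G k x)) - d (G (k + 1) (d x))"
    unfolding P_def d_simps(2)[OF A_closed(3)[OF x dG_A[OF x]] Gd_A[OF x]] d_simps(2)[OF x dG_A[OF x]] ..
  then show ?thesis using d_d[OF G_A[OF x]] d_d[OF x] by (simp add: P_def G_zero)
qed

definition R :: "int \<Rightarrow> 'v set" where
  "R k = {x \<in> A k. G k x = 0 \<and> G (k + 1) (d x) = 0}"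

lemma R_A: "x \<in> R k \<Longrightarrow> x \<in> A k"
  by (simp add: R_def)

lemma subspace_R: "subspace (R k)"
  unfolding R_def
  by (auto simp: subspace_def A_closed G_zero d_zero G_simps d_simps G_simps[OF d_A d_A])

text \<open>\<open>G P\<close> vanishes because \<open>G d G = G\<close> and \<open>G\<close> kills
  its own values. For \<open>G d P\<close>, square zero of \<open>d\<close> leaves
  \<open>G d - G d G d\<close>, which is zero for the same reason.\<close>

lemma P_R: "x \<in> A k \<Longrightarrow> P k x \<in> R k"
proof -
  assume x: "x \<in> A k"
  have "G k (P k x) = G k x - G k (d (G k x)) - G k (G (k + 1) (d x))"
    unfolding P_def G_simps(2)[OF A_closed(3)[OF x dG_A[OF x]] Gd_A[OF x]] G_simps(2)[OF x dG_A[OF x]] ..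
  then have 1: "G k (P k x) = 0" using G_d_G[OF x] G_vanish[OF Gd_N[OF x]] by simp
  have "G (k + 1) (d (P k x)) = G (k + 1) (d x) - G (k + 1) (d (G (k + 1) (d x)))"
    using d_P[OF x] d_d[OF x] d_A[OF x] Gd_A[OF x] d_A[OF Gd_A[OF x]]
    by (simp add: P_def G_zero G_simps)
  then show ?thesis using 1 P_A[OF x] G_d_G[OF d_A[OF x]] by (simp add: R_def)
qed

lemma P_eq: "x \<in> R k \<Longrightarrow> P k x = x"
  by (simp add: R_def P_def d_zero)

text \<open>An element of \<open>R\<close> is its own projection, and \<open>P\<close> commutes with
  \<open>d\<close>.\<close>

lemma d_R: "x \<in> R k \<Longrightarrow> d x \<in> R (k + 1)"
  using P_R[OF d_A[OF R_A]] d_P[OF R_A] P_eq by metis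

section \<open>The transferred operations and their identities\<close>

fun op :: "(int \<times> 'v) list \<Rightarrow> 'v" where
  "op [(i, x)] = d x"
| "op [(i, x), (j, y)] = P (i + j) (w x y)"
| "op [(i, x), (j, y), (k, z)] =
     P (i + j + k - 1) (w (G (i + j) (w x y)) z - (-1) powi i *\<^sub>R w x (G (j + k) (w y z)))"
| "op _ = 0"

text \<open>The ternary operation before projection. Both of its terms have a value of
  \<open>G\<close> as a factor, so it takes values in the ideal \<open>N\<close>.\<close>

definition u3 :: "int \<Rightarrow> 'v \<Rightarrow> int \<Rightarrow> 'v \<Rightarrow> int \<Rightarrow> 'v \<Rightarrow> 'v" where
  "u3 i x j y k z = w (G (i + j) (w x y)) z - (-1) powi i *\<^sub>R w x (G (j + k) (w y z))"

lemma Gw_N: "x \<in> A i \<Longrightarrow> y \<in> A j \<Longrightarrow> G (i + j) (w x y) \<in> N (i + j - 1)"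
  using G_N[OF w_A] .

lemmas Gw_A = N_A[OF Gw_N]

lemma u3_N: "x \<in> A i \<Longrightarrow> y \<in> A j \<Longrightarrow> z \<in> A k \<Longrightarrow> u3 i x j y k z \<in> N (i + j + k - 1)"
proof -
  assume a: "x \<in> A i" "y \<in> A j" "z \<in> A k"
  have "w (G (i + j) (w x y)) z \<in> N (i + j + k - 1)"
    using N_w[OF Gw_N[OF a(1,2)] a(3)] by (simp add: algebra_simps)
  moreover have "w x (G (j + k) (w y z)) \<in> N (i + j + k - 1)"
    using N_w_right[OF a(1) Gw_N[OF a(2,3)]] by (simp add: algebra_simps)
  ultimately show ?thesis unfolding u3_def by (intro N_closed)
qed

lemmas u3_A = N_A[OF u3_N]

lemma op3: "op [(i, x), (j, y), (k, z)] = P (i + j + k - 1) (u3 i x j y k z)"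
  by (simp add: u3_def)

lemma op_long: "length xs \<ge> 4 \<Longrightarrow> op xs = 0"
  by (cases xs rule: op.cases) auto

lemma op_R:
  assumes "xs \<noteq> []" "set xs \<subseteq> homogeneous R"
  shows "op xs \<in> R (total_degree xs + 2 - int (length xs))"
proof (cases xs rule: op.cases)
  case (1 i x)
  then show ?thesis using assms d_R[of x i] by (auto simp: homogeneous_def total_degree_def add.commute)
next
  case (2 i x j y)
  then show ?thesis
    using assms P_R[OF w_A[OF R_A R_A], of x i y j] by (auto simp: homogeneous_def total_degree_def)
next
  case (3 i x j y k z)
  then have "x \<in> A i" "y \<in> A j" "z \<in> A k" using assms R_A by (auto simp: homogeneous_def)
  from P_R[OF u3_A[OF this]]
  have "op xs \<in> R (i + j + k - 1)" using 3 by (simp add: op3 del: op.simps)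
  then show ?thesis by (simp add: 3 total_degree_def algebra_simps)
qed (use assms subspace_0[OF subspace_R] in auto)

lemma d_u3:
  assumes x: "x \<in> A i" and y: "y \<in> A j" and z: "z \<in> A k"
  shows "d (u3 i x j y k z) = w (d (G (i + j) (w x y))) z
    - ((-1) powi i * (-1) powi j) *\<^sub>R w (G (i + j) (w x y)) (d z)
    - (-1) powi i *\<^sub>R w (d x) (G (j + k) (w y z)) - w x (d (G (j + k) (w y z)))"
proof -
  let ?e = "(-1::real) powi i" and ?f = "(-1::real) powi j" and ?m = "i + j + k - 1"
  let ?Gxy = "G (i + j) (w x y)" and ?Gyz = "G (j + k) (w y z)"
  have a: "w ?Gxy z \<in> A ?m" "w x ?Gyz \<in> A ?m"
    using w_A[OF Gw_A[OF x y] z] w_A[OF x Gw_A[OF y z]] by (simp_all add: algebra_simps)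
  have s: "(-1::real) powi (i + j - 1) = - (?e * ?f)"
    by (cases "even i"; cases "even j") auto
  have "d (u3 i x j y k z) = d (w ?Gxy z) - ?e *\<^sub>R d (w x ?Gyz)"
    unfolding u3_def using a by (simp add: d_simps[where k = ?m] A_closed)
  then show ?thesis
    by (simp add: d_w[OF Gw_A[OF x y] z] d_w[OF x Gw_A[OF y z]] s scaleR_add_right)
qed

text \<open>Since \<open>u3\<close> lies in \<open>N\<close>, the correction \<open>d G\<close>
  vanishes and only \<open>G d\<close> remains. In \<open>d\<close> of \<open>u3\<close> the two
  triple products cancel by associativity and the terms in \<open>N\<close> are killed by
  \<open>G\<close>. The formula removes the inner projections in \<open>relation_4\<close>.\<close>

lemma P_u3:
  assumes x: "x \<in> A i" and y: "y \<in> A j" and z: "z \<in> A k"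
  shows "P (i + j + k - 1) (u3 i x j y k z) = u3 i x j y k z
    + G (i + j + k) (w (P (i + j) (w x y)) z) - G (i + j + k) (w x (P (j + k) (w y z)))"
proof -
  let ?n = "i + j + k"
  let ?Gxy = "G (i + j) (w x y)" and ?Gyz = "G (j + k) (w y z)"
  let ?Hxy = "G (i + j + 1) (d (w x y))" and ?Hyz = "G (j + k + 1) (d (w y z))"
  let ?Pxy = "P (i + j) (w x y)" and ?Pyz = "P (j + k) (w y z)"
  have N: "w ?Gxy (d z) \<in> N ?n" "w (d x) ?Gyz \<in> N ?n" "w ?Hxy z \<in> N ?n" "w x ?Hyz \<in> N ?n"
    using N_w[OF Gw_N[OF x y] d_A[OF z]] N_w_right[OF d_A[OF x] Gw_N[OF y z]]
      N_w[OF Gd_N[OF w_A[OF x y]] z] N_w_right[OF x Gd_N[OF w_A[OF y z]]] by (simp_all add: algebra_simps)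
  have A: "w (w x y) z \<in> A ?n" "w ?Pxy z \<in> A ?n" "w x ?Pyz \<in> A ?n"
    using w_A[OF w_A[OF x y] z] w_A[OF P_A[OF w_A[OF x y]] z] w_A[OF x P_A[OF w_A[OF y z]]]
    by (simp_all add: algebra_simps)
  have dG: "d ?Gxy = w x y - ?Pxy - ?Hxy" "d ?Gyz = w y z - ?Pyz - ?Hyz" by (simp_all add: P_def)
  have "w (d ?Gxy) z = w (w x y) z - w ?Pxy z - w ?Hxy z"
    unfolding dG using w_A[OF x y] P_A[OF w_A[OF x y]] Gd_A[OF w_A[OF x y]]
    by (simp add: w_diff_left[where i = "i + j", OF _ _ z] A_closed)
  moreover have "w x (d ?Gyz) = w (w x y) z - w x ?Pyz - w x ?Hyz"
    unfolding dG w_assoc using w_A[OF y z] P_A[OF w_A[OF y z]] Gd_A[OF w_A[OF y z]]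
    by (simp add: w_diff_right[where j = "j + k", OF x] A_closed)
  ultimately have "G ?n (d (u3 i x j y k z)) = G ?n (w x ?Pyz) - G ?n (w ?Pxy z)"
    unfolding d_u3[OF x y z] using A N N_A[OF N(1)] N_A[OF N(2)] N_A[OF N(3)] N_A[OF N(4)]
    by (simp add: G_simps[where k = ?n] G_minus A_closed G_vanish)
  then show ?thesis
    by (simp add: P_def[of "?n - 1"] G_vanish[OF u3_N[OF x y z]] d_zero)
qed

text \<open>With an argument in \<open>N\<close>, each term is either a product of two elements of
  \<open>N\<close> or contains \<open>G\<close> of an element of \<open>N\<close>. Hence a ternary
  operation fed with the value of another one is zero.\<close>

lemma u3_vanish:
  assumes "x \<in> A i" "y \<in> A j" "z \<in> A k" "x \<in> N i \<or> y \<in> N j \<or> z \<in> N k"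
  shows "u3 i x j y k z = 0"
proof -
  have 1: "w (G (i + j) (w x y)) z = 0"
  proof (cases "z \<in> N k")
    case True
    then show ?thesis using N_N[OF Gw_N[OF assms(1,2)]] by blast
  next
    case False
    then have "w x y \<in> N (i + j)" using assms N_w[of x i y j] N_w_right[of x i y j] by blast
    then show ?thesis using w_zero(2)[OF assms(3)] by (simp add: G_vanish)
  qed
  have 2: "w x (G (j + k) (w y z)) = 0"
  proof (cases "x \<in> N i")
    case True
    then show ?thesis using N_N[OF _ Gw_N[OF assms(2,3)]] by blast
  next
    case False
    then have "w y z \<in> N (j + k)" using assms N_w[of y j z k] N_w_right[of y j z k] by blast
    then show ?thesis using w_zero(1)[OF assms(1)] by (simp add: G_vanish)
  qed
  show ?thesis by (simp add: u3_def 1 2)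
qed

text \<open>As \<open>P\<close> commutes with \<open>d\<close>, every term is \<open>P\<close> of
  something. Expanding the inner projections, the triple products cancel by associativity, the
  \<open>d G\<close> terms against \<open>d\<close> of \<open>u3\<close>, and the \<open>G d\<close>
  terms, by the Leibniz rule, against \<open>u3\<close> of differentiated arguments.\<close>

lemma relation_3:
  assumes x: "x \<in> A i" and y: "y \<in> A j" and z: "z \<in> A k"
  defines "m \<equiv> i + j + k - 1"
  shows "P (i + j + k) (w (P (i + j) (w x y)) z) - P (i + j + k) (w x (P (j + k) (w y z)))
    + d (P m (u3 i x j y k z)) + P (m + 1) (u3 (i + 1) (d x) j y k z)
    + (-1) powi i *\<^sub>R P (m + 1) (u3 i x (j + 1) (d y) k z)
    + (-1) powi (i + j) *\<^sub>R P (m + 1) (u3 i x j y (k + 1) (d z)) = 0"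
proof -
  let ?e = "(-1::real) powi i" and ?f = "(-1::real) powi j"
  let ?n = "i + j + k"
  note cl = x y z d_A[OF x] d_A[OF y] d_A[OF z]
  let ?Gxy = "G (i + j) (w x y)" and ?Gyz = "G (j + k) (w y z)"
  have mem: "w (w x y) z \<in> A ?n" "w (d ?Gxy) z \<in> A ?n" "w (G (i + j + 1) (d (w x y))) z \<in> A ?n"
    "w x (d ?Gyz) \<in> A ?n" "w x (G (j + k + 1) (d (w y z))) \<in> A ?n"
    "w ?Gxy (d z) \<in> A ?n" "w (d x) ?Gyz \<in> A ?n"
    using w_A[OF w_A[OF x y] z] w_A[OF dG_A[OF w_A[OF x y]] z] w_A[OF Gd_A[OF w_A[OF x y]] z]
      w_A[OF x dG_A[OF w_A[OF y z]]] w_A[OF x Gd_A[OF w_A[OF y z]]] w_A[OF Gw_A[OF x y] d_A[OF z]]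
      w_A[OF d_A[OF x] Gw_A[OF y z]] by (simp_all add: algebra_simps)
  have 1: "w (P (i + j) (w x y)) z = w (w x y) z - w (d ?Gxy) z - w (G (i + j + 1) (d (w x y))) z"
    unfolding P_def using x y z
    by (simp add: w_diff_left[where i = "i + j", OF _ _ z] A_closed(3) w_A dG_A Gd_A)
  have 2: "w x (P (j + k) (w y z)) = w x (w y z) - w x (d ?Gyz) - w x (G (j + k + 1) (d (w y z)))"
    unfolding P_def using x y z
    by (simp add: w_diff_right[where j = "j + k", OF x] A_closed(3) w_A dG_A Gd_A)
  have Gdxy: "G (i + j + 1) (d (w x y)) = G (i + j + 1) (w (d x) y) + ?e *\<^sub>R G (i + j + 1) (w x (d y))"
  proof -
    have "w (d x) y \<in> A (i + j + 1)" "w x (d y) \<in> A (i + j + 1)"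
      using w_A[OF d_A[OF x] y] w_A[OF x d_A[OF y]] by (simp_all add: algebra_simps)
    then show ?thesis by (simp add: d_w[OF x y] G_simps[where k = "i + j + 1"] A_closed)
  qed
  have Gdyz: "G (j + k + 1) (d (w y z)) = G (j + k + 1) (w (d y) z) + ?f *\<^sub>R G (j + k + 1) (w y (d z))"
  proof -
    have "w (d y) z \<in> A (j + k + 1)" "w y (d z) \<in> A (j + k + 1)"
      using w_A[OF d_A[OF y] z] w_A[OF y d_A[OF z]] by (simp_all add: algebra_simps)
    then show ?thesis by (simp add: d_w[OF y z] G_simps[where k = "j + k + 1"] A_closed)
  qed
  note GA = Gw_A[OF d_A[OF x] y] Gw_A[OF x d_A[OF y]] Gw_A[OF d_A[OF y] z] Gw_A[OF y d_A[OF z]]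
  have mem2: "w (G (i + j + 1) (w (d x) y)) z \<in> A ?n" "w (G (i + j + 1) (w x (d y))) z \<in> A ?n"
    "w x (G (j + k + 1) (w (d y) z)) \<in> A ?n" "w x (G (j + k + 1) (w y (d z))) \<in> A ?n"
    using w_A[OF GA(1) z] w_A[OF GA(2) z] w_A[OF x GA(3)] w_A[OF x GA(4)] by (simp_all add: algebra_simps)
  have GA': "G (i + j + 1) (w (d x) y) \<in> A (i + j)" "G (i + j + 1) (w x (d y)) \<in> A (i + j)"
    "G (j + k + 1) (w (d y) z) \<in> A (j + k)" "G (j + k + 1) (w y (d z)) \<in> A (j + k)"
    using GA by (simp_all add: algebra_simps)
  have 3: "w (G (i + j + 1) (d (w x y))) z = w (G (i + j + 1) (w (d x) y)) z + ?e *\<^sub>R w (G (i + j + 1) (w x (d y))) z"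
    using GA' by (simp add: Gdxy w_add_left[where i = "i + j", OF _ _ z] w_scale_left[where i = "i + j", OF _ z] A_closed)
  have 4: "w x (G (j + k + 1) (d (w y z))) = w x (G (j + k + 1) (w (d y) z)) + ?f *\<^sub>R w x (G (j + k + 1) (w y (d z)))"
    using GA' by (simp add: Gdyz w_add_right[where j = "j + k", OF x] w_scale_right[where j = "j + k", OF x] A_closed)
  note du = d_u3[OF x y z]
  have u1: "u3 (i + 1) (d x) j y k z = w (G (i + j + 1) (w (d x) y)) z + ?e *\<^sub>R w (d x) ?Gyz"
    by (simp add: u3_def power_int_add algebra_simps)
  have u2: "u3 i x (j + 1) (d y) k z = w (G (i + j + 1) (w x (d y))) z - ?e *\<^sub>R w x (G (j + k + 1) (w (d y) z))"
    by (simp add: u3_def algebra_simps)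
  have u3': "u3 i x j y (k + 1) (d z) = w ?Gxy (d z) - ?e *\<^sub>R w x (G (j + k + 1) (w y (d z)))"
    by (simp add: u3_def algebra_simps)
  have ef: "(-1::real) powi (i + j) = ?e * ?f" by (simp add: power_int_add)
  have "?e * ?e = 1" "?e * (?e * r) = r" "?e * (?f * ?e) = ?f" for r :: real by (cases "even i"; simp)+
  note sg = this
  have mn: "m + 1 = ?n" by (simp add: m_def)
  have "d (P m (u3 i x j y k z)) = P ?n (d (u3 i x j y k z))"
    using d_P[OF u3_A[OF x y z]] by (simp add: m_def)
  then show ?thesis
    unfolding mn 1 2 3 4 du u1 u2 u3' ef w_assoc[of x y z, symmetric]
    using mem mem2
    by (simp add: P_simps[where k = ?n] A_closed scaleR_add_right scaleR_diff_right sg)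
qed

text \<open>After \<open>P_u3\<close> all terms of the form \<open>G\<close> of a product with a
  projection cancel between the binary and ternary composites. What remains compares
  \<open>G(x y)\<close> times \<open>d G(z v)\<close> with \<open>d G(x y)\<close> times
  \<open>G(z v)\<close>, and this is the derivative of a product of two elements of
  \<open>N\<close>, which is zero.\<close>

lemma relation_4:
  assumes x: "x \<in> A i" and y: "y \<in> A j" and z: "z \<in> A k" and v: "v \<in> A l"
  defines "m \<equiv> i + j + k + l - 1"
  shows "- P m (w (P (i + j + k - 1) (u3 i x j y k z)) v)
    - (-1) powi i *\<^sub>R P m (w x (P (j + k + l - 1) (u3 j y k z l v)))
    + P m (u3 (i + j) (P (i + j) (w x y)) k z l v)
    - P m (u3 i x (j + k) (P (j + k) (w y z)) l v)
    + P m (u3 i x j y (k + l) (P (k + l) (w z v))) = 0"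
proof -
  let ?e = "(-1::real) powi i" and ?f = "(-1::real) powi j"
  let ?Gxy = "G (i + j) (w x y)" and ?Gzv = "G (k + l) (w z v)"
  let ?Pxy = "P (i + j) (w x y)" and ?Pyz = "P (j + k) (w y z)" and ?Pzv = "P (k + l) (w z v)"
  let ?U = "u3 i x j y k z" and ?W = "u3 j y k z l v"
  note PA = P_A[OF w_A[OF x y]] P_A[OF w_A[OF y z]] P_A[OF w_A[OF z v]]
  let ?A1 = "G (i + j + k) (w ?Pxy z)" and ?A2 = "G (i + j + k) (w x ?Pyz)"
  let ?B1 = "G (j + k + l) (w ?Pyz v)" and ?B2 = "G (j + k + l) (w y ?Pzv)"
  have AB: "?A1 \<in> A (i + j + k - 1)" "?A2 \<in> A (i + j + k - 1)" "?B1 \<in> A (j + k + l - 1)" "?B2 \<in> A (j + k + l - 1)"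
    using Gw_A[OF PA(1) z] Gw_A[OF x PA(2)] Gw_A[OF PA(2) v] Gw_A[OF y PA(3)] by (simp_all add: algebra_simps)
  note UW = u3_A[OF x y z] u3_A[OF y z v]
  have t1: "w (P (i + j + k - 1) ?U) v = w ?U v + w ?A1 v - w ?A2 v"
    unfolding P_u3[OF x y z] using AB UW
    by (simp add: w_diff_left[where i = "i + j + k - 1", OF _ _ v] w_add_left[where i = "i + j + k - 1", OF _ _ v] A_closed)
  have t2: "w x (P (j + k + l - 1) ?W) = w x ?W + w x ?B1 - w x ?B2"
    unfolding P_u3[OF y z v] using AB UW
    by (simp add: w_diff_right[where j = "j + k + l - 1", OF x] w_add_right[where j = "j + k + l - 1", OF x] A_closed)
  have ef: "(-1::real) powi (i + j) = ?e * ?f" by (simp add: power_int_add)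
  have t3: "u3 (i + j) ?Pxy k z l v = w ?A1 v - (?e * ?f) *\<^sub>R w ?Pxy ?Gzv" by (simp add: u3_def ef)
  have t4: "u3 i x (j + k) ?Pyz l v = w ?A2 v - ?e *\<^sub>R w x ?B1" by (simp add: u3_def add.assoc)
  have t5: "u3 i x j y (k + l) ?Pzv = w ?Gxy ?Pzv - ?e *\<^sub>R w x ?B2" by (simp add: u3_def add.assoc)
  have Uv: "w ?U v = w ?Gxy (w z v) - ?e *\<^sub>R w x (w (G (j + k) (w y z)) v)"
  proof -
    have "w ?Gxy z \<in> A (i + j + k - 1)" "w x (G (j + k) (w y z)) \<in> A (i + j + k - 1)"
      using w_A[OF Gw_A[OF x y] z] w_A[OF x Gw_A[OF y z]] by (simp_all add: algebra_simps)
    then show ?thesis unfolding u3_def by (simp add: w_diff_left[where i = "i + j + k - 1", OF _ _ v] w_scale_left[where i = "i + j + k - 1", OF _ v] A_closed w_assoc)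
  qed
  have xW: "w x ?W = w x (w (G (j + k) (w y z)) v) - ?f *\<^sub>R w (w x y) ?Gzv"
  proof -
    have "w (G (j + k) (w y z)) v \<in> A (j + k + l - 1)" "w y ?Gzv \<in> A (j + k + l - 1)"
      using w_A[OF Gw_A[OF y z] v] w_A[OF y Gw_A[OF z v]] by (simp_all add: algebra_simps)
    then show ?thesis unfolding u3_def by (simp add: w_diff_right[where j = "j + k + l - 1", OF x] w_scale_right[where j = "j + k + l - 1", OF x] A_closed w_assoc)
  qed
  \<comment> \<open>Of the two corrections in the projection only \<open>d G\<close> survives,
    because \<open>G d\<close> has values in \<open>N\<close> and the other factor is in
    \<open>N\<close> too.\<close>
  have zP: "w ?Gxy (w z v) - w ?Gxy ?Pzv = w ?Gxy (d ?Gzv)"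
  proof -
    have eq: "w z v - ?Pzv = d ?Gzv + G (k + l + 1) (d (w z v))" by (simp add: P_def)
    have "w ?Gxy (G (k + l + 1) (d (w z v))) = 0" by (rule N_N[OF Gw_N[OF x y] Gd_N[OF w_A[OF z v]]])
    then show ?thesis
      using w_diff_right[OF Gw_A[OF x y] w_A[OF z v] PA(3)] w_add_right[OF Gw_A[OF x y] dG_A[OF w_A[OF z v]] Gd_A[OF w_A[OF z v]]]
      by (simp add: eq)
  qed
  have xP: "w (w x y) ?Gzv - w ?Pxy ?Gzv = w (d ?Gxy) ?Gzv"
  proof -
    have eq: "w x y - ?Pxy = d ?Gxy + G (i + j + 1) (d (w x y))" by (simp add: P_def)
    have "w (G (i + j + 1) (d (w x y))) ?Gzv = 0" by (rule N_N[OF Gd_N[OF w_A[OF x y]] Gw_N[OF z v]])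
    then show ?thesis
      using w_diff_left[OF w_A[OF x y] PA(1) Gw_A[OF z v]] w_add_left[OF dG_A[OF w_A[OF x y]] Gd_A[OF w_A[OF x y]] Gw_A[OF z v]]
      by (simp add: eq)
  qed
  \<comment> \<open>Differentiating the vanishing product gives the one relation that is not a
    formal cancellation.\<close>
  have "d (w ?Gxy ?Gzv) = 0" using N_N[OF Gw_N[OF x y] Gw_N[OF z v]] d_zero by simp
  moreover have "(-1::real) powi (i + j - 1) = - (?e * ?f)" by (cases "even i"; cases "even j") auto
  ultimately have dGG: "w (d ?Gxy) ?Gzv = (?e * ?f) *\<^sub>R w ?Gxy (d ?Gzv)"
    using d_w[OF Gw_A[OF x y] Gw_A[OF z v]] by simp
  let ?S = "- w (P (i + j + k - 1) ?U) v - ?e *\<^sub>R w x (P (j + k + l - 1) ?W) + u3 (i + j) ?Pxy k z l v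
    - u3 i x (j + k) ?Pyz l v + u3 i x j y (k + l) ?Pzv"
  have "?S = - (w ?Gxy (w z v) - w ?Gxy ?Pzv) + (?e * ?f) *\<^sub>R (w (w x y) ?Gzv - w ?Pxy ?Gzv)"
    unfolding t1 t2 t3 t4 t5 Uv xW by (simp add: scaleR_diff_right scaleR_add_right)
  also have "\<dots> = 0"
    unfolding zP xP dGG by (cases "even i"; cases "even j") auto
  finally have S: "?S = 0" .
  have mem: "w (P (i + j + k - 1) ?U) v \<in> A m" "w x (P (j + k + l - 1) ?W) \<in> A m"
    "u3 (i + j) ?Pxy k z l v \<in> A m" "u3 i x (j + k) ?Pyz l v \<in> A m" "u3 i x j y (k + l) ?Pzv \<in> A m"
    using w_A[OF P_A[OF UW(1)] v] w_A[OF x P_A[OF UW(2)]] u3_A[OF PA(1) z v] u3_A[OF x PA(2) v] u3_A[OF x y PA(3)]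
    by (simp_all add: m_def algebra_simps)
  have "P m ?S = - P m (w (P (i + j + k - 1) ?U) v) - ?e *\<^sub>R P m (w x (P (j + k + l - 1) ?W))
     + P m (u3 (i + j) ?Pxy k z l v) - P m (u3 i x (j + k) ?Pyz l v) + P m (u3 i x j y (k + l) ?Pzv)"
    using mem P_simps(3)[of "w (P (i + j + k - 1) ?U) v" m _ "-1"]
    by (simp add: P_simps[where k = m] A_closed)
  then show ?thesis unfolding S P_zero by simp
qed

lemma op_multilinear: "multilinear_on R op"
  unfolding multilinear_on_def
proof (intro allI impI)
  fix us ws :: "(int \<times> 'v) list" and k x y and a b :: real
  assume us: "set us \<subseteq> homogeneous R" and ws: "set ws \<subseteq> homogeneous R" and x: "x \<in> R k" and y: "y \<in> R k"
  let ?z = "a *\<^sub>R x + b *\<^sub>R y"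
  note xA = R_A[OF x] and yA = R_A[OF y]
  have zA: "?z \<in> A k" using xA yA by (intro A_closed)
  have wl: "w ?z u = a *\<^sub>R w x u + b *\<^sub>R w y u" if "u \<in> A j" for u j
    using xA yA that by (simp add: w_add_left[where i = k, OF _ _ that] w_scale_left[where i = k, OF _ that] A_closed)
  have wr: "w u ?z = a *\<^sub>R w u x + b *\<^sub>R w u y" if "u \<in> A j" for u j
    using xA yA that by (simp add: w_add_right[where j = k, OF that] w_scale_right[where j = k, OF that] A_closed)
  have Gl: "G (j + l) (a *\<^sub>R w u x + b *\<^sub>R w u' x') = a *\<^sub>R G (j + l) (w u x) + b *\<^sub>R G (j + l) (w u' x')"
    if "u \<in> A j" "u' \<in> A j" "x \<in> A l" "x' \<in> A l" for u u' x x' j l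
    using that by (intro G_linear w_A)
  \<comment> \<open>The six cases are the positions of a slot in a list of at most three arguments;
    on longer lists \<open>op\<close> is zero.\<close>
  have lin: "op (us @ (k, ?z) # ws) = a *\<^sub>R op (us @ (k, x) # ws) + b *\<^sub>R op (us @ (k, y) # ws)"
    if c: "us = [] \<and> ws = [] \<or> (\<exists>p. us = [p] \<and> ws = []) \<or> (\<exists>p. us = [] \<and> ws = [p])
      \<or> (\<exists>p q. us = [] \<and> ws = [p, q]) \<or> (\<exists>p q. us = [p] \<and> ws = [q]) \<or> (\<exists>p q. us = [p, q] \<and> ws = [])"
    using c
  proof (elim disjE exE conjE)
    assume "us = []" "ws = []"
    then show ?thesis using d_linear[OF xA yA] by simp
  next
    fix p assume "us = [p]" "ws = []"
    then obtain j u where p: "us = [(j, u)]" "ws = []" "u \<in> A j" using us R_A by (cases p) (auto simp: homogeneous_def)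
    then show ?thesis by (simp add: wr P_linear w_A xA yA)
  next
    fix p assume "us = []" "ws = [p]"
    then obtain j u where p: "us = []" "ws = [(j, u)]" "u \<in> A j" using ws R_A by (cases p) (auto simp: homogeneous_def)
    then show ?thesis by (simp add: wl P_linear w_A xA yA)
  next
    fix p q assume "us = []" "ws = [p, q]"
    then obtain j u l v where p: "us = []" "ws = [(j, u), (l, v)]" and uv: "u \<in> A j" "v \<in> A l"
      using ws R_A by (cases p; cases q) (auto simp: homogeneous_def)
    have "u3 k ?z j u l v = a *\<^sub>R u3 k x j u l v + b *\<^sub>R u3 k y j u l v"
      unfolding u3_def using Gw_A[OF xA uv(1)] Gw_A[OF yA uv(1)] Gw_A[OF uv]
      by (simp add: wl[OF uv(1)] Gl[OF xA yA uv(1,1)] wl[OF Gw_A[OF uv]] w_add_left[where i = "k + j - 1", OF _ _ uv(2)] w_scale_left[where i = "k + j - 1", OF _ uv(2)] A_closed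
          scaleR_diff_right scaleR_add_right mult.commute)
    then show ?thesis
      using P_linear[OF u3_A[OF xA uv] u3_A[OF yA uv]] by (simp add: p op3 del: op.simps(3))
  next
    fix p q assume "us = [p]" "ws = [q]"
    then obtain j u l v where p: "us = [(j, u)]" "ws = [(l, v)]" and uv: "u \<in> A j" "v \<in> A l"
      using us ws R_A by (cases p; cases q) (auto simp: homogeneous_def)
    have "u3 j u k ?z l v = a *\<^sub>R u3 j u k x l v + b *\<^sub>R u3 j u k y l v"
      unfolding u3_def using Gw_A[OF uv(1) xA] Gw_A[OF uv(1) yA] Gw_A[OF xA uv(2)] Gw_A[OF yA uv(2)]
      by (simp add: wr[OF uv(1)] wl[OF uv(2)] Gl[OF uv(1,1) xA yA] Gl[OF xA yA uv(2,2)]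
          w_add_left[where i = "j + k - 1", OF _ _ uv(2)] w_scale_left[where i = "j + k - 1", OF _ uv(2)]
          w_add_right[where j = "k + l - 1", OF uv(1)] w_scale_right[where j = "k + l - 1", OF uv(1)] A_closed
          scaleR_diff_right scaleR_add_right mult.commute)
    then show ?thesis
      using P_linear[OF u3_A[OF uv(1) xA uv(2)] u3_A[OF uv(1) yA uv(2)]] by (simp add: p op3 del: op.simps(3))
  next
    fix p q assume "us = [p, q]" "ws = []"
    then obtain j u l v where p: "us = [(j, u), (l, v)]" "ws = []" and uv: "u \<in> A j" "v \<in> A l"
      using us R_A by (cases p; cases q) (auto simp: homogeneous_def)
    have "u3 j u l v k ?z = a *\<^sub>R u3 j u l v k x + b *\<^sub>R u3 j u l v k y"
      unfolding u3_def using Gw_A[OF uv(2) xA] Gw_A[OF uv(2) yA] Gw_A[OF uv]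
      by (simp add: wr[OF uv(2)] wr[OF Gw_A[OF uv]] Gl[OF uv(2,2) xA yA]
          w_add_right[where j = "l + k - 1", OF uv(1)] w_scale_right[where j = "l + k - 1", OF uv(1)] A_closed scaleR_diff_right scaleR_add_right mult.commute)
    then show ?thesis
      using P_linear[OF u3_A[OF uv xA] u3_A[OF uv yA]] by (simp add: p op3 del: op.simps(3))
  qed
  show "op (us @ (k, ?z) # ws) = a *\<^sub>R op (us @ (k, x) # ws) + b *\<^sub>R op (us @ (k, y) # ws)"
  proof (cases "length us + length ws \<ge> 3")
    case True
    then show ?thesis by (simp add: op_long)
  next
    case False
    then show ?thesis
      by (intro lin) (cases us rule: remdups_adj.cases; cases ws rule: remdups_adj.cases; auto simp: not_le)
  qed
qed

lemma op_zero_arg: "set us \<subseteq> homogeneous R \<Longrightarrow> set ws \<subseteq> homogeneous R \<Longrightarrow> op (us @ (k, 0) # ws) = 0"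
  using op_multilinear[unfolded multilinear_on_def, rule_format, of us ws 0 k 0 0 0] subspace_0[OF subspace_R]
  by simp

section \<open>Verification of the A-infinity relations\<close>

lemma sum_rst:
  "(\<Sum>(r, s, t) \<in> {(r, s, t). r + s + t = n \<and> s \<ge> 1}. f r s t) =
    (\<Sum>s<n. \<Sum>r<n - s. f r (Suc s) (n - Suc s - r) :: 'v)"
proof -
  have "(\<Sum>(r, s, t) \<in> {(r, s, t). r + s + t = n \<and> s \<ge> 1}. f r s t)
      = (\<Sum>(s, r) \<in> Sigma {..<n} (\<lambda>s. {..<n - s}). f r (Suc s) (n - Suc s - r))"
    by (rule sum.reindex_bij_witness[where i = "\<lambda>(s, r). (r, Suc s, n - Suc s - r)" and j = "\<lambda>(r, s, t). (s - 1, r)"])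
      auto
  then show ?thesis by (simp add: sum.Sigma)
qed

definition rel_term :: "(int \<times> 'v) list \<Rightarrow> nat \<Rightarrow> nat \<Rightarrow> nat \<Rightarrow> 'v" where
  "rel_term xs r s t = ((-1) ^ (r + s * t) * (-1) powi ((2 - int s) * total_degree (take r xs))) *\<^sub>R
     op (take r xs @ hom_value op (take s (drop r xs)) # drop (r + s) xs)"

text \<open>The outer operation has \<open>r + t + 1\<close> inputs and the inner one
  \<open>s\<close>. If the outer has at least four it is zero; if the inner has, the outer receives
  a zero argument.\<close>

lemma rel_term_long:
  assumes "set xs \<subseteq> homogeneous R" "r + s + t = length xs" "3 \<le> r + t \<or> 4 \<le> s"
  shows "rel_term xs r s t = 0"
proof -
  have "op (take r xs @ hom_value op (take s (drop r xs)) # drop (r + s) xs) = 0"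
  proof (cases "3 \<le> r + t")
    case True
    then show ?thesis using assms(2) by (intro op_long) auto
  next
    case False
    then have "op (take s (drop r xs)) = 0" using assms(2,3) by (intro op_long) auto
    moreover have "set (take r xs) \<subseteq> homogeneous R" "set (drop (r + s) xs) \<subseteq> homogeneous R"
      using assms(1) set_take_subset set_drop_subset by fast+
    ultimately show ?thesis by (simp add: hom_value_def op_zero_arg)
  qed
  then show ?thesis by (simp add: rel_term_def)
qed

lemma op_N_slot:
  assumes "set [p, q, r] \<subseteq> homogeneous A" "\<exists>(k, x) \<in> set [p, q, r]. x \<in> N k"
  shows "op [p, q, r] = 0"
proof -
  obtain i x j y k z where "p = (i, x)" "q = (j, y)" "r = (k, z)" by (cases p; cases q; cases r)
  then show ?thesis
    using assms u3_vanish[of x i y j z k] by (auto simp: op3 homogeneous_def P_zero simp del: op.simps(3))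
qed

lemma op3_N:
  assumes "x \<in> A i" "y \<in> A j" "z \<in> A k"
  shows "op [(i, x), (j, y), (k, z)] \<in> N (i + j + k - 1)"
  unfolding op3 using P_N[OF u3_N[OF assms]] .

text \<open>With six or more inputs one of the two operations has at least four. With five, only
  ternary operations composed with each other survive, and they vanish since the inner value lies in
  \<open>N\<close>. Up to four inputs the relations are \<open>d_d\<close>, the Leibniz rule under
  \<open>P\<close>, \<open>relation_3\<close> and \<open>relation_4\<close>.\<close>

lemma op_relations:
  assumes "xs \<noteq> []" and R: "set xs \<subseteq> homogeneous R"
  shows "(\<Sum>s<length xs. \<Sum>r<length xs - s. rel_term xs r (Suc s) (length xs - Suc s - r)) = 0"
proof -
  have A: "set xs \<subseteq> homogeneous A" using R R_A by (auto simp: homogeneous_def)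
  consider (1) i x where "xs = [(i, x)]" | (2) i x j y where "xs = [(i, x), (j, y)]"
    | (3) i x j y k z where "xs = [(i, x), (j, y), (k, z)]"
    | (4) i x j y k z l v where "xs = [(i, x), (j, y), (k, z), (l, v)]"
    | (5) i x j y k z l v h u where "xs = [(i, x), (j, y), (k, z), (l, v), (h, u)]"
    | (6) "6 \<le> length xs"
  proof (cases xs)
    case (Cons p1 xs1)
    note c1 = this
    show ?thesis
    proof (cases xs1)
      case Nil
      then show ?thesis using c1 that(1) by (cases p1) auto
    next
      case (Cons p2 xs2)
      note c2 = this
      show ?thesis
      proof (cases xs2)
        case Nil
        then show ?thesis using c1 c2 that(2) by (cases p1; cases p2) auto
      next
        case (Cons p3 xs3)
        note c3 = this
        show ?thesis
        proof (cases xs3)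
          case Nil
          then show ?thesis using c1 c2 c3 that(3) by (cases p1; cases p2; cases p3) auto
        next
          case (Cons p4 xs4)
          note c4 = this
          show ?thesis
          proof (cases xs4)
            case Nil
            then show ?thesis using c1 c2 c3 c4 that(4) by (cases p1; cases p2; cases p3; cases p4) auto
          next
            case (Cons p5 xs5)
            note c5 = this
            show ?thesis
            proof (cases xs5)
              case Nil
              then show ?thesis using c1 c2 c3 c4 c5 that(5) by (cases p1; cases p2; cases p3; cases p4; cases p5) auto
            qed (use c1 c2 c3 c4 c5 that(6) in auto)
          qed
        qed
      qed
    qed
  qed (use assms in simp)
  then show ?thesis
  proof cases
    case 1
    then show ?thesis using A d_d by (auto simp: rel_term_def hom_value_def homogeneous_def total_degree_def)
  next
    case 2
    then have xy: "x \<in> A i" "y \<in> A j" using A by (auto simp: homogeneous_def)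
    have "(\<Sum>s<length xs. \<Sum>r<length xs - s. rel_term xs r (Suc s) (length xs - Suc s - r))
      = rel_term xs 0 1 1 + rel_term xs 1 1 0 + rel_term xs 0 2 0"
      by (simp add: 2 eval_nat_numeral)
    also have "rel_term xs 0 1 1 = - P (i + j + 1) (w (d x) y)"
      by (simp add: 2 rel_term_def hom_value_def total_degree_def algebra_simps)
    also have "rel_term xs 1 1 0 = - ((-1) powi i *\<^sub>R P (i + j + 1) (w x (d y)))"
      by (simp add: 2 rel_term_def hom_value_def total_degree_def algebra_simps)
    also have "rel_term xs 0 2 0 = d (P (i + j) (w x y))"
      by (simp add: 2 rel_term_def hom_value_def total_degree_def)
    also have "d (P (i + j) (w x y)) = P (i + j + 1) (w (d x) y) + (-1) powi i *\<^sub>R P (i + j + 1) (w x (d y))"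
    proof -
      have "w (d x) y \<in> A (i + j + 1)" "w x (d y) \<in> A (i + j + 1)"
        using w_A[OF d_A[OF xy(1)] xy(2)] w_A[OF xy(1) d_A[OF xy(2)]] by (simp_all add: algebra_simps)
      then show ?thesis
        by (simp add: d_P[OF w_A[OF xy]] d_w[OF xy] P_simps[where k = "i + j + 1"] A_closed)
    qed
    finally show ?thesis by simp
  next
    case 3
    then have xyz: "x \<in> A i" "y \<in> A j" "z \<in> A k" using A by (auto simp: homogeneous_def)
    have "(\<Sum>s<length xs. \<Sum>r<length xs - s. rel_term xs r (Suc s) (length xs - Suc s - r))
      = rel_term xs 0 1 2 + rel_term xs 1 1 1 + rel_term xs 2 1 0 + rel_term xs 0 2 1 + rel_term xs 1 2 0 + rel_term xs 0 3 0"
      by (simp add: 3 eval_nat_numeral)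
    also have "rel_term xs 0 1 2 = P (i + j + k - 1 + 1) (u3 (i + 1) (d x) j y k z)"
      by (simp add: 3 rel_term_def hom_value_def total_degree_def op3 add.commute add.left_commute del: op.simps(3))
    also have "rel_term xs 1 1 1 = (-1) powi i *\<^sub>R P (i + j + k - 1 + 1) (u3 i x (j + 1) (d y) k z)"
      by (simp add: 3 rel_term_def hom_value_def total_degree_def op3 add.commute add.left_commute del: op.simps(3))
    also have "rel_term xs 2 1 0 = (-1) powi (i + j) *\<^sub>R P (i + j + k - 1 + 1) (u3 i x j y (k + 1) (d z))"
      by (simp add: 3 rel_term_def hom_value_def total_degree_def op3 add.commute add.left_commute numeral_2_eq_2 del: op.simps(3))
    also have "rel_term xs 0 2 1 = P (i + j + k) (w (P (i + j) (w x y)) z)"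
      by (simp add: 3 rel_term_def hom_value_def total_degree_def)
    also have "rel_term xs 1 2 0 = - P (i + j + k) (w x (P (j + k) (w y z)))"
      by (simp add: 3 rel_term_def hom_value_def total_degree_def add.assoc)
    also have "rel_term xs 0 3 0 = d (P (i + j + k - 1) (u3 i x j y k z))"
      by (simp add: 3 rel_term_def hom_value_def total_degree_def op3 del: op.simps(3))
    finally show ?thesis using relation_3[OF xyz] by (simp add: algebra_simps)
  next
    case 4
    \<comment> \<open>The ternary operation has degree -1, so its Koszul sign past the first
      argument carries the exponent \<open>- i\<close>.\<close>
    have inv: "inverse ((-1::real) powi i) = (-1) powi i" by (cases "even i") auto
    have x: "x \<in> A i" "y \<in> A j" "z \<in> A k" "v \<in> A l" using A 4 by (auto simp: homogeneous_def)
    have "(\<Sum>s<length xs. \<Sum>r<length xs - s. rel_term xs r (Suc s) (length xs - Suc s - r))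
      = rel_term xs 0 1 3 + rel_term xs 1 1 2 + rel_term xs 2 1 1 + rel_term xs 3 1 0
       + rel_term xs 0 2 2 + rel_term xs 1 2 1 + rel_term xs 2 2 0 + rel_term xs 0 3 1 + rel_term xs 1 3 0 + rel_term xs 0 4 0"
      by (simp add: 4 eval_nat_numeral)
    also have "\<dots> = rel_term xs 0 2 2 + rel_term xs 1 2 1 + rel_term xs 2 2 0 + rel_term xs 0 3 1 + rel_term xs 1 3 0"
      using rel_term_long[OF R] by (simp add: 4)
    also have "rel_term xs 0 2 2 = P (i + j + k + l - 1) (u3 (i + j) (P (i + j) (w x y)) k z l v)"
      by (simp add: 4 rel_term_def hom_value_def total_degree_def op3 del: op.simps(3))
    also have "rel_term xs 1 2 1 = - P (i + j + k + l - 1) (u3 i x (j + k) (P (j + k) (w y z)) l v)"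
      by (simp add: 4 rel_term_def hom_value_def total_degree_def op3 add.assoc del: op.simps(3))
    also have "rel_term xs 2 2 0 = P (i + j + k + l - 1) (u3 i x j y (k + l) (P (k + l) (w z v)))"
      by (simp add: 4 rel_term_def hom_value_def total_degree_def op3 add.assoc numeral_2_eq_2 del: op.simps(3))
    also have "rel_term xs 0 3 1 = - P (i + j + k + l - 1) (w (P (i + j + k - 1) (u3 i x j y k z)) v)"
      by (simp add: 4 rel_term_def hom_value_def total_degree_def op3 algebra_simps del: op.simps(3))
    also have "rel_term xs 1 3 0 = - ((-1) powi i *\<^sub>R P (i + j + k + l - 1) (w x (P (j + k + l - 1) (u3 j y k z l v))))"
      by (simp add: 4 rel_term_def hom_value_def total_degree_def op3 algebra_simps power_int_minus inv del: op.simps(3))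
    finally show ?thesis using relation_4[OF x] by (simp add: algebra_simps)
  next
    case 5
    then have x: "x \<in> A i" "y \<in> A j" "z \<in> A k" "v \<in> A l" "u \<in> A h" using A by (auto simp: homogeneous_def)
    have "(\<Sum>s<length xs. \<Sum>r<length xs - s. rel_term xs r (Suc s) (length xs - Suc s - r))
      = rel_term xs 0 1 4 + rel_term xs 1 1 3 + rel_term xs 2 1 2 + rel_term xs 3 1 1 + rel_term xs 4 1 0
       + rel_term xs 0 2 3 + rel_term xs 1 2 2 + rel_term xs 2 2 1 + rel_term xs 3 2 0
       + rel_term xs 0 3 2 + rel_term xs 1 3 1 + rel_term xs 2 3 0 + rel_term xs 0 4 1 + rel_term xs 1 4 0 + rel_term xs 0 5 0"
      by (simp add: 5 eval_nat_numeral)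
    also have "\<dots> = rel_term xs 0 3 2 + rel_term xs 1 3 1 + rel_term xs 2 3 0"
      using rel_term_long[OF R] by (simp add: 5)
    also have "\<dots> = 0"
    proof -
      have "op [(a, op [(i', p), (j', q), (k', r)]), (b, s), (c, t)] = 0"
        "op [(b, s), (a, op [(i', p), (j', q), (k', r)]), (c, t)] = 0"
        "op [(b, s), (c, t), (a, op [(i', p), (j', q), (k', r)])] = 0"
        if "p \<in> A i'" "q \<in> A j'" "r \<in> A k'" "s \<in> A b" "t \<in> A c" "a = i' + j' + k' - 1" for a b c i' j' k' p q r s t
        using op3_N[OF that(1-3)] that N_A[OF op3_N[OF that(1-3)]]
        by (auto intro!: op_N_slot simp: homogeneous_def simp del: op.simps)
      note * = this
      show ?thesis
        using *(1)[OF x(1,2,3,4,5)] *(2)[OF x(2,3,4,1,5)] *(3)[OF x(3,4,5,1,2)]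
        by (simp add: 5 rel_term_def add.assoc hom_value_def total_degree_def eval_nat_numeral del: op.simps)
    qed
    finally show ?thesis .
  next
    case 6
    have "rel_term xs r (Suc s) (length xs - Suc s - r) = 0" if "s < length xs" "r < length xs - s" for r s
      using that 6 by (intro rel_term_long[OF R]) auto
    then show ?thesis by simp
  qed
qed

lemma A_infinity: "A_infinity_algebra R op"
  unfolding A_infinity_algebra_def
proof (intro conjI allI impI)
  show "subspace (R k)" for k by (rule subspace_R)
  show "multilinear_on R op" by (rule op_multilinear)
  fix xs :: "(int \<times> 'v) list" assume xs: "xs \<noteq> []" "set xs \<subseteq> homogeneous R"
  show "hom_value op xs \<in> homogeneous R" using op_R[OF xs] by (simp add: hom_value_def homogeneous_def)
  show "(\<Sum>(r, s, t) \<in> {(r, s, t). r + s + t = length xs \<and> s \<ge> 1}.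
           ((-1) ^ (r + s * t) * (-1) powi ((2 - int s) * total_degree (take r xs))) *\<^sub>R
           op (take r xs @ hom_value op (take s (drop r xs)) # drop (r + s) xs)) = 0"
    using op_relations[OF xs] sum_rst[of "rel_term xs" "length xs"] by (simp add: rel_term_def)
qed

section \<open>Vanishing on shuffles\<close>

lemma inv_eq_at: "\<sigma> permutes {..<m} \<Longrightarrow> \<sigma> i = j \<Longrightarrow> inv \<sigma> j = i"
  using permutes_inj inv_f_eq by metis

lemma koszul_sign_2:
  "koszul_sign \<sigma> [(i, x), (j, y)] = (if \<sigma> 1 < \<sigma> 0 then (-1) powi (i * j) else 1)"
proof -
  have "{(a, b). a < b \<and> b < length [(i, x), (j, y)] \<and> \<sigma> b < \<sigma> a} = (if \<sigma> 1 < \<sigma> 0 then {(0, 1)} else {})"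
    by (auto simp: less_Suc_eq)
  then show ?thesis by (simp add: koszul_sign_def)
qed

lemma koszul_sign_3:
  "koszul_sign \<sigma> [(i, x), (j, y), (k, z)] = (if \<sigma> 1 < \<sigma> 0 then (-1) powi (i * j) else 1) *
    (if \<sigma> 2 < \<sigma> 0 then (-1) powi (i * k) else 1) * (if \<sigma> 2 < \<sigma> 1 then (-1) powi (j * k) else 1)"
proof -
  let ?S = "{(a, b). a < b \<and> b < length [(i, x), (j, y), (k, z)] \<and> \<sigma> b < \<sigma> a}"
  have "?S = (if \<sigma> 1 < \<sigma> 0 then {(0, 1)} else {}) \<union> (if \<sigma> 2 < \<sigma> 0 then {(0, 2)} else {}) \<union> (if \<sigma> 2 < \<sigma> 1 then {(1, 2)} else {})"
    by (auto simp: less_Suc_eq numeral_2_eq_2)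
  then show ?thesis by (simp add: koszul_sign_def prod.union_disjoint numeral_2_eq_2)
qed

lemma G_comm: "x \<in> A i \<Longrightarrow> y \<in> A j \<Longrightarrow> G (i + j) (w x y) = (-1) powi (i * j) *\<^sub>R G (j + i) (w y x)"
  using w_comm[of x i y j] G_simps(3)[OF w_A[of y j x i] w_A[of y j x i], of "(-1) powi (i * j)"] by (simp add: add.commute)

text \<open>Up to order there are three products of one argument with \<open>G\<close> of the other
  two. Each occurs twice in the shuffle sum, and graded commutativity gives the two occurrences
  opposite signs, as the cases of parity show.\<close>

lemma u3_shuffle_12:
  assumes "x \<in> A i" "y \<in> A j" "z \<in> A k"
  shows "u3 i x j y k z - (-1) powi (i * j) *\<^sub>R u3 j y i x k z
    + ((-1) powi (i * j) * (-1) powi (i * k)) *\<^sub>R u3 j y k z i x = 0"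
proof -
  have G: "G (i + j) (w x y) \<in> A (i + j - 1)" "G (i + k) (w x z) \<in> A (i + k - 1)" "G (j + k) (w y z) \<in> A (j + k - 1)"
    using assms G_A w_A by auto
  have "w (G (j + i) (w y x)) z = (-1) powi (i * j) *\<^sub>R w (G (i + j) (w x y)) z"
    using w_scale_left[OF G(1) assms(3), of "(-1) powi (i * j)"] G_comm[OF assms(2,1)] by (simp add: mult.commute)
  moreover have "w y (G (k + i) (w z x)) = (-1) powi (i * k) *\<^sub>R w y (G (i + k) (w x z))"
    using w_scale_right[OF assms(2) G(2), of "(-1) powi (i * k)"] G_comm[OF assms(3,1)] by (simp add: mult.commute)
  moreover have "w x (G (j + k) (w y z)) = (-1) powi (i * (j + k - 1)) *\<^sub>R w (G (j + k) (w y z)) x"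
    by (rule w_comm[OF assms(1) G(3)])
  ultimately show ?thesis
    unfolding u3_def by (cases "even i"; cases "even j"; cases "even k"; simp)
qed

lemma u3_shuffle_21:
  assumes "x \<in> A i" "y \<in> A j" "z \<in> A k"
  shows "u3 i x j y k z - (-1) powi (j * k) *\<^sub>R u3 i x k z j y
    + ((-1) powi (i * k) * (-1) powi (j * k)) *\<^sub>R u3 k z i x j y = 0"
proof -
  have G: "G (i + j) (w x y) \<in> A (i + j - 1)" "G (i + k) (w x z) \<in> A (i + k - 1)" "G (j + k) (w y z) \<in> A (j + k - 1)"
    using assms G_A w_A by auto
  have "w (G (k + i) (w z x)) y = (-1) powi (i * k) *\<^sub>R w (G (i + k) (w x z)) y"
    using w_scale_left[OF G(2) assms(2), of "(-1) powi (i * k)"] G_comm[OF assms(3,1)] by (simp add: mult.commute)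
  moreover have "w x (G (k + j) (w z y)) = (-1) powi (j * k) *\<^sub>R w x (G (j + k) (w y z))"
    using w_scale_right[OF assms(1) G(3), of "(-1) powi (j * k)"] G_comm[OF assms(3,2)] by (simp add: mult.commute)
  moreover have "w z (G (i + j) (w x y)) = (-1) powi (k * (i + j - 1)) *\<^sub>R w (G (i + j) (w x y)) z"
    by (rule w_comm[OF assms(3) G(1)])
  ultimately show ?thesis
    unfolding u3_def by (cases "even i"; cases "even j"; cases "even k"; simp)
qed

lemma P_alternating_sum:
  assumes "x \<in> A m" "y \<in> A m" "z \<in> A m" "x - a *\<^sub>R y + b *\<^sub>R z = 0"
  shows "P m x - a *\<^sub>R P m y + b *\<^sub>R P m z = 0"
  using arg_cong[OF assms(4), of "P m"] P_zero P_simps[OF A_closed(3)[OF assms(1) A_closed(4)[OF assms(2)]] A_closed(4)[OF assms(3)]]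
    P_simps(2)[OF assms(1) A_closed(4)[OF assms(2)]] P_simps(3)[OF assms(2,2)] P_simps(3)[OF assms(3,3)]
  by simp

text \<open>Operations with four or more inputs are zero, so only the shuffles of type (1,1), (1,2)
  and (2,1) matter. The first is graded commutativity; the others reduce to identities for
  \<open>u3\<close> before the projection.\<close>

lemma balanced_op: "balanced R op"
  unfolding balanced_def
proof (intro allI impI)
  fix p q :: nat and xs :: "(int \<times> 'v) list"
  assume p: "1 \<le> p" and q: "1 \<le> q" and len: "length xs = p + q" and R: "set xs \<subseteq> homogeneous R"
  let ?f = "\<lambda>\<sigma>. (of_int (sign \<sigma>) * koszul_sign \<sigma> xs) *\<^sub>R op (map (\<lambda>j. xs ! inv \<sigma> j) [0..<p + q])"
  have A: "set xs \<subseteq> homogeneous A" using R R_A by (auto simp: homogeneous_def)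
  have perm1: "insert_zero a id permutes {..<2}" "sign (insert_zero a id) = (-1) ^ a" if "a \<le> 1" for a
    using insert_zero_permutes[OF permutes_id[of "{..<1}"] that] sign_insert_zero[OF permutes_id[of "{..<1}"] that]
    by (simp_all add: numeral_2_eq_2 sign_id)
  have perm2: "insert_zero b (insert_zero a id) permutes {..<3}" "sign (insert_zero b (insert_zero a id)) = (-1) ^ b * (-1) ^ a"
    if "b \<le> 2" "a \<le> 1" for a b
    using insert_zero_permutes[OF perm1(1)[OF that(2)] that(1)] sign_insert_zero[OF perm1(1)[OF that(2)] that(1)] perm1(2)[OF that(2)]
    by (simp_all add: numeral_3_eq_3 numeral_2_eq_2)
  have id0: "insert_zero 0 id = id" by (auto simp: insert_zero_def fun_eq_iff)
  \<comment> \<open>The shuffles are listed by the recursion \<open>sum_Sh\<close> as iterated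
    insertions of the smallest value, which also yields their signs.\<close>
  have Sh11: "(\<Sum>\<sigma>\<in>Sh 1 1. f \<sigma>) = f id + f (insert_zero 1 id)" for f :: "(nat \<Rightarrow> nat) \<Rightarrow> 'v"
    by (subst sum_Sh) (simp_all add: id0)
  have Sh12: "(\<Sum>\<sigma>\<in>Sh 1 2. f \<sigma>) = f id + (f (insert_zero 1 id) + f (insert_zero 1 (insert_zero 1 id)))"
    for f :: "(nat \<Rightarrow> nat) \<Rightarrow> 'v"
    using Sh11[of "\<lambda>\<sigma>. f (insert_zero 1 \<sigma>)"] by (subst sum_Sh) (simp_all add: id0)
  have Sh21: "(\<Sum>\<sigma>\<in>Sh 2 1. f \<sigma>) = (f id + f (insert_zero 0 (insert_zero 1 id))) + f (insert_zero 2 id)"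
    for f :: "(nat \<Rightarrow> nat) \<Rightarrow> 'v"
    using Sh11[of "\<lambda>\<sigma>. f (insert_zero 0 \<sigma>)"] by (subst sum_Sh) (simp_all add: id0)
  have upt: "[0..<2] = [0, 1]" "[0..<3] = [0, 1, 2]" by (simp_all add: upt_rec)
  have eqs: "insert_zero 1 id 0 = 1" "insert_zero 1 id 1 = 0" "insert_zero 1 id 2 = 2"
    "insert_zero 1 (insert_zero 1 id) 0 = 2" "insert_zero 1 (insert_zero 1 id) 1 = 0" "insert_zero 1 (insert_zero 1 id) 2 = 1"
    "insert_zero 0 (insert_zero 1 id) 0 = 0" "insert_zero 0 (insert_zero 1 id) 1 = 2" "insert_zero 0 (insert_zero 1 id) 2 = 1"
    "insert_zero 2 id 0 = 1" "insert_zero 2 id 1 = 2" "insert_zero 2 id 2 = 0"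
    "insert_zero 2 id 1 = Suc (Suc 0)"
    by (simp_all add: insert_zero_def)
  have perms: "insert_zero 1 id permutes {..<3}" "insert_zero 2 id permutes {..<3}" "sign (insert_zero 2 id) = 1"
    using perm2[of 1 0] perm2[of 2 0] by (simp_all add: id0)
  note inv11 = inv_eq_at[OF perm1(1)[of 1, simplified] eqs(1)[simplified]] inv_eq_at[OF perm1(1)[of 1, simplified] eqs(2)[simplified]]
    inv_eq_at[OF perms(1) eqs(3)]
  note inv21 = inv_eq_at[OF perm2(1)[of 1 1] eqs(4)] inv_eq_at[OF perm2(1)[of 1 1] eqs(5)] inv_eq_at[OF perm2(1)[of 1 1] eqs(6)]
    inv_eq_at[OF perm2(1)[of 0 1] eqs(7)] inv_eq_at[OF perm2(1)[of 0 1] eqs(8)] inv_eq_at[OF perm2(1)[of 0 1] eqs(9)]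
    inv_eq_at[OF perms(2) eqs(10)] inv_eq_at[OF perms(2) eqs(11)] inv_eq_at[OF perms(2) eqs(12)] inv_eq_at[OF perms(2) eqs(13)]
  have signs: "sign (insert_zero 1 id) = -1" "sign (insert_zero 1 (insert_zero 1 id)) = 1" "sign (insert_zero 0 (insert_zero 1 id)) = -1"
    using perm1(2)[of 1] perm2(2)[of 1 1] perm2(2)[of 0 1] by simp_all
  note ev = inv11 inv21 signs perms(3) eqs upt koszul_sign_2 koszul_sign_3 sign_id
  consider "p = 1" "q = 1" | "p = 1" "q = 2" | "p = 2" "q = 1" | "4 \<le> p + q" using p q by linarith
  then show "(\<Sum>\<sigma>\<in>Sh p q. ?f \<sigma>) = 0"
  proof cases
    case 1
    obtain i x j y where xs: "xs = [(i, x), (j, y)]"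
      using len 1 by (auto simp: length_Suc_conv numeral_2_eq_2)
    then have xy: "x \<in> A i" "y \<in> A j" using A by (auto simp: homogeneous_def)
    have "w x y = (-1) powi (i * j) *\<^sub>R w y x" by (rule w_comm[OF xy])
    moreover have "?f id + ?f (insert_zero 1 id) = P (i + j) (w x y) - (-1) powi (i * j) *\<^sub>R P (i + j) (w y x)"
      by (simp add: ev[unfolded One_nat_def] 1 xs add.commute[of j i])
    ultimately show ?thesis
      unfolding 1 Sh11 using P_simps(3)[OF w_A[OF xy(2,1)] w_A[OF xy(2,1)], of "(-1) powi (i * j)"] 1
      by (simp add: add.commute)
  next
    case 2
    obtain i x j y k z where xs: "xs = [(i, x), (j, y), (k, z)]"
      using len 2 by (auto simp: length_Suc_conv numeral_3_eq_3)
    then have xyz: "x \<in> A i" "y \<in> A j" "z \<in> A k" using A by (auto simp: homogeneous_def)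
    have "?f id + (?f (insert_zero 1 id) + ?f (insert_zero 1 (insert_zero 1 id)))
      = P (i + j + k - 1) (u3 i x j y k z) - (-1) powi (i * j) *\<^sub>R P (i + j + k - 1) (u3 j y i x k z)
        + ((-1) powi (i * j) * (-1) powi (i * k)) *\<^sub>R P (i + j + k - 1) (u3 j y k z i x)"
      by (simp add: ev[unfolded One_nat_def] ev[unfolded One_nat_def numeral_2_eq_2] 2 xs op3 add.commute add.left_commute del: op.simps)
    also have "\<dots> = 0"
      using u3_N[OF xyz] u3_N[OF xyz(2,1,3)] u3_N[OF xyz(2,3,1)]
      by (intro P_alternating_sum u3_shuffle_12 xyz) (simp_all add: N_A add.commute add.left_commute)
    finally show ?thesis unfolding 2 Sh12 using 2 by simp
  next
    case 3
    obtain i x j y k z where xs: "xs = [(i, x), (j, y), (k, z)]"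
      using len 3 by (auto simp: length_Suc_conv numeral_3_eq_3)
    then have xyz: "x \<in> A i" "y \<in> A j" "z \<in> A k" using A by (auto simp: homogeneous_def)
    have "(?f id + ?f (insert_zero 0 (insert_zero 1 id))) + ?f (insert_zero 2 id)
      = P (i + j + k - 1) (u3 i x j y k z) - (-1) powi (j * k) *\<^sub>R P (i + j + k - 1) (u3 i x k z j y)
        + ((-1) powi (i * k) * (-1) powi (j * k)) *\<^sub>R P (i + j + k - 1) (u3 k z i x j y)"
      by (simp add: ev[unfolded One_nat_def] ev[unfolded One_nat_def numeral_2_eq_2] 3 xs op3 add.commute add.left_commute del: op.simps)
    also have "\<dots> = 0"
      using u3_N[OF xyz] u3_N[OF xyz(1,3,2)] u3_N[OF xyz(3,1,2)]
      by (intro P_alternating_sum u3_shuffle_21 xyz) (simp_all add: N_A add.commute add.left_commute)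
    finally show ?thesis unfolding 3 Sh21 using 3 by simp
  next
    case 4
    then show ?thesis by (simp add: op_long)
  qed
qed

end

section \<open>The operator \<open>\<Gamma>\<close> on forms\<close>

context CR
begin

lemma contact_cover:
  assumes "open V" "c \<in> \<A>" "x \<in> coords c V"
  obtains W \<theta> where "open W" "W \<subseteq> V" "x \<in> coords c W" "\<theta> \<in> contact_forms \<A> T W"
proof -
  have p: "chart_point c x \<in> V" "x \<in> snd c ` fst c" using assms(2,3) coords_iff by auto
  show ?thesis
    by (rule local_contact_form[OF assms(1) p(1)]) (use that p assms(2) coords_iff in auto)
qed

lemma contact_field_coords:
  assumes "open W" "\<theta> \<in> contact_forms \<A> T W" "c \<in> \<A>"
  shows "contact_field (coords c W) n (\<theta> c) (ext_deriv (\<theta> c))"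
  by unfold_locales
    (use open_coords[OF assms(3,1)] form_smooth[OF contact_forms_D(1)[OF assms(2)] assms(3)]
      smooth_field_ext_deriv contact_pair[OF assms(1-3)] in auto)

text \<open>A gluing principle, used for \<Gamma> and for its cofactors. A construction
  \<open>\<Phi>\<close> on fibres that preserves smoothness and is natural under linear isomorphisms
  defines a form, provided that near each point one contact form computes it in all charts;
  independence of the contact form is what supplies that premise for \<Gamma>.\<close>

lemma natural_form:
  assumes V: "open V" and \<omega>: "\<omega> \<in> forms \<A> V (int k)"
    and outside: "\<And>c x. c \<notin> \<A> \<or> x \<notin> coords c V \<Longrightarrow> \<gamma> c x = 0"
    and local: "\<And>c x. c \<in> \<A> \<Longrightarrow> x \<in> coords c V \<Longrightarrow>
      \<exists>W \<theta>. open W \<and> W \<subseteq> V \<and> x \<in> coords c W \<and> \<theta> \<in> contact_forms \<A> T W \<and>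
        (\<forall>c\<in>\<A>. \<forall>y\<in>coords c W. \<gamma> c y = \<Phi> (\<theta> c y) (ext_deriv (\<theta> c) y) (\<omega> c y))"
    and alt: "\<And>\<theta> \<beta> \<omega>. contact_pair n \<theta> \<beta> \<Longrightarrow> alternating k \<omega> \<Longrightarrow> alternating m (\<Phi> \<theta> \<beta> \<omega>)"
    and smooth: "\<And>S \<theta> \<beta> \<omega>. contact_field S n \<theta> \<beta> \<Longrightarrow> smooth_field S \<omega> \<Longrightarrow> (\<And>y. y \<in> S \<Longrightarrow> alternating k (\<omega> y)) \<Longrightarrow>
      smooth_field S (\<lambda>y. \<Phi> (\<theta> y) (\<beta> y) (\<omega> y))"
    and natural: "\<And>\<theta> \<beta> \<omega> A. contact_pair n \<theta> \<beta> \<Longrightarrow> linear A \<Longrightarrow> surj A \<Longrightarrow>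
      contact_pair n (pullback A \<theta>) (pullback A \<beta>) \<Longrightarrow> alternating k \<omega> \<Longrightarrow>
      \<Phi> (pullback A \<theta>) (pullback A \<beta>) (pullback A \<omega>) = pullback A (\<Phi> \<theta> \<beta> \<omega>)"
  shows "\<gamma> \<in> forms \<A> V (int m)"
  unfolding forms_iff
proof (intro conjI allI impI ballI)
  show "\<gamma> c x = 0" if "c \<notin> \<A> \<or> x \<notin> coords c V" for c x by (rule outside[OF that])
  show "alternating m (\<gamma> c x)" if c: "c \<in> \<A>" and x: "x \<in> coords c V" for c x
  proof -
    obtain W \<theta> where W: "open W" "x \<in> coords c W" "\<theta> \<in> contact_forms \<A> T W"
      "\<forall>c\<in>\<A>. \<forall>y\<in>coords c W. \<gamma> c y = \<Phi> (\<theta> c y) (ext_deriv (\<theta> c) y) (\<omega> c y)"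
      using local[OF c x] by metis
    then show ?thesis
      using alt[OF contact_pair[OF W(1,3) c W(2)] form_alternating[OF \<omega> c, of x]] c by metis
  qed
  show "smooth_field (coords c V) (\<gamma> c)" if c: "c \<in> \<A>" for c
    unfolding smooth_field_def
  proof (intro allI smooth_on_local)
    fix vs x assume x: "x \<in> coords c V"
    obtain W \<theta> where W: "open W" "W \<subseteq> V" "x \<in> coords c W" "\<theta> \<in> contact_forms \<A> T W"
      "\<forall>c\<in>\<A>. \<forall>y\<in>coords c W. \<gamma> c y = \<Phi> (\<theta> c y) (ext_deriv (\<theta> c) y) (\<omega> c y)"
      using local[OF c x] by metis
    have "smooth_field (coords c W) (\<gamma> c)"
      by (rule smooth_field_cong[OF open_coords[OF c W(1)] smooth[OF contact_field_coords[OF W(1,4) c]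
            smooth_field_subset[OF form_smooth[OF \<omega> c] coords_mono[OF W(2)]] form_alternating[OF \<omega> c]]])
        (use W(5) c in auto)
    then show "\<exists>T. open T \<and> x \<in> T \<and> smooth_on T (\<lambda>y. \<gamma> c y vs)"
      using open_coords[OF c W(1)] W(3) unfolding smooth_field_def by metis
  qed
  fix c c' x assume c: "c \<in> \<A>" "c' \<in> \<A>" and x: "x \<in> coords c (V \<inter> fst c')"
  then have xV: "x \<in> coords c V" and xc: "x \<in> coords c (fst c')" using coords_Int by auto
  obtain W \<theta> where W: "open W" "x \<in> coords c W" "\<theta> \<in> contact_forms \<A> T W"
    "\<forall>c\<in>\<A>. \<forall>y\<in>coords c W. \<gamma> c y = \<Phi> (\<theta> c y) (ext_deriv (\<theta> c) y) (\<omega> c y)"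
    using local[OF c(1) xV] by metis
  have xW: "x \<in> coords c (W \<inter> fst c')" using W(2) xc coords_Int[OF c(1)] by auto
  let ?A = "transition_deriv c c' x" and ?x = "transition c c' x"
  have x': "?x \<in> coords c' W" by (rule transition_coords'[OF c xW])
  note \<theta> = contact_forms_D(1)[OF W(3)]
  have "d_form W \<theta> \<in> forms \<A> W (int 2)" using d_form_forms[OF W(1) \<theta>] by simp
  then have 1: "ext_deriv (\<theta> c) x = pullback ?A (ext_deriv (\<theta> c') ?x)"
    using form_transition[of "d_form W \<theta>" W 2, OF _ c xW] d_form_apply[OF W(1) W(2)] d_form_apply[OF W(1) x'] by simp
  note 2 = form_transition[OF \<theta> c xW] and 3 = form_transition[OF \<omega> c x]
  note pair = contact_pair[OF W(1,3) c(1) W(2)]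
  show "\<gamma> c x = pullback ?A (\<gamma> c' ?x)"
    using natural[OF contact_pair[OF W(1,3) c(2) x'] linear_transition_deriv[OF c xc] surj_transition_deriv[OF c xc]
        pair[unfolded 1 2] form_alternating[OF \<omega> c(2)]] W(4) c W(2) x' 1 2 3 by metis
qed

text \<open>The contact form is chosen anew at each point, without any coherence. This is harmless
  because \<open>gam_rescale\<close> makes the value independent of the choice, which gives the
  formula of \<open>gamma_form_apply\<close> for every local contact form.\<close>

definition gamma_form :: "'a set \<Rightarrow> nat \<Rightarrow> ('a, 'e) form \<Rightarrow> ('a, 'e) form" where
  "gamma_form V k \<omega> = (\<lambda>c x. if c \<in> \<A> \<and> x \<in> coords c V then
     let \<theta> = SOME \<theta>. \<exists>W. open W \<and> W \<subseteq> V \<and> x \<in> coords c W \<and> \<theta> \<in> contact_forms \<A> T W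
     in gam n k (\<theta> c x) (ext_deriv (\<theta> c) x) (\<omega> c x) else 0)"

lemma gamma_form_apply:
  assumes \<omega>: "\<omega> \<in> forms \<A> V (int k)" and W: "open W" "W \<subseteq> V" "\<theta> \<in> contact_forms \<A> T W"
    and c: "c \<in> \<A>" and x: "x \<in> coords c W"
  shows "gamma_form V k \<omega> c x = gam n k (\<theta> c x) (ext_deriv (\<theta> c) x) (\<omega> c x)"
proof -
  let ?P = "\<lambda>\<theta>. \<exists>W. open W \<and> W \<subseteq> V \<and> x \<in> coords c W \<and> \<theta> \<in> contact_forms \<A> T W"
  have "?P (SOME \<theta>. ?P \<theta>)" by (rule someI[of ?P \<theta>]) (use W x in blast)
  then obtain W' where W': "open W'" "(SOME \<theta>. ?P \<theta>) \<in> contact_forms \<A> T W'" "x \<in> coords c W'" by blast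
  obtain f where f: "f \<noteq> 0" "(SOME \<theta>. ?P \<theta>) c x = f *\<^sub>R \<theta> c x"
    "wedge_alt (\<theta> c x) (ext_deriv ((SOME \<theta>. ?P \<theta>) c) x) = f *\<^sub>R wedge_alt (\<theta> c x) (ext_deriv (\<theta> c) x)"
    by (rule contact_rescale[OF W(1) W'(1) W(3) W'(2) c x W'(3)]) blast
  show ?thesis
    using gam_rescale[OF contact_pair[OF W(1,3) c x] f(1,3) _ form_alternating[OF \<omega> c, of x]]
      contact_pair[OF W'(1,2) c W'(3)] c coords_monoD[OF x W(2)]
    by (simp add: gamma_form_def f(2))
qed

lemma gamma_form_forms:
  assumes V: "open V" and \<omega>: "\<omega> \<in> forms \<A> V (int k)"
  shows "gamma_form V k \<omega> \<in> forms \<A> V (int k - 1)"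
proof (cases k)
  case 0
  have "gamma_form V k \<omega> = 0"
  proof (rule form_eqI)
    fix c x
    show "gamma_form V k \<omega> c x = (0 :: ('a, 'e) form) c x"
    proof (cases "c \<in> \<A> \<and> x \<in> coords c V")
      case True
      then have c: "c \<in> \<A>" and x: "x \<in> coords c V" by auto
      obtain W \<theta> where W: "open W" "W \<subseteq> V" "x \<in> coords c W" "\<theta> \<in> contact_forms \<A> T W"
        by (rule contact_cover[OF V c x])
      show ?thesis
        using gamma_form_apply[OF \<omega> W(1,2,4) c W(3)] by (simp add: 0 gam_def form_apply)
    qed (auto simp: gamma_form_def form_apply)
  qed
  then show ?thesis using zero_forms by simp
next
  case (Suc m)
  have "gamma_form V k \<omega> \<in> forms \<A> V (int m)"
  proof (rule natural_form[OF V \<omega>, of _ "gam n k"])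
    fix c x assume c: "c \<in> \<A>" and x: "x \<in> coords c V"
    obtain W \<theta> where W: "open W" "W \<subseteq> V" "x \<in> coords c W" "\<theta> \<in> contact_forms \<A> T W"
      by (rule contact_cover[OF V c x])
    show "\<exists>W \<theta>. open W \<and> W \<subseteq> V \<and> x \<in> coords c W \<and> \<theta> \<in> contact_forms \<A> T W \<and>
      (\<forall>c\<in>\<A>. \<forall>y\<in>coords c W. gamma_form V k \<omega> c y = gam n k (\<theta> c y) (ext_deriv (\<theta> c) y) (\<omega> c y))"
      using W gamma_form_apply[OF \<omega> W(1,2,4)] by blast
  next
    show "contact_pair n \<theta> \<beta> \<Longrightarrow> alternating k \<omega> \<Longrightarrow> alternating m (gam n k \<theta> \<beta> \<omega>)" for \<theta> \<beta> \<omega>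
      unfolding Suc by (rule alternating_gam)
  next
    fix \<theta> \<beta> \<omega> :: "'e list \<Rightarrow> real" and A :: "'e \<Rightarrow> 'e"
    assume *: "contact_pair n \<theta> \<beta>" "linear A" "contact_pair n (pullback A \<theta>) (pullback A \<beta>)" "alternating k \<omega>"
    show "gam n k (pullback A \<theta>) (pullback A \<beta>) (pullback A \<omega>) = pullback A (gam n k \<theta> \<beta> \<omega>)"
      by (rule gam_pullback[OF *])
  qed (unfold gamma_form_def, auto intro: contact_field.smooth_field_gam)
  then show ?thesis by (simp add: Suc)
qed

section \<open>The definite description of the operator on forms\<close>

definition Gamma_cond :: "int \<Rightarrow> 'a set \<Rightarrow> ('a, 'e) form \<Rightarrow> ('a, 'e) form \<Rightarrow> ('a, 'e) form \<Rightarrow> bool" where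
  "Gamma_cond k W \<theta> \<omega> \<gamma> \<longleftrightarrow>
     (let \<omega>' = restrict_form W \<omega>; \<gamma>' = restrict_form W \<gamma>; d\<theta> = wedge_power \<A> W (d_form W \<theta>) in
      if k \<le> int n then
        \<exists>\<xi> \<in> forms \<A> W (k - 2).
          \<theta> \<and>\<^sub>d \<omega>' \<and>\<^sub>d d\<theta> (nat (int n + 1 - k)) = \<theta> \<and>\<^sub>d \<xi> \<and>\<^sub>d d\<theta> (nat (int n + 2 - k)) \<and>
          \<gamma>' = \<theta> \<and>\<^sub>d \<xi>
      else
        \<exists>\<xi> \<in> forms \<A> W (2 * int n - k).
          \<theta> \<and>\<^sub>d \<omega>' = \<theta> \<and>\<^sub>d \<xi> \<and>\<^sub>d d\<theta> (nat (k - int n)) \<and>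
          \<gamma>' = \<theta> \<and>\<^sub>d \<xi> \<and>\<^sub>d d\<theta> (nat (k - int n - 1)))"

lemma Gamma_eq: "Gamma n \<A> T V k \<omega> = (THE \<gamma>. \<gamma> \<in> forms \<A> V (k - 1) \<and>
    (\<forall>W \<theta>. open W \<longrightarrow> W \<subseteq> V \<longrightarrow> \<theta> \<in> contact_forms \<A> T W \<longrightarrow> Gamma_cond k W \<theta> \<omega> \<gamma>))"
  unfolding Gamma_def Gamma_cond_def ..

context
  fixes W \<theta> assumes W: "open W" and \<theta>: "\<theta> \<in> contact_forms \<A> T W"
begin

lemma contact_d_apply:
  assumes "c \<in> \<A>" "x \<in> coords c W"
  shows "wedge_power \<A> W (d_form W \<theta>) m c x = wpow (ext_deriv (\<theta> c) x) m"
  using wedge_power_apply[OF W assms] d_form_apply[OF W assms(2)] by simp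

lemma contact_d_forms: "wedge_power \<A> W (d_form W \<theta>) m \<in> forms \<A> W (2 * int m)"
  using wedge_power_forms[OF W] d_form_forms[OF W contact_forms_D(1)[OF \<theta>]] by simp

text \<open>Uniqueness: whichever cofactor witnesses the condition, at each point it satisfies the
  equation that characterises \<open>gam\<close>.\<close>

lemma Gamma_cond_D:
  assumes V: "W \<subseteq> V" and \<omega>: "\<omega> \<in> forms \<A> V (int k)" and "Gamma_cond (int k) W \<theta> \<omega> \<gamma>"
    and c: "c \<in> \<A>" and x: "x \<in> coords c W"
  shows "\<gamma> c x = gam n k (\<theta> c x) (ext_deriv (\<theta> c) x) (\<omega> c x)"
proof -
  note ap = wedge_apply[OF W] restrict_apply[OF x] contact_d_apply[OF c x]
  note pair = contact_pair[OF W \<theta> c x]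
  show ?thesis
  proof (cases k n rule: gam_cases)
    case trivial
    then have "forms \<A> W (int k - 2) = {0}" using forms_neg by simp
    then have "restrict_form W \<gamma> = \<theta> \<and>\<^sub>d 0" using assms(3) trivial by (auto simp: Gamma_cond_def Let_def)
    then have "restrict_form W \<gamma> c x = 0" using wedge_zero[OF W] by (simp add: form_apply)
    then show ?thesis using gam_trivial(1)[OF pair trivial] by (simp add: ap)
  next
    case low
    then obtain \<xi> where \<xi>: "\<xi> \<in> forms \<A> W (int (k - 2))"
      "\<theta> \<and>\<^sub>d restrict_form W \<omega> \<and>\<^sub>d wedge_power \<A> W (d_form W \<theta>) (n + 1 - k)
        = \<theta> \<and>\<^sub>d \<xi> \<and>\<^sub>d wedge_power \<A> W (d_form W \<theta>) (n + 2 - k)"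
      "restrict_form W \<gamma> = \<theta> \<and>\<^sub>d \<xi>"
      using assms(3) by (auto simp: Gamma_cond_def Let_def of_nat_diff nat_diff_distrib' nat_add_distrib)
    have "wedge_alt (wedge_alt (\<theta> c x) (\<omega> c x)) (wpow (ext_deriv (\<theta> c) x) (n + 1 - k))
      = wedge_alt (wedge_alt (\<theta> c x) (\<xi> c x)) (wpow (ext_deriv (\<theta> c) x) (n + 2 - k))"
      using fun_cong[OF fun_cong[OF \<xi>(2), of c], of x] by (simp add: ap)
    then show ?thesis
      using gam_low_eqI[OF pair low form_alternating[OF \<xi>(1) c, of x]] fun_cong[OF fun_cong[OF \<xi>(3), of c], of x]
      by (simp add: ap)
  next
    case high
    then obtain \<xi> where \<xi>: "\<xi> \<in> forms \<A> W (int (2 * n - k))"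
      "\<theta> \<and>\<^sub>d restrict_form W \<omega> = \<theta> \<and>\<^sub>d \<xi> \<and>\<^sub>d wedge_power \<A> W (d_form W \<theta>) (k - n)"
      "restrict_form W \<gamma> = \<theta> \<and>\<^sub>d \<xi> \<and>\<^sub>d wedge_power \<A> W (d_form W \<theta>) (k - n - 1)"
      using assms(3) by (auto simp: Gamma_cond_def Let_def of_nat_diff nat_diff_distrib')
    have "wedge_alt (\<theta> c x) (\<omega> c x) = wedge_alt (wedge_alt (\<theta> c x) (\<xi> c x)) (wpow (ext_deriv (\<theta> c) x) (k - n))"
      using fun_cong[OF fun_cong[OF \<xi>(2), of c], of x] by (simp add: ap)
    then show ?thesis
      using gam_high_eqI[OF pair high form_alternating[OF \<xi>(1) c, of x]] fun_cong[OF fun_cong[OF \<xi>(3), of c], of x]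
      by (simp add: ap)
  next
    case above
    then have "forms \<A> W (2 * int n - int k) = {0}" using forms_neg by simp
    then have "restrict_form W \<gamma> = \<theta> \<and>\<^sub>d 0 \<and>\<^sub>d wedge_power \<A> W (d_form W \<theta>) (nat (int k - int n - 1))"
      using assms(3) above by (auto simp: Gamma_cond_def Let_def)
    then have "restrict_form W \<gamma> c x = 0" using wedge_zero[OF W] by (simp add: form_apply)
    then show ?thesis using gam_trivial(2)[OF pair above] by (simp add: ap)
  qed
qed

text \<open>Existence: the pointwise equation must be witnessed by a form on \<open>W\<close>. For
  the fixed contact form, the normalised cofactors \<open>lef\<close> glue to one by
  \<open>natural_form\<close>.\<close>

lemma Gamma_cond_I:
  assumes V: "W \<subseteq> V" and \<omega>: "\<omega> \<in> forms \<A> V (int k)"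
    and \<gamma>: "\<gamma> \<in> forms \<A> V (int k - 1)"
    and eq: "\<And>c x. c \<in> \<A> \<Longrightarrow> x \<in> coords c W \<Longrightarrow> \<gamma> c x = gam n k (\<theta> c x) (ext_deriv (\<theta> c) x) (\<omega> c x)"
  shows "Gamma_cond (int k) W \<theta> \<omega> \<gamma>"
proof -
  note \<omega>W = restrict_forms[OF W V \<omega>] and \<gamma>W = restrict_forms[OF W V \<gamma>]
  note \<theta>1 = contact_forms_D(1)[OF \<theta>]
  note f\<omega> = wedge_forms[OF W \<theta>1 \<omega>W]
  note ap = wedge_apply[OF W] restrict_apply contact_d_apply
  show ?thesis
  proof (cases k n rule: gam_cases)
    case trivial
    \<comment> \<open>The degree \<open>2 * n + 3 - k\<close> of the product exceeds the dimension,
      so the zero cofactor is a witness.\<close>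
    have "\<theta> \<and>\<^sub>d restrict_form W \<omega> \<and>\<^sub>d wedge_power \<A> W (d_form W \<theta>) (n + 1 - k) = 0"
      using wedge_forms[OF W f\<omega> contact_d_forms[of "n + 1 - k"]] forms_above_DIM[OF W, of "int 1 + int k + 2 * int (n + 1 - k)"] trivial CR_dim
      by (simp add: of_nat_diff)
    moreover have "restrict_form W \<gamma> = 0"
      by (rule forms_eqI[OF \<gamma>W zero_forms])
        (use eq gam_trivial(1)[OF contact_pair[OF W \<theta>] trivial] in \<open>simp add: ap form_apply\<close>)
    ultimately show ?thesis
      using trivial zero_forms[of W "int k - 2"] wedge_zero[OF W]
      by (auto simp: Gamma_cond_def Let_def nat_diff_distrib' nat_add_distrib intro!: bexI[of _ 0])
  next
    case low
    \<comment> \<open>Unlike the value of \<Gamma>, this cofactor depends on the contact form, which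
      is kept fixed on \<open>W\<close>; hence \<open>W\<close> and \<open>\<theta>\<close>
      themselves are the local data for \<open>natural_form\<close>.\<close>
    define \<xi> where "\<xi> = (\<lambda>c x. if c \<in> \<A> \<and> x \<in> coords c W then
      lef n (k - 2) (\<theta> c x) (ext_deriv (\<theta> c) x) (wedge_alt (restrict_form W \<omega> c x) (wpow (ext_deriv (\<theta> c) x) (n + 1 - k))) else 0)"
    have \<xi>: "\<xi> \<in> forms \<A> W (int (k - 2))"
    proof (rule natural_form[OF W \<omega>W, of _ "\<lambda>\<theta> \<beta> \<omega>. lef n (k - 2) \<theta> \<beta> (wedge_alt \<omega> (wpow \<beta> (n + 1 - k)))"])
      show "\<exists>W' \<theta>'. open W' \<and> W' \<subseteq> W \<and> x \<in> coords c W' \<and> \<theta>' \<in> contact_forms \<A> T W' \<and>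
        (\<forall>c\<in>\<A>. \<forall>y\<in>coords c W'. \<xi> c y = lef n (k - 2) (\<theta>' c y) (ext_deriv (\<theta>' c) y)
          (wedge_alt (restrict_form W \<omega> c y) (wpow (ext_deriv (\<theta>' c) y) (n + 1 - k))))"
        if "x \<in> coords c W" for c x
        using that W \<theta> by (intro exI[of _ W] exI[of _ \<theta>]) (simp add: \<xi>_def)
      show "alternating (k - 2) (lef n (k - 2) \<theta> \<beta> (wedge_alt \<omega> (wpow \<beta> (n + 1 - k))))"
        if "contact_pair n \<theta> \<beta>" "alternating k \<omega>" for \<theta> \<beta> \<omega>
        by (rule gam_low(1)[OF that(1) low that(2)])
      show "smooth_field S (\<lambda>y. lef n (k - 2) (\<theta> y) (\<beta> y) (wedge_alt (\<omega> y) (wpow (\<beta> y) (n + 1 - k))))"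
        if S: "contact_field S n \<theta> \<beta>" and \<omega>: "smooth_field S \<omega>" "\<And>y. y \<in> S \<Longrightarrow> alternating k (\<omega> y)" for S and \<theta> \<beta> \<omega> :: "'e \<Rightarrow> 'e list \<Rightarrow> real"
      proof -
        interpret contact_field S n \<theta> \<beta> by (rule S)
        show ?thesis
          by (rule smooth_field_lef)
            (use low smooth_field_wedge[OF op \<omega>(1) smooth_field_wpow[OF op sm2]] alternating_low[OF pair \<omega>(2) low] in auto)
      qed
      show "lef n (k - 2) (pullback A \<theta>) (pullback A \<beta>) (wedge_alt (pullback A \<omega>) (wpow (pullback A \<beta>) (n + 1 - k)))
        = pullback A (lef n (k - 2) \<theta> \<beta> (wedge_alt \<omega> (wpow \<beta> (n + 1 - k))))"
        if "contact_pair n \<theta> \<beta>" "linear A" "surj A" "contact_pair n (pullback A \<theta>) (pullback A \<beta>)" "alternating k \<omega>"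
        for \<theta> \<beta> \<omega> and A :: "'e \<Rightarrow> 'e"
        using lef_pullback[OF that(1-4) _ alternating_low[OF that(1,5) low]] low by (simp add: pullback_wedge pullback_wpow)
    qed (auto simp: \<xi>_def)
    have g: "wedge_alt (wedge_alt (\<theta> c x) (\<omega> c x)) (wpow (ext_deriv (\<theta> c) x) (n + 1 - k))
        = wedge_alt (wedge_alt (\<theta> c x) (\<xi> c x)) (wpow (ext_deriv (\<theta> c) x) (n + 2 - k))"
      "\<gamma> c x = wedge_alt (\<theta> c x) (\<xi> c x)" if cx: "c \<in> \<A>" "x \<in> coords c W" for c x
      using gam_low(3,4)[OF contact_pair[OF W \<theta> cx] low form_alternating[OF \<omega> cx(1), of x]] cx eq[OF cx]
      by (simp_all add: \<xi>_def restrict_apply)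
    have "\<theta> \<and>\<^sub>d restrict_form W \<omega> \<and>\<^sub>d wedge_power \<A> W (d_form W \<theta>) (n + 1 - k)
        = \<theta> \<and>\<^sub>d \<xi> \<and>\<^sub>d wedge_power \<A> W (d_form W \<theta>) (n + 2 - k)"
      by (rule forms_eqI[OF wedge_forms[OF W f\<omega> contact_d_forms] wedge_forms[OF W wedge_forms[OF W \<theta>1 \<xi>] contact_d_forms]])
        (use g(1) in \<open>simp add: ap\<close>)
    moreover have "restrict_form W \<gamma> = \<theta> \<and>\<^sub>d \<xi>"
      by (rule forms_eqI[OF \<gamma>W wedge_forms[OF W \<theta>1 \<xi>]]) (use g(2) in \<open>simp add: ap\<close>)
    moreover have "int (k - 2) = int k - 2" "nat (int n + 1 - int k) = n + 1 - k" "nat (int n + 2 - int k) = n + 2 - k" using low by linarith+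
    ultimately show ?thesis using \<xi> low by (auto simp: Gamma_cond_def Let_def intro!: bexI[of _ \<xi>])
  next
    case high
    define \<xi> where "\<xi> = (\<lambda>c x. if c \<in> \<A> \<and> x \<in> coords c W then
      lef n (2 * n - k) (\<theta> c x) (ext_deriv (\<theta> c) x) (restrict_form W \<omega> c x) else 0)"
    have alt: "alternating (2 * n - (2 * n - k)) \<omega>" if "alternating k \<omega>" for \<omega> :: "'e list \<Rightarrow> real"
      using that high by simp
    have \<xi>: "\<xi> \<in> forms \<A> W (int (2 * n - k))"
    proof (rule natural_form[OF W \<omega>W, of _ "lef n (2 * n - k)"])
      show "\<exists>W' \<theta>'. open W' \<and> W' \<subseteq> W \<and> x \<in> coords c W' \<and> \<theta>' \<in> contact_forms \<A> T W' \<and>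
        (\<forall>c\<in>\<A>. \<forall>y\<in>coords c W'. \<xi> c y = lef n (2 * n - k) (\<theta>' c y) (ext_deriv (\<theta>' c) y) (restrict_form W \<omega> c y))"
        if "x \<in> coords c W" for c x
        using that W \<theta> by (intro exI[of _ W] exI[of _ \<theta>]) (simp add: \<xi>_def)
      show "alternating (2 * n - k) (lef n (2 * n - k) \<theta> \<beta> \<omega>)"
        if "contact_pair n \<theta> \<beta>" "alternating k \<omega>" for \<theta> \<beta> \<omega>
        by (rule gam_high(1)[OF that(1) high that(2)])
      show "smooth_field S (\<lambda>y. lef n (2 * n - k) (\<theta> y) (\<beta> y) (\<omega> y))"
        if S: "contact_field S n \<theta> \<beta>" and \<omega>: "smooth_field S \<omega>" "\<And>y. y \<in> S \<Longrightarrow> alternating k (\<omega> y)" for S and \<theta> \<beta> \<omega> :: "'e \<Rightarrow> 'e list \<Rightarrow> real"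
        by (rule contact_field.smooth_field_lef[OF S _ \<omega>(1) alt[OF \<omega>(2)]]) (use high in auto)
      show "lef n (2 * n - k) (pullback A \<theta>) (pullback A \<beta>) (pullback A \<omega>) = pullback A (lef n (2 * n - k) \<theta> \<beta> \<omega>)"
        if "contact_pair n \<theta> \<beta>" "linear A" "surj A" "contact_pair n (pullback A \<theta>) (pullback A \<beta>)" "alternating k \<omega>"
        for \<theta> \<beta> \<omega> and A :: "'e \<Rightarrow> 'e"
        by (rule lef_pullback[OF that(1-4) _ alt[OF that(5)]]) (use high in auto)
    qed (auto simp: \<xi>_def)
    have g: "wedge_alt (\<theta> c x) (\<omega> c x) = wedge_alt (wedge_alt (\<theta> c x) (\<xi> c x)) (wpow (ext_deriv (\<theta> c) x) (k - n))"
      "\<gamma> c x = wedge_alt (wedge_alt (\<theta> c x) (\<xi> c x)) (wpow (ext_deriv (\<theta> c) x) (k - n - 1))" if cx: "c \<in> \<A>" "x \<in> coords c W" for c x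
      using gam_high(3,4)[OF contact_pair[OF W \<theta> cx] high form_alternating[OF \<omega> cx(1), of x]] cx eq[OF cx]
      by (simp_all add: \<xi>_def restrict_apply)
    note f\<xi> = wedge_forms[OF W wedge_forms[OF W \<theta>1 \<xi>] contact_d_forms]
    have "\<theta> \<and>\<^sub>d restrict_form W \<omega> = \<theta> \<and>\<^sub>d \<xi> \<and>\<^sub>d wedge_power \<A> W (d_form W \<theta>) (k - n)"
      by (rule forms_eqI[OF f\<omega> f\<xi>]) (use g(1) in \<open>simp add: ap\<close>)
    moreover have "restrict_form W \<gamma> = \<theta> \<and>\<^sub>d \<xi> \<and>\<^sub>d wedge_power \<A> W (d_form W \<theta>) (k - n - 1)"
      by (rule forms_eqI[OF \<gamma>W f\<xi>]) (use g(2) in \<open>simp add: ap\<close>)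
    moreover have "int (2 * n - k) = 2 * int n - int k" "nat (int k - int n) = k - n" "nat (int k - int n - 1) = k - n - 1" using high by linarith+
    ultimately show ?thesis using \<xi> high by (auto simp: Gamma_cond_def Let_def intro!: bexI[of _ \<xi>])
  next
    case above
    have "\<theta> \<and>\<^sub>d restrict_form W \<omega> = 0"
      using f\<omega> forms_above_DIM[OF W, of "int 1 + int k"] above CR_dim by simp
    moreover have "restrict_form W \<gamma> = 0"
      by (rule forms_eqI[OF \<gamma>W zero_forms])
        (use eq gam_trivial(2)[OF contact_pair[OF W \<theta>] above] in \<open>simp add: ap form_apply\<close>)
    ultimately show ?thesis
      using above zero_forms[of W "2 * int n - int k"] wedge_zero[OF W]
      by (auto simp: Gamma_cond_def Let_def intro!: bexI[of _ 0])
  qed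
qed

end

text \<open>\<open>Gamma_cond_I\<close> shows that the glued form meets the description; it is the
  only one because its values are prescribed on sets with contact forms, and these cover
  \<open>V\<close>.\<close>

lemma Gamma_gamma_form:
  assumes V: "open V" and \<omega>: "\<omega> \<in> forms \<A> V (int k)"
  shows "Gamma n \<A> T V (int k) \<omega> = gamma_form V k \<omega>"
  unfolding Gamma_eq
proof (rule the_equality)
  note f = gamma_form_forms[OF V \<omega>]
  show "gamma_form V k \<omega> \<in> forms \<A> V (int k - 1) \<and>
    (\<forall>W \<theta>. open W \<longrightarrow> W \<subseteq> V \<longrightarrow> \<theta> \<in> contact_forms \<A> T W \<longrightarrow> Gamma_cond (int k) W \<theta> \<omega> (gamma_form V k \<omega>))"
    using f by (auto intro!: Gamma_cond_I[OF _ _ _ \<omega> f] gamma_form_apply[OF \<omega>])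
  fix \<gamma> assume \<gamma>: "\<gamma> \<in> forms \<A> V (int k - 1) \<and>
    (\<forall>W \<theta>. open W \<longrightarrow> W \<subseteq> V \<longrightarrow> \<theta> \<in> contact_forms \<A> T W \<longrightarrow> Gamma_cond (int k) W \<theta> \<omega> \<gamma>)"
  show "\<gamma> = gamma_form V k \<omega>"
  proof (rule forms_eqI[OF _ f])
    show "\<gamma> \<in> forms \<A> V (int k - 1)" using \<gamma> by blast
    fix c x assume c: "c \<in> \<A>" and x: "x \<in> coords c V"
    obtain W \<theta> where W: "open W" "W \<subseteq> V" "x \<in> coords c W" "\<theta> \<in> contact_forms \<A> T W"
      by (rule contact_cover[OF V c x])
    show "\<gamma> c x = gamma_form V k \<omega> c x"
      using Gamma_cond_D[OF W(1,4,2) \<omega> _ c W(3)] \<gamma> W gamma_form_apply[OF \<omega> W(1,2,4) c W(3)] by auto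
  qed
qed

lemma Gamma_neg:
  assumes "open V" "k < 0"
  shows "Gamma n \<A> T V k 0 = 0"
  unfolding Gamma_eq
proof (rule the_equality)
  have "restrict_form W (0 :: ('a, 'e) form) = 0" for W
    by (rule form_eqI) (simp add: restrict_form_def form_apply)
  then show "0 \<in> forms \<A> V (k - 1) \<and>
    (\<forall>W \<theta>. open W \<longrightarrow> W \<subseteq> V \<longrightarrow> \<theta> \<in> contact_forms \<A> T W \<longrightarrow> Gamma_cond k W \<theta> 0 0)"
    using assms wedge_zero by (auto simp: Gamma_cond_def Let_def zero_forms intro!: bexI[of _ 0])
qed (use assms forms_neg in auto)

lemma Gamma_apply:
  assumes "open V" "\<omega> \<in> forms \<A> V (int k)" "open W" "W \<subseteq> V" "\<theta> \<in> contact_forms \<A> T W" "c \<in> \<A>" "x \<in> coords c W"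
  shows "Gamma n \<A> T V (int k) \<omega> c x = gam n k (\<theta> c x) (ext_deriv (\<theta> c) x) (\<omega> c x)"
  using Gamma_gamma_form[OF assms(1,2)] gamma_form_apply[OF assms(2-)] by simp

lemma Gamma_forms:
  assumes "open V" "\<omega> \<in> forms \<A> V k"
  shows "Gamma n \<A> T V k \<omega> \<in> forms \<A> V (k - 1)"
  using assms Gamma_neg[OF assms(1), of k] Gamma_gamma_form[OF assms(1)] gamma_form_forms[OF assms(1)]
  by (cases k rule: int_cases_neg) (auto simp: forms_neg)

end

section \<open>Vertical forms and the hypotheses of the transfer\<close>

context CR
begin

text \<open>The multiples of \<theta>, described by annihilation instead of divisibility so that no
  cofactor has to be chosen or glued. This is the ideal \<open>N\<close> of the transfer.\<close>

definition vertical :: "'a set \<Rightarrow> int \<Rightarrow> ('a, 'e) form set" where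
  "vertical V k = {\<omega> \<in> forms \<A> V k. \<forall>W \<theta>. open W \<longrightarrow> W \<subseteq> V \<longrightarrow> \<theta> \<in> contact_forms \<A> T W \<longrightarrow>
     (\<forall>c\<in>\<A>. \<forall>x\<in>coords c W. wedge_alt (\<theta> c x) (\<omega> c x) = 0)}"

context
  fixes V :: "'a set" assumes V: "open V"
begin

lemma contact_eqI:
  assumes "\<omega> \<in> forms \<A> V k" "\<tau> \<in> forms \<A> V l"
    and "\<And>W \<theta> c x. open W \<Longrightarrow> W \<subseteq> V \<Longrightarrow> \<theta> \<in> contact_forms \<A> T W \<Longrightarrow> c \<in> \<A> \<Longrightarrow> x \<in> coords c W \<Longrightarrow> \<omega> c x = \<tau> c x"
  shows "\<omega> = \<tau>"
proof (rule forms_eqI[OF assms(1,2)])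
  fix c x assume c: "c \<in> \<A>" and x: "x \<in> coords c V"
  obtain W \<theta> where W: "open W" "W \<subseteq> V" "x \<in> coords c W" "\<theta> \<in> contact_forms \<A> T W"
    by (rule contact_cover[OF V c x])
  show "\<omega> c x = \<tau> c x" by (rule assms(3)[OF W(1,2,4) c W(3)])
qed

lemma vertical_forms: "\<omega> \<in> vertical V k \<Longrightarrow> \<omega> \<in> forms \<A> V k"
  by (simp add: vertical_def)

lemma vertical_wedge_0:
  "\<omega> \<in> vertical V k \<Longrightarrow> open W \<Longrightarrow> W \<subseteq> V \<Longrightarrow> \<theta> \<in> contact_forms \<A> T W \<Longrightarrow> c \<in> \<A> \<Longrightarrow> x \<in> coords c W \<Longrightarrow>
    wedge_alt (\<theta> c x) (\<omega> c x) = 0"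
  by (simp add: vertical_def)

lemma subspace_vertical: "subspace (vertical V k)"
  using subspace_forms[OF V, of k]
  by (auto simp: subspace_def vertical_def form_apply wedge_alt_linear)

lemma vertical_wedge:
  assumes "\<omega> \<in> vertical V i" "\<tau> \<in> forms \<A> V j"
  shows "\<omega> \<and>\<^sub>d \<tau> \<in> vertical V (i + j)"
  using wedge_forms[OF V vertical_forms[OF assms(1)] assms(2)] vertical_wedge_0[OF assms(1)]
  by (auto simp: vertical_def wedge_apply[OF V] wedge_alt_linear simp flip: wedge_alt_assoc)

text \<open>The second factor is \<theta> times its contraction with the Reeb vector, and the first
  factor is annihilated by \<theta> on the right as well.\<close>

lemma vertical_wedge_vertical:
  assumes "\<omega> \<in> vertical V i" "\<tau> \<in> vertical V j"
  shows "\<omega> \<and>\<^sub>d \<tau> = 0"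
proof (cases i rule: int_cases_neg)
  case 1
  then show ?thesis using vertical_forms[OF assms(1)] wedge_zero[OF V] by (simp add: forms_neg)
next
  case (2 m)
  show ?thesis
  proof (rule contact_eqI[OF wedge_forms[OF V assms[THEN vertical_forms]] zero_forms])
    fix W \<theta> c x assume W: "open W" "W \<subseteq> V" "\<theta> \<in> contact_forms \<A> T W" and c: "c \<in> \<A>" and x: "x \<in> coords c W"
    note p = contact_pair[OF W(1,3) c x]
    note z = assms[THEN vertical_wedge_0, OF W c x]
    note deg = alternating_of_degree[OF form_alternating[OF vertical_forms[OF assms(1), unfolded 2] c]] alternating_of_degree[OF alt1[OF p]]
    have "wedge_alt (\<omega> c x) (\<theta> c x) = 0"
      using wedge_alt_comm[OF deg, of x] z(1) by simp
    then have "wedge_alt (\<omega> c x) (wedge_alt (\<theta> c x) (contract (reeb (\<theta> c x) (ext_deriv (\<theta> c) x)) (\<tau> c x))) = 0"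
      by (simp add: wedge_alt_linear flip: wedge_alt_assoc)
    then show "(\<omega> \<and>\<^sub>d \<tau>) c x = (0 :: ('a, 'e) form) c x"
      using wedge_contract_eq[OF alt1[OF p] reeb(1)[OF p] z(2)] by (simp add: wedge_apply[OF V] form_apply)
  qed
qed

lemma Gamma_vertical:
  assumes "\<omega> \<in> forms \<A> V k"
  shows "Gamma n \<A> T V k \<omega> \<in> vertical V (k - 1)"
proof (cases k rule: int_cases_neg)
  case 1
  then show ?thesis using assms Gamma_neg[OF V 1] subspace_0[OF subspace_vertical] by (simp add: forms_neg)
next
  case (2 m)
  note \<omega> = assms[unfolded 2]
  show ?thesis
    using Gamma_forms[OF V \<omega>] Gamma_apply[OF V \<omega>] theta_gam[OF contact_pair] by (simp add: vertical_def 2)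
qed

lemma Gamma_linear:
  assumes "\<omega> \<in> forms \<A> V k" "\<tau> \<in> forms \<A> V k"
  shows "Gamma n \<A> T V k (a *\<^sub>R \<omega> + b *\<^sub>R \<tau>) = a *\<^sub>R Gamma n \<A> T V k \<omega> + b *\<^sub>R Gamma n \<A> T V k \<tau>"
proof (cases k rule: int_cases_neg)
  case 1
  then show ?thesis using assms Gamma_neg[OF V 1] by (simp add: forms_neg)
next
  case (2 m)
  note f = assms[unfolded 2]
  have lin: "a *\<^sub>R x + b *\<^sub>R y \<in> forms \<A> V l" if "x \<in> forms \<A> V l" "y \<in> forms \<A> V l" for x y l
    using that by (intro subspace_add subspace_scale subspace_forms[OF V])
  show ?thesis unfolding 2
  proof (rule contact_eqI[OF Gamma_forms[OF V lin[OF f]] lin[OF Gamma_forms[OF V f(1)] Gamma_forms[OF V f(2)]]])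
    fix W \<theta> c x assume W: "open W" "W \<subseteq> V" "\<theta> \<in> contact_forms \<A> T W" and c: "c \<in> \<A>" and x: "x \<in> coords c W"
    note p = contact_pair[OF W(1,3) c x] and alt = f[THEN form_alternating, OF c, of x]
    have alt': "alternating m (a *\<^sub>R \<omega> c x)" "alternating m (b *\<^sub>R \<tau> c x)"
      using subspace_scale[OF subspace_forms[OF V] f(1), of a, THEN form_alternating, OF c, of x]
        subspace_scale[OF subspace_forms[OF V] f(2), of b, THEN form_alternating, OF c, of x] by (simp_all add: form_apply)
    show "Gamma n \<A> T V (int m) (a *\<^sub>R \<omega> + b *\<^sub>R \<tau>) c x
      = (a *\<^sub>R Gamma n \<A> T V (int m) \<omega> + b *\<^sub>R Gamma n \<A> T V (int m) \<tau>) c x"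
      by (simp add: form_apply Gamma_apply[OF V _ W c x] lin f gam_add[OF p alt'] gam_scaleR[OF p alt(1)] gam_scaleR[OF p alt(2)])
  qed
qed

lemma Gamma_vanish:
  assumes "\<omega> \<in> vertical V k"
  shows "Gamma n \<A> T V k \<omega> = 0"
proof (cases k rule: int_cases_neg)
  case 1
  then show ?thesis using vertical_forms[OF assms] Gamma_neg[OF V 1] by (simp add: forms_neg)
next
  case (2 m)
  note \<omega> = vertical_forms[OF assms, unfolded 2]
  show ?thesis unfolding 2
  proof (rule contact_eqI[OF Gamma_forms[OF V \<omega>] zero_forms])
    fix W \<theta> c x assume W: "open W" "W \<subseteq> V" "\<theta> \<in> contact_forms \<A> T W" and c: "c \<in> \<A>" and x: "x \<in> coords c W"
    show "Gamma n \<A> T V (int m) \<omega> c x = (0 :: ('a, 'e) form) c x"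
      using gam_vertical[OF contact_pair[OF W(1,3) c x] form_alternating[OF \<omega> c] vertical_wedge_0[OF assms W c x]]
      by (simp add: form_apply Gamma_apply[OF V \<omega> W c x])
  qed
qed

lemma Gamma_d_Gamma:
  assumes "\<omega> \<in> forms \<A> V k"
  shows "Gamma n \<A> T V k (d_form V (Gamma n \<A> T V k \<omega>)) = Gamma n \<A> T V k \<omega>"
proof (cases k rule: int_cases_neg)
  case 1
  then show ?thesis using assms Gamma_neg[OF V 1] d_form_zero[OF V] by (simp add: forms_neg)
next
  case (2 m)
  note \<omega> = assms[unfolded 2]
  have d: "d_form V (Gamma n \<A> T V (int m) \<omega>) \<in> forms \<A> V (int m)"
    using d_form_forms[OF V Gamma_forms[OF V \<omega>]] by simp
  show ?thesis unfolding 2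
  proof (rule contact_eqI[OF Gamma_forms[OF V d] Gamma_forms[OF V \<omega>]])
    fix W \<theta> c x assume W: "open W" "W \<subseteq> V" "\<theta> \<in> contact_forms \<A> T W" and c: "c \<in> \<A>" and x: "x \<in> coords c W"
    \<comment> \<open>The derivative needs the values of \<Gamma> near \<open>x\<close>; on
      \<open>coords c W\<close> they are all computed by the same contact form.\<close>
    have "d_form V (Gamma n \<A> T V (int m) \<omega>) c x
      = ext_deriv (\<lambda>y. gam n m (\<theta> c y) (ext_deriv (\<theta> c) y) (\<omega> c y)) x"
      unfolding d_form_apply[OF V coords_monoD[OF x W(2)]]
      by (rule ext_deriv_cong[OF open_coords[OF c W(1)] x]) (rule Gamma_apply[OF V \<omega> W c])
    moreover have "smooth_field (coords c W) (\<omega> c)"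
      by (rule smooth_field_subset[OF form_smooth[OF \<omega> c] coords_mono[OF W(2)]])
    ultimately show "Gamma n \<A> T V (int m) (d_form V (Gamma n \<A> T V (int m) \<omega>)) c x = Gamma n \<A> T V (int m) \<omega> c x"
      using gam_ext_deriv_gam[OF open_coords[OF c W(1)] x form_smooth[OF contact_forms_D(1)[OF W(3)] c] _
          contact_pair[OF W(1,3) c] form_alternating[OF \<omega> c]]
      by (simp add: Gamma_apply[OF V _ W c x] \<omega> d)
  qed
qed

lemma Gamma_eq_0_iff:
  assumes \<omega>: "\<omega> \<in> forms \<A> V (int k)"
  shows "Gamma n \<A> T V (int k) \<omega> = 0 \<longleftrightarrow>
    (\<forall>W \<theta>. open W \<longrightarrow> W \<subseteq> V \<longrightarrow> \<theta> \<in> contact_forms \<A> T W \<longrightarrow> (\<forall>c\<in>\<A>. \<forall>x\<in>coords c W.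
      if k \<le> n then wedge_alt (wedge_alt (\<theta> c x) (\<omega> c x)) (wpow (ext_deriv (\<theta> c) x) (n + 1 - k)) = 0
      else wedge_alt (\<theta> c x) (\<omega> c x) = 0))" (is "?L = ?R")
proof -
  have eq: "gam n k (\<theta> c x) (ext_deriv (\<theta> c) x) (\<omega> c x) = 0 \<longleftrightarrow>
      (if k \<le> n then wedge_alt (wedge_alt (\<theta> c x) (\<omega> c x)) (wpow (ext_deriv (\<theta> c) x) (n + 1 - k)) = 0
      else wedge_alt (\<theta> c x) (\<omega> c x) = 0)"
    if "open W" "\<theta> \<in> contact_forms \<A> T W" "c \<in> \<A>" "x \<in> coords c W" for W \<theta> c x
    using gam_eq_0_low[OF contact_pair[OF that], of k] gam_eq_0_high[OF contact_pair[OF that], of k] form_alternating[OF \<omega> that(3)]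
    by (simp add: not_le)
  have "?L \<longleftrightarrow> (\<forall>W \<theta>. open W \<longrightarrow> W \<subseteq> V \<longrightarrow> \<theta> \<in> contact_forms \<A> T W \<longrightarrow> (\<forall>c\<in>\<A>. \<forall>x\<in>coords c W.
      gam n k (\<theta> c x) (ext_deriv (\<theta> c) x) (\<omega> c x) = 0))" (is "_ = ?G")
  proof
    assume ?L
    then show ?G using Gamma_apply[OF V \<omega>] by (simp add: form_apply)
  next
    assume G: ?G
    show ?L
      by (rule contact_eqI[OF Gamma_forms[OF V \<omega>] zero_forms])
        (use G Gamma_apply[OF V \<omega>] in \<open>simp add: form_apply\<close>)
  qed
  also have "?G \<longleftrightarrow> ?R"
    by (intro all_cong1 imp_cong ball_cong refl eq)
  finally show ?thesis .
qed

lemma form_eq_0_iff: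
  assumes "\<omega> \<in> forms \<A> W k"
  shows "\<omega> = 0 \<longleftrightarrow> (\<forall>c\<in>\<A>. \<forall>x\<in>coords c W. \<omega> c x = 0)"
  using forms_eqI[OF assms zero_forms] by (auto simp: form_apply)

text \<open>The two Rumin conditions are the vanishing of \<Gamma> on \<omega> and on d\<omega>, by
  the pointwise kernel lemmas in degrees \<open>k\<close> and \<open>k + 1\<close>. Thus the image
  of \<pi> in the abstract transfer is the Rumin complex.\<close>

lemma rumin_eq: "rumin n \<A> T V k = {\<omega> \<in> forms \<A> V k. Gamma n \<A> T V k \<omega> = 0 \<and> Gamma n \<A> T V (k + 1) (d_form V \<omega>) = 0}"
proof (cases "k < 0 \<or> k > 2 * int n + 1")
  case True
  then have "forms \<A> V k = {0}" using forms_neg forms_above_DIM[OF V] CR_dim by auto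
  then show ?thesis
    using True Gamma_vanish[OF subspace_0[OF subspace_vertical]] d_form_zero[OF V] by (auto simp: rumin_def)
next
  case False
  then obtain m where m: "k = int m" by (metis int_cases_neg)
  have 1: "(let \<omega>' = restrict_form W \<omega>; d\<theta> = wedge_power \<A> W (d_form W \<theta>) in
         if k \<le> int n then
           \<theta> \<and>\<^sub>d \<omega>' \<and>\<^sub>d d\<theta> (nat (int n + 1 - k)) = 0 \<and>
           \<theta> \<and>\<^sub>d d_form W \<omega>' \<and>\<^sub>d d\<theta> (nat (int n - k)) = 0
         else \<theta> \<and>\<^sub>d \<omega>' = 0 \<and> \<theta> \<and>\<^sub>d d_form W \<omega>' = 0) \<longleftrightarrow>
     (\<forall>c\<in>\<A>. \<forall>x\<in>coords c W.
      if m \<le> n then wedge_alt (wedge_alt (\<theta> c x) (\<omega> c x)) (wpow (ext_deriv (\<theta> c) x) (n + 1 - m)) = 0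
      else wedge_alt (\<theta> c x) (\<omega> c x) = 0) \<and>
     (\<forall>c\<in>\<A>. \<forall>x\<in>coords c W.
      if Suc m \<le> n then wedge_alt (wedge_alt (\<theta> c x) (d_form V \<omega> c x)) (wpow (ext_deriv (\<theta> c) x) (n + 1 - Suc m)) = 0
      else wedge_alt (\<theta> c x) (d_form V \<omega> c x) = 0)"
    if \<omega>: "\<omega> \<in> forms \<A> V k" and W: "open W" "W \<subseteq> V" "\<theta> \<in> contact_forms \<A> T W" for \<omega> W \<theta>
  proof -
    note \<omega>W = restrict_forms[OF W(1,2) \<omega>] and \<theta> = contact_forms_D(1)[OF W(3)]
    note d\<omega>W = d_form_forms[OF W(1) \<omega>W]
    note f = wedge_forms[OF W(1) \<theta> \<omega>W] wedge_forms[OF W(1) \<theta> d\<omega>W]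
    note z = f[THEN form_eq_0_iff] wedge_forms[OF W(1) f(1) contact_d_forms[OF W(1,3)], THEN form_eq_0_iff]
      wedge_forms[OF W(1) f(2) contact_d_forms[OF W(1,3)], THEN form_eq_0_iff]
    have d: "d_form W (restrict_form W \<omega>) c x = d_form V \<omega> c x" if "x \<in> coords c W" for c x
      using restrict_d_form[OF W(1) V W(2) \<omega>] restrict_apply[OF that] by metis
    have nat: "nat (int n + 1 - k) = n + 1 - m" "nat (int n - k) = n - m" using m by auto
    consider "Suc m \<le> n" | "m = n" | "n < m" by linarith
    then show ?thesis
    proof cases
      \<comment> \<open>Here d\<omega> has degree \<open>n + 1\<close>, in the upper range of
        \<Gamma>, while the Rumin condition still carries a power of d\<theta>; its exponent is 0,
        so the two agree.\<close>
      case 2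
      then show ?thesis
        unfolding Let_def z nat
          by (simp add: m wedge_apply[OF W(1)] restrict_apply d d_form_apply[OF W(1), where \<omega> = \<theta>] contact_d_apply[OF W(1,3), where m = 0, simplified])
    qed (unfold Let_def z nat, simp_all add: m(1) wedge_apply[OF W(1)] restrict_apply d contact_d_apply[OF W(1,3)])
  qed
  have d: "d_form V \<omega> \<in> forms \<A> V (int (Suc m))" if "\<omega> \<in> forms \<A> V k" for \<omega>
    using d_form_forms[OF V that] by (simp add: m(1) add.commute)
  have "\<omega> \<in> rumin n \<A> T V k \<longleftrightarrow> Gamma n \<A> T V k \<omega> = 0 \<and> Gamma n \<A> T V (k + 1) (d_form V \<omega>) = 0" if \<omega>: "\<omega> \<in> forms \<A> V k" for \<omega>
  proof -
    have k1: "k + 1 = int (Suc m)" by (simp add: m(1))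
    have "\<omega> \<in> rumin n \<A> T V k \<longleftrightarrow> (\<forall>W \<theta>. open W \<longrightarrow> W \<subseteq> V \<longrightarrow> \<theta> \<in> contact_forms \<A> T W \<longrightarrow>
      (let \<omega>' = restrict_form W \<omega>; d\<theta> = wedge_power \<A> W (d_form W \<theta>) in
         if k \<le> int n then
           \<theta> \<and>\<^sub>d \<omega>' \<and>\<^sub>d d\<theta> (nat (int n + 1 - k)) = 0 \<and>
           \<theta> \<and>\<^sub>d d_form W \<omega>' \<and>\<^sub>d d\<theta> (nat (int n - k)) = 0
         else \<theta> \<and>\<^sub>d \<omega>' = 0 \<and> \<theta> \<and>\<^sub>d d_form W \<omega>' = 0))"
      unfolding rumin_def if_not_P[OF False] mem_Collect_eq using \<omega> by (simp only: simp_thms)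
    also have "\<dots> \<longleftrightarrow> Gamma n \<A> T V (int m) \<omega> = 0 \<and> Gamma n \<A> T V (int (Suc m)) (d_form V \<omega>) = 0"
      unfolding Gamma_eq_0_iff[OF \<omega>[unfolded m(1)]] Gamma_eq_0_iff[OF d[OF \<omega>]]
        all_conj_distrib[symmetric] imp_conjR[symmetric]
      by (intro all_cong1 imp_cong refl 1[OF \<omega>])
    finally show ?thesis unfolding k1[symmetric] m(1)[symmetric] .
  qed
  moreover have "rumin n \<A> T V k \<subseteq> forms \<A> V k" using False by (auto simp: rumin_def)
  ultimately show ?thesis by blast
qed

lemma balanced_A_infinity: "balanced_A_infinity_algebra (rumin n \<A> T V) (rumin_op n \<A> T V)"
proof -
  interpret square_zero_transfer "forms \<A> V" "vertical V" "(\<and>\<^sub>d)" "d_form V" "Gamma n \<A> T V"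
  proof unfold_locales
    show "\<omega> \<and>\<^sub>d \<tau> \<in> forms \<A> V (i + j)" if "\<omega> \<in> forms \<A> V i" "\<tau> \<in> forms \<A> V j" for \<omega> \<tau> i j
      by (rule wedge_forms[OF V that])
    show "(\<omega> \<and>\<^sub>d \<tau>) \<and>\<^sub>d \<eta> = \<omega> \<and>\<^sub>d (\<tau> \<and>\<^sub>d \<eta>)" for \<omega> \<tau> \<eta> :: "('a, 'e) form"
      by (rule wedge_assoc[OF V])
    show "(\<omega> + \<omega>') \<and>\<^sub>d \<tau> = \<omega> \<and>\<^sub>d \<tau> + \<omega>' \<and>\<^sub>d \<tau>" for \<omega> \<omega>' \<tau> :: "('a, 'e) form"
      by (rule form_eqI) (simp add: wedge_apply[OF V] form_apply wedge_alt_linear)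
    show "(r *\<^sub>R \<omega>) \<and>\<^sub>d \<tau> = r *\<^sub>R (\<omega> \<and>\<^sub>d \<tau>)" for r and \<omega> \<tau> :: "('a, 'e) form"
      by (rule form_eqI) (simp add: wedge_apply[OF V] form_apply wedge_alt_linear)
  qed (assumption | rule subspace_forms[OF V] subspace_vertical wedge_comm[OF V] d_form_forms[OF V] d_form_linear[OF V]
      d_form_d_form[OF V] d_form_wedge[OF V] Gamma_vertical Gamma_linear Gamma_vanish vertical_wedge
      vertical_wedge_vertical Gamma_d_Gamma vertical_forms)+
  have "op xs = rumin_op n \<A> T V xs" for xs
    by (cases xs rule: op.cases) (simp_all add: P_def rumin_proj_def)
  then have "op = rumin_op n \<A> T V" by (rule ext)
  moreover have "R = rumin n \<A> T V" by (rule ext) (simp add: R_def rumin_eq)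
  ultimately show ?thesis
    using A_infinity balanced_op by (simp add: balanced_A_infinity_algebra_def)
qed

end

end

section \<open>Sheaf properties\<close>

context CR
begin

text \<open>A contact form on a subset of \<open>W\<close> serves for \<open>V\<close> as well, and
  both sides are computed from it by \<open>gam\<close>.\<close>

lemma restrict_Gamma:
  assumes V: "open V" and W: "open W" "W \<subseteq> V" and \<omega>: "\<omega> \<in> forms \<A> V k"
  shows "restrict_form W (Gamma n \<A> T V k \<omega>) = Gamma n \<A> T W k (restrict_form W \<omega>)"
proof (cases k rule: int_cases_neg)
  case 1
  have "restrict_form W (0 :: ('a, 'e) form) = 0"
    by (rule form_eqI) (simp add: restrict_form_def form_apply)
  then show ?thesis using 1 \<omega> Gamma_neg[OF V 1] Gamma_neg[OF W(1) 1] by (simp add: forms_neg)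
next
  case (2 m)
  note \<omega>' = \<omega>[unfolded 2]
  note \<omega>W = restrict_forms[OF W \<omega>']
  show ?thesis unfolding 2
  proof (rule contact_eqI[OF W(1) restrict_forms[OF W Gamma_forms[OF V \<omega>']] Gamma_forms[OF W(1) \<omega>W]])
    fix O' \<theta> c x assume O': "open O'" "O' \<subseteq> W" "\<theta> \<in> contact_forms \<A> T O'" and c: "c \<in> \<A>" and x: "x \<in> coords c O'"
    note xW = coords_monoD[OF x O'(2)]
    show "restrict_form W (Gamma n \<A> T V (int m) \<omega>) c x = Gamma n \<A> T W (int m) (restrict_form W \<omega>) c x"
      using Gamma_apply[OF V \<omega>' O'(1) _ O'(3) c x] Gamma_apply[OF W(1) \<omega>W O' c x] O'(2) W(2)
      by (simp add: restrict_apply[OF xW])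
  qed
qed

lemma restrict_rumin_proj:
  assumes V: "open V" and W: "open W" "W \<subseteq> V" and \<omega>: "\<omega> \<in> forms \<A> V k"
  shows "restrict_form W (rumin_proj n \<A> T V k \<omega>) = rumin_proj n \<A> T W k (restrict_form W \<omega>)"
  unfolding rumin_proj_def restrict_linear
  by (simp add: restrict_d_form[OF W(1) V W(2), symmetric, OF Gamma_forms[OF V \<omega>]] restrict_Gamma[OF V W \<omega>]
      restrict_Gamma[OF V W d_form_forms[OF V \<omega>]] restrict_d_form[OF W(1) V W(2) \<omega>])

lemma rumin_forms: "open V \<Longrightarrow> \<omega> \<in> rumin n \<A> T V k \<Longrightarrow> \<omega> \<in> forms \<A> V k"
  by (simp add: rumin_eq)

lemma restrict_zero: "restrict_form W (0 :: ('a, 'e) form) = 0"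
  by (rule form_eqI) (simp add: restrict_form_def form_apply)

lemma restrict_rumin_op:
  assumes V: "open V" and W: "open W" "W \<subseteq> V" and xs: "set xs \<subseteq> homogeneous (rumin n \<A> T V)"
  shows "restrict_form W (rumin_op n \<A> T V xs) = rumin_op n \<A> T W (map (\<lambda>(k, x). (k, restrict_form W x)) xs)"
proof (cases "(n, \<A>, T, V, xs)" rule: rumin_op.cases)
  case (1 n' \<A>' T' V' i \<omega>)
  then have f: "\<omega> \<in> forms \<A> V i" and eqs: "xs = [(i, \<omega>)]"
    using xs rumin_forms[OF V] by (auto simp: homogeneous_def)
  show ?thesis by (simp add: eqs restrict_d_form[OF W(1) V W(2) f])
next
  case (2 n' \<A>' T' V' i \<omega> j \<tau>)
  then have f: "\<omega> \<in> forms \<A> V i" "\<tau> \<in> forms \<A> V j" and eqs: "xs = [(i, \<omega>), (j, \<tau>)]"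
    using xs rumin_forms[OF V] by (auto simp: homogeneous_def)
  show ?thesis
    by (simp add: eqs restrict_rumin_proj[OF V W wedge_forms[OF V f]] restrict_wedge)
next
  case (3 n' \<A>' T' V' i \<omega> j \<tau> k \<eta>)
  then have f: "\<omega> \<in> forms \<A> V i" "\<tau> \<in> forms \<A> V j" "\<eta> \<in> forms \<A> V k" and eqs: "xs = [(i, \<omega>), (j, \<tau>), (k, \<eta>)]"
    using xs rumin_forms[OF V] by (auto simp: homogeneous_def)
  have g: "Gamma n \<A> T V (i + j) (\<omega> \<and>\<^sub>d \<tau>) \<and>\<^sub>d \<eta> \<in> forms \<A> V (i + j + k - 1)"
    "\<omega> \<and>\<^sub>d Gamma n \<A> T V (j + k) (\<tau> \<and>\<^sub>d \<eta>) \<in> forms \<A> V (i + j + k - 1)"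
    using wedge_forms[OF V Gamma_forms[OF V wedge_forms[OF V f(1,2)]] f(3)]
      wedge_forms[OF V f(1) Gamma_forms[OF V wedge_forms[OF V f(2,3)]]] by (simp_all add: algebra_simps)
  have "Gamma n \<A> T V (i + j) (\<omega> \<and>\<^sub>d \<tau>) \<and>\<^sub>d \<eta> - (-1) powi i *\<^sub>R (\<omega> \<and>\<^sub>d Gamma n \<A> T V (j + k) (\<tau> \<and>\<^sub>d \<eta>))
    \<in> forms \<A> V (i + j + k - 1)"
    by (intro subspace_diff subspace_scale subspace_forms V g)
  from restrict_rumin_proj[OF V W this] show ?thesis
    by (simp add: eqs restrict_linear restrict_wedge restrict_Gamma[OF V W wedge_forms[OF V f(1,2)]]
        restrict_Gamma[OF V W wedge_forms[OF V f(2,3)]])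
qed (simp_all add: restrict_zero)

lemma restrict_rumin:
  assumes V: "open V" and W: "open W" "W \<subseteq> V" and \<omega>: "\<omega> \<in> rumin n \<A> T V k"
  shows "restrict_form W \<omega> \<in> rumin n \<A> T W k"
proof -
  note f = rumin_forms[OF V \<omega>]
  have "Gamma n \<A> T V k \<omega> = 0" "Gamma n \<A> T V (k + 1) (d_form V \<omega>) = 0" using \<omega> by (simp_all add: rumin_eq[OF V])
  then show ?thesis
    using restrict_forms[OF W f] restrict_Gamma[OF V W f] restrict_Gamma[OF V W d_form_forms[OF V f]]
    by (simp add: rumin_eq[OF W(1)] restrict_zero restrict_d_form[OF W(1) V W(2) f])
qed

lemma coords_UnionE:
  assumes "x \<in> coords c (\<Union>\<V>)"
  obtains V where "V \<in> \<V>" "x \<in> coords c V"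
  using assms by (auto simp: coords_def)

lemma forms_glue:
  assumes "\<And>V. V \<in> \<V> \<Longrightarrow> open V" "\<And>V. V \<in> \<V> \<Longrightarrow> s V \<in> forms \<A> V k"
    and compat: "\<And>V W. V \<in> \<V> \<Longrightarrow> W \<in> \<V> \<Longrightarrow> restrict_form (V \<inter> W) (s V) = restrict_form (V \<inter> W) (s W)"
  obtains \<omega> where "\<omega> \<in> forms \<A> (\<Union>\<V>) k" "\<And>V. V \<in> \<V> \<Longrightarrow> restrict_form V \<omega> = s V"
proof (cases k rule: int_cases_neg)
  case 1
  then have "s V = 0" if "V \<in> \<V>" for V using assms(2)[OF that] by (simp add: forms_neg)
  then show ?thesis using that[of 0] zero_forms restrict_zero by simp
next
  case (2 m)
  note f = assms(2)[unfolded 2]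
  define \<omega> :: "('a, 'e) form" where
    "\<omega> c x = (if c \<in> \<A> \<and> x \<in> coords c (\<Union>\<V>) then s (SOME V. V \<in> \<V> \<and> x \<in> coords c V) c x else 0)" for c x
  \<comment> \<open>Compatibility on the intersection of two members makes the chosen member
    immaterial.\<close>
  have eq: "\<omega> c x = s V c x" if V: "V \<in> \<V>" and c: "c \<in> \<A>" and x: "x \<in> coords c V" for V c x
  proof -
    define W where "W = (SOME V. V \<in> \<V> \<and> x \<in> coords c V)"
    have W: "W \<in> \<V>" "x \<in> coords c W"
      using someI[of "\<lambda>V. V \<in> \<V> \<and> x \<in> coords c V" V] V x by (simp_all add: W_def)
    have "x \<in> coords c (V \<inter> W)" using c x W(2) by (simp add: coords_Int)
    then have "s V c x = s W c x" using compat[OF V W(1)] restrict_apply by metis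
    then show ?thesis using c coords_monoD[OF x, of "\<Union>\<V>"] V by (auto simp: \<omega>_def W_def)
  qed
  have "\<omega> \<in> forms \<A> (\<Union>\<V>) (int m)"
    unfolding forms_iff
  proof (intro conjI allI impI ballI)
    show "\<omega> c x = 0" if "c \<notin> \<A> \<or> x \<notin> coords c (\<Union>\<V>)" for c x using that by (auto simp: \<omega>_def)
    show "alternating m (\<omega> c x)" if c: "c \<in> \<A>" and x: "x \<in> coords c (\<Union>\<V>)" for c x
    proof -
      obtain V where V: "V \<in> \<V>" "x \<in> coords c V" by (rule coords_UnionE[OF x])
      show ?thesis unfolding eq[OF V(1) c V(2)] by (rule form_alternating[OF f[OF V(1)] c])
    qed
    show "smooth_field (coords c (\<Union>\<V>)) (\<omega> c)" if c: "c \<in> \<A>" for c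
      unfolding smooth_field_def
    proof (intro allI smooth_on_local)
      fix vs x assume "x \<in> coords c (\<Union>\<V>)"
      then obtain V where V: "V \<in> \<V>" "x \<in> coords c V" by (rule coords_UnionE)
      note op = open_coords[OF c assms(1)[OF V(1)]]
      have "smooth_field (coords c V) (\<omega> c)"
        by (rule smooth_field_cong[OF op form_smooth[OF f[OF V(1)] c]]) (rule eq[OF V(1) c, symmetric])
      then show "\<exists>T. open T \<and> x \<in> T \<and> smooth_on T (\<lambda>y. \<omega> c y vs)"
        using op V(2) unfolding smooth_field_def by metis
    qed
    fix c c' x assume c: "c \<in> \<A>" "c' \<in> \<A>" and x: "x \<in> coords c (\<Union>\<V> \<inter> fst c')"
    have "x \<in> coords c (\<Union>\<V>)" and xc: "x \<in> coords c (fst c')" using x coords_Int[OF c(1)] by auto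
    from this(1) obtain V where V: "V \<in> \<V>" "x \<in> coords c V" by (rule coords_UnionE)
    have xV: "x \<in> coords c (V \<inter> fst c')" using V(2) xc coords_Int[OF c(1)] by auto
    show "\<omega> c x = pullback (transition_deriv c c' x) (\<omega> c' (transition c c' x))"
      unfolding eq[OF V(1) c(1) V(2)] eq[OF V(1) c(2) transition_coords'[OF c xV]]
      by (rule form_transition[OF f[OF V(1)] c xV])
  qed
  moreover have "restrict_form V \<omega> = s V" if V: "V \<in> \<V>" for V
  proof (rule form_eqI)
    fix c x show "restrict_form V \<omega> c x = s V c x"
    proof (cases "c \<in> \<A> \<and> x \<in> coords c V")
      case True
      then show ?thesis using eq[OF V, of c x] by (simp add: restrict_apply)
    next
      case False
      then show ?thesis using form_outside[OF f[OF V], of c x] by (auto simp: restrict_form_def \<omega>_def)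
    qed
  qed
  ultimately show ?thesis using that 2 by simp
qed

lemma forms_locally_eq:
  assumes "\<omega> \<in> forms \<A> (\<Union>\<V>) k" "\<tau> \<in> forms \<A> (\<Union>\<V>) l" "\<And>V. V \<in> \<V> \<Longrightarrow> restrict_form V \<omega> = restrict_form V \<tau>"
  shows "\<omega> = \<tau>"
proof (rule forms_eqI[OF assms(1,2)])
  fix c :: "('a, 'e) chart" and x assume "x \<in> coords c (\<Union>\<V>)"
  then obtain V where "V \<in> \<V>" "x \<in> coords c V" by (rule coords_UnionE)
  then show "\<omega> c x = \<tau> c x" using assms(3) restrict_apply by metis
qed

text \<open>By \<open>rumin_eq\<close> the Rumin conditions are equations between forms. \<Gamma>
  and the exterior derivative commute with restriction, so these equations can be checked on the
  members of the cover.\<close>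

lemma rumin_glue:
  assumes op: "\<And>V. V \<in> \<V> \<Longrightarrow> open V" and s: "\<And>V. V \<in> \<V> \<Longrightarrow> s V \<in> rumin n \<A> T V k"
    and compat: "\<And>V W. V \<in> \<V> \<Longrightarrow> W \<in> \<V> \<Longrightarrow> restrict_form (V \<inter> W) (s V) = restrict_form (V \<inter> W) (s W)"
  shows "\<exists>!\<omega>. \<omega> \<in> rumin n \<A> T (\<Union>\<V>) k \<and> (\<forall>V\<in>\<V>. restrict_form V \<omega> = s V)"
proof -
  have U: "open (\<Union>\<V>)" using op by auto
  have sub: "V \<subseteq> \<Union>\<V>" if "V \<in> \<V>" for V using that by blast
  obtain \<omega> where \<omega>: "\<omega> \<in> forms \<A> (\<Union>\<V>) k" "\<And>V. V \<in> \<V> \<Longrightarrow> restrict_form V \<omega> = s V"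
    by (rule forms_glue[OF op rumin_forms[OF op s] compat]) auto
  have sR: "Gamma n \<A> T V k (s V) = 0" "Gamma n \<A> T V (k + 1) (d_form V (s V)) = 0" if "V \<in> \<V>" for V
    using s[OF that] rumin_eq[OF op[OF that]] by auto
  note d\<omega> = d_form_forms[OF U \<omega>(1)]
  have "Gamma n \<A> T (\<Union>\<V>) k \<omega> = 0"
    by (rule forms_locally_eq[OF Gamma_forms[OF U \<omega>(1)] zero_forms])
      (simp add: restrict_Gamma[OF U op sub \<omega>(1)] \<omega>(2) sR restrict_zero)
  moreover have "Gamma n \<A> T (\<Union>\<V>) (k + 1) (d_form (\<Union>\<V>) \<omega>) = 0"
    by (rule forms_locally_eq[OF Gamma_forms[OF U d\<omega>] zero_forms])
      (simp add: restrict_Gamma[OF U op sub d\<omega>] restrict_d_form[OF op U sub \<omega>(1), symmetric] \<omega>(2) sR restrict_zero)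
  ultimately have "\<omega> \<in> rumin n \<A> T (\<Union>\<V>) k" using \<omega>(1) by (simp add: rumin_eq[OF U])
  moreover have "\<tau> = \<omega>" if "\<tau> \<in> rumin n \<A> T (\<Union>\<V>) k" "\<forall>V\<in>\<V>. restrict_form V \<tau> = s V" for \<tau>
    by (rule forms_locally_eq[OF rumin_forms[OF U that(1)] \<omega>(1)]) (use that(2) \<omega>(2) in simp)
  ultimately show ?thesis using \<omega>(2) by blast
qed

lemma subspace_rumin: "open V \<Longrightarrow> subspace (rumin n \<A> T V k)"
  using balanced_A_infinity[of V] by (simp add: balanced_A_infinity_algebra_def A_infinity_algebra_def)

lemma rumin_sheaf: "sheaf_of_vector_spaces (\<lambda>V. rumin n \<A> T V k) restrict_form"
  unfolding sheaf_of_vector_spaces_def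
proof (intro conjI allI impI ballI)
  show "subspace (rumin n \<A> T V k)" if "open V" for V by (rule subspace_rumin[OF that])
  show "restrict_form V \<omega> = \<omega>" if "open V" "\<omega> \<in> rumin n \<A> T V k" for V \<omega>
    by (rule restrict_self[OF rumin_forms[OF that]])
  show "restrict_form W ` rumin n \<A> T V k \<subseteq> rumin n \<A> T W k" if "open V" "open W" "W \<subseteq> V" for V W
    using restrict_rumin[OF that] by blast
  show "restrict_form W (a *\<^sub>R x + b *\<^sub>R y) = a *\<^sub>R restrict_form W x + b *\<^sub>R restrict_form W y"
    for W a b and x y :: "('a, 'e) form" by (rule restrict_linear)
  show "restrict_form O' (restrict_form W x) = restrict_form O' x" if "O' \<subseteq> W" for O' W and x :: "('a, 'e) form"
    by (rule restrict_restrict[OF that])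
  show "\<exists>!x. x \<in> rumin n \<A> T (\<Union>\<V>) k \<and> (\<forall>V\<in>\<V>. restrict_form V x = s V)"
    if "\<forall>V\<in>\<V>. open V \<and> s V \<in> rumin n \<A> T V k"
      "\<forall>V\<in>\<V>. \<forall>W\<in>\<V>. restrict_form (V \<inter> W) (s V) = restrict_form (V \<inter> W) (s W)" for \<V> s
    by (rule rumin_glue) (use that in auto)
qed

end

theorem theorem8p8:
  fixes n :: nat
    and \<A> :: "('a::{t2_space, second_countable_topology}, 'e::euclidean_space) chart set"
    and T :: "('a, 'e) distribution"
  assumes "CR_manifold n \<A> T"
  shows "sheaf_of_balanced_A_infinity_algebras (rumin n \<A> T) restrict_form (rumin_op n \<A> T)"
proof -
  interpret CR \<A> n T
    using assms by unfold_locales (auto simp: CR_manifold_def)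
  show ?thesis
    unfolding sheaf_of_balanced_A_infinity_algebras_def
    by (auto intro!: balanced_A_infinity rumin_sheaf restrict_rumin_op)
qed

end
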